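(* Let $\mathbf{g}$ be a Ricci-flat metric on an open subset $\mathcal{U}$ of a manifold, let $h$ be a $2$-tensor which is the first jet of a smooth curve of Einstein metrics starting at $\mathbf{g}$, and let $X$ be a Killing vector field for $\mathbf{g}$. Then, for any compact hypersurface $\Sigma\subset\mathcal{U}$ such that $X$ restricted to $\Sigma$ is tangent to $\Sigma$, one has $$\int_\Sigma\big(\mathring{\operatorname{Ric}}^{(2)}_{\mathbf{g}}(h,h)\big)(X,n_\Sigma)\,dv_\Sigma=0 .$$
   Context: An Einstein metric is one satisfying $\operatorname{Ric}(g)=\Lambda g$ for some $\Lambda\in\mathbb{R}$. "$h$ is the first jet of a smooth curve of Einstein metrics starting at $\mathbf{g}$" means that on any compact $K\subset\mathcal{U}$ there is a smooth curve $t\in[0,1]\mapsto\mathbf{g}_t$ of Einstein metrics on $K$ (with constants $\Lambda(t)$ depending on $t$, not necessarily zero) with $\mathbf{g}_0=\mathbf{g}$ and $\partial_t\mathbf{g}_t|_{t=0}=h$. Hypersurfaces are closed and orientable, with unit normal $n_\Sigma$. $\mathring{\operatorname{Ric}}(g)$ is the traceless part (with respect to $g$) of $\operatorname{Ric}(g)$, and $\mathring{\operatorname{Ric}}^{(2)}_{\mathbf{g}}(h,h)$ is the quadratic term in the expansion of $h\mapsto\mathring{\operatorname{Ric}}(\mathbf{g}+h)$ at $h=0$. *)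

theory Defs
  imports "HOL-Analysis.Analysis"
begin

section \<open>Smooth maps\<close>

text \<open>Only used for open \<open>T\<close>, where the derivatives at a point of \<open>T\<close> are unique; in finite
  dimension this is the usual class of \<open>k\<close> times continuously differentiable maps.\<close>

primrec Ck_on :: "nat \<Rightarrow> 'a::real_normed_vector set \<Rightarrow> ('a \<Rightarrow> 'b::real_normed_vector) \<Rightarrow> bool" where
  "Ck_on 0 T f \<longleftrightarrow> continuous_on T f"
| "Ck_on (Suc k) T f \<longleftrightarrow>
     f differentiable_on T \<and> (\<forall>v. Ck_on k T (\<lambda>x. frechet_derivative f (at x) v))"

text \<open>Smoothness on an arbitrary set means local extendability to a smooth map on an open set.
  For open sets this is ordinary smoothness; it is also applied to products of
  \<open>{0..1}\<close> with an open set, and to coordinate images of hypersurfaces.\<close>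

definition smooth_on :: "'a::real_normed_vector set \<Rightarrow> ('a \<Rightarrow> 'b::real_normed_vector) \<Rightarrow> bool" where
  "smooth_on S f \<longleftrightarrow>
     (\<forall>x\<in>S. \<exists>T F. open T \<and> x \<in> T \<and> (\<forall>k. Ck_on k T F) \<and> (\<forall>y\<in>S \<inter> T. F y = f y))"


section \<open>Manifolds and tensor fields\<close>

datatype ('m, 'n::finite) chart =
  Chart (chart_dom: "'m set") (chart_map: "'m \<Rightarrow> real^'n")

definition chart_inv :: "('m, 'n::finite) chart \<Rightarrow> real^'n \<Rightarrow> 'm" where
  "chart_inv c = inv_into (chart_dom c) (chart_map c)"

definition chart_img :: "('m, 'n::finite) chart \<Rightarrow> (real^'n) set" where
  "chart_img c = chart_map c ` chart_dom c"

definition is_chart :: "('m::topological_space, 'n::finite) chart \<Rightarrow> bool" where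
  "is_chart c \<longleftrightarrow> open (chart_dom c) \<and> open (chart_img c) \<and>
     homeomorphism (chart_dom c) (chart_img c) (chart_map c) (chart_inv c)"

definition compatible :: "('m, 'n::finite) chart \<Rightarrow> ('m, 'n) chart \<Rightarrow> bool" where
  "compatible c d \<longleftrightarrow>
     smooth_on (chart_map c ` (chart_dom c \<inter> chart_dom d)) (chart_map d \<circ> chart_inv c) \<and>
     smooth_on (chart_map d ` (chart_dom c \<inter> chart_dom d)) (chart_map c \<circ> chart_inv d)"

text \<open>The manifold is the open set covered by the atlas; its dimension is \<open>CARD('n)\<close>.\<close>

definition smooth_atlas ::
    "('m::{t2_space, second_countable_topology}, 'n::finite) chart set \<Rightarrow> bool" where
  "smooth_atlas A \<longleftrightarrow> (\<forall>c\<in>A. is_chart c) \<and> (\<forall>c\<in>A. \<forall>d\<in>A. compatible c d)"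

definition manifold_space :: "('m, 'n::finite) chart set \<Rightarrow> 'm set" where
  "manifold_space A = (\<Union>c\<in>A. chart_dom c)"

text \<open>The charts of the maximal atlas whose domain lies in \<open>U\<close>.\<close>

definition charts ::
    "('m::topological_space, 'n::finite) chart set \<Rightarrow> 'm set \<Rightarrow> ('m, 'n) chart set" where
  "charts A U = {c. is_chart c \<and> chart_dom c \<subseteq> U \<inter> manifold_space A \<and> (\<forall>d\<in>A. compatible c d)}"

definition transition_jacobian ::
    "('m, 'n::finite) chart \<Rightarrow> ('m, 'n) chart \<Rightarrow> 'm \<Rightarrow> real^'n^'n" where
  "transition_jacobian c d p = jacobian (chart_map d \<circ> chart_inv c) (at (chart_map c p))"

text \<open>Tensor fields are given by their components in every chart, subject to the
  transformation law. Values outside the chart domain (or for other charts) are irrelevant.\<close>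

type_synonym ('m, 'n) vfield = "('m, 'n) chart \<Rightarrow> 'm \<Rightarrow> real^'n"
type_synonym ('m, 'n) tfield = "('m, 'n) chart \<Rightarrow> 'm \<Rightarrow> real^'n^'n"

text \<open>Smooth vector fields along a subset \<open>S\<close> of \<open>U\<close>, with values in the tangent bundle of the
  manifold; for \<open>S = U\<close> these are the vector fields on \<open>U\<close>.\<close>

definition vector_field_along ::
    "('m::topological_space, 'n::finite) chart set \<Rightarrow> 'm set \<Rightarrow> 'm set \<Rightarrow> ('m, 'n) vfield \<Rightarrow> bool" where
  "vector_field_along A U S X \<longleftrightarrow>
     (\<forall>c\<in>charts A U. \<forall>d\<in>charts A U. \<forall>p\<in>chart_dom c \<inter> chart_dom d \<inter> S.
        X d p = transition_jacobian c d p *v X c p) \<and>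
     (\<forall>c\<in>charts A U. smooth_on (chart_map c ` (chart_dom c \<inter> S)) (\<lambda>x. X c (chart_inv c x)))"

abbreviation "vector_field A U X \<equiv> vector_field_along A U U X"

text \<open>Smooth covariant 2-tensor fields on \<open>U\<close>.\<close>

definition tensor_field ::
    "('m::topological_space, 'n::finite) chart set \<Rightarrow> 'm set \<Rightarrow> ('m, 'n) tfield \<Rightarrow> bool" where
  "tensor_field A U T \<longleftrightarrow>
     (\<forall>c\<in>charts A U. \<forall>d\<in>charts A U. \<forall>p\<in>chart_dom c \<inter> chart_dom d.
        T c p = transpose (transition_jacobian c d p) ** T d p ** transition_jacobian c d p) \<and>
     (\<forall>c\<in>charts A U. smooth_on (chart_img c) (\<lambda>x. T c (chart_inv c x)))"

text \<open>The number \<open>T(X,Y)\<close> at the point \<open>p\<close>, evaluated in an arbitrary chart around \<open>p\<close>.\<close>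

definition eval_tensor ::
    "('m::topological_space, 'n::finite) chart set \<Rightarrow> 'm set \<Rightarrow> ('m, 'n) tfield \<Rightarrow>
     ('m, 'n) vfield \<Rightarrow> ('m, 'n) vfield \<Rightarrow> 'm \<Rightarrow> real" where
  "eval_tensor A U T X Y p =
     (let c = (SOME c. c \<in> charts A U \<and> p \<in> chart_dom c) in X c p \<bullet> (T c p *v Y c p))"


section \<open>Curvature and Einstein metrics\<close>

definition riemannian_metric ::
    "('m::topological_space, 'n::finite) chart set \<Rightarrow> 'm set \<Rightarrow> ('m, 'n) tfield \<Rightarrow> bool" where
  "riemannian_metric A U g \<longleftrightarrow> tensor_field A U g \<and>
     (\<forall>c\<in>charts A U. \<forall>p\<in>chart_dom c.
        transpose (g c p) = g c p \<and> (\<forall>v. v \<noteq> 0 \<longrightarrow> v \<bullet> (g c p *v v) > 0))"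

definition pderiv_at :: "'n::finite \<Rightarrow> (real^'n \<Rightarrow> real) \<Rightarrow> real^'n \<Rightarrow> real" where
  "pderiv_at i f x = frechet_derivative f (at x) (axis i 1)"

text \<open>The Christoffel symbol \<open>\<Gamma>\<^sup>k\<^sub>i\<^sub>j\<close> of a metric \<open>\<gamma>\<close> in coordinates.\<close>

definition christoffel :: "(real^'n::finite \<Rightarrow> real^'n^'n) \<Rightarrow> 'n \<Rightarrow> 'n \<Rightarrow> 'n \<Rightarrow> real^'n \<Rightarrow> real" where
  "christoffel \<gamma> k i j x = (\<Sum>l\<in>UNIV. matrix_inv (\<gamma> x) $ k $ l *
     (pderiv_at i (\<lambda>y. \<gamma> y $ j $ l) x + pderiv_at j (\<lambda>y. \<gamma> y $ i $ l) x
        - pderiv_at l (\<lambda>y. \<gamma> y $ i $ j) x)) / 2"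

definition coord_ricci :: "(real^'n::finite \<Rightarrow> real^'n^'n) \<Rightarrow> real^'n \<Rightarrow> real^'n^'n" where
  "coord_ricci \<gamma> x = (\<chi> i j.
     (\<Sum>k\<in>UNIV. pderiv_at k (christoffel \<gamma> k i j) x - pderiv_at j (christoffel \<gamma> k i k) x) +
     (\<Sum>k\<in>UNIV. \<Sum>l\<in>UNIV. christoffel \<gamma> k k l x * christoffel \<gamma> l i j x
                           - christoffel \<gamma> k j l x * christoffel \<gamma> l i k x))"

definition ricci :: "('m, 'n::finite) tfield \<Rightarrow> ('m, 'n) tfield" where
  "ricci g c p = coord_ricci (\<lambda>x. g c (chart_inv c x)) (chart_map c p)"

definition scalar_curvature :: "('m, 'n::finite) tfield \<Rightarrow> ('m, 'n) chart \<Rightarrow> 'm \<Rightarrow> real" where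
  "scalar_curvature g c p =
     (\<Sum>i\<in>UNIV. \<Sum>j\<in>UNIV. matrix_inv (g c p) $ i $ j * ricci g c p $ i $ j)"

definition traceless_ricci :: "('m, 'n::finite) tfield \<Rightarrow> ('m, 'n) tfield" where
  "traceless_ricci g c p =
     ricci g c p - (scalar_curvature g c p / real CARD('n)) *\<^sub>R g c p"

text \<open>The quadratic term, evaluated at \<open>(h,h)\<close>, of the expansion of the traceless Ricci tensor at
  \<open>g\<close>, i.e. the coefficient of \<open>s\<^sup>2\<close> in the expansion of the traceless Ricci tensor of
  \<open>g + s h\<close> (including the Taylor factor \<open>1/2\<close>).\<close>

definition traceless_ricci2 ::
    "('m, 'n::finite) tfield \<Rightarrow> ('m, 'n) tfield \<Rightarrow> ('m, 'n) tfield" where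
  "traceless_ricci2 g h c p = (\<chi> i j.
     (deriv ^^ 2) (\<lambda>s::real. traceless_ricci (\<lambda>d q. g d q + s *\<^sub>R h d q) c p $ i $ j) 0 / 2)"

definition einstein_metric ::
    "('m::topological_space, 'n::finite) chart set \<Rightarrow> 'm set \<Rightarrow> ('m, 'n) tfield \<Rightarrow> bool" where
  "einstein_metric A U g \<longleftrightarrow> riemannian_metric A U g \<and>
     (\<exists>\<Lambda>::real. \<forall>c\<in>charts A U. \<forall>p\<in>chart_dom c. ricci g c p = \<Lambda> *\<^sub>R g c p)"

definition ricci_flat_metric ::
    "('m::topological_space, 'n::finite) chart set \<Rightarrow> 'm set \<Rightarrow> ('m, 'n) tfield \<Rightarrow> bool" where
  "ricci_flat_metric A U g \<longleftrightarrow> riemannian_metric A U g \<and>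
     (\<forall>c\<in>charts A U. \<forall>p\<in>chart_dom c. ricci g c p = 0)"

text \<open>A metric on a compact set \<open>K\<close> is understood as a metric on an open neighbourhood
  \<open>W\<close> of \<open>K\<close>.\<close>

definition einstein_first_jet ::
    "('m::topological_space, 'n::finite) chart set \<Rightarrow> 'm set \<Rightarrow> ('m, 'n) tfield \<Rightarrow>
     ('m, 'n) tfield \<Rightarrow> bool" where
  "einstein_first_jet A U g h \<longleftrightarrow>
     (\<forall>K. compact K \<and> K \<subseteq> U \<longrightarrow>
       (\<exists>W G. open W \<and> K \<subseteq> W \<and> W \<subseteq> U \<and>
          (\<forall>t\<in>{0..1::real}. einstein_metric A W (G t)) \<and>
          (\<forall>c\<in>charts A W.
             smooth_on ({0..1} \<times> chart_img c) (\<lambda>(t, x). G t c (chart_inv c x)) \<and>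
             (\<forall>p\<in>chart_dom c. G 0 c p = g c p \<and>
                ((\<lambda>t. G t c p) has_vector_derivative h c p) (at 0 within {0..1})))))"

text \<open>The last conjunct says that the Lie derivative of \<open>g\<close> along \<open>X\<close> vanishes.\<close>

definition killing_field ::
    "('m::topological_space, 'n::finite) chart set \<Rightarrow> 'm set \<Rightarrow> ('m, 'n) tfield \<Rightarrow>
     ('m, 'n) vfield \<Rightarrow> bool" where
  "killing_field A U g X \<longleftrightarrow> vector_field A U X \<and>
     (\<forall>c\<in>charts A U. \<forall>x\<in>chart_img c.
        let \<gamma> = (\<lambda>y. g c (chart_inv c y)); \<xi> = (\<lambda>y. X c (chart_inv c y)) in
        \<forall>i j. (\<Sum>k\<in>UNIV. \<xi> x $ k * pderiv_at k (\<lambda>y. \<gamma> y $ i $ j) x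
                 + \<gamma> x $ k $ j * pderiv_at i (\<lambda>y. \<xi> y $ k) x
                 + \<gamma> x $ i $ k * pderiv_at j (\<lambda>y. \<xi> y $ k) x) = 0)"


section \<open>Hypersurfaces\<close>

definition slice_chart ::
    "('m::topological_space, 'n::finite) chart set \<Rightarrow> 'm set \<Rightarrow> 'm set \<Rightarrow> ('m, 'n) chart \<Rightarrow> 'n \<Rightarrow> bool"
  where
  "slice_chart A U S c i \<longleftrightarrow> c \<in> charts A U \<and>
     chart_map c ` (chart_dom c \<inter> S) = {x \<in> chart_img c. x $ i = 0}"

text \<open>\<open>M\<close> with its \<open>i\<close>-th row and column replaced by those of the identity matrix. Its
  determinant is that of \<open>M\<close> with the \<open>i\<close>-th row and column deleted.\<close>

definition drop_index :: "'n \<Rightarrow> real^'n^'n \<Rightarrow> real^'n^'n" where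
  "drop_index i M = (\<chi> j k. if j = i \<or> k = i then (if j = k then 1 else 0) else M $ j $ k)"

text \<open>Orientability of \<open>S\<close> itself: an atlas of \<open>S\<close> whose transition maps have positive Jacobian
  determinant. Permuting coordinates, all slice charts may use the same index.\<close>

definition orientable ::
    "('m::topological_space, 'n::finite) chart set \<Rightarrow> 'm set \<Rightarrow> 'm set \<Rightarrow> bool" where
  "orientable A U S \<longleftrightarrow> (\<exists>i C.
     (\<forall>c\<in>C. slice_chart A U S c i) \<and> S \<subseteq> (\<Union>c\<in>C. chart_dom c) \<and>
     (\<forall>c\<in>C. \<forall>d\<in>C. \<forall>p\<in>chart_dom c \<inter> chart_dom d \<inter> S.
        det (drop_index i (transition_jacobian c d p)) > 0))"

definition compact_hypersurface ::
    "('m::topological_space, 'n::finite) chart set \<Rightarrow> 'm set \<Rightarrow> 'm set \<Rightarrow> bool" where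
  "compact_hypersurface A U S \<longleftrightarrow> compact S \<and> S \<subseteq> U \<and>
     (\<forall>p\<in>S. \<exists>c i. slice_chart A U S c i \<and> p \<in> chart_dom c) \<and> orientable A U S"

text \<open>In a slice chart \<open>(c, i)\<close>, the tangent vectors of \<open>S\<close> are those with vanishing \<open>i\<close>-th
  component.\<close>

definition tangent_along ::
    "('m::topological_space, 'n::finite) chart set \<Rightarrow> 'm set \<Rightarrow> 'm set \<Rightarrow> ('m, 'n) vfield \<Rightarrow> bool" where
  "tangent_along A U S X \<longleftrightarrow>
     (\<forall>c i. slice_chart A U S c i \<longrightarrow> (\<forall>p\<in>chart_dom c \<inter> S. X c p $ i = 0))"

definition unit_normal_field ::
    "('m::topological_space, 'n::finite) chart set \<Rightarrow> 'm set \<Rightarrow> ('m, 'n) tfield \<Rightarrow> 'm set \<Rightarrow>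
     ('m, 'n) vfield \<Rightarrow> bool" where
  "unit_normal_field A U g S \<nu> \<longleftrightarrow> vector_field_along A U S \<nu> \<and>
     (\<forall>c i. slice_chart A U S c i \<longrightarrow> (\<forall>p\<in>chart_dom c \<inter> S.
        \<nu> c p \<bullet> (g c p *v \<nu> c p) = 1 \<and>
        (\<forall>v. v $ i = 0 \<longrightarrow> v \<bullet> (g c p *v \<nu> c p) = 0)))"

text \<open>The integral of \<open>f\<close>, supported in the slice chart \<open>(c, i)\<close>, with respect to the volume
  density of the metric induced on \<open>S\<close>. The coordinates on \<open>S\<close> are those with index \<open>j \<noteq> i\<close>, and
  the Gram determinant in these coordinates is the minor of the metric matrix.\<close>

definition slice_integral ::
    "('m, 'n::finite) tfield \<Rightarrow> ('m, 'n) chart \<Rightarrow> 'n \<Rightarrow> ('m \<Rightarrow> real) \<Rightarrow> real" where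
  "slice_integral g c i f =
     (\<integral>y. (let x = (\<chi> j. if j = i then 0 else y j); p = chart_inv c x in
             if x \<in> chart_img c then f p * sqrt (det (drop_index i (g c p))) else 0)
        \<partial>(Pi\<^sub>M (UNIV - {i}) (\<lambda>_. lborel)))"

text \<open>A finite smooth partition of unity on \<open>S\<close> subordinate to slice charts.\<close>

definition slice_partition ::
    "('m::topological_space, 'n::finite) chart set \<Rightarrow> 'm set \<Rightarrow> 'm set \<Rightarrow>
     (('m, 'n) chart \<times> 'n \<times> ('m \<Rightarrow> real)) list \<Rightarrow> bool" where
  "slice_partition A U S P \<longleftrightarrow>
     (\<forall>(c, i, \<rho>) \<in> set P. slice_chart A U S c i \<and> (\<forall>p\<in>S. \<rho> p \<ge> 0) \<and>
        S \<inter> closure {p \<in> S. \<rho> p \<noteq> 0} \<subseteq> chart_dom c \<and>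
        (\<forall>d\<in>charts A U. smooth_on (chart_map d ` (chart_dom d \<inter> S)) (\<lambda>x. \<rho> (chart_inv d x)))) \<and>
     (\<forall>p\<in>S. (\<Sum>(c, i, \<rho>)\<leftarrow>P. \<rho> p) = 1)"

text \<open>For compact hypersurfaces and continuous \<open>f\<close> this does not depend on the chosen
  partition of unity.\<close>

definition hypersurface_integral ::
    "('m::topological_space, 'n::finite) chart set \<Rightarrow> 'm set \<Rightarrow> ('m, 'n) tfield \<Rightarrow> 'm set \<Rightarrow>
     ('m \<Rightarrow> real) \<Rightarrow> real" where
  "hypersurface_integral A U g S f =
     (\<Sum>(c, i, \<rho>)\<leftarrow>(SOME P. slice_partition A U S P). slice_integral g c i (\<lambda>p. \<rho> p * f p))"

end

theory Submission
  imports Defs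
begin

text \<open>
  Let \<open>g\<^sub>t\<close> be the curve of Einstein metrics and \<open>k\<close> its second derivative at \<open>t = 0\<close>. Differentiating
  the vanishing of the traceless Ricci tensor of \<open>g\<^sub>t\<close> twice expresses its quadratic term at \<open>(h, h)\<close>
  as minus one half of its linearization at \<open>k\<close>. Since \<open>g\<close> is Ricci-flat, this linearization differs
  from the linearized Ricci tensor \<open>r\<close> of \<open>k\<close> by a multiple of \<open>g\<close>, which does not contribute because
  \<open>X\<close> is tangent and \<open>\<nu>\<close> is normal. The expression \<open>r(X, \<nu>)\<close> is linear in \<open>k\<close>, and \<open>k\<close> need not be tangent
  to a curve of Einstein metrics, so \<open>k\<close> may be cut off: it is a sum of tensors supported in single slice
  charts. For each of them, the linearized contracted Bianchi identity and the Killing equation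
  show that \<open>(r - (tr r / 2) g)(X, _)\<close> is a divergence-free covector field of compact support in the chart,
  so its flux through the coordinate hyperplane vanishes by the divergence theorem on a half-space;
  on the hypersurface that flux density is \<open>r(X, \<nu>)\<close>, as \<open>X\<close> is tangent.
\<close>

text \<open>Two obstacles shape the work. First, tensors are given by components in charts, so the
  linearized Ricci tensor of a cut-off tensor must itself be shown to transform as a tensor. This is
  inherited from the covariance of the Ricci tensors of the metrics \<open>\<gamma> + s l\<close> by
  differentiating at \<open>s = 0\<close>. Ricci curvature is treated as a smooth function of the
  2-jet of the metric, which makes derivatives with respect to the metric finite-dimensional.
  Second, the hypersurface need not bound a region, and its integral is defined by a partition of
  unity about which nothing is known but its defining properties. Cutting off \<open>k\<close>
  replaces a global boundary by coordinate balls, each cut by its slice into two half-balls.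
  Comparing the given partition with the pieces in these balls requires slice integrals to be
  independent of the slice chart. The curve exists for \<open>t \<ge> 0\<close> only. Its
  derivatives at 0 are read off from local smooth extensions across \<open>t = 0\<close>, along
  which the Einstein equation is known on one side only.\<close>

named_theorems smooth_intros

text \<open>The direction comes first, so that \<open>dird v\<close> is an operator on functions and
  iterated derivatives such as \<open>dird u (dird v f)\<close> are again functions of the
  point.\<close>

definition dird :: "'a::real_normed_vector \<Rightarrow> ('a \<Rightarrow> 'b::real_normed_vector) \<Rightarrow> 'a \<Rightarrow> 'b" where
  "dird v f x = frechet_derivative f (at x) v"

lemma dird_eqI: "(f has_derivative f') (at x) \<Longrightarrow> dird v f x = f' v"
  unfolding dird_def by (metis frechet_derivative_at)

lemma pderiv_at_eq_dird: "pderiv_at i f x = dird (axis i 1) f x"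
  by (simp add: pderiv_at_def dird_def)

lemma has_derivative_dird: "f differentiable (at x) \<Longrightarrow> (f has_derivative (\<lambda>v. dird v f x)) (at x)"
  unfolding dird_def using frechet_derivative_works by auto

lemma frechet_derivative_cong_open:
  assumes "open S" "x \<in> S" "\<And>y. y \<in> S \<Longrightarrow> f y = g y"
  shows "frechet_derivative f (at x) = frechet_derivative g (at x)"
proof -
  have "(f has_derivative f') (at x) \<longleftrightarrow> (g has_derivative f') (at x)" for f'
    using assms by (metis has_derivative_transform_within_open)
  then show ?thesis unfolding frechet_derivative_def by simp
qed

lemma dird_cong_open:
  assumes "open S" "x \<in> S" "\<And>y. y \<in> S \<Longrightarrow> f y = g y"
  shows "dird v f x = dird v g x"
  unfolding dird_def using frechet_derivative_cong_open[OF assms] by simp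

section \<open>Closure properties of the classes \<open>Ck_on\<close>\<close>

lemma Ck_on_Suc_dird:
  "Ck_on (Suc k) S f \<longleftrightarrow> f differentiable_on S \<and> (\<forall>v. Ck_on k S (dird v f))"
  by (simp add: dird_def[abs_def])

lemma Ck_on_cong:
  assumes "open S" "\<And>x. x \<in> S \<Longrightarrow> f x = g x"
  shows "Ck_on k S f \<longleftrightarrow> Ck_on k S g"
  using assms(2)
proof (induction k arbitrary: f g)
  case 0
  then show ?case by (simp cong: continuous_on_cong)
next
  case (Suc k)
  have "f differentiable_on S \<longleftrightarrow> g differentiable_on S"
    using Suc.prems unfolding differentiable_on_def
    by (metis differentiable_transform_within zero_less_one)
  moreover have "Ck_on k S (dird v f) \<longleftrightarrow> Ck_on k S (dird v g)" for v
    by (rule Suc.IH) (rule dird_cong_open[OF assms(1)], use Suc.prems in auto)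
  ultimately show ?case unfolding Ck_on_Suc_dird by simp
qed

lemma Ck_on_subset: "Ck_on k S f \<Longrightarrow> T \<subseteq> S \<Longrightarrow> Ck_on k T f"
proof (induction k arbitrary: f)
  case 0 then show ?case by (auto intro: continuous_on_subset)
next
  case (Suc k) then show ?case
    unfolding Ck_on_Suc_dird by (meson differentiable_on_subset)
qed

lemma Ck_on_local:
  assumes "\<And>x. x \<in> S \<Longrightarrow> \<exists>T. open T \<and> x \<in> T \<and> Ck_on k T f"
  shows "Ck_on k S f"
  using assms
proof (induction k arbitrary: f)
  case 0
  have "continuous (at x within S) f" if "x \<in> S" for x
  proof -
    obtain T where "open T" "x \<in> T" "continuous_on T f" using 0[OF \<open>x \<in> S\<close>] by auto
    then have "isCont f x" using continuous_on_eq_continuous_at by blast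
    then show ?thesis using continuous_at_imp_continuous_at_within by blast
  qed
  then show ?case by (simp add: continuous_on_eq_continuous_within)
next
  case (Suc k)
  have "f differentiable (at x within S)" if "x \<in> S" for x
  proof -
    obtain T where "open T" "x \<in> T" "f differentiable_on T" using Suc.prems[OF \<open>x \<in> S\<close>] by auto
    then show ?thesis
      using differentiable_at_withinI differentiable_on_eq_differentiable_at by blast
  qed
  moreover have "Ck_on k S (dird v f)" for v
    by (rule Suc.IH) (use Suc.prems in \<open>unfold Ck_on_Suc_dird, blast\<close>)
  ultimately show ?case unfolding Ck_on_Suc_dird differentiable_on_def by blast
qed

lemma Ck_on_SucD: "Ck_on (Suc k) S f \<Longrightarrow> Ck_on k S f"
proof (induction k arbitrary: f)
  case 0 then show ?case by (auto intro: differentiable_imp_continuous_on)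
next
  case (Suc k)
  then show ?case unfolding Ck_on_Suc_dird[of "Suc k"] unfolding Ck_on_Suc_dird[of k] by blast
qed

text \<open>The form in which the closure properties are proved: an explicit derivative formula
  whose values in each fixed direction are already known to be in \<open>Ck_on k\<close>. The
  inductions on \<open>k\<close> below thus need only the usual product, quotient and chain
  rules.\<close>

lemma Ck_on_SucI:
  assumes "open S" "\<And>x. x \<in> S \<Longrightarrow> (f has_derivative f' x) (at x)"
    and "\<And>v. Ck_on k S (\<lambda>x. f' x v)"
  shows "Ck_on (Suc k) S f"
proof -
  have "f differentiable_on S"
    using assms(1,2) unfolding differentiable_on_def differentiable_def
    by (meson has_derivative_at_withinI)
  moreover have "Ck_on k S (dird v f)" for v
    using assms(3)[of v] Ck_on_cong[OF assms(1), of "dird v f" "\<lambda>x. f' x v"] dird_eqI[OF assms(2)]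
    by blast
  ultimately show ?thesis unfolding Ck_on_Suc_dird by blast
qed

lemma Ck_on_Suc_has_derivative:
  assumes "open S" "Ck_on (Suc k) S f" "x \<in> S"
  shows "(f has_derivative (\<lambda>v. dird v f x)) (at x)"
  using assms unfolding Ck_on_Suc_dird
  by (metis differentiable_on_eq_differentiable_at has_derivative_dird)

lemma Ck_on_const: "Ck_on k S (\<lambda>x::'a::real_normed_vector. c::'b::real_normed_vector)"
proof (induction k arbitrary: c)
  case (Suc k)
  have "dird v (\<lambda>x::'a. c) = (\<lambda>x. 0)" for v by (auto simp: dird_def)
  then show ?case unfolding Ck_on_Suc_dird using Suc by simp
qed simp

lemma Ck_on_linear:
  assumes "bounded_linear h" "open S" "Ck_on k S f"
  shows "Ck_on k S (\<lambda>x. h (f x))"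
  using assms(3)
proof (induction k arbitrary: f)
  case 0
  then show ?case using assms(1) by (simp add: bounded_linear.continuous_on)
next
  case (Suc k)
  show ?case
  proof (rule Ck_on_SucI[OF assms(2), where f' = "\<lambda>x v. h (dird v f x)"])
    show "((\<lambda>x. h (f x)) has_derivative (\<lambda>v. h (dird v f x))) (at x)" if "x \<in> S" for x
      using bounded_linear.has_derivative[OF assms(1) Ck_on_Suc_has_derivative[OF assms(2) Suc.prems that]] .
    show "Ck_on k S (\<lambda>x. h (dird v f x))" for v
      using Suc.IH Suc.prems unfolding Ck_on_Suc_dird by blast
  qed
qed

lemma Ck_on_ident: "Ck_on k S (\<lambda>x. x)"
proof (cases k)
  case (Suc l)
  have "dird v (\<lambda>x. x) = (\<lambda>x. v)" for v :: 'a by (auto simp: dird_def)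
  then show ?thesis unfolding Suc Ck_on_Suc_dird by (simp add: Ck_on_const differentiable_on_def)
qed simp

lemma Ck_on_add:
  assumes "open S" "Ck_on k S f" "Ck_on k S g"
  shows "Ck_on k S (\<lambda>x. f x + g x)"
  using assms(2,3)
proof (induction k arbitrary: f g)
  case 0 then show ?case by (auto intro: continuous_intros)
next
  case (Suc k)
  show ?case
  proof (rule Ck_on_SucI[OF assms(1), where f' = "\<lambda>x v. dird v f x + dird v g x"])
    show "((\<lambda>x. f x + g x) has_derivative (\<lambda>v. dird v f x + dird v g x)) (at x)" if "x \<in> S" for x
      by (rule has_derivative_add[OF Ck_on_Suc_has_derivative[OF assms(1) Suc.prems(1) that]
            Ck_on_Suc_has_derivative[OF assms(1) Suc.prems(2) that]])
    show "Ck_on k S (\<lambda>x. dird v f x + dird v g x)" for v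
      using Suc.IH Suc.prems unfolding Ck_on_Suc_dird by blast
  qed
qed

lemma Ck_on_bilinear:
  assumes "bounded_bilinear h" "open S" "Ck_on k S f" "Ck_on k S g"
  shows "Ck_on k S (\<lambda>x. h (f x) (g x))"
  using assms(3,4)
proof (induction k arbitrary: f g)
  case 0 then show ?case using assms(1) by (simp add: bounded_bilinear.continuous_on)
next
  case (Suc k)
  show ?case
  proof (rule Ck_on_SucI[OF assms(2), where f' = "\<lambda>x v. h (f x) (dird v g x) + h (dird v f x) (g x)"])
    show "((\<lambda>x. h (f x) (g x)) has_derivative (\<lambda>v. h (f x) (dird v g x) + h (dird v f x) (g x))) (at x)"
      if "x \<in> S" for x
      by (rule bounded_bilinear.FDERIV[OF assms(1) Ck_on_Suc_has_derivative[OF assms(2) Suc.prems(1) that]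
            Ck_on_Suc_has_derivative[OF assms(2) Suc.prems(2) that]])
    have "Ck_on k S f" "Ck_on k S g" using Suc.prems Ck_on_SucD by blast+
    then show "Ck_on k S (\<lambda>x. h (f x) (dird v g x) + h (dird v f x) (g x))" for v
      using Suc.IH Suc.prems unfolding Ck_on_Suc_dird by (intro Ck_on_add[OF assms(2)]) blast+
  qed
qed

lemma Ck_on_sum:
  assumes "open S" "\<And>i. i \<in> I \<Longrightarrow> Ck_on k S (f i)"
  shows "Ck_on k S (\<lambda>x. \<Sum>i\<in>I. f i x)"
proof (cases "finite I")
  case True
  then show ?thesis using assms(2)
    by (induction I rule: finite_induct) (auto intro: Ck_on_const Ck_on_add[OF assms(1)])
qed (simp add: Ck_on_const)

text \<open>In the chain rule the direction \<open>dird v f x\<close> depends on \<open>x\<close>,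
  while \<open>Ck_on\<close> speaks of fixed directions. Expanding it in \<open>Basis\<close> leaves
  derivatives of \<open>g\<close> in fixed directions, to which the induction hypothesis applies;
  hence the Euclidean middle space.\<close>

lemma Ck_on_compose:
  fixes f :: "'a::real_normed_vector \<Rightarrow> 'b::euclidean_space"
  assumes "open S" "open T" "f ` S \<subseteq> T" "Ck_on k S f" "Ck_on k T g"
  shows "Ck_on k S (\<lambda>x. g (f x))"
  using assms(4,5)
proof (induction k arbitrary: g)
  case 0 then show ?case using assms(3) by (auto intro: continuous_on_compose2)
next
  case (Suc k)
  show ?case
  proof (rule Ck_on_SucI[OF assms(1), where f' = "\<lambda>x v. \<Sum>b\<in>Basis. (dird v f x \<bullet> b) *\<^sub>R dird b g (f x)"])
    fix x assume x: "x \<in> S"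
    have f: "(f has_derivative (\<lambda>v. dird v f x)) (at x)"
      using Ck_on_Suc_has_derivative[OF assms(1) Suc.prems(1) x] .
    have g: "(g has_derivative (\<lambda>w. dird w g (f x))) (at (f x))"
      using Ck_on_Suc_has_derivative[OF assms(2) Suc.prems(2)] x assms(3) by blast
    have lin: "linear (\<lambda>w. dird w g (f x))" using g has_derivative_linear by blast
    have *: "dird w g (f x) = (\<Sum>b\<in>Basis. (w \<bullet> b) *\<^sub>R dird b g (f x))" for w
    proof -
      have "dird w g (f x) = dird (\<Sum>b\<in>Basis. (w \<bullet> b) *\<^sub>R b) g (f x)"
        by (simp add: euclidean_representation)
      also have "\<dots> = (\<Sum>b\<in>Basis. (w \<bullet> b) *\<^sub>R dird b g (f x))"
        by (simp add: linear_sum[OF lin] linear_cmul[OF lin])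
      finally show ?thesis .
    qed
    show "((\<lambda>x. g (f x)) has_derivative (\<lambda>v. \<Sum>b\<in>Basis. (dird v f x \<bullet> b) *\<^sub>R dird b g (f x))) (at x)"
      using has_derivative_compose[OF f g] by (subst (asm) *)
  next
    fix v
    have f: "Ck_on k S f" using Suc.prems(1) Ck_on_SucD by blast
    have "Ck_on k S (\<lambda>x. dird b g (f x))" for b
      using Suc.IH[OF f] Suc.prems(2) unfolding Ck_on_Suc_dird by blast
    moreover have "Ck_on k S (\<lambda>x. dird v f x \<bullet> b)" for b
      using Ck_on_linear[OF bounded_linear_inner_left assms(1)] Suc.prems(1) unfolding Ck_on_Suc_dird
      by blast
    ultimately show "Ck_on k S (\<lambda>x. \<Sum>b\<in>Basis. (dird v f x \<bullet> b) *\<^sub>R dird b g (f x))"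
      by (intro Ck_on_sum[OF assms(1)] Ck_on_bilinear[OF bounded_bilinear_scaleR assms(1)])
  qed
qed

lemma Ck_on_inverse:
  fixes f :: "'a::real_normed_vector \<Rightarrow> real"
  assumes "open S" "\<And>x. x \<in> S \<Longrightarrow> f x \<noteq> 0" "Ck_on k S f"
  shows "Ck_on k S (\<lambda>x. inverse (f x))"
  using assms(3)
proof (induction k)
  case 0 then show ?case using assms(2) by (auto intro: continuous_on_inverse)
next
  case (Suc k)
  show ?case
  proof (rule Ck_on_SucI[OF assms(1), where f' = "\<lambda>x v. - (inverse (f x) * dird v f x * inverse (f x))"])
    fix x assume x: "x \<in> S"
    show "((\<lambda>x. inverse (f x)) has_derivative (\<lambda>v. - (inverse (f x) * dird v f x * inverse (f x)))) (at x)"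
      by (rule Deriv.has_derivative_inverse[OF assms(2)[OF x] Ck_on_Suc_has_derivative[OF assms(1) Suc.prems x]])
  next
    fix v
    have f: "Ck_on k S f" using Suc.prems(1) Ck_on_SucD by blast
    have "Ck_on k S (\<lambda>x. inverse (f x) * dird v f x * inverse (f x))"
      using Suc.IH[OF f] Suc.prems(1) unfolding Ck_on_Suc_dird
      by (intro Ck_on_bilinear[OF bounded_bilinear_mult assms(1)]) auto
    then show "Ck_on k S (\<lambda>x. - (inverse (f x) * dird v f x * inverse (f x)))"
      by (intro Ck_on_linear[OF bounded_linear_minus[OF bounded_linear_ident] assms(1)])
  qed
qed

lemma Ck_on_sqrt:
  fixes f :: "'a::real_normed_vector \<Rightarrow> real"
  assumes "open S" "\<And>x. x \<in> S \<Longrightarrow> f x > 0" "Ck_on k S f"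
  shows "Ck_on k S (\<lambda>x. sqrt (f x))"
  using assms(3)
proof (induction k)
  case 0 then show ?case by (auto intro: continuous_on_real_sqrt)
next
  case (Suc k)
  show ?case
  proof (rule Ck_on_SucI[OF assms(1), where f' = "\<lambda>x v. (1/2) * (dird v f x * inverse (sqrt (f x)))"])
    fix x assume x: "x \<in> S"
    have "(\<lambda>v. dird v f x * (inverse (sqrt (f x)) / 2)) = (\<lambda>v. (1/2) * (dird v f x * inverse (sqrt (f x))))"
      by auto
    then show "((\<lambda>x. sqrt (f x)) has_derivative (\<lambda>v. (1/2) * (dird v f x * inverse (sqrt (f x))))) (at x)"
      using has_derivative_real_sqrt[OF assms(2)[OF x] Ck_on_Suc_has_derivative[OF assms(1) Suc.prems x]]
      by (simp only:)
  next
    fix v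
    have "Ck_on k S (\<lambda>x. sqrt (f x))" using Suc Ck_on_SucD by blast
    then have "Ck_on k S (\<lambda>x. inverse (sqrt (f x)))"
      using assms(2) by (intro Ck_on_inverse[OF assms(1)]) fastforce+
    then show "Ck_on k S (\<lambda>x. (1/2) * (dird v f x * inverse (sqrt (f x))))"
      using Suc.prems(1) unfolding Ck_on_Suc_dird
      by (intro Ck_on_bilinear[OF bounded_bilinear_mult assms(1)]  Ck_on_const) auto
  qed
qed

section \<open>Smoothness on arbitrary sets\<close>

lemma smooth_on_open_iff:
  assumes "open S"
  shows "smooth_on S f \<longleftrightarrow> (\<forall>k. Ck_on k S f)"
proof
  assume sm: "smooth_on S f"
  show "\<forall>k. Ck_on k S f"
  proof
    fix k
    show "Ck_on k S f"
    proof (rule Ck_on_local)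
      fix x assume "x \<in> S"
      then obtain T F where T: "open T" "x \<in> T" "Ck_on k T F" "\<And>y. y\<in>S \<inter> T \<Longrightarrow> F y = f y"
        using sm unfolding smooth_on_def by meson
      have "Ck_on k (S \<inter> T) F" using T(3) Ck_on_subset by blast
      then have "Ck_on k (S \<inter> T) f" using Ck_on_cong[of "S \<inter> T" F f k] T assms by blast
      then show "\<exists>T. open T \<and> x \<in> T \<and> Ck_on k T f"
        using T assms \<open>x \<in> S\<close> by (meson IntI open_Int)
    qed
  qed
next
  assume "\<forall>k. Ck_on k S f"
  then show "smooth_on S f" unfolding smooth_on_def using assms by blast
qed

lemma smooth_on_cong:
  assumes "\<And>x. x \<in> S \<Longrightarrow> f x = g x" "smooth_on S f"
  shows "smooth_on S g"
  unfolding smooth_on_def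
proof
  fix x assume "x \<in> S"
  then obtain T F where T: "open T" "x \<in> T" "\<forall>k. Ck_on k T F" "\<forall>y\<in>S \<inter> T. F y = f y"
    using assms(2) unfolding smooth_on_def by blast
  have "F y = g y" if "y \<in> S \<inter> T" for y
    using T(4)[rule_format, OF that] assms(1)[of y] that by (elim IntE) (rule trans)
  then show "\<exists>T F. open T \<and> x \<in> T \<and> (\<forall>k. Ck_on k T F) \<and> (\<forall>y\<in>S \<inter> T. F y = g y)"
    using T(1-3) by blast
qed

lemma smooth_on_subset:
  assumes "smooth_on S f" "T \<subseteq> S"
  shows "smooth_on T f"
  unfolding smooth_on_def
proof
  fix x assume "x \<in> T"
  then have "x \<in> S" using assms(2) by blast
  then obtain T' F where T': "open T'" "x \<in> T'" "\<forall>k. Ck_on k T' F" "\<forall>y\<in>S \<inter> T'. F y = f y"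
    using assms(1) unfolding smooth_on_def by blast
  have "F y = f y" if "y \<in> T \<inter> T'" for y
    using T'(4) assms(2) that by blast
  then show "\<exists>T' F. open T' \<and> x \<in> T' \<and> (\<forall>k. Ck_on k T' F) \<and> (\<forall>y\<in>T \<inter> T'. F y = f y)"
    using T'(1-3) by blast
qed

lemma smooth_on_local:
  assumes "\<And>x. x \<in> S \<Longrightarrow> \<exists>T. open T \<and> x \<in> T \<and> smooth_on (S \<inter> T) f"
  shows "smooth_on S f"
  unfolding smooth_on_def
proof
  fix x assume x: "x \<in> S"
  obtain T where T: "open T" "x \<in> T" "smooth_on (S \<inter> T) f" using assms[OF x] by blast
  have "x \<in> S \<inter> T" using x T(2) by blast
  then obtain T' F where T': "open T'" "x \<in> T'" "\<forall>k. Ck_on k T' F" "\<forall>y\<in>S \<inter> T \<inter> T'. F y = f y"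
    using T(3) unfolding smooth_on_def by blast
  have "\<forall>k. Ck_on k (T \<inter> T') F" using T'(3) Ck_on_subset by blast
  moreover have "F y = f y" if "y \<in> S \<inter> (T \<inter> T')" for y
    using T'(4) that by blast
  moreover have "open (T \<inter> T')" "x \<in> T \<inter> T'" using T T' by auto
  ultimately show "\<exists>T F. open T \<and> x \<in> T \<and> (\<forall>k. Ck_on k T F) \<and> (\<forall>y\<in>S \<inter> T. F y = f y)"
    by blast
qed

lemma smooth_on_dird [smooth_intros]:
  assumes "open S" "smooth_on S f"
  shows "smooth_on S (\<lambda>x. dird v f x)"
  using assms(2) unfolding smooth_on_open_iff[OF assms(1)] by (metis Ck_on_Suc_dird)

lemma smooth_on_has_derivative:
  assumes "open S" "smooth_on S f" "x \<in> S"
  shows "(f has_derivative (\<lambda>v. dird v f x)) (at x)"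
  using assms(2) unfolding smooth_on_open_iff[OF assms(1)]
  by (metis Ck_on_Suc_has_derivative assms(1,3))

lemma smooth_on_continuous_on:
  assumes "smooth_on S f"
  shows "continuous_on S f"
  unfolding continuous_on_eq_continuous_within
proof
  fix x assume x: "x \<in> S"
  obtain T F where T: "open T" "x \<in> T" "\<forall>k. Ck_on k T F" "\<forall>y\<in>S \<inter> T. F y = f y"
    using assms x unfolding smooth_on_def by blast
  have "Ck_on 0 T F" using T(3) by blast
  then have "isCont F x" using T(1,2) by (simp add: continuous_on_eq_continuous_at)
  then have "continuous (at x within S) F" by (rule continuous_at_imp_continuous_at_within)
  then have "(F \<longlongrightarrow> F x) (at x within S)" by (simp only: continuous_within)
  moreover have "\<forall>\<^sub>F y in at x within S. F y = f y"
    unfolding eventually_at_topological using T(1,2,4) by (intro exI[of _ T]) simp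
  ultimately have "(f \<longlongrightarrow> F x) (at x within S)" by (rule Lim_transform_eventually)
  moreover have "F x = f x" using T(2,4) x by simp
  ultimately show "continuous (at x within S) f" by (simp only: continuous_within)
qed

lemma smooth_on_const [smooth_intros]: "smooth_on S (\<lambda>x. c)"
  unfolding smooth_on_def using Ck_on_const open_UNIV by blast

lemma smooth_on_ident [smooth_intros]: "smooth_on S (\<lambda>x. x)"
  unfolding smooth_on_def using Ck_on_ident open_UNIV by blast

text \<open>The local extensions are combined on the intersection of their domains.\<close>

lemma smooth_on_lift2:
  fixes f :: "'a::real_normed_vector \<Rightarrow> 'b::real_normed_vector" and g :: "'a \<Rightarrow> 'c::real_normed_vector"
    and h :: "'b \<Rightarrow> 'c \<Rightarrow> 'd::real_normed_vector"
  assumes "\<And>(T :: 'a set) F G. open T \<Longrightarrow> \<forall>k. Ck_on k T F \<Longrightarrow> \<forall>k. Ck_on k T G \<Longrightarrow> \<forall>k. Ck_on k T (\<lambda>x. h (F x) (G x))"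
  assumes "smooth_on S f" "smooth_on S g"
  shows "smooth_on S (\<lambda>x. h (f x) (g x))"
  unfolding smooth_on_def
proof
  fix x assume x: "x \<in> S"
  obtain T F where T: "open T" "x \<in> T" "\<forall>k. Ck_on k T F" "\<forall>y\<in>S \<inter> T. F y = f y"
    using assms(2) x unfolding smooth_on_def by blast
  obtain T' G where T': "open T'" "x \<in> T'" "\<forall>k. Ck_on k T' G" "\<forall>y\<in>S \<inter> T'. G y = g y"
    using assms(3) x unfolding smooth_on_def by blast
  have "\<forall>k. Ck_on k (T \<inter> T') (\<lambda>x. h (F x) (G x))"
    using T(1,3) T'(1,3) Ck_on_subset[of _ T F "T \<inter> T'"] Ck_on_subset[of _ T' G "T \<inter> T'"]
    by (intro assms(1)) blast+
  moreover have "h (F y) (G y) = h (f y) (g y)" if "y \<in> S \<inter> (T \<inter> T')" for y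
    using T(4) T'(4) that by auto
  moreover have "open (T \<inter> T')" "x \<in> T \<inter> T'" using T T' by auto
  ultimately show "\<exists>T F. open T \<and> x \<in> T \<and> (\<forall>k. Ck_on k T F) \<and> (\<forall>y\<in>S \<inter> T. F y = h (f y) (g y))"
    by blast
qed

lemma smooth_on_add [smooth_intros]:
  "smooth_on S f \<Longrightarrow> smooth_on S g \<Longrightarrow> smooth_on S (\<lambda>x. f x + g x)"
  by (rule smooth_on_lift2[of "(+)"]) (auto intro: Ck_on_add)

lemma smooth_on_bilinear:
  "bounded_bilinear h \<Longrightarrow> smooth_on S f \<Longrightarrow> smooth_on S g \<Longrightarrow> smooth_on S (\<lambda>x. h (f x) (g x))"
  by (rule smooth_on_lift2[of h]) (auto intro: Ck_on_bilinear)

lemma smooth_on_linear: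
  "bounded_linear h \<Longrightarrow> smooth_on S f \<Longrightarrow> smooth_on S (\<lambda>x. h (f x))"
  by (rule smooth_on_lift2[of "\<lambda>a b. h a"]) (auto intro: Ck_on_linear)

lemmas smooth_on_scaleR [smooth_intros] = smooth_on_bilinear[OF bounded_bilinear_scaleR]
lemmas smooth_on_mult [smooth_intros] =
  smooth_on_bilinear[OF bounded_bilinear_mult[where 'a = real]]
lemmas smooth_on_inner [smooth_intros] = smooth_on_bilinear[OF bounded_bilinear_inner]
lemmas smooth_on_minus [smooth_intros] = smooth_on_linear[OF bounded_linear_minus[OF bounded_linear_ident]]
lemmas smooth_on_nth [smooth_intros] = smooth_on_linear[OF bounded_linear_vec_nth]

lemma smooth_on_diff [smooth_intros]:
  "smooth_on S f \<Longrightarrow> smooth_on S g \<Longrightarrow> smooth_on S (\<lambda>x. f x - g x)"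
  using smooth_on_add[of S f "\<lambda>x. - g x"] smooth_on_minus[of S g] by simp

lemma smooth_on_sum [smooth_intros]:
  assumes "\<And>i. i \<in> I \<Longrightarrow> smooth_on S (f i)"
  shows "smooth_on S (\<lambda>x. \<Sum>i\<in>I. f i x)"
proof (cases "finite I")
  case True
  then show ?thesis using assms
    by (induction I rule: finite_induct) (auto intro: smooth_on_const smooth_on_add)
qed (simp add: smooth_on_const)

lemma smooth_on_prod [smooth_intros]:
  fixes f :: "'i \<Rightarrow> 'a::real_normed_vector \<Rightarrow> real"
  assumes "\<And>i. i \<in> I \<Longrightarrow> smooth_on S (f i)"
  shows "smooth_on S (\<lambda>x. \<Prod>i\<in>I. f i x)"
proof (cases "finite I")
  case True
  then show ?thesis using assms
    by (induction I rule: finite_induct) (auto intro: smooth_on_const smooth_on_mult)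
qed (simp add: smooth_on_const)

lemma smooth_on_Pair [smooth_intros]:
  assumes "smooth_on S f" "smooth_on S g"
  shows "smooth_on S (\<lambda>x. (f x, g x))"
proof -
  have "smooth_on S (\<lambda>x. (f x, 0) + (0, g x))"
    by (intro smooth_on_add smooth_on_linear[of "\<lambda>a. (a, 0)"] smooth_on_linear[of "\<lambda>a. (0, a)"] assms
        bounded_linear_Pair bounded_linear_ident bounded_linear_zero)
  then show ?thesis by simp
qed

lemma smooth_on_fst [smooth_intros]: "smooth_on S f \<Longrightarrow> smooth_on S (\<lambda>x. fst (f x))"
  and smooth_on_snd [smooth_intros]: "smooth_on S f \<Longrightarrow> smooth_on S (\<lambda>x. snd (f x))"
  by (intro smooth_on_linear[OF bounded_linear_fst] smooth_on_linear[OF bounded_linear_snd]; assumption)+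

lemma bounded_linear_axis: "bounded_linear (\<lambda>x::'b::euclidean_space. axis i x :: 'b^'n::finite)"
  by (intro linear_conv_bounded_linear[THEN iffD1] linearI) (auto simp: axis_def vec_eq_iff)

lemma smooth_on_vec_lambda [smooth_intros]:
  fixes f :: "'n::finite \<Rightarrow> 'a::real_normed_vector \<Rightarrow> 'b::euclidean_space"
  assumes "\<And>i. smooth_on S (f i)"
  shows "smooth_on S (\<lambda>x. \<chi> i. f i x)"
proof -
  have "smooth_on S (\<lambda>x. \<Sum>i\<in>UNIV. axis i (f i x))"
    by (intro smooth_on_sum smooth_on_linear[OF bounded_linear_axis] assms)
  also have "(\<lambda>x. \<Sum>i\<in>UNIV. axis i (f i x)) = (\<lambda>x. \<chi> i. f i x)"
    by (auto simp: vec_eq_iff axis_def fun_eq_iff)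
  finally show ?thesis .
qed

lemma smooth_on_compose:
  fixes f :: "'a::real_normed_vector \<Rightarrow> 'b::euclidean_space"
  assumes "smooth_on S f" "smooth_on T g" "f ` S \<subseteq> T"
  shows "smooth_on S (\<lambda>x. g (f x))"
  unfolding smooth_on_def
proof
  fix x assume x: "x \<in> S"
  obtain A F where A: "open A" "x \<in> A" "\<forall>k. Ck_on k A F" "\<forall>y\<in>S \<inter> A. F y = f y"
    using assms(1) x unfolding smooth_on_def by blast
  have "f x \<in> T" using assms(3) x by blast
  then obtain B G where B: "open B" "f x \<in> B" "\<forall>k. Ck_on k B G" "\<forall>y\<in>T \<inter> B. G y = g y"
    using assms(2) unfolding smooth_on_def by blast
  \<comment> \<open>The composite of the two extensions is considered only where \<open>F\<close>
    lands in the domain of \<open>G\<close>; since \<open>F x = f x\<close>, this open set contains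
    \<open>x\<close>.\<close>
  define C where "C = A \<inter> F -` B"
  have "continuous_on A F" using A(3) Ck_on.simps(1) by blast
  then have C: "open C" unfolding C_def
    using A(1) B(1) continuous_on_open_vimage by (metis inf_commute)
  have "Ck_on k C F" for k by (rule Ck_on_subset[OF A(3)[rule_format]]) (simp add: C_def)
  then have "\<forall>k. Ck_on k C (\<lambda>x. G (F x))"
    by (intro allI Ck_on_compose[OF C B(1) _ _ B(3)[rule_format]]) (simp_all add: C_def image_subset_iff)
  moreover have "F x = f x" using A(2,4) x by blast
  then have "x \<in> C" using A(2) B(2) by (simp add: C_def)
  moreover have "G (F y) = g (f y)" if "y \<in> S \<inter> C" for y
  proof -
    have "F y = f y" using A(4) that by (simp add: C_def)
    then have "f y \<in> T \<inter> B" using that assms(3) by (auto simp: C_def)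
    then show ?thesis using B(4) \<open>F y = f y\<close> by simp
  qed
  ultimately show "\<exists>T F. open T \<and> x \<in> T \<and> (\<forall>k. Ck_on k T F) \<and> (\<forall>y\<in>S \<inter> T. F y = g (f y))"
    using C by (intro exI[of _ C] exI[of _ "\<lambda>x. G (F x)"]) blast
qed

lemma smooth_on_inverse [smooth_intros]:
  fixes f :: "'a::real_normed_vector \<Rightarrow> real"
  assumes "smooth_on S f" "\<And>x. x \<in> S \<Longrightarrow> f x \<noteq> 0"
  shows "smooth_on S (\<lambda>x. inverse (f x))"
proof -
  have op: "open (- {0::real})" by (simp add: open_Compl)
  have "\<forall>k. Ck_on k (- {0}) (\<lambda>x::real. inverse x)"
    by (intro allI Ck_on_inverse[OF op] Ck_on_ident) blast
  then have "smooth_on (- {0}) (\<lambda>x::real. inverse x)" unfolding smooth_on_open_iff[OF op] .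
  then show ?thesis by (rule smooth_on_compose[OF assms(1)]) (rule subsetI, erule imageE, simp add: assms(2))
qed

lemma smooth_on_divide [smooth_intros]:
  fixes f :: "'a::real_normed_vector \<Rightarrow> real"
  assumes "smooth_on S f" "smooth_on S g" "\<And>x. x \<in> S \<Longrightarrow> g x \<noteq> 0"
  shows "smooth_on S (\<lambda>x. f x / g x)"
  unfolding divide_inverse by (intro smooth_intros assms)

lemma smooth_on_sqrt [smooth_intros]:
  fixes f :: "'a::real_normed_vector \<Rightarrow> real"
  assumes "smooth_on S f" "\<And>x. x \<in> S \<Longrightarrow> f x > 0"
  shows "smooth_on S (\<lambda>x. sqrt (f x))"
proof -
  have op: "open {0::real<..}" by simp
  have "\<forall>k. Ck_on k {0<..} (\<lambda>x::real. sqrt x)"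
    by (intro allI Ck_on_sqrt[OF op] Ck_on_ident) simp
  then have "smooth_on {0<..} (\<lambda>x::real. sqrt x)" unfolding smooth_on_open_iff[OF op] .
  then show ?thesis by (rule smooth_on_compose[OF assms(1)]) (rule subsetI, erule imageE, simp add: assms(2))
qed

lemma smooth_on_det [smooth_intros]:
  fixes M :: "'a::real_normed_vector \<Rightarrow> real^'n::finite^'n"
  assumes "smooth_on S M"
  shows "smooth_on S (\<lambda>x. det (M x))"
  unfolding det_def by (intro smooth_intros assms)

lemma smooth_on_matrix_vector [smooth_intros]:
  fixes M :: "'a::real_normed_vector \<Rightarrow> real^'n::finite^'m::finite"
  assumes "smooth_on S M" "smooth_on S v"
  shows "smooth_on S (\<lambda>x. M x *v v x)"
  unfolding matrix_vector_mult_def by (intro smooth_intros assms)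

lemma smooth_on_matrix_mult [smooth_intros]:
  fixes M :: "'a::real_normed_vector \<Rightarrow> real^'n::finite^'m::finite" and N :: "'a \<Rightarrow> real^'k::finite^'n"
  assumes "smooth_on S M" "smooth_on S N"
  shows "smooth_on S (\<lambda>x. M x ** N x)"
  unfolding matrix_matrix_mult_def by (intro smooth_intros assms)

section \<open>Smoothness of matrix inversion\<close>

lemma matrix_inv_mult:
  fixes M :: "real^'n::finite^'n"
  assumes "det M \<noteq> 0"
  shows "M ** matrix_inv M = mat 1" "matrix_inv M ** M = mat 1"
proof -
  have "\<exists>A'. M ** A' = mat 1 \<and> A' ** M = mat 1" using assms invertible_det_nz[of M] by (simp add: invertible_def)
  from someI_ex[OF this] show "M ** matrix_inv M = mat 1" "matrix_inv M ** M = mat 1"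
    unfolding matrix_inv_def by blast+
qed

text \<open>Cramer's rule writes the entries of the inverse as quotients of determinants, which
  reduces the smoothness of inversion to that of \<open>det\<close>.\<close>

lemma matrix_inv_nth_cramer:
  fixes M :: "real^'n::finite^'n"
  assumes "det M \<noteq> 0"
  shows "matrix_inv M $ k $ l = det (\<chi> i j. if j = k then axis l 1 $ i else M $ i $ j) / det M"
proof -
  have "M *v (matrix_inv M *v axis l 1) = axis l 1"
    using matrix_inv_mult[OF assms] by (simp add: matrix_vector_mul_assoc)
  then have "matrix_inv M *v axis l 1 = (\<chi> k. det (\<chi> i j. if j = k then axis l 1 $ i else M $ i $ j) / det M)"
    using cramer[OF assms, of "matrix_inv M *v axis l 1" "axis l 1"] by blast
  moreover have "(matrix_inv M *v axis l 1) $ k = matrix_inv M $ k $ l"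
    by (simp add: matrix_vector_mul_component inner_axis)
  ultimately show ?thesis by simp
qed

lemma smooth_on_matrix_inv [smooth_intros]:
  fixes M :: "'a::real_normed_vector \<Rightarrow> real^'n::finite^'n"
  assumes "smooth_on S M" "\<And>x. x \<in> S \<Longrightarrow> det (M x) \<noteq> 0"
  shows "smooth_on S (\<lambda>x. matrix_inv (M x))"
proof -
  have if_smooth: "smooth_on S (\<lambda>x. if P then f x else g x)"
    if "smooth_on S f" "smooth_on S g" for P and f g :: "'a \<Rightarrow> real"
    using that by (cases P) auto
  have "smooth_on S (\<lambda>x. \<chi> k l. det (\<chi> i j. if j = k then axis l 1 $ i else M x $ i $ j) / det (M x))"
    by (intro smooth_intros assms if_smooth)
  then show ?thesis
    by (rule smooth_on_cong[rotated]) (simp add: vec_eq_iff matrix_inv_nth_cramer assms)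
qed

subsection \<open>Symmetry of second derivatives\<close>

lemma mvt_line:
  fixes f :: "real \<Rightarrow> real"
  assumes "h > 0" "\<And>s. 0 \<le> s \<Longrightarrow> s \<le> h \<Longrightarrow> (f has_real_derivative f' s) (at s)"
  obtains \<sigma> where "0 < \<sigma>" "\<sigma> < h" "f h - f 0 = h * f' \<sigma>"
  using MVT2[of 0 h f f'] assms by auto

lemma dird_line:
  fixes f :: "'a::real_normed_vector \<Rightarrow> real"
  assumes "f differentiable (at (x + s *\<^sub>R u))"
  shows "((\<lambda>s. f (x + s *\<^sub>R u)) has_real_derivative dird u f (x + s *\<^sub>R u)) (at s)"
proof -
  have "(f has_derivative (\<lambda>v. dird v f (x + s *\<^sub>R u))) (at (x + s *\<^sub>R u))"
    using has_derivative_dird[OF assms] .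
  moreover have "((\<lambda>s. x + s *\<^sub>R u) has_derivative (\<lambda>r. r *\<^sub>R u)) (at s)"
    by (auto intro!: derivative_eq_intros)
  ultimately have "((\<lambda>s. f (x + s *\<^sub>R u)) has_derivative (\<lambda>r. dird (r *\<^sub>R u) f (x + s *\<^sub>R u))) (at s)"
    by (rule has_derivative_compose[rotated])
  moreover have "linear (\<lambda>v. dird v f (x + s *\<^sub>R u))"
    using has_derivative_dird[OF assms] has_derivative_linear by blast
  then have "(\<lambda>r. dird (r *\<^sub>R u) f (x + s *\<^sub>R u)) = (*) (dird u f (x + s *\<^sub>R u))"
    using linear_cmul by (fastforce simp: mult.commute)
  ultimately show ?thesis by (simp add: has_field_derivative_def)
qed

text \<open>The second difference quotient of \<open>f\<close> is a value of \<open>dird u (dird v f)\<close> near \<open>x\<close>; being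
  symmetric in \<open>u\<close> and \<open>v\<close>, it is also a value of \<open>dird v (dird u f)\<close>.\<close>

lemma second_difference:
  fixes f :: "'a::real_normed_vector \<Rightarrow> real"
  assumes S: "open S" "Ck_on 2 S f" and h: "h > 0"
    and sub: "\<And>s t. 0 \<le> s \<Longrightarrow> s \<le> h \<Longrightarrow> 0 \<le> t \<Longrightarrow> t \<le> h \<Longrightarrow> x + s *\<^sub>R u + t *\<^sub>R v \<in> S"
  obtains s t where "0 \<le> s" "s \<le> h" "0 \<le> t" "t \<le> h"
    "f (x + h *\<^sub>R u + h *\<^sub>R v) - f (x + h *\<^sub>R u) - f (x + h *\<^sub>R v) + f x
      = h * h * dird v (dird u f) (x + s *\<^sub>R u + t *\<^sub>R v)"
proof -
  have d1: "f differentiable (at y)" if "y \<in> S" for y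
    using S that by (simp add: numeral_2_eq_2 differentiable_on_eq_differentiable_at)
  have d2: "dird u f differentiable (at y)" if "y \<in> S" for y
    using S that by (simp add: numeral_2_eq_2 differentiable_on_eq_differentiable_at dird_def[abs_def])
  define p where "p = (\<lambda>s. f ((x + h *\<^sub>R v) + s *\<^sub>R u) - f (x + s *\<^sub>R u))"
  have "(p has_real_derivative (dird u f ((x + h *\<^sub>R v) + s *\<^sub>R u) - dird u f (x + s *\<^sub>R u))) (at s)"
    if s: "0 \<le> s" "s \<le> h" for s
  proof -
    have "(x + h *\<^sub>R v) + s *\<^sub>R u = x + s *\<^sub>R u + h *\<^sub>R v" by simp
    then have "(x + h *\<^sub>R v) + s *\<^sub>R u \<in> S" using sub[of s h] s h by (simp only:)
    moreover have "x + s *\<^sub>R u \<in> S" using sub[of s 0] s h by simp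
    ultimately show ?thesis unfolding p_def by (intro DERIV_diff dird_line d1)
  qed
  then obtain s where s: "0 < s" "s < h"
    "p h - p 0 = h * (dird u f ((x + h *\<^sub>R v) + s *\<^sub>R u) - dird u f (x + s *\<^sub>R u))"
    using mvt_line[OF h, of p "\<lambda>s. dird u f ((x + h *\<^sub>R v) + s *\<^sub>R u) - dird u f (x + s *\<^sub>R u)"]
    by metis
  have "((\<lambda>t. dird u f ((x + s *\<^sub>R u) + t *\<^sub>R v)) has_real_derivative
      dird v (dird u f) ((x + s *\<^sub>R u) + t *\<^sub>R v)) (at t)" if "0 \<le> t" "t \<le> h" for t
    using sub[of s t] that s by (intro dird_line d2) simp
  then obtain t where t: "0 < t" "t < h"
    "dird u f ((x + s *\<^sub>R u) + h *\<^sub>R v) - dird u f ((x + s *\<^sub>R u) + 0 *\<^sub>R v)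
      = h * dird v (dird u f) ((x + s *\<^sub>R u) + t *\<^sub>R v)"
    using mvt_line[OF h, of "\<lambda>t. dird u f ((x + s *\<^sub>R u) + t *\<^sub>R v)"
        "\<lambda>t. dird v (dird u f) ((x + s *\<^sub>R u) + t *\<^sub>R v)"] by metis
  have "(x + h *\<^sub>R v) + s *\<^sub>R u = x + s *\<^sub>R u + h *\<^sub>R v" by simp
  with s(3) have "p h - p 0 = h * (dird u f ((x + s *\<^sub>R u) + h *\<^sub>R v) - dird u f (x + s *\<^sub>R u))"
    by (simp only:)
  moreover have "p h - p 0 = f (x + h *\<^sub>R u + h *\<^sub>R v) - f (x + h *\<^sub>R u) - f (x + h *\<^sub>R v) + f x"
    by (simp add: p_def add_ac)
  ultimately have "f (x + h *\<^sub>R u + h *\<^sub>R v) - f (x + h *\<^sub>R u) - f (x + h *\<^sub>R v) + f x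
      = h * (h * dird v (dird u f) ((x + s *\<^sub>R u) + t *\<^sub>R v))"
    using t(3) by simp
  then show thesis
    by (intro that[of s t]) (use s t in simp_all)
qed

text \<open>If the two mixed derivatives differed at \<open>x\<close>, continuity would keep their
  values near \<open>x\<close> apart, but a small second difference is a value of both.\<close>

lemma dird_commute_real:
  fixes f :: "'a::real_normed_vector \<Rightarrow> real"
  assumes S: "open S" "Ck_on 2 S f" and x: "x \<in> S"
  shows "dird u (dird v f) x = dird v (dird u f) x"
proof (rule ccontr)
  assume neq: "\<not> ?thesis"
  \<comment> \<open>Half the distance: a number cannot lie within less than \<open>e\<close> of both
    values.\<close>
  define e where "e = dist (dird u (dird v f) x) (dird v (dird u f) x) / 2"
  have e: "e > 0" using neq by (simp add: e_def)
  have cont: "continuous_on S (dird a (dird b f))" for a b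
    using S by (simp add: numeral_2_eq_2 dird_def[abs_def])
  define N where "N = S \<inter> {y \<in> S. dist (dird u (dird v f) y) (dird u (dird v f) x) < e}
      \<inter> {y \<in> S. dist (dird v (dird u f) y) (dird v (dird u f) x) < e}"
  have op: "open {y \<in> S. dist (dird a (dird b f) y) c < e}" for a b c
  proof -
    have "{y \<in> S. dist (dird a (dird b f) y) c < e} = dird a (dird b f) -` ball c e \<inter> S"
      by (auto simp: dist_commute)
    then show ?thesis using continuous_on_open_vimage[OF S(1), THEN iffD1, OF cont] by simp
  qed
  have "open N" "x \<in> N" unfolding N_def using op S x e by (auto intro!: open_Int)
  then obtain r where r: "r > 0" "ball x r \<subseteq> N" using open_contains_ball by blast
  \<comment> \<open>With this \<open>h\<close> the parallelogram at \<open>x\<close> spanned by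
    \<open>h *\<^sub>R u\<close> and \<open>h *\<^sub>R v\<close> lies in the ball of radius
    \<open>r\<close>; the summand 1 keeps the denominator positive when \<open>u\<close> and
    \<open>v\<close> vanish.\<close>
  define h where "h = r / (2 * (norm u + norm v + 1))"
  have pos: "2 * (norm u + norm v + 1) > 0" by (smt (verit) norm_ge_zero)
  have h: "h > 0" using r pos by (simp add: h_def)
  have hb: "h * (norm u + norm v) < r"
  proof -
    have "h * (norm u + norm v) \<le> h * (norm u + norm v + 1)" using h by simp
    also have "\<dots> = r / 2" using pos by (simp add: h_def field_simps)
    finally show ?thesis using r by simp
  qed
  have sub: "x + s *\<^sub>R u + t *\<^sub>R v \<in> N" if "0 \<le> s" "s \<le> h" "0 \<le> t" "t \<le> h" for s t
  proof -
    have "norm (s *\<^sub>R u + t *\<^sub>R v) \<le> s * norm u + t * norm v"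
      using norm_triangle_ineq[of "s *\<^sub>R u" "t *\<^sub>R v"] that by simp
    also have "\<dots> \<le> h * norm u + h * norm v"
      using that by (intro add_mono mult_right_mono) auto
    finally have "norm (s *\<^sub>R u + t *\<^sub>R v) < r" using hb by (simp add: algebra_simps)
    then have "dist x (x + (s *\<^sub>R u + t *\<^sub>R v)) < r" by (metis add_diff_cancel_left' dist_commute dist_norm)
    then have "x + (s *\<^sub>R u + t *\<^sub>R v) \<in> N" using r(2) by (meson mem_ball subsetD)
    then show ?thesis by (simp add: add.assoc)
  qed
  have sub': "x + s *\<^sub>R v + t *\<^sub>R u \<in> N" if "0 \<le> s" "s \<le> h" "0 \<le> t" "t \<le> h" for s t
    using sub[OF that(3,4,1,2)] by (simp add: add.commute add.left_commute)
  have NS: "N \<subseteq> S" by (auto simp: N_def)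
  obtain s t where st: "0 \<le> s" "s \<le> h" "0 \<le> t" "t \<le> h"
    "f (x + h *\<^sub>R u + h *\<^sub>R v) - f (x + h *\<^sub>R u) - f (x + h *\<^sub>R v) + f x
      = h * h * dird v (dird u f) (x + s *\<^sub>R u + t *\<^sub>R v)"
    using second_difference[OF S h, of x u v] sub NS by blast
  obtain s' t' where st': "0 \<le> s'" "s' \<le> h" "0 \<le> t'" "t' \<le> h"
    "f (x + h *\<^sub>R v + h *\<^sub>R u) - f (x + h *\<^sub>R v) - f (x + h *\<^sub>R u) + f x
      = h * h * dird u (dird v f) (x + s' *\<^sub>R v + t' *\<^sub>R u)"
    using second_difference[OF S h, of x v u] sub' NS by blast
  have "h * h * dird v (dird u f) (x + s *\<^sub>R u + t *\<^sub>R v) = h * h * dird u (dird v f) (x + s' *\<^sub>R v + t' *\<^sub>R u)"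
    unfolding st(5)[symmetric] st'(5)[symmetric] by (simp add: add.commute add.left_commute)
  then have eq: "dird v (dird u f) (x + s *\<^sub>R u + t *\<^sub>R v) = dird u (dird v f) (x + s' *\<^sub>R v + t' *\<^sub>R u)"
    using h by simp
  have "dist (dird v (dird u f) (x + s *\<^sub>R u + t *\<^sub>R v)) (dird v (dird u f) x) < e"
    using sub[OF st(1-4)] by (auto simp: N_def)
  moreover have "dist (dird u (dird v f) (x + s' *\<^sub>R v + t' *\<^sub>R u)) (dird u (dird v f) x) < e"
    using sub'[OF st'(1-4)] by (auto simp: N_def)
  ultimately have "dist (dird u (dird v f) x) (dird v (dird u f) x) < e + e"
    unfolding eq by (metis dist_commute dist_triangle_lt add.commute dist_triangle_less_add)
  then show False by (simp add: e_def)
qed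

lemma dird_inner_left:
  assumes "f differentiable (at x)"
  shows "dird v (\<lambda>y. f y \<bullet> b) x = dird v f x \<bullet> b"
  by (rule dird_eqI) (intro has_derivative_inner_left has_derivative_dird assms)

lemma dird_commute:
  fixes f :: "'a::real_normed_vector \<Rightarrow> 'b::euclidean_space"
  assumes S: "open S" "smooth_on S f" and x: "x \<in> S"
  shows "dird u (dird v f) x = dird v (dird u f) x"
proof (rule euclidean_eqI)
  fix b :: 'b assume "b \<in> Basis"
  have diff: "g differentiable (at y)" if "y \<in> S" "smooth_on S g" for g :: "'a \<Rightarrow> 'b" and y
    using smooth_on_has_derivative[OF S(1) that(2,1)] differentiable_def by blast
  have "Ck_on 2 S (\<lambda>y. f y \<bullet> b)"
    using S by (intro Ck_on_linear[OF bounded_linear_inner_left S(1)]) (auto simp: smooth_on_open_iff)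
  note comm = dird_commute_real[OF S(1) this x, of u v]
  have "dird u (dird v f) x \<bullet> b = dird u (dird v (\<lambda>y. f y \<bullet> b)) x" for u v
  proof -
    have "dird u (dird v f) x \<bullet> b = dird u (\<lambda>y. dird v f y \<bullet> b) x"
      using dird_inner_left[OF diff[OF x smooth_on_dird[OF S]]] by simp
    also have "\<dots> = dird u (dird v (\<lambda>y. f y \<bullet> b)) x"
      by (rule dird_cong_open[OF S(1) x]) (simp add: dird_inner_left[OF diff[OF _ S(2)]])
    finally show ?thesis .
  qed
  then show "dird u (dird v f) x \<bullet> b = dird v (dird u f) x \<bullet> b" using comm by simp
qed

subsection \<open>Calculus of directional derivatives\<close>

lemma smooth_on_differentiable:
  "open S \<Longrightarrow> smooth_on S f \<Longrightarrow> x \<in> S \<Longrightarrow> f differentiable (at x)"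
  by (rule differentiableI[OF smooth_on_has_derivative])

lemma linear_dird: "f differentiable (at x) \<Longrightarrow> linear (\<lambda>v. dird v f x)"
  by (rule has_derivative_linear[OF has_derivative_dird])

lemma dird_const [simp]: "dird v (\<lambda>x. c) x = 0"
  by (rule dird_eqI[OF has_derivative_const])

lemma dird_add:
  "f differentiable (at x) \<Longrightarrow> g differentiable (at x) \<Longrightarrow>
    dird v (\<lambda>y. f y + g y) x = dird v f x + dird v g x"
  by (rule dird_eqI[OF has_derivative_add[OF has_derivative_dird has_derivative_dird]])

lemma dird_diff:
  "f differentiable (at x) \<Longrightarrow> g differentiable (at x) \<Longrightarrow>
    dird v (\<lambda>y. f y - g y) x = dird v f x - dird v g x"
  by (rule dird_eqI[OF has_derivative_diff[OF has_derivative_dird has_derivative_dird]])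

lemma dird_linear:
  "bounded_linear h \<Longrightarrow> f differentiable (at x) \<Longrightarrow> dird v (\<lambda>y. h (f y)) x = h (dird v f x)"
  by (rule dird_eqI[OF bounded_linear.has_derivative[OF _ has_derivative_dird]])

lemmas dird_nth = dird_linear[OF bounded_linear_vec_nth]
lemmas dird_scaleR_right = dird_linear[OF bounded_linear_scaleR_right]
lemmas dird_minus = dird_linear[OF bounded_linear_minus[OF bounded_linear_ident]]

lemma dird_bilinear:
  "bounded_bilinear h \<Longrightarrow> f differentiable (at x) \<Longrightarrow> g differentiable (at x) \<Longrightarrow>
    dird v (\<lambda>y. h (f y) (g y)) x = h (f x) (dird v g x) + h (dird v f x) (g x)"
  by (rule dird_eqI[OF bounded_bilinear.FDERIV[OF _ has_derivative_dird has_derivative_dird]])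

lemmas dird_mult = dird_bilinear[OF bounded_bilinear_mult[where 'a = real]]

lemma dird_sum:
  "(\<And>i. i \<in> I \<Longrightarrow> f i differentiable (at x)) \<Longrightarrow>
    dird v (\<lambda>y. \<Sum>i\<in>I. f i y) x = (\<Sum>i\<in>I. dird v (f i) x)"
  by (rule dird_eqI[OF has_derivative_sum[OF has_derivative_dird]])

lemma dird_sum_UNIV:
  "(\<And>i. f i differentiable (at x)) \<Longrightarrow>
    dird v (\<lambda>y. \<Sum>i\<in>(UNIV :: 'i::finite set). f i y) x = (\<Sum>i\<in>UNIV. dird v (f i) x)"
  by (rule dird_sum)

lemma dird_compose:
  assumes "f differentiable (at x)" "g differentiable (at (f x))"
  shows "dird v (\<lambda>y. g (f y)) x = dird (dird v f x) g (f x)"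
  by (rule dird_eqI[OF has_derivative_compose[OF has_derivative_dird[OF assms(1)] has_derivative_dird[OF assms(2)]]])

text \<open>The product rule for a bilinear map that varies with the point, such as the metric, the
  Christoffel map or a Ricci tensor, possibly composed with a coordinate change \<phi>. Expansion in
  \<open>Basis\<close> reduces it to products of scalars, so only derivatives of
  \<open>B y u v\<close> with fixed \<open>u\<close> and \<open>v\<close> are needed.\<close>

lemma bilinear_family_has_derivative:
  fixes B :: "'c::real_normed_vector \<Rightarrow> 'v::euclidean_space \<Rightarrow> 'v \<Rightarrow> 'b::real_normed_vector"
  assumes bil: "\<And>y. bilinear (B y)"
    and dB: "\<And>u v. (\<lambda>y. B y u v) differentiable (at (\<phi> x))"
    and \<phi>: "\<phi> differentiable (at x)" and a: "a differentiable (at x)" and b: "b differentiable (at x)"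
  shows "dird w (\<lambda>y. B (\<phi> y) (a y) (b y)) x =
      dird (dird w \<phi> x) (\<lambda>z. B z (a x) (b x)) (\<phi> x)
      + B (\<phi> x) (dird w a x) (b x) + B (\<phi> x) (a x) (dird w b x)"
    and "(\<lambda>y. B (\<phi> y) (a y) (b y)) differentiable (at x)"
proof -
  have expand: "B y u v = (\<Sum>i\<in>Basis. \<Sum>j\<in>Basis. ((u \<bullet> i) * (v \<bullet> j)) *\<^sub>R B y i j)" for y u v
  proof -
    have "B y u v = B y (\<Sum>i\<in>Basis. (u \<bullet> i) *\<^sub>R i) (\<Sum>j\<in>Basis. (v \<bullet> j) *\<^sub>R j)"
      by (simp add: euclidean_representation)
    also have "\<dots> = (\<Sum>(i,j)\<in>Basis \<times> Basis. B y ((u \<bullet> i) *\<^sub>R i) ((v \<bullet> j) *\<^sub>R j))"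
      by (rule bilinear_sum[OF bil])
    also have "\<dots> = (\<Sum>i\<in>Basis. \<Sum>j\<in>Basis. ((u \<bullet> i) * (v \<bullet> j)) *\<^sub>R B y i j)"
      by (simp add: sum.cartesian_product[symmetric] bilinear_lmul[OF bil] bilinear_rmul[OF bil] mult.commute)
    finally show ?thesis .
  qed
  define B' where "B' = (\<lambda>w u v. dird w (\<lambda>z. B z u v) (\<phi> x))"
  have B'_expand: "B' w u v = (\<Sum>i\<in>Basis. \<Sum>j\<in>Basis. ((u \<bullet> i) * (v \<bullet> j)) *\<^sub>R B' w i j)" for w u v
    unfolding B'_def
    by (subst expand)
      (rule dird_eqI[OF has_derivative_sum[OF has_derivative_sum[OF has_derivative_scaleR_right[OF has_derivative_dird[OF dB]]]]])
  have a': "((\<lambda>y. a y \<bullet> i) has_derivative (\<lambda>w. dird w a x \<bullet> i)) (at x)" for i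
    by (intro has_derivative_inner_left has_derivative_dird a)
  have b': "((\<lambda>y. b y \<bullet> i) has_derivative (\<lambda>w. dird w b x \<bullet> i)) (at x)" for i
    by (intro has_derivative_inner_left has_derivative_dird b)
  have ab: "((\<lambda>y. (a y \<bullet> i) * (b y \<bullet> j)) has_derivative
      (\<lambda>w. (a x \<bullet> i) * (dird w b x \<bullet> j) + (dird w a x \<bullet> i) * (b x \<bullet> j))) (at x)" for i j
    by (rule has_derivative_mult[OF a' b'])
  have Bij: "((\<lambda>y. B (\<phi> y) i j) has_derivative (\<lambda>w. B' (dird w \<phi> x) i j)) (at x)" for i j
    unfolding B'_def
    by (rule has_derivative_compose[OF has_derivative_dird[OF \<phi>] has_derivative_dird[OF dB]])
  have der: "((\<lambda>y. B (\<phi> y) (a y) (b y)) has_derivative (\<lambda>w. \<Sum>i\<in>Basis. \<Sum>j\<in>Basis.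
      ((a x \<bullet> i) * (b x \<bullet> j)) *\<^sub>R B' (dird w \<phi> x) i j
      + ((a x \<bullet> i) * (dird w b x \<bullet> j) + (dird w a x \<bullet> i) * (b x \<bullet> j)) *\<^sub>R B (\<phi> x) i j)) (at x)"
    by (subst expand) (rule has_derivative_sum[OF has_derivative_sum[OF has_derivative_scaleR[OF ab Bij]]])
  show "(\<lambda>y. B (\<phi> y) (a y) (b y)) differentiable (at x)"
    by (rule differentiableI[OF der])
  have "dird w (\<lambda>y. B (\<phi> y) (a y) (b y)) x = B' (dird w \<phi> x) (a x) (b x)
      + B (\<phi> x) (dird w a x) (b x) + B (\<phi> x) (a x) (dird w b x)"
    unfolding dird_eqI[OF der] B'_expand[of _ "a x" "b x"] expand[of _ "a x" "dird w b x"]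
      expand[of _ "dird w a x" "b x"] by (simp add: sum.distrib scaleR_add_left)
  then show "dird w (\<lambda>y. B (\<phi> y) (a y) (b y)) x =
      dird (dird w \<phi> x) (\<lambda>z. B z (a x) (b x)) (\<phi> x)
      + B (\<phi> x) (dird w a x) (b x) + B (\<phi> x) (a x) (dird w b x)"
    unfolding B'_def .
qed

lemma dird_ident [simp]: "dird v (\<lambda>y. y) x = v"
  by (rule dird_eqI[OF has_derivative_ident])

lemmas dird_bilinear_family = bilinear_family_has_derivative(1)[where \<phi> = "\<lambda>y. y", simplified]

subsection \<open>Linear algebra\<close>

lemma linear_chain: "linear f \<Longrightarrow> linear g \<Longrightarrow> linear (\<lambda>x. g (f x))"
  using linear_compose[of f g] by (simp add: o_def)

lemma linear_expand:
  fixes f :: "real^'n::finite \<Rightarrow> 'b::real_vector"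
  assumes "linear f"
  shows "f w = (\<Sum>k\<in>UNIV. w $ k *\<^sub>R f (axis k 1))"
proof -
  have "f w = f (\<Sum>k\<in>UNIV. w $ k *\<^sub>R axis k 1)"
    using basis_expansion[of w] by (simp add: scalar_mult_eq_scaleR)
  also have "\<dots> = (\<Sum>k\<in>UNIV. w $ k *\<^sub>R f (axis k 1))"
    by (simp add: linear_sum[OF assms] linear_cmul[OF assms])
  finally show ?thesis .
qed

definition tr :: "(real^'n::finite \<Rightarrow> real^'n) \<Rightarrow> real" where
  "tr f = (\<Sum>k\<in>UNIV. f (axis k 1) $ k)"

lemma tr_comp_commute:
  fixes f g :: "real^'n::finite \<Rightarrow> real^'n"
  assumes "linear f" "linear g"
  shows "tr (\<lambda>w. f (g w)) = tr (\<lambda>w. g (f w))"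
proof -
  have *: "tr (\<lambda>w. f (g w)) = (\<Sum>k\<in>UNIV. \<Sum>i\<in>UNIV. g (axis k 1) $ i * f (axis i 1) $ k)"
    if "linear f" for f g :: "real^'n \<Rightarrow> real^'n"
  proof -
    have "f (g (axis k 1)) $ k = (\<Sum>i\<in>UNIV. g (axis k 1) $ i * f (axis i 1) $ k)" for k
      by (subst linear_expand[OF that]) simp
    then show ?thesis by (simp add: tr_def)
  qed
  show ?thesis
    unfolding *[OF assms(1)] *[OF assms(2)] by (subst sum.swap) (simp add: mult.commute)
qed

definition bf :: "real^'n::finite^'n \<Rightarrow> real^'n \<Rightarrow> real^'n \<Rightarrow> real" where
  "bf M u v = u \<bullet> (M *v v)"

lemma bilinear_bf: "bilinear (bf M)"
  unfolding bf_def
  by (auto simp: bilinear_def intro!: linearI simp: inner_add_left inner_add_right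
      matrix_vector_right_distrib matrix_vector_mult_scaleR)

lemma bf_axis: "bf M (axis i 1) (axis j 1) = M $ i $ j"
  by (simp add: bf_def inner_axis' matrix_vector_mul_component inner_axis)

lemma bf_sym: "transpose M = M \<Longrightarrow> bf M u v = bf M v u"
  by (metis bf_def dot_lmul_matrix inner_commute transpose_matrix_vector)

lemmas bf_simps = bilinear_ladd[OF bilinear_bf] bilinear_radd[OF bilinear_bf]
  bilinear_lsub[OF bilinear_bf] bilinear_rsub[OF bilinear_bf]
  bilinear_lneg[OF bilinear_bf] bilinear_rneg[OF bilinear_bf]
  bilinear_lmul[OF bilinear_bf] bilinear_rmul[OF bilinear_bf]
  bilinear_lzero[OF bilinear_bf] bilinear_rzero[OF bilinear_bf]

lemma linear_bf: "linear (bf M u)" "linear (\<lambda>u. bf M u v)"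
  using bilinear_bf[of M] by (simp_all add: bilinear_def)

lemma bf_add_matrix: "bf (M + N) u v = bf M u v + bf N u v"
  by (simp add: bf_def matrix_vector_mult_add_rdistrib inner_add_right)

lemma bf_scaleR_matrix: "bf (c *\<^sub>R M) u v = c * bf M u v"
  by (simp add: bf_def scaleR_matrix_vector_assoc[symmetric])

lemma smooth_on_bf [smooth_intros]:
  assumes "smooth_on S M" "smooth_on S u" "smooth_on S v"
  shows "smooth_on S (\<lambda>x. bf (M x) (u x) (v x))"
  unfolding bf_def by (intro smooth_intros assms)

lemma bounded_linear_bf: "bounded_linear (\<lambda>M. bf M u v)"
  by (intro linear_conv_bounded_linear[THEN iffD1] linearI) (auto simp: bf_add_matrix bf_scaleR_matrix)

lemma dird_bf:
  "\<gamma> differentiable (at x) \<Longrightarrow> dird w (\<lambda>y. bf (\<gamma> y) u v) x = bf (dird w \<gamma> x) u v"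
  by (rule dird_linear[OF bounded_linear_bf])

text \<open>The \<open>k\<close>-th coordinate covector with its index raised.\<close>

definition sharp :: "real^'n::finite^'n \<Rightarrow> 'n \<Rightarrow> real^'n" where
  "sharp M k = matrix_inv M *v axis k 1"

lemma bf_sharp:
  assumes "transpose M = M" "det M \<noteq> 0"
  shows "bf M w (sharp M k) = w $ k" "bf M (sharp M k) w = w $ k"
proof -
  show "bf M w (sharp M k) = w $ k"
    by (simp add: bf_def sharp_def matrix_vector_mul_assoc matrix_inv_mult[OF assms(2)] inner_axis)
  then show "bf M (sharp M k) w = w $ k" using bf_sym[OF assms(1)] by metis
qed

lemma bf_nondeg:
  assumes "transpose M = M" "det M \<noteq> 0" "\<And>w. bf M u w = bf M v w"
  shows "u = v"
  using assms(3) bf_sharp(1)[OF assms(1,2)] by (metis vec_eq_iff)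

lemma sharp_expand:
  assumes "transpose M = M" "det M \<noteq> 0"
  shows "w = (\<Sum>k\<in>UNIV. bf M w (axis k 1) *\<^sub>R sharp M k)"
proof (rule bf_nondeg[OF assms])
  fix v
  have "bf M (\<Sum>k\<in>UNIV. bf M w (axis k 1) *\<^sub>R sharp M k) v
      = (\<Sum>k\<in>UNIV. bf M w (axis k 1) * bf M (sharp M k) v)"
    by (simp add: linear_sum[OF linear_bf(2)] bf_simps)
  also have "\<dots> = (\<Sum>k\<in>UNIV. v $ k *\<^sub>R bf M w (axis k 1))"
    by (simp add: bf_sharp[OF assms] mult.commute)
  also have "\<dots> = bf M w v" using linear_expand[OF linear_bf(1), of M w v] by simp
  finally show "bf M w v = bf M (\<Sum>k\<in>UNIV. bf M w (axis k 1) *\<^sub>R sharp M k) v" by simp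
qed

text \<open>The entries of the vectors \<open>sharp M k\<close> form the inverse matrix, which is
  symmetric; so it does not matter in which slot the index is raised.\<close>

lemma contraction_commute:
  assumes M: "transpose M = M" "det M \<noteq> 0" and B: "bilinear (B :: real^'n::finite \<Rightarrow> real^'n \<Rightarrow> 'b::real_vector)"
  shows "(\<Sum>k\<in>UNIV. B (axis k 1) (sharp M k)) = (\<Sum>k\<in>UNIV. B (sharp M k) (axis k 1))"
proof -
  have lin: "linear (B u)" "linear (\<lambda>u. B u v)" for u v using B by (simp_all add: bilinear_def)
  have "(\<Sum>k\<in>UNIV. B (axis k 1) (sharp M k)) = (\<Sum>k\<in>UNIV. \<Sum>l\<in>UNIV. sharp M k $ l *\<^sub>R B (axis k 1) (axis l 1))"
    by (subst linear_expand[OF lin(1)]) simp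
  also have "\<dots> = (\<Sum>k\<in>UNIV. \<Sum>l\<in>UNIV. sharp M l $ k *\<^sub>R B (axis k 1) (axis l 1))"
  proof -
    have "sharp M k $ l = sharp M l $ k" for k l
      using bf_sharp[OF M] by metis
    then show ?thesis by simp
  qed
  also have "\<dots> = (\<Sum>l\<in>UNIV. \<Sum>k\<in>UNIV. sharp M l $ k *\<^sub>R B (axis k 1) (axis l 1))"
    by (rule sum.swap)
  also have "\<dots> = (\<Sum>l\<in>UNIV. B (sharp M l) (axis l 1))"
    by (subst (2) linear_expand[OF lin(2)]) simp
  finally show ?thesis .
qed

lemma tr_sharp:
  assumes M: "transpose M = M" "det M \<noteq> 0"
  shows "tr f = (\<Sum>k\<in>UNIV. bf M (f (axis k 1)) (sharp M k))"
  unfolding tr_def by (simp add: bf_sharp[OF M])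

lemma tr_sharp':
  assumes M: "transpose M = M" "det M \<noteq> 0" and f: "linear f"
  shows "tr f = (\<Sum>k\<in>UNIV. bf M (f (sharp M k)) (axis k 1))"
proof -
  have "bilinear (\<lambda>u v. bf M (f u) v)"
    unfolding bilinear_def using linear_bf(1) linear_chain[OF f linear_bf(2)] by blast
  from contraction_commute[OF M this] show ?thesis unfolding tr_sharp[OF M] .
qed

text \<open>After \<open>A (axis k 1)\<close> is expanded in the vectors \<open>sharp M l\<close>,
  the symmetric array \<open>bf r (sharp M k) (sharp M l)\<close> is paired with a skew one. This is
  used with \<open>A\<close> a curvature operator and with \<open>A\<close> the covariant derivative
  of a Killing field.\<close>

lemma contraction_skew:
  assumes M: "transpose M = M" "det M \<noteq> 0" and A: "linear A"
    and skew: "\<And>u v. bf M (A u) v + bf M u (A v) = 0"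
    and r: "transpose r = r"
  shows "(\<Sum>k\<in>UNIV. bf r (sharp M k) (A (axis k 1))) = 0"
proof -
  have bil: "bilinear (\<lambda>u v. bf r u (A v))"
    unfolding bilinear_def using linear_bf(2) linear_chain[OF A linear_bf(1)] by blast
  have Aexp: "A u = (\<Sum>l\<in>UNIV. bf M (A u) (axis l 1) *\<^sub>R sharp M l)" for u
    by (rule sharp_expand[OF M])
  have "bf r w (A u) = (\<Sum>l\<in>UNIV. bf M (A u) (axis l 1) * bf r w (sharp M l))" for u w
    by (rule trans[OF arg_cong[OF Aexp[of u], of "bf r w"]])
      (simp add: linear_sum[OF linear_bf(1)] bf_simps)
  then have "(\<Sum>k\<in>UNIV. bf r (sharp M k) (A (axis k 1)))
      = (\<Sum>k\<in>UNIV. \<Sum>l\<in>UNIV. bf M (A (axis k 1)) (axis l 1) * bf r (sharp M k) (sharp M l))"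
    by simp
  also have "\<dots> = (\<Sum>k\<in>UNIV. \<Sum>l\<in>UNIV. - (bf M (A (axis l 1)) (axis k 1) * bf r (sharp M k) (sharp M l)))"
  proof (intro sum.cong refl)
    fix k l
    have "bf M (A (axis k 1)) (axis l 1) = - bf M (A (axis l 1)) (axis k 1)"
      using skew[of "axis k 1" "axis l 1"] bf_sym[OF M(1), of "axis k 1" "A (axis l 1)"] by linarith
    then show "bf M (A (axis k 1)) (axis l 1) * bf r (sharp M k) (sharp M l)
        = - (bf M (A (axis l 1)) (axis k 1) * bf r (sharp M k) (sharp M l))" by simp
  qed
  also have "\<dots> = - (\<Sum>k\<in>UNIV. \<Sum>l\<in>UNIV. bf M (A (axis l 1)) (axis k 1) * bf r (sharp M k) (sharp M l))"
    by (simp only: sum_negf)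
  also have "(\<Sum>k\<in>UNIV. \<Sum>l\<in>UNIV. bf M (A (axis l 1)) (axis k 1) * bf r (sharp M k) (sharp M l))
      = (\<Sum>k\<in>UNIV. \<Sum>l\<in>UNIV. bf M (A (axis k 1)) (axis l 1) * bf r (sharp M k) (sharp M l))"
    by (subst sum.swap) (simp only: bf_sym[OF r, of "sharp M _" "sharp M _"])
  finally show ?thesis
    using \<open>(\<Sum>k\<in>UNIV. bf r (sharp M k) (A (axis k 1)))
      = (\<Sum>k\<in>UNIV. \<Sum>l\<in>UNIV. bf M (A (axis k 1)) (axis l 1) * bf r (sharp M k) (sharp M l))\<close>
    by linarith
qed

subsection \<open>Curvature of a metric in coordinates\<close>

lemma linear_eq_axis:
  fixes f :: "real^'n::finite \<Rightarrow> 'b::real_vector"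
  assumes "linear f" "linear g" "\<And>i. f (axis i 1) = g (axis i 1)"
  shows "f w = g w"
  unfolding linear_expand[OF assms(1), of w] linear_expand[OF assms(2), of w] assms(3) ..

text \<open>The Christoffel symbols as a vector-valued bilinear map on constant coordinate vectors.
  It allows curvature identities to be derived without indices, from bilinearity and the product
  rule.\<close>

definition Gam :: "(real^'n::finite \<Rightarrow> real^'n^'n) \<Rightarrow> real^'n \<Rightarrow> real^'n \<Rightarrow> real^'n \<Rightarrow> real^'n" where
  "Gam \<gamma> x u v = (\<Sum>i\<in>UNIV. \<Sum>j\<in>UNIV. (u $ i * v $ j) *\<^sub>R (\<chi> k. christoffel \<gamma> k i j x))"

lemma bilinear_Gam: "bilinear (Gam \<gamma> x)"
  unfolding bilinear_def Gam_def
  by (intro conjI allI linearI)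
    (simp_all add: distrib_left distrib_right scaleR_add_left sum.distrib scaleR_sum_right mult.assoc mult.left_commute)

lemmas Gam_simps = bilinear_ladd[OF bilinear_Gam] bilinear_radd[OF bilinear_Gam]
  bilinear_lsub[OF bilinear_Gam] bilinear_rsub[OF bilinear_Gam]
  bilinear_lneg[OF bilinear_Gam] bilinear_rneg[OF bilinear_Gam]
  bilinear_lmul[OF bilinear_Gam] bilinear_rmul[OF bilinear_Gam]

lemma linear_Gam: "linear (Gam \<gamma> x u)" "linear (\<lambda>u. Gam \<gamma> x u v)"
  using bilinear_Gam[of \<gamma> x] by (simp_all add: bilinear_def)

lemma sum_axis_mult: "(\<Sum>i\<in>UNIV. axis j (1::real) $ i *\<^sub>R f i) = (f (j::'n::finite) :: 'b::real_vector)"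
proof -
  have "(\<Sum>i\<in>UNIV. axis j (1::real) $ i *\<^sub>R f i) = (\<Sum>i\<in>UNIV. if i = j then f i else 0)"
    by (rule sum.cong) (auto simp: axis_def)
  then show ?thesis by simp
qed

lemma Gam_axis_left:
  "Gam \<gamma> x (axis i 1) v = (\<Sum>l\<in>UNIV. v $ l *\<^sub>R (\<chi> k. christoffel \<gamma> k i l x))"
  unfolding Gam_def scaleR_scaleR[symmetric] scaleR_sum_right[symmetric] sum_axis_mult ..

lemma Gam_axis: "Gam \<gamma> x (axis i 1) (axis j 1) $ k = christoffel \<gamma> k i j x"
  unfolding Gam_axis_left sum_axis_mult by simp

text \<open>The curvature operator for fields with constant components: their brackets vanish, so it
  is the commutator of the covariant derivatives along \<open>a\<close> and \<open>b\<close>. With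
  this sign the Ricci tensor is the trace over the first slot.\<close>

definition Rm ::
  "(real^'n::finite \<Rightarrow> real^'n^'n) \<Rightarrow> real^'n \<Rightarrow> real^'n \<Rightarrow> real^'n \<Rightarrow> real^'n \<Rightarrow> real^'n" where
  "Rm \<gamma> x a b u = dird a (\<lambda>y. Gam \<gamma> y b u) x - dird b (\<lambda>y. Gam \<gamma> y a u) x
     + Gam \<gamma> x a (Gam \<gamma> x b u) - Gam \<gamma> x b (Gam \<gamma> x a u)"

definition Ric :: "(real^'n::finite \<Rightarrow> real^'n^'n) \<Rightarrow> real^'n \<Rightarrow> real^'n \<Rightarrow> real^'n \<Rightarrow> real" where
  "Ric \<gamma> x u v = tr (\<lambda>w. Rm \<gamma> x w v u)"

lemma Rm_skew: "Rm \<gamma> x a b u = - Rm \<gamma> x b a u"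
  by (simp add: Rm_def)

text \<open>Stated with nondegeneracy instead of positivity: it is an open condition on the
  determinant, so the perturbed metrics \<open>\<gamma> + s l\<close> with small \<open>s\<close>
  stay in the locale near a point.\<close>

locale metric_chart =
  fixes \<Omega> :: "(real^'n::finite) set" and \<gamma> :: "real^'n \<Rightarrow> real^'n^'n"
  assumes open_dom: "open \<Omega>" and smooth: "smooth_on \<Omega> \<gamma>"
    and sym: "x \<in> \<Omega> \<Longrightarrow> transpose (\<gamma> x) = \<gamma> x" and nondeg: "x \<in> \<Omega> \<Longrightarrow> det (\<gamma> x) \<noteq> 0"
begin

lemma differentiable: "smooth_on \<Omega> f \<Longrightarrow> x \<in> \<Omega> \<Longrightarrow> f differentiable (at x)"
  by (rule smooth_on_differentiable[OF open_dom])

lemma smooth_christoffel: "smooth_on \<Omega> (\<lambda>x. christoffel \<gamma> k i j x)"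
  unfolding christoffel_def pderiv_at_eq_dird
  by (intro smooth_intros smooth open_dom nondeg) simp_all

lemma smooth_Gam:
  assumes "smooth_on \<Omega> u" "smooth_on \<Omega> v"
  shows "smooth_on \<Omega> (\<lambda>x. Gam \<gamma> x (u x) (v x))"
  unfolding Gam_def by (intro smooth_intros smooth_christoffel assms)

lemma diff_Gam: "x \<in> \<Omega> \<Longrightarrow> (\<lambda>y. Gam \<gamma> y u v) differentiable (at x)"
  by (intro differentiable smooth_Gam smooth_on_const)

lemma diff_g: "x \<in> \<Omega> \<Longrightarrow> (\<lambda>y. bf (\<gamma> y) u v) differentiable (at x)"
  by (intro differentiable smooth_on_bf smooth smooth_on_const)

lemma diff_\<gamma>: "x \<in> \<Omega> \<Longrightarrow> \<gamma> differentiable (at x)"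
  by (intro differentiable smooth)

lemma g_sym: "x \<in> \<Omega> \<Longrightarrow> bf (\<gamma> x) u v = bf (\<gamma> x) v u"
  by (rule bf_sym[OF sym])

lemma dird_g_sym: "x \<in> \<Omega> \<Longrightarrow> dird w (\<lambda>y. bf (\<gamma> y) u v) x = dird w (\<lambda>y. bf (\<gamma> y) v u) x"
  by (rule dird_cong_open[OF open_dom]) (auto intro: g_sym)

text \<open>Lowering the index removes the inverse metric from the Christoffel symbols. On
  coordinate vectors the identity is then their definition, and both sides are trilinear.
  Torsion-freeness, metric compatibility and the transformation law of the connection all follow
  from it.\<close>

lemma koszul:
  assumes x: "x \<in> \<Omega>"
  shows "2 * bf (\<gamma> x) (Gam \<gamma> x u v) w = dird u (\<lambda>y. bf (\<gamma> y) v w) x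
    + dird v (\<lambda>y. bf (\<gamma> y) u w) x - dird w (\<lambda>y. bf (\<gamma> y) u v) x"
proof -
  note d = dird_bf[OF diff_\<gamma>[OF x]]
  have comp: "pderiv_at i (\<lambda>y. \<gamma> y $ j $ l) x = bf (dird (axis i 1) \<gamma> x) (axis j 1) (axis l 1)" for i j l
  proof -
    have "(\<lambda>y. \<gamma> y $ j) differentiable (at x)"
      by (intro differentiable smooth_on_nth smooth x)
    then show ?thesis
      unfolding pderiv_at_eq_dird bf_axis by (simp add: dird_nth diff_\<gamma>[OF x])
  qed
  define T where "T u v w = bf (dird u \<gamma> x) v w + bf (dird v \<gamma> x) u w - bf (dird w \<gamma> x) u v" for u v w
  have basis: "2 * bf (\<gamma> x) (Gam \<gamma> x (axis i 1) (axis j 1)) (axis m 1) = T (axis i 1) (axis j 1) (axis m 1)"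
    for i j m
  proof -
    define Q where "Q = (\<chi> l. T (axis i 1) (axis j 1) (axis l 1))"
    have "Gam \<gamma> x (axis i 1) (axis j 1) = (1/2) *\<^sub>R (matrix_inv (\<gamma> x) *v Q)"
      by (simp add: vec_eq_iff Gam_axis christoffel_def matrix_vector_mult_def Q_def T_def comp)
    then have "\<gamma> x *v Gam \<gamma> x (axis i 1) (axis j 1) = (1/2) *\<^sub>R Q"
      by (simp add: matrix_vector_mult_scaleR matrix_vector_mul_assoc matrix_inv_mult[OF nondeg[OF x]])
    then have "bf (\<gamma> x) (axis m 1) (Gam \<gamma> x (axis i 1) (axis j 1)) = Q $ m / 2"
      by (simp add: bf_def inner_axis')
    then show ?thesis unfolding g_sym[OF x, of "axis m 1"] by (simp add: Q_def)
  qed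
  have lind: "linear (\<lambda>u. bf (dird u \<gamma> x) v w)" for v w
    by (rule linear_chain[OF linear_dird[OF diff_\<gamma>[OF x]] bounded_linear.linear[OF bounded_linear_bf]])
  have T: "linear (\<lambda>u. T u v w)" "linear (\<lambda>v. T u v w)" "linear (\<lambda>w. T u v w)" for u v w
    unfolding T_def by (intro linear_compose_add linear_compose_sub lind linear_bf)+
  have L: "linear (\<lambda>u. 2 * bf (\<gamma> x) (Gam \<gamma> x u v) w)" "linear (\<lambda>v. 2 * bf (\<gamma> x) (Gam \<gamma> x u v) w)"
    "linear (\<lambda>w. 2 * bf (\<gamma> x) (Gam \<gamma> x u v) w)" for u v w
    by (rule linearI; simp add: bf_simps Gam_simps)+
  have "2 * bf (\<gamma> x) (Gam \<gamma> x u v) w = T u v w"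
    by (rule linear_eq_axis[OF L(1) T(1)], rule linear_eq_axis[OF L(2) T(2)],
        rule linear_eq_axis[OF L(3) T(3)], rule basis)
  then show ?thesis unfolding d T_def .
qed

lemma Gam_sym: "x \<in> \<Omega> \<Longrightarrow> Gam \<gamma> x u v = Gam \<gamma> x v u"
proof (rule bf_nondeg[OF sym nondeg])
  fix w assume x: "x \<in> \<Omega>"
  show "bf (\<gamma> x) (Gam \<gamma> x u v) w = bf (\<gamma> x) (Gam \<gamma> x v u) w"
    using koszul[OF x, of u v w] koszul[OF x, of v u w] dird_g_sym[OF x, of w u v] by linarith
qed

lemma compat:
  assumes x: "x \<in> \<Omega>"
  shows "dird w (\<lambda>y. bf (\<gamma> y) u v) x = bf (\<gamma> x) (Gam \<gamma> x w u) v + bf (\<gamma> x) u (Gam \<gamma> x w v)"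
  using koszul[OF x, of w u v] koszul[OF x, of w v u] dird_g_sym[OF x, of w u v]
    dird_g_sym[OF x, of u v w] dird_g_sym[OF x, of v w u] g_sym[OF x, of u "Gam \<gamma> x w v"]
    dird_g_sym[OF x, of u w v]
  by linarith

lemma christoffel_sym: "x \<in> \<Omega> \<Longrightarrow> christoffel \<gamma> k i j x = christoffel \<gamma> k j i x"
  using Gam_sym[of x "axis i 1" "axis j 1"] by (simp add: Gam_axis[symmetric])

lemma dGam_sym: "x \<in> \<Omega> \<Longrightarrow> dird w (\<lambda>y. Gam \<gamma> y u v) x = dird w (\<lambda>y. Gam \<gamma> y v u) x"
  by (rule dird_cong_open[OF open_dom]) (auto intro: Gam_sym)

lemma linear_dGam:
  assumes x: "x \<in> \<Omega>"
  shows "linear (\<lambda>w. dird w (\<lambda>y. Gam \<gamma> y u v) x)" "linear (\<lambda>u. dird w (\<lambda>y. Gam \<gamma> y u v) x)"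
    "linear (\<lambda>v. dird w (\<lambda>y. Gam \<gamma> y u v) x)"
proof -
  note dG = diff_Gam[OF x]
  show "linear (\<lambda>w. dird w (\<lambda>y. Gam \<gamma> y u v) x)" by (rule linear_dird[OF dG])
  show "linear (\<lambda>u. dird w (\<lambda>y. Gam \<gamma> y u v) x)"
    by (rule linearI) (simp_all add: Gam_simps dird_add[OF dG dG] dird_scaleR_right[OF dG])
  show "linear (\<lambda>v. dird w (\<lambda>y. Gam \<gamma> y u v) x)"
    by (rule linearI) (simp_all add: Gam_simps dird_add[OF dG dG] dird_scaleR_right[OF dG])
qed

lemma linear_Rm:
  assumes x: "x \<in> \<Omega>"
  shows "linear (\<lambda>a. Rm \<gamma> x a b u)" "linear (\<lambda>b. Rm \<gamma> x a b u)" "linear (\<lambda>u. Rm \<gamma> x a b u)"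
  unfolding Rm_def
  by (intro linear_compose_add linear_compose_sub linear_dGam[OF x] linear_Gam
      linear_chain[OF linear_Gam(1) linear_Gam(1)] linear_chain[OF linear_Gam(2) linear_Gam(1)])+

lemma linear_Ric:
  assumes x: "x \<in> \<Omega>"
  shows "linear (\<lambda>u. Ric \<gamma> x u v)" "linear (\<lambda>v. Ric \<gamma> x u v)"
  unfolding Ric_def tr_def
  by (intro linear_compose_sum ballI linear_chain[OF _ bounded_linear.linear[OF bounded_linear_vec_nth]] linear_Rm[OF x] finite)+

lemma smooth_Rm: "smooth_on \<Omega> (\<lambda>y. Rm \<gamma> y a b u)"
  unfolding Rm_def by (intro smooth_intros smooth_Gam open_dom)

lemma smooth_Ric: "smooth_on \<Omega> (\<lambda>y. Ric \<gamma> y u v)"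
  unfolding Ric_def tr_def by (intro smooth_intros smooth_Rm)

text \<open>Connects the index formula for the Ricci tensor with the trace \<open>Ric\<close>. The
  two have some lower indices of the Christoffel symbols in opposite order, which is where their
  symmetry enters.\<close>

lemma coord_ricci_axis:
  assumes x: "x \<in> \<Omega>"
  shows "coord_ricci \<gamma> x $ i $ j = Ric \<gamma> x (axis i 1) (axis j 1)"
proof -
  have d: "dird w (\<lambda>y. Gam \<gamma> y (axis a 1) (axis b 1)) x $ k = dird w (christoffel \<gamma> k b a) x" for w a b k
  proof -
    have "dird w (\<lambda>y. Gam \<gamma> y (axis a 1) (axis b 1)) x $ k
        = dird w (\<lambda>y. Gam \<gamma> y (axis a 1) (axis b 1) $ k) x"
      by (rule dird_nth[symmetric]) (rule diff_Gam[OF x])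
    also have "\<dots> = dird w (christoffel \<gamma> k b a) x"
      by (rule dird_cong_open[OF open_dom x]) (simp add: Gam_axis christoffel_sym)
    finally show ?thesis .
  qed
  have G: "Gam \<gamma> x (axis a 1) (Gam \<gamma> x (axis b 1) (axis c 1)) $ k
      = (\<Sum>l\<in>UNIV. christoffel \<gamma> k a l x * christoffel \<gamma> l c b x)" for a b c k
    by (simp add: Gam_axis_left[of _ _ a] Gam_axis christoffel_sym[OF x, of _ b c] mult.commute)
  show ?thesis
    unfolding Ric_def tr_def Rm_def coord_ricci_def pderiv_at_eq_dird
    by (simp add: d G sum.distrib sum_subtractf)
qed

lemma bf_coord_ricci:
  assumes x: "x \<in> \<Omega>"
  shows "bf (coord_ricci \<gamma> x) u v = Ric \<gamma> x u v"
  by (rule linear_eq_axis[OF linear_bf(2) linear_Ric(1)[OF x]],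
      rule linear_eq_axis[OF linear_bf(1) linear_Ric(2)[OF x]])
    (simp add: bf_axis coord_ricci_axis[OF x])

end

subsection \<open>Covariance of the curvature\<close>

text \<open>The chain rule when both the base point \<open>j z\<close> and the direction
  \<open>a z\<close> move. It serves for the differential of a coordinate change in a moving
  direction and for the second derivative of a function along a curve.\<close>

lemma dird_dird_family:
  fixes \<phi> :: "'v::euclidean_space \<Rightarrow> 'b::real_normed_vector"
    and j a :: "'a::real_normed_vector \<Rightarrow> 'v"
  assumes S: "open S" "smooth_on S \<phi>" and T: "open T" "x \<in> T" "\<And>z. z \<in> T \<Longrightarrow> j z \<in> S"
    and j: "j differentiable (at x)" and a: "a differentiable (at x)"
  shows "dird w (\<lambda>z. dird (a z) \<phi> (j z)) x
    = dird (dird w j x) (dird (a x) \<phi>) (j x) + dird (dird w a x) \<phi> (j x)"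
proof -
  note jx = T(3)[OF T(2)]
  have ex: "dird v \<phi> z = (\<Sum>k\<in>Basis. (v \<bullet> k) *\<^sub>R dird k \<phi> z)" if "z \<in> S" for v z
  proof -
    note lin = linear_dird[OF smooth_on_differentiable[OF S that]]
    have "dird v \<phi> z = dird (\<Sum>k\<in>Basis. (v \<bullet> k) *\<^sub>R k) \<phi> z" by (simp add: euclidean_representation)
    then show ?thesis by (simp only: linear_sum[OF lin] linear_cmul[OF lin])
  qed
  have d\<phi>: "dird v \<phi> differentiable (at (j x))" for v
    by (rule smooth_on_differentiable[OF S(1) smooth_on_dird[OF S] jx])
  have dj: "(\<lambda>z. dird v \<phi> (j z)) differentiable (at x)" for v
    by (rule differentiableI[OF has_derivative_compose[OF has_derivative_dird[OF j] has_derivative_dird[OF d\<phi>]]])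
  have dn: "(\<lambda>z. a z \<bullet> k) differentiable (at x)" for k
    by (rule differentiableI[OF bounded_linear.has_derivative[OF bounded_linear_inner_left has_derivative_dird[OF a]]])
  have ds: "(\<lambda>z. c z *\<^sub>R dird v \<phi> (j z)) differentiable (at x)" if "c differentiable (at x)" for c v
    by (rule differentiableI[OF has_derivative_scaleR[OF has_derivative_dird[OF that] has_derivative_dird[OF dj]]])
  have *: "dird w (\<lambda>z. dird (b z) \<phi> (j z)) x
      = (\<Sum>k\<in>Basis. (b x \<bullet> k) *\<^sub>R dird w (\<lambda>z. dird k \<phi> (j z)) x + dird w (\<lambda>z. b z \<bullet> k) x *\<^sub>R dird k \<phi> (j x))"
    if b: "\<And>k. (\<lambda>z. b z \<bullet> k) differentiable (at x)" for b
  proof -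
    have "dird w (\<lambda>z. dird (b z) \<phi> (j z)) x = dird w (\<lambda>z. \<Sum>k\<in>Basis. (b z \<bullet> k) *\<^sub>R dird k \<phi> (j z)) x"
      by (rule dird_cong_open[OF T(1,2) ex[OF T(3)]])
    also have "\<dots> = (\<Sum>k\<in>Basis. dird w (\<lambda>z. (b z \<bullet> k) *\<^sub>R dird k \<phi> (j z)) x)"
      by (rule dird_sum[OF ds[OF b]])
    also have "\<dots> = (\<Sum>k\<in>Basis. (b x \<bullet> k) *\<^sub>R dird w (\<lambda>z. dird k \<phi> (j z)) x
        + dird w (\<lambda>z. b z \<bullet> k) x *\<^sub>R dird k \<phi> (j x))"
      by (rule sum.cong[OF refl dird_bilinear[OF bounded_bilinear_scaleR b dj]])
    finally show ?thesis .
  qed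
  have "dird w (\<lambda>z. dird (a x) \<phi> (j z)) x = (\<Sum>k\<in>Basis. (a x \<bullet> k) *\<^sub>R dird w (\<lambda>z. dird k \<phi> (j z)) x)"
    using *[of "\<lambda>_. a x"] by simp
  moreover have "dird w (\<lambda>z. dird (a x) \<phi> (j z)) x = dird (dird w j x) (dird (a x) \<phi>) (j x)"
    by (rule dird_compose[OF j d\<phi>])
  moreover have "dird (dird w a x) \<phi> (j x) = (\<Sum>k\<in>Basis. (dird w a x \<bullet> k) *\<^sub>R dird k \<phi> (j x))"
    by (rule ex[OF jx])
  ultimately show ?thesis unfolding *[OF dn] dird_linear[OF bounded_linear_inner_left a] sum.distrib by simp
qed

locale metric_pullback = source: metric_chart \<Omega>' \<gamma>' + target: metric_chart \<Omega> \<gamma>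
  for \<Omega>' :: "(real^'n::finite) set" and \<gamma>' and \<Omega> :: "(real^'n) set" and \<gamma> +
  fixes \<phi> :: "real^'n \<Rightarrow> real^'n"
  assumes smooth_\<phi>: "smooth_on \<Omega>' \<phi>" and range_\<phi>: "y \<in> \<Omega>' \<Longrightarrow> \<phi> y \<in> \<Omega>"
    and pullback: "y \<in> \<Omega>' \<Longrightarrow> bf (\<gamma>' y) u v = bf (\<gamma> (\<phi> y)) (dird u \<phi> y) (dird v \<phi> y)"
begin

lemma linear_d\<phi>: "y \<in> \<Omega>' \<Longrightarrow> linear (\<lambda>u. dird u \<phi> y)"
  by (intro linear_dird source.differentiable smooth_\<phi>)

text \<open>A vector killed by the differential of \<phi> is orthogonal to everything for the pulled
  back metric, hence 0; an injective endomorphism in finite dimension is bijective.\<close>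

lemma d\<phi>_inverse:
  assumes y: "y \<in> \<Omega>'"
  obtains K where "linear K" "\<And>u. K (dird u \<phi> y) = u" "\<And>w. dird (K w) \<phi> y = w"
proof -
  let ?J = "\<lambda>u. dird u \<phi> y"
  have inj: "inj ?J"
    unfolding linear_injective_0[OF linear_d\<phi>[OF y]]
  proof (intro allI impI)
    fix u assume "?J u = 0"
    then have "bf (\<gamma>' y) u v = bf (\<gamma>' y) 0 v" for v
      unfolding pullback[OF y] linear_0[OF linear_d\<phi>[OF y]] by simp
    then show "u = 0" by (rule bf_nondeg[OF source.sym[OF y] source.nondeg[OF y]])
  qed
  obtain K where K: "linear K" "K \<circ> ?J = id"
    using linear_injective_left_inverse[OF linear_d\<phi>[OF y] inj] by blast
  then have "?J \<circ> K = id" using linear_inverse_left[OF linear_d\<phi>[OF y] K(1)] by blast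
  show thesis
    by (rule that[OF K(1)]) (use K(2) \<open>?J \<circ> K = id\<close> in \<open>simp_all add: fun_eq_iff\<close>)
qed

lemma d2\<phi>_sym: "y \<in> \<Omega>' \<Longrightarrow> dird u (dird v \<phi>) y = dird v (dird u \<phi>) y"
  by (rule dird_commute[OF source.open_dom smooth_\<phi>])

text \<open>The inhomogeneous transformation law of a connection. When \<open>pullback\<close> is
  differentiated and inserted into the Koszul formulas, second derivatives of \<phi> appear in six
  terms; by symmetry four of them cancel and the other two produce the last summand.\<close>

lemma Gam_pullback:
  assumes y: "y \<in> \<Omega>'"
  shows "dird (Gam \<gamma>' y u v) \<phi> y = Gam \<gamma> (\<phi> y) (dird u \<phi> y) (dird v \<phi> y) + dird u (dird v \<phi>) y"
proof -
  let ?J = "\<lambda>u. dird u \<phi> y" and ?x = "\<phi> y" and ?g = "bf (\<gamma> (\<phi> y))"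
  have x: "?x \<in> \<Omega>" using range_\<phi>[OF y] .
  have D: "dird w (\<lambda>z. bf (\<gamma>' z) u v) y = dird (?J w) (\<lambda>z. bf (\<gamma> z) (?J u) (?J v)) ?x
      + ?g (dird w (dird u \<phi>) y) (?J v) + ?g (?J u) (dird w (dird v \<phi>) y)" for u v w
  proof -
    have "dird w (\<lambda>z. bf (\<gamma>' z) u v) y = dird w (\<lambda>z. bf (\<gamma> (\<phi> z)) (dird u \<phi> z) (dird v \<phi> z)) y"
      by (rule dird_cong_open[OF source.open_dom y pullback])
    also have "\<dots> = dird (?J w) (\<lambda>z. bf (\<gamma> z) (?J u) (?J v)) ?x
      + ?g (dird w (dird u \<phi>) y) (?J v) + ?g (?J u) (dird w (dird v \<phi>) y)"
      by (rule bilinear_family_has_derivative(1)[of "\<lambda>z. bf (\<gamma> z)"])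
        (intro bilinear_bf target.diff_g x source.differentiable smooth_\<phi> y smooth_on_dird source.open_dom)+
    finally show ?thesis .
  qed
  have *: "?g (dird (Gam \<gamma>' y u v) \<phi> y) (?J w)
      = ?g (Gam \<gamma> ?x (?J u) (?J v) + dird u (dird v \<phi>) y) (?J w)" for w
  proof -
    have "2 * ?g (dird (Gam \<gamma>' y u v) \<phi> y) (?J w) = 2 * ?g (Gam \<gamma> ?x (?J u) (?J v)) (?J w)
        + ?g (dird u (dird v \<phi>) y) (?J w) + ?g (?J v) (dird u (dird w \<phi>) y)
        + (?g (dird u (dird v \<phi>) y) (?J w) + ?g (?J u) (dird v (dird w \<phi>) y))
        - (?g (dird u (dird w \<phi>) y) (?J v) + ?g (?J u) (dird v (dird w \<phi>) y))"
      using source.koszul[OF y, of u v w] target.koszul[OF x, of "?J u" "?J v" "?J w"]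
      unfolding D pullback[OF y, of "Gam \<gamma>' y u v" w]
        d2\<phi>_sym[OF y, of v u] d2\<phi>_sym[OF y, of w u] d2\<phi>_sym[OF y, of w v] by linarith
    then show ?thesis
      using target.g_sym[OF x, of "?J v" "dird u (dird w \<phi>) y"] unfolding bf_simps by linarith
  qed
  obtain K where K: "\<And>w. ?J (K w) = w" using d\<phi>_inverse[OF y] by metis
  show ?thesis
  proof (rule bf_nondeg[OF target.sym[OF x] target.nondeg[OF x]])
    fix w
    show "?g (dird (Gam \<gamma>' y u v) \<phi> y) w = ?g (Gam \<gamma> ?x (?J u) (?J v) + dird u (dird v \<phi>) y) w"
      using *[of "K w"] unfolding K .
  qed
qed

text \<open>The derivative of \<open>Gam_pullback\<close>. On its left side the direction
  \<open>Gam \<gamma>' z u v\<close> in which \<phi> is differentiated moves with \<open>z\<close>,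
  which accounts for the subtracted term.\<close>

lemma dGam_pullback:
  assumes y: "y \<in> \<Omega>'"
  shows "dird (dird w (\<lambda>z. Gam \<gamma>' z u v) y) \<phi> y =
    dird (dird w \<phi> y) (\<lambda>z. Gam \<gamma> z (dird u \<phi> y) (dird v \<phi> y)) (\<phi> y)
    + Gam \<gamma> (\<phi> y) (dird w (dird u \<phi>) y) (dird v \<phi> y) + Gam \<gamma> (\<phi> y) (dird u \<phi> y) (dird w (dird v \<phi>) y)
    + dird w (dird u (dird v \<phi>)) y - dird w (dird (Gam \<gamma>' y u v) \<phi>) y"
proof -
  have sd: "smooth_on \<Omega>' (dird v \<phi>)" "smooth_on \<Omega>' (dird u (dird v \<phi>))" for u v
    by (intro smooth_on_dird source.open_dom smooth_\<phi>)+
  note fam = bilinear_family_has_derivative[where B = "Gam \<gamma>" and \<phi> = \<phi> and x = y and a = "dird u \<phi>" and b = "dird v \<phi>",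
      OF bilinear_Gam target.diff_Gam[OF range_\<phi>[OF y]] source.differentiable[OF smooth_\<phi> y]
        source.differentiable[OF sd(1) y] source.differentiable[OF sd(1) y]]
  have "dird w (\<lambda>z. dird (Gam \<gamma>' z u v) \<phi> z) y
      = dird w (\<lambda>z. Gam \<gamma> (\<phi> z) (dird u \<phi> z) (dird v \<phi> z) + dird u (dird v \<phi>) z) y"
    by (rule dird_cong_open[OF source.open_dom y Gam_pullback])
  also have "\<dots> = dird w (\<lambda>z. Gam \<gamma> (\<phi> z) (dird u \<phi> z) (dird v \<phi> z)) y + dird w (dird u (dird v \<phi>)) y"
    by (rule dird_add[OF fam(2) source.differentiable[OF sd(2) y]])
  finally have "dird w (\<lambda>z. dird (Gam \<gamma>' z u v) \<phi> z) y
      = dird w (\<lambda>z. Gam \<gamma> (\<phi> z) (dird u \<phi> z) (dird v \<phi> z)) y + dird w (dird u (dird v \<phi>)) y" .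
  moreover have "dird w (\<lambda>z. dird (Gam \<gamma>' z u v) \<phi> z) y
      = dird (dird w (\<lambda>z. z) y) (dird (Gam \<gamma>' y u v) \<phi>) y + dird (dird w (\<lambda>z. Gam \<gamma>' z u v) y) \<phi> y"
    by (rule dird_dird_family[OF source.open_dom smooth_\<phi> source.open_dom y _ differentiable_ident source.diff_Gam[OF y]])
  ultimately show ?thesis unfolding fam(1) by (simp add: algebra_simps)
qed

text \<open>The failure of the Christoffel map to be a tensor cancels on antisymmetrization: the
  third derivatives of \<phi> by their symmetry, the terms with second derivatives against those
  from the quadratic part of the curvature.\<close>

lemma Rm_pullback:
  assumes y: "y \<in> \<Omega>'"
  shows "dird (Rm \<gamma>' y w v u) \<phi> y = Rm \<gamma> (\<phi> y) (dird w \<phi> y) (dird v \<phi> y) (dird u \<phi> y)"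
proof -
  note lin = linear_add[OF linear_d\<phi>[OF y]] linear_diff[OF linear_d\<phi>[OF y]]
  have d3: "dird w (dird v (dird u \<phi>)) y = dird v (dird w (dird u \<phi>)) y"
    by (rule dird_commute[OF source.open_dom smooth_on_dird[OF source.open_dom smooth_\<phi>] y])
  show ?thesis
    unfolding Rm_def lin dGam_pullback[OF y] Gam_pullback[OF y] Gam_simps d3 d2\<phi>_sym[OF y, of w v]
    by simp
qed

text \<open>The differential of \<phi> conjugates one curvature operator into the other, and the
  trace is invariant under conjugation.\<close>

lemma Ric_pullback:
  assumes y: "y \<in> \<Omega>'"
  shows "Ric \<gamma>' y u v = Ric \<gamma> (\<phi> y) (dird u \<phi> y) (dird v \<phi> y)"
proof -
  let ?J = "\<lambda>u. dird u \<phi> y"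
  obtain K where K: "linear K" "\<And>u. K (?J u) = u" "\<And>w. ?J (K w) = w"
    using d\<phi>_inverse[OF y] by metis
  let ?F = "\<lambda>w. Rm \<gamma> (\<phi> y) w (?J v) (?J u)"
  have F: "linear ?F" by (rule target.linear_Rm(1)[OF range_\<phi>[OF y]])
  have "Rm \<gamma>' y w v u = K (?F (?J w))" for w
    using K(2)[of "Rm \<gamma>' y w v u"] unfolding Rm_pullback[OF y] by simp
  then have "Ric \<gamma>' y u v = tr (\<lambda>w. K (?F (?J w)))" unfolding Ric_def by simp
  also have "\<dots> = tr (\<lambda>w. ?F (?J (K w)))"
    by (rule tr_comp_commute[OF K(1) linear_chain[OF linear_d\<phi>[OF y] F]])
  finally show ?thesis unfolding K(3) Ric_def .
qed

end

subsection \<open>The contracted Bianchi identity\<close>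

definition nabla_Rm ::
  "(real^'n::finite \<Rightarrow> real^'n^'n) \<Rightarrow> real^'n \<Rightarrow> real^'n \<Rightarrow> real^'n \<Rightarrow> real^'n \<Rightarrow> real^'n \<Rightarrow> real^'n" where
  "nabla_Rm \<gamma> x e a b u = dird e (\<lambda>y. Rm \<gamma> y a b u) x + Gam \<gamma> x e (Rm \<gamma> x a b u)
     - Rm \<gamma> x a b (Gam \<gamma> x e u) - Rm \<gamma> x (Gam \<gamma> x e a) b u - Rm \<gamma> x a (Gam \<gamma> x e b) u"

definition nabla ::
  "(real^'n::finite \<Rightarrow> real^'n^'n) \<Rightarrow> (real^'n \<Rightarrow> real^'n \<Rightarrow> real^'n \<Rightarrow> real) \<Rightarrow>
    real^'n \<Rightarrow> real^'n \<Rightarrow> real^'n \<Rightarrow> real^'n \<Rightarrow> real" where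
  "nabla \<gamma> q x e u v = dird e (\<lambda>y. q y u v) x - q x (Gam \<gamma> x e u) v - q x u (Gam \<gamma> x e v)"

context metric_chart
begin

lemma diff_Rm: "x \<in> \<Omega> \<Longrightarrow> (\<lambda>y. Rm \<gamma> y a b u) differentiable (at x)"
  by (intro differentiable smooth_Rm)

lemma dird_Gam_Gam:
  assumes x: "x \<in> \<Omega>"
  shows "dird e (\<lambda>y. Gam \<gamma> y a (Gam \<gamma> y b u)) x
    = dird e (\<lambda>y. Gam \<gamma> y a (Gam \<gamma> x b u)) x + Gam \<gamma> x a (dird e (\<lambda>y. Gam \<gamma> y b u) x)"
proof -
  have "dird e (\<lambda>y. Gam \<gamma> y a (Gam \<gamma> y b u)) x
    = dird e (\<lambda>y. Gam \<gamma> y a (Gam \<gamma> x b u)) x + Gam \<gamma> x (dird e (\<lambda>y. a) x) (Gam \<gamma> x b u)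
      + Gam \<gamma> x a (dird e (\<lambda>y. Gam \<gamma> y b u) x)"
    by (rule dird_bilinear_family[where B = "Gam \<gamma>"])
      (intro bilinear_Gam diff_Gam x differentiable smooth_on_const)+
  then show ?thesis by (simp add: linear_0[OF linear_Gam(2)])
qed

lemma dird_Rm:
  assumes x: "x \<in> \<Omega>"
  shows "dird e (\<lambda>y. Rm \<gamma> y a b u) x =
      dird e (dird a (\<lambda>y. Gam \<gamma> y b u)) x - dird e (dird b (\<lambda>y. Gam \<gamma> y a u)) x
      + (dird e (\<lambda>y. Gam \<gamma> y a (Gam \<gamma> x b u)) x + Gam \<gamma> x a (dird e (\<lambda>y. Gam \<gamma> y b u) x))
      - (dird e (\<lambda>y. Gam \<gamma> y b (Gam \<gamma> x a u)) x + Gam \<gamma> x b (dird e (\<lambda>y. Gam \<gamma> y a u) x))"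
proof -
  have 1: "dird a (\<lambda>y. Gam \<gamma> y b u) differentiable (at x)" for a b
    by (intro differentiable smooth_on_dird open_dom smooth_Gam smooth_on_const x)
  have 2: "(\<lambda>y. Gam \<gamma> y a (Gam \<gamma> y b u)) differentiable (at x)" for a b
    by (intro differentiable smooth_Gam smooth_on_const x)
  have 3: "(\<lambda>y. dird a (\<lambda>y. Gam \<gamma> y b u) y - dird b (\<lambda>y. Gam \<gamma> y a u) y) differentiable (at x)"
    by (intro differentiable smooth_on_diff smooth_on_dird open_dom smooth_Gam smooth_on_const x)
  have 4: "(\<lambda>y. dird a (\<lambda>y. Gam \<gamma> y b u) y - dird b (\<lambda>y. Gam \<gamma> y a u) y + Gam \<gamma> y a (Gam \<gamma> y b u)) differentiable (at x)"
    by (intro differentiable smooth_on_diff smooth_on_add smooth_on_dird open_dom smooth_Gam smooth_on_const x)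
  show ?thesis
    unfolding Rm_def dird_Gam_Gam[OF x, symmetric]
    by (simp only: dird_diff[OF 4 2] dird_add[OF 3 2] dird_diff[OF 1 1])
qed

lemma Rm_first_bianchi:
  assumes x: "x \<in> \<Omega>"
  shows "Rm \<gamma> x a b u + Rm \<gamma> x b u a + Rm \<gamma> x u a b = 0"
  unfolding Rm_def
  using Gam_sym[OF x, of a b] Gam_sym[OF x, of b u] Gam_sym[OF x, of u a]
    dGam_sym[OF x, of a b u] dGam_sym[OF x, of b a u] dGam_sym[OF x, of u a b]
  by simp

lemma second_bianchi:
  assumes x: "x \<in> \<Omega>"
  shows "nabla_Rm \<gamma> x e a b u + nabla_Rm \<gamma> x a b e u + nabla_Rm \<gamma> x b e a u = 0"
proof -
  \<comment> \<open>\<open>d e a b\<close> omits the corrections for the slots \<open>a\<close> and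
    \<open>b\<close>. Its cyclic sum vanishes because derivatives of the Christoffel map commute;
    the omitted corrections cancel in the cyclic sum by the symmetry of \<open>Gam\<close> and the
    skewness of \<open>Rm\<close>.\<close>
  define d where "d e a b = dird e (\<lambda>y. Rm \<gamma> y a b u) x + Gam \<gamma> x e (Rm \<gamma> x a b u)
     - Rm \<gamma> x a b (Gam \<gamma> x e u)" for e a b
  have comm: "dird v (dird w (\<lambda>y. Gam \<gamma> y c u)) x = dird w (dird v (\<lambda>y. Gam \<gamma> y c u)) x" for v w c
    by (rule dird_commute[OF open_dom _ x]) (intro smooth_Gam smooth_on_const)
  have "d e a b + d a b e + d b e a = 0"
    unfolding d_def dird_Rm[OF x] unfolding Rm_def Gam_simps
    using comm[of e a b] comm[of e b a] comm[of a b e] by (simp add: algebra_simps)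
  moreover have n: "nabla_Rm \<gamma> x e a b u = d e a b - Rm \<gamma> x (Gam \<gamma> x e a) b u + Rm \<gamma> x (Gam \<gamma> x e b) a u" for e a b
    unfolding nabla_Rm_def d_def Rm_skew[of \<gamma> x a "Gam \<gamma> x e b"] by simp
  ultimately show ?thesis
    unfolding n Gam_sym[OF x, of e a] Gam_sym[OF x, of a b] Gam_sym[OF x, of b e] by (simp add: algebra_simps)
qed

text \<open>The second derivatives of \<open>bf (\<gamma> y) u v\<close> along \<open>a\<close> and
  \<open>b\<close> commute. Expanding both orders by \<open>compat\<close>, the difference is the
  left side of the claim.\<close>

lemma bf_skew_Rm:
  assumes x: "x \<in> \<Omega>"
  shows "bf (\<gamma> x) (Rm \<gamma> x a b u) v + bf (\<gamma> x) u (Rm \<gamma> x a b v) = 0"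
proof -
  have D: "dird a (dird b (\<lambda>y. bf (\<gamma> y) u v)) x
      = bf (\<gamma> x) (Gam \<gamma> x a (Gam \<gamma> x b u)) v + bf (\<gamma> x) (Gam \<gamma> x b u) (Gam \<gamma> x a v)
        + bf (\<gamma> x) (dird a (\<lambda>y. Gam \<gamma> y b u) x) v
      + (bf (\<gamma> x) (Gam \<gamma> x a u) (Gam \<gamma> x b v) + bf (\<gamma> x) u (Gam \<gamma> x a (Gam \<gamma> x b v))
        + bf (\<gamma> x) u (dird a (\<lambda>y. Gam \<gamma> y b v) x))" for a b
  proof -
    have c: "(\<lambda>y. c) differentiable (at x)" for c :: "real^'n" by simp
    have 1: "dird a (\<lambda>y. bf (\<gamma> y) (Gam \<gamma> y b u) v) x
        = dird a (\<lambda>y. bf (\<gamma> y) (Gam \<gamma> x b u) v) x + bf (\<gamma> x) (dird a (\<lambda>y. Gam \<gamma> y b u) x) v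
          + bf (\<gamma> x) (Gam \<gamma> x b u) (dird a (\<lambda>y. v) x)"
      by (rule dird_bilinear_family[where B = "\<lambda>y. bf (\<gamma> y)", OF bilinear_bf diff_g[OF x] diff_Gam[OF x] c])
    have 2: "dird a (\<lambda>y. bf (\<gamma> y) u (Gam \<gamma> y b v)) x
        = dird a (\<lambda>y. bf (\<gamma> y) u (Gam \<gamma> x b v)) x + bf (\<gamma> x) (dird a (\<lambda>y. u) x) (Gam \<gamma> x b v)
          + bf (\<gamma> x) u (dird a (\<lambda>y. Gam \<gamma> y b v) x)"
      by (rule dird_bilinear_family[where B = "\<lambda>y. bf (\<gamma> y)", OF bilinear_bf diff_g[OF x] c diff_Gam[OF x]])
    have "dird a (dird b (\<lambda>y. bf (\<gamma> y) u v)) x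
        = dird a (\<lambda>y. bf (\<gamma> y) (Gam \<gamma> y b u) v + bf (\<gamma> y) u (Gam \<gamma> y b v)) x"
      by (rule dird_cong_open[OF open_dom x compat])
    also have "\<dots> = dird a (\<lambda>y. bf (\<gamma> y) (Gam \<gamma> y b u) v) x + dird a (\<lambda>y. bf (\<gamma> y) u (Gam \<gamma> y b v)) x"
      by (rule dird_add) (intro differentiable smooth_on_bf smooth smooth_Gam smooth_on_const x)+
    finally show ?thesis unfolding 1 2 compat[OF x] by (simp add: bf_simps)
  qed
  have "dird a (dird b (\<lambda>y. bf (\<gamma> y) u v)) x = dird b (dird a (\<lambda>y. bf (\<gamma> y) u v)) x"
    by (rule dird_commute[OF open_dom _ x]) (intro smooth_on_bf smooth smooth_on_const)
  then show ?thesis unfolding D Rm_def bf_simps by linarith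
qed

text \<open>The derivative of the identity \<open>bf_skew_Rm\<close>, corrected by the instances of
  that identity in which one argument is replaced by a Christoffel term.\<close>

lemma bf_skew_nabla_Rm:
  assumes x: "x \<in> \<Omega>"
  shows "bf (\<gamma> x) (nabla_Rm \<gamma> x e a b u) v + bf (\<gamma> x) u (nabla_Rm \<gamma> x e a b v) = 0"
proof -
  have c: "(\<lambda>y. c) differentiable (at x)" for c :: "real^'n" by simp
  have 1: "dird e (\<lambda>y. bf (\<gamma> y) (Rm \<gamma> y a b u) v) x
      = dird e (\<lambda>y. bf (\<gamma> y) (Rm \<gamma> x a b u) v) x + bf (\<gamma> x) (dird e (\<lambda>y. Rm \<gamma> y a b u) x) v
        + bf (\<gamma> x) (Rm \<gamma> x a b u) (dird e (\<lambda>y. v) x)"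
    by (rule dird_bilinear_family[where B = "\<lambda>y. bf (\<gamma> y)", OF bilinear_bf diff_g[OF x] diff_Rm[OF x] c])
  have 2: "dird e (\<lambda>y. bf (\<gamma> y) u (Rm \<gamma> y a b v)) x
      = dird e (\<lambda>y. bf (\<gamma> y) u (Rm \<gamma> x a b v)) x + bf (\<gamma> x) (dird e (\<lambda>y. u) x) (Rm \<gamma> x a b v)
        + bf (\<gamma> x) u (dird e (\<lambda>y. Rm \<gamma> y a b v) x)"
    by (rule dird_bilinear_family[where B = "\<lambda>y. bf (\<gamma> y)", OF bilinear_bf diff_g[OF x] c diff_Rm[OF x]])
  have "dird e (\<lambda>y. bf (\<gamma> y) (Rm \<gamma> y a b u) v) x + dird e (\<lambda>y. bf (\<gamma> y) u (Rm \<gamma> y a b v)) x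
      = dird e (\<lambda>y. bf (\<gamma> y) (Rm \<gamma> y a b u) v + bf (\<gamma> y) u (Rm \<gamma> y a b v)) x"
    by (rule dird_add[symmetric]) (intro differentiable smooth_on_bf smooth smooth_Rm smooth_on_const x)+
  also have "\<dots> = dird e (\<lambda>y. 0) x"
    by (rule dird_cong_open[OF open_dom x bf_skew_Rm])
  also have "\<dots> = 0" by simp
  finally have "bf (\<gamma> x) (Gam \<gamma> x e (Rm \<gamma> x a b u)) v + bf (\<gamma> x) (Rm \<gamma> x a b u) (Gam \<gamma> x e v)
      + bf (\<gamma> x) (dird e (\<lambda>y. Rm \<gamma> y a b u) x) v
      + (bf (\<gamma> x) (Gam \<gamma> x e u) (Rm \<gamma> x a b v) + bf (\<gamma> x) u (Gam \<gamma> x e (Rm \<gamma> x a b v))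
      + bf (\<gamma> x) u (dird e (\<lambda>y. Rm \<gamma> y a b v) x)) = 0"
    unfolding 1 2 compat[OF x] by (simp add: bf_simps)
  then show ?thesis
    using bf_skew_Rm[OF x, of a b u "Gam \<gamma> x e v"] bf_skew_Rm[OF x, of a b "Gam \<gamma> x e u" v]
      bf_skew_Rm[OF x, of "Gam \<gamma> x e a" b u v] bf_skew_Rm[OF x, of a "Gam \<gamma> x e b" u v]
    unfolding nabla_Rm_def bf_simps by linarith
qed

text \<open>Linearity in the traced slot lets \<open>contracted_bianchi\<close> rewrite a sum over
  raised vectors as a trace by \<open>tr_sharp'\<close>. The term with a second derivative along
  \<open>a\<close> becomes visibly linear once the two derivatives are interchanged.\<close>

lemma linear_nabla_Rm:
  assumes x: "x \<in> \<Omega>"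
  shows "linear (\<lambda>a. nabla_Rm \<gamma> x e a b u)"
proof -
  have "linear (\<lambda>a. dird e (\<lambda>y. Rm \<gamma> y a b u) x)"
    unfolding dird_Rm[OF x]
  proof (intro linear_compose_add linear_compose_sub)
    have d: "dird a (\<lambda>y. Gam \<gamma> y b u) differentiable (at x)" for a b
      by (intro differentiable smooth_on_dird open_dom smooth_Gam smooth_on_const x)
    have "dird e (dird a (\<lambda>y. Gam \<gamma> y b u)) x = dird a (dird e (\<lambda>y. Gam \<gamma> y b u)) x" for a
      by (rule dird_commute[OF open_dom _ x]) (intro smooth_Gam smooth_on_const)
    then show "linear (\<lambda>a. dird e (dird a (\<lambda>y. Gam \<gamma> y b u)) x)"
      using linear_dird[OF d] by simp
    have "dird e (dird b (\<lambda>y. Gam \<gamma> y (a + a') u)) x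
        = dird e (dird b (\<lambda>y. Gam \<gamma> y a u)) x + dird e (dird b (\<lambda>y. Gam \<gamma> y a' u)) x" for a a'
    proof -
      have "dird e (dird b (\<lambda>y. Gam \<gamma> y (a + a') u)) x
          = dird e (\<lambda>z. dird b (\<lambda>y. Gam \<gamma> y a u) z + dird b (\<lambda>y. Gam \<gamma> y a' u) z) x"
        by (rule dird_cong_open[OF open_dom x]) (simp add: linear_add[OF linear_dGam(2)])
      then show ?thesis by (simp only: dird_add[OF d d])
    qed
    moreover have "dird e (dird b (\<lambda>y. Gam \<gamma> y (c *\<^sub>R a) u)) x
        = c *\<^sub>R dird e (dird b (\<lambda>y. Gam \<gamma> y a u)) x" for c a
    proof -
      have "dird e (dird b (\<lambda>y. Gam \<gamma> y (c *\<^sub>R a) u)) x = dird e (\<lambda>z. c *\<^sub>R dird b (\<lambda>y. Gam \<gamma> y a u) z) x"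
        by (rule dird_cong_open[OF open_dom x]) (simp add: linear_cmul[OF linear_dGam(2)])
      then show ?thesis by (simp only: dird_scaleR_right[OF d])
    qed
    ultimately show "linear (\<lambda>a. dird e (dird b (\<lambda>y. Gam \<gamma> y a u)) x)" by (rule linearI)
  qed (intro linear_dGam[OF x] linear_Gam linear_chain[OF linear_Gam(2) linear_Gam(1)]
      linear_chain[OF linear_Gam(2) linear_dGam(3)[OF x]] linear_chain[OF linear_dGam(2)[OF x] linear_Gam(1)])+
  then show ?thesis
    unfolding nabla_Rm_def
    by (intro linear_compose_add linear_compose_sub linear_Rm[OF x]
        linear_chain[OF linear_Rm(1)[OF x] linear_Gam(1)] linear_chain[OF linear_Gam(1) linear_Rm(1)[OF x]])
qed

text \<open>Contraction commutes with covariant differentiation: the corrections for the value and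
  for the traced slot have the same trace and opposite signs.\<close>

lemma trace_nabla_Rm:
  assumes x: "x \<in> \<Omega>"
  shows "tr (\<lambda>w. nabla_Rm \<gamma> x e w v u) = nabla \<gamma> (Ric \<gamma>) x e u v"
proof -
  have n: "(\<lambda>y. Rm \<gamma> y a b u $ k) differentiable (at x)" for a b u k
    by (intro differentiable smooth_on_nth smooth_Rm x)
  have "dird e (\<lambda>y. Ric \<gamma> y u v) x = tr (\<lambda>w. dird e (\<lambda>y. Rm \<gamma> y w v u) x)"
    unfolding Ric_def tr_def dird_sum_UNIV[OF n] by (simp add: dird_nth[OF diff_Rm[OF x]])
  moreover have "tr (\<lambda>w. Gam \<gamma> x e (Rm \<gamma> x w v u)) = tr (\<lambda>w. Rm \<gamma> x (Gam \<gamma> x e w) v u)"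
    by (rule tr_comp_commute[OF linear_Gam(1) linear_Rm(1)[OF x]])
  ultimately show ?thesis
    unfolding nabla_def nabla_Rm_def Ric_def by (simp add: tr_def sum.distrib sum_subtractf)
qed

text \<open>By the first Bianchi identity the two sides differ by the trace of the operator
  \<open>Rm \<gamma> x v u\<close>, which vanishes because the operator is skew for the
  metric.\<close>

lemma Ric_sym:
  assumes x: "x \<in> \<Omega>"
  shows "Ric \<gamma> x u v = Ric \<gamma> x v u"
proof -
  note M = sym[OF x] nondeg[OF x]
  have "(\<Sum>k\<in>UNIV. bf (\<gamma> x) (sharp (\<gamma> x) k) (Rm \<gamma> x v u (axis k 1))) = 0"
    by (rule contraction_skew[OF M linear_Rm(3)[OF x] bf_skew_Rm[OF x] M(1)])
  then have "tr (Rm \<gamma> x v u) = 0" by (simp add: tr_def bf_sharp[OF M])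
  moreover have "Rm \<gamma> x w v u = Rm \<gamma> x w u v - Rm \<gamma> x v u w" for w
    using Rm_first_bianchi[OF x, of w v u] Rm_skew[of \<gamma> x u w v] by (simp add: algebra_simps eq_neg_iff_add_eq_0)
  then have "Ric \<gamma> x u v = Ric \<gamma> x v u - tr (Rm \<gamma> x v u)"
    unfolding Ric_def by (simp add: tr_def sum_subtractf)
  ultimately show ?thesis by simp
qed

lemma linear_nabla_Ric:
  assumes x: "x \<in> \<Omega>"
  shows "linear (\<lambda>e. nabla \<gamma> (Ric \<gamma>) x e u v)" "linear (\<lambda>u. nabla \<gamma> (Ric \<gamma>) x e u v)"
    "linear (\<lambda>v. nabla \<gamma> (Ric \<gamma>) x e u v)"
proof -
  have d: "(\<lambda>y. Ric \<gamma> y u v) differentiable (at x)" for u v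
    by (intro differentiable smooth_Ric x)
  have L: "linear (\<lambda>u. dird e (\<lambda>y. Ric \<gamma> y u v) x)" for v
  proof (rule linearI)
    show "dird e (\<lambda>y. Ric \<gamma> y (a + b) v) x = dird e (\<lambda>y. Ric \<gamma> y a v) x + dird e (\<lambda>y. Ric \<gamma> y b v) x" for a b
      unfolding dird_add[OF d d, symmetric]
      by (rule dird_cong_open[OF open_dom x]) (rule linear_add[OF linear_Ric(1)])
    show "dird e (\<lambda>y. Ric \<gamma> y (c *\<^sub>R a) v) x = c *\<^sub>R dird e (\<lambda>y. Ric \<gamma> y a v) x" for c a
      unfolding dird_scaleR_right[OF d, symmetric]
      by (rule dird_cong_open[OF open_dom x]) (rule linear_cmul[OF linear_Ric(1)])
  qed
  have sw: "dird e (\<lambda>y. Ric \<gamma> y u v) x = dird e (\<lambda>y. Ric \<gamma> y v u) x" for u v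
    by (rule dird_cong_open[OF open_dom x Ric_sym])
  show "linear (\<lambda>e. nabla \<gamma> (Ric \<gamma>) x e u v)" unfolding nabla_def
    by (intro linear_compose_sub linear_dird d linear_chain[OF linear_Gam(2) linear_Ric(1)[OF x]]
        linear_chain[OF linear_Gam(2) linear_Ric(2)[OF x]])
  show "linear (\<lambda>u. nabla \<gamma> (Ric \<gamma>) x e u v)" unfolding nabla_def
    by (intro linear_compose_sub L linear_Ric[OF x] linear_chain[OF linear_Gam(1) linear_Ric(1)[OF x]])
  show "linear (\<lambda>v. nabla \<gamma> (Ric \<gamma>) x e u v)" unfolding nabla_def sw[of u]
    by (intro linear_compose_sub L linear_Ric[OF x] linear_chain[OF linear_Gam(1) linear_Ric(2)[OF x]])
qed

text \<open>The second Bianchi identity is traced over its first form slot and the value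
  (\<open>cyc\<close>), then over the two remaining slots with the metric. Two of the three
  resulting terms are the divergence of the Ricci tensor, whence the factor 2.\<close>

lemma contracted_bianchi:
  assumes x: "x \<in> \<Omega>"
  shows "(\<Sum>m\<in>UNIV. nabla \<gamma> (Ric \<gamma>) x e (axis m 1) (sharp (\<gamma> x) m))
    = 2 * (\<Sum>k\<in>UNIV. nabla \<gamma> (Ric \<gamma>) x (axis k 1) (sharp (\<gamma> x) k) e)"
proof -
  note M = sym[OF x] nondeg[OF x]
  let ?N = "nabla \<gamma> (Ric \<gamma>) x" and ?s = "sharp (\<gamma> x)" and ?e = "\<lambda>k. axis k (1::real)"
  have skew: "nabla_Rm \<gamma> x b w e u = - nabla_Rm \<gamma> x b e w u" for b w e u
  proof -
    have "dird b (\<lambda>y. Rm \<gamma> y w e u) x = dird b (\<lambda>y. - Rm \<gamma> y e w u) x"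
      by (rule dird_cong_open[OF open_dom x Rm_skew])
    also have "\<dots> = - dird b (\<lambda>y. Rm \<gamma> y e w u) x" by (rule dird_minus[OF diff_Rm[OF x]])
    finally show ?thesis
      unfolding nabla_Rm_def Rm_skew[of \<gamma> x w e] Rm_skew[of \<gamma> x _ e u] Rm_skew[of \<gamma> x w _ u]
      by (simp add: Gam_simps)
  qed
  have cyc: "?N e u b - ?N b u e + tr (\<lambda>w. nabla_Rm \<gamma> x w b e u) = 0" for u b
  proof -
    have "tr (\<lambda>w. nabla_Rm \<gamma> x e w b u + nabla_Rm \<gamma> x w b e u + nabla_Rm \<gamma> x b e w u) = tr (\<lambda>w. (0 :: real^'n))"
      by (simp only: second_bianchi[OF x])
    moreover have "tr (\<lambda>w. nabla_Rm \<gamma> x b e w u) = - ?N b u e"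
      unfolding trace_nabla_Rm[OF x, symmetric] skew[of b _ e] by (simp add: tr_def sum_negf)
    moreover have "tr (\<lambda>w. nabla_Rm \<gamma> x e w b u + nabla_Rm \<gamma> x w b e u + nabla_Rm \<gamma> x b e w u)
        = ?N e u b + tr (\<lambda>w. nabla_Rm \<gamma> x w b e u) + tr (\<lambda>w. nabla_Rm \<gamma> x b e w u)"
      unfolding trace_nabla_Rm[OF x, symmetric] by (simp add: tr_def sum.distrib)
    ultimately show ?thesis by (simp add: tr_def)
  qed
  \<comment> \<open>Skewness of \<open>nabla_Rm\<close> for the metric exchanges the argument
    \<open>?e m\<close> with the test vector \<open>?s k\<close>; the sum over \<open>m\<close> is
    then a trace over a form slot, that is, a Ricci term.\<close>
  have third: "(\<Sum>m\<in>UNIV. tr (\<lambda>w. nabla_Rm \<gamma> x w (?s m) e (?e m))) = - (\<Sum>k\<in>UNIV. ?N (?e k) (?s k) e)"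
  proof -
    have "(\<Sum>m\<in>UNIV. bf (\<gamma> x) (nabla_Rm \<gamma> x (?e k) (?s m) e (?e m)) (?s k)) = - ?N (?e k) (?s k) e" for k
    proof -
      have "bf (\<gamma> x) (nabla_Rm \<gamma> x (?e k) (?s m) e (?e m)) (?s k)
          = - bf (\<gamma> x) (nabla_Rm \<gamma> x (?e k) (?s m) e (?s k)) (?e m)" for m
        using bf_skew_nabla_Rm[OF x, of "?e k" "?s m" e "?e m" "?s k"] g_sym[OF x, of "?e m"] by smt
      then have "(\<Sum>m\<in>UNIV. bf (\<gamma> x) (nabla_Rm \<gamma> x (?e k) (?s m) e (?e m)) (?s k))
          = - (\<Sum>m\<in>UNIV. bf (\<gamma> x) (nabla_Rm \<gamma> x (?e k) (?s m) e (?s k)) (?e m))"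
        by (simp add: sum_negf)
      also have "\<dots> = - tr (\<lambda>w. nabla_Rm \<gamma> x (?e k) w e (?s k))"
        unfolding tr_sharp'[OF M linear_nabla_Rm[OF x]] ..
      finally show ?thesis unfolding trace_nabla_Rm[OF x] .
    qed
    then show ?thesis
      unfolding tr_sharp[OF M] by (subst sum.swap) (simp add: sum_negf)
  qed
  have second: "(\<Sum>m\<in>UNIV. ?N (?s m) (?e m) e) = (\<Sum>m\<in>UNIV. ?N (?e m) (?s m) e)"
    by (rule contraction_commute[OF M, symmetric]) (unfold bilinear_def, blast intro: linear_nabla_Ric[OF x])
  have "(\<Sum>m\<in>UNIV. ?N e (?e m) (?s m) - ?N (?s m) (?e m) e + tr (\<lambda>w. nabla_Rm \<gamma> x w (?s m) e (?e m))) = 0"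
    by (simp only: cyc sum.neutral_const)
  then show ?thesis unfolding sum.distrib sum_subtractf third second by simp
qed

end

subsection \<open>The derivative of the determinant\<close>

text \<open>The derivative of the determinant at the identity is linear, so it is enough to perturb
  single entries: a diagonal one rescales a row, an off-diagonal one is a row operation.\<close>

lemma det_mat_1_plus_axis:
  "det (mat 1 + t *\<^sub>R axis i (axis j 1) :: real^'n::finite^'n) = 1 + (if i = j then t else 0)"
proof (cases "i = j")
  case True
  let ?A = "mat 1 + t *\<^sub>R axis i (axis j 1) :: real^'n^'n"
  have "det ?A = (\<Prod>k\<in>UNIV. ?A $ k $ k)"
    by (rule det_diagonal) (auto simp: True mat_def axis_def)
  also have "\<dots> = (\<Prod>k\<in>UNIV. if k = i then 1 + t else 1)"
    by (rule prod.cong) (simp_all add: True mat_def axis_def)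
  finally show ?thesis using True by simp
next
  case False
  have "mat 1 + t *\<^sub>R axis i (axis j 1) =
      (\<chi> k. if k = i then row i (mat 1) + t *s row j (mat 1) else row k (mat 1) :: real^'n^'n)"
    by (auto simp: vec_eq_iff mat_def axis_def row_def)
  then show ?thesis using det_row_operation[OF False, of "mat 1 :: real^'n^'n" t] False by simp
qed

lemma smooth_det: "smooth_on UNIV (det :: real^'n::finite^'n \<Rightarrow> real)"
  using smooth_on_det[OF smooth_on_ident] .

lemma differentiable_det: "(det :: real^'n::finite^'n \<Rightarrow> real) differentiable (at M)"
  by (rule smooth_on_differentiable[OF open_UNIV smooth_det UNIV_I])

lemma dird_det_mat_1: "dird H det (mat 1 :: real^'n::finite^'n) = (\<Sum>k\<in>UNIV. H $ k $ k)"
proof -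
  have lin: "linear (\<lambda>H. dird H det (mat 1 :: real^'n^'n))"
    by (rule linear_dird[OF differentiable_det])
  have ax: "dird (axis i (axis j 1)) det (mat 1 :: real^'n^'n) = (if i = j then 1 else 0)" for i j
  proof -
    have "((\<lambda>t. det (mat 1 + t *\<^sub>R axis i (axis j 1) :: real^'n^'n)) has_real_derivative
        dird (axis i (axis j 1)) det (mat 1 + 0 *\<^sub>R axis i (axis j 1) :: real^'n^'n)) (at 0)"
      by (rule dird_line[OF differentiable_det])
    then have "((\<lambda>t. 1 + (if i = j then t else 0)) has_real_derivative
        dird (axis i (axis j 1)) det (mat 1 :: real^'n^'n)) (at 0)"
      by (simp only: det_mat_1_plus_axis) simp
    moreover have "((\<lambda>t. 1 + (if i = j then t else 0)) has_real_derivative (if i = j then 1 else 0)) (at (0::real))"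
      by (cases "i = j") (auto intro!: derivative_eq_intros)
    ultimately show ?thesis by (rule DERIV_unique)
  qed
  have comp: "(c *\<^sub>R axis i (axis j 1) :: real^'n^'n) $ a $ b = (if i = a then if j = b then c else 0 else 0)" for i j a b c
    by (simp add: axis_def)
  have "H = (\<Sum>i\<in>UNIV. \<Sum>j\<in>UNIV. H $ i $ j *\<^sub>R axis i (axis j 1))"
    unfolding vec_eq_iff
  proof (intro allI)
    fix a b
    have "(\<Sum>i\<in>UNIV. \<Sum>j\<in>UNIV. H $ i $ j *\<^sub>R axis i (axis j 1)) $ a $ b
        = (\<Sum>i\<in>UNIV. \<Sum>j\<in>UNIV. if i = a then if j = b then H $ i $ j else 0 else 0)"
      by (simp only: sum_component comp)
    also have "\<dots> = (\<Sum>i\<in>UNIV. if i = a then (\<Sum>j\<in>UNIV. if j = b then H $ i $ j else 0) else 0)"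
      by (intro sum.cong refl) simp
    finally show "H $ a $ b = (\<Sum>i\<in>UNIV. \<Sum>j\<in>UNIV. H $ i $ j *\<^sub>R axis i (axis j 1)) $ a $ b"
      by simp
  qed
  then have "dird H det (mat 1 :: real^'n^'n)
      = dird (\<Sum>i\<in>UNIV. \<Sum>j\<in>UNIV. H $ i $ j *\<^sub>R axis i (axis j 1)) det (mat 1 :: real^'n^'n)" by simp
  also have "\<dots> = (\<Sum>i\<in>UNIV. \<Sum>j\<in>UNIV. H $ i $ j * (if i = j then 1 else 0))"
    by (simp only: linear_sum[OF lin] linear_cmul[OF lin] ax real_scaleR_def)
  also have "\<dots> = (\<Sum>i\<in>UNIV. \<Sum>j\<in>UNIV. if i = j then H $ i $ j else 0)"
    by (intro sum.cong refl) simp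
  finally show ?thesis by simp
qed

text \<open>Jacobi's formula. Multiplication by the inverse of \<open>M x\<close>, held fixed, moves
  the base point to the identity matrix, where the derivative is the trace.\<close>

lemma dird_det:
  fixes M :: "'a::real_normed_vector \<Rightarrow> real^'n::finite^'n"
  assumes M: "M differentiable (at x)" and nz: "det (M x) \<noteq> 0"
  shows "dird w (\<lambda>y. det (M y)) x = det (M x) * (\<Sum>k\<in>UNIV. (matrix_inv (M x) ** dird w M x) $ k $ k)"
proof -
  let ?U = "matrix_inv (M x)"
  have bl: "bounded_linear (\<lambda>A. ?U ** A)"
    by (intro linear_conv_bounded_linear[THEN iffD1] linearI)
      (simp_all add: vec_eq_iff matrix_matrix_mult_def
        sum_distrib_left distrib_left sum.distrib mult.left_commute)
  have UM: "?U ** M x = mat 1" by (rule matrix_inv_mult(2)[OF nz])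
  have "det (M x) * det ?U = 1" using matrix_inv_mult(1)[OF nz] by (metis det_I det_mul)
  then have "det (M x) *\<^sub>R det (?U ** M y) = det (M y)" for y
    by (simp add: det_mul mult.assoc[symmetric])
  then have "dird w (\<lambda>y. det (M y)) x = dird w (\<lambda>y. det (M x) *\<^sub>R det (?U ** M y)) x"
    by (simp only:)
  also have "\<dots> = det (M x) *\<^sub>R dird w (\<lambda>y. det (?U ** M y)) x"
  proof (rule dird_scaleR_right)
    show "(\<lambda>y. det (?U ** M y)) differentiable (at x)"
      by (rule differentiableI[OF has_derivative_compose[OF bounded_linear.has_derivative[OF bl has_derivative_dird[OF M]]
            has_derivative_dird[OF differentiable_det]]])
  qed
  also have "dird w (\<lambda>y. det (?U ** M y)) x = dird (dird w (\<lambda>y. ?U ** M y) x) det (?U ** M x)"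
    by (rule dird_compose[OF differentiableI[OF bounded_linear.has_derivative[OF bl has_derivative_dird[OF M]]] differentiable_det])
  also have "dird w (\<lambda>y. ?U ** M y) x = ?U ** dird w M x"
    by (rule dird_linear[OF bl M])
  finally show ?thesis unfolding UM dird_det_mat_1 by simp
qed

subsection \<open>A divergence-free vector field\<close>

text \<open>The trace-reversed tensor \<open>r - (tr r / 2) \<gamma>\<close> applied to \<open>X\<close>, with its index raised; the volume density
  turns the covariant divergence into the coordinate one.\<close>

definition conserved_current ::
  "(real^'n::finite \<Rightarrow> real^'n^'n) \<Rightarrow> (real^'n \<Rightarrow> real^'n^'n) \<Rightarrow> (real^'n \<Rightarrow> real^'n) \<Rightarrow> real^'n \<Rightarrow> real^'n" where
  "conserved_current \<gamma> r X y = sqrt (det (\<gamma> y)) *\<^sub>R (matrix_inv (\<gamma> y) *v (r y *v X y)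
     - ((\<Sum>m\<in>UNIV. bf (r y) (axis m 1) (sharp (\<gamma> y) m)) / 2) *\<^sub>R X y)"

context metric_chart
begin

lemma smooth_sharp: "smooth_on \<Omega> (\<lambda>y. sharp (\<gamma> y) m)"
  unfolding sharp_def by (intro smooth_intros smooth nondeg)

text \<open>Jacobi's formula combined with metric compatibility: the two Christoffel terms in the
  derivative of the metric contribute equal traces, and the square root halves their sum.\<close>

lemma dird_sqrt_det:
  assumes x: "x \<in> \<Omega>" and pos: "det (\<gamma> x) > 0"
  shows "dird w (\<lambda>y. sqrt (det (\<gamma> y))) x = sqrt (det (\<gamma> x)) * tr (Gam \<gamma> x w)"
proof -
  note M = sym[OF x] nondeg[OF x]
  have "(matrix_inv (\<gamma> x) ** dird w \<gamma> x) $ k $ k = bf (dird w \<gamma> x) (sharp (\<gamma> x) k) (axis k 1)" for k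
  proof -
    have "(matrix_inv (\<gamma> x) ** dird w \<gamma> x) $ k $ k
        = (matrix_inv (\<gamma> x) *v (dird w \<gamma> x *v axis k 1)) $ k"
      by (simp add: matrix_vector_mul_assoc matrix_vector_mul_component inner_axis)
    also have "\<dots> = bf (\<gamma> x) (sharp (\<gamma> x) k) (matrix_inv (\<gamma> x) *v (dird w \<gamma> x *v axis k 1))"
      by (rule bf_sharp(2)[OF M, symmetric])
    finally show ?thesis
      by (simp add: bf_def matrix_vector_mul_assoc matrix_mul_assoc matrix_inv_mult[OF M(2)])
  qed
  then have "dird w (\<lambda>y. det (\<gamma> y)) x = det (\<gamma> x) * (\<Sum>k\<in>UNIV. bf (dird w \<gamma> x) (sharp (\<gamma> x) k) (axis k 1))"
    unfolding dird_det[OF diff_\<gamma>[OF x] M(2)] by simp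
  also have "(\<Sum>k\<in>UNIV. bf (dird w \<gamma> x) (sharp (\<gamma> x) k) (axis k 1))
      = (\<Sum>k\<in>UNIV. bf (\<gamma> x) (Gam \<gamma> x w (sharp (\<gamma> x) k)) (axis k 1))
        + (\<Sum>k\<in>UNIV. bf (\<gamma> x) (Gam \<gamma> x w (axis k 1)) (sharp (\<gamma> x) k))"
    unfolding dird_bf[OF diff_\<gamma>[OF x], symmetric] compat[OF x] sum.distrib
    by (simp only: g_sym[OF x, of "sharp (\<gamma> x) _"])
  also have "\<dots> = 2 * tr (Gam \<gamma> x w)"
    unfolding tr_sharp[OF M, symmetric] tr_sharp'[OF M linear_Gam(1), symmetric] by simp
  finally have d: "dird w (\<lambda>y. det (\<gamma> y)) x = det (\<gamma> x) * (2 * tr (Gam \<gamma> x w))" .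
  have dd: "(\<lambda>y. det (\<gamma> y)) differentiable (at x)"
    by (intro differentiable smooth_on_det smooth x)
  have "dird w (\<lambda>y. sqrt (det (\<gamma> y))) x = dird w (\<lambda>y. det (\<gamma> y)) x * (inverse (sqrt (det (\<gamma> x))) / 2)"
    by (rule dird_eqI[OF has_derivative_real_sqrt[OF pos has_derivative_dird[OF dd]]])
  also have "\<dots> = (det (\<gamma> x) * inverse (sqrt (det (\<gamma> x)))) * tr (Gam \<gamma> x w)"
    unfolding d by simp
  also have "det (\<gamma> x) * inverse (sqrt (det (\<gamma> x))) = sqrt (det (\<gamma> x))"
    using pos by (metis divide_inverse real_div_sqrt less_imp_le)
  finally show ?thesis .
qed

text \<open>The metric is parallel, so the trace formed with it commutes with covariant
  differentiation.\<close>

lemma dird_trace: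
  assumes r: "smooth_on \<Omega> r" and x: "x \<in> \<Omega>"
  shows "dird e (\<lambda>y. \<Sum>m\<in>UNIV. bf (r y) (axis m 1) (sharp (\<gamma> y) m)) x
    = (\<Sum>m\<in>UNIV. nabla \<gamma> (\<lambda>y. bf (r y)) x e (axis m 1) (sharp (\<gamma> x) m))"
proof -
  note M = sym[OF x] nondeg[OF x]
  let ?s = "sharp (\<gamma> x)" and ?e = "\<lambda>k. axis k (1::real)"
  have dr: "(\<lambda>y. bf (r y) u v) differentiable (at x)" for u v
    by (intro differentiable smooth_on_bf r smooth_on_const x)
  have ds: "(\<lambda>y. sharp (\<gamma> y) m) differentiable (at x)" for m
    by (intro differentiable smooth_sharp x)
  have c: "(\<lambda>y. c) differentiable (at x)" for c :: "real^'n" by simp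
  \<comment> \<open>\<open>d m\<close> is the covariant derivative of the raised coordinate
    covector. Differentiating the constant pairing of \<open>bf_sharp\<close> shows that it
    represents the covector sending \<open>w\<close> to
    \<open>- Gam \<gamma> x e w $ m\<close>.\<close>
  define d where "d m = dird e (\<lambda>y. sharp (\<gamma> y) m) x + Gam \<gamma> x e (?s m)" for m
  have d: "bf (\<gamma> x) (d m) w = - Gam \<gamma> x e w $ m" for m w
  proof -
    have "dird e (\<lambda>y. bf (\<gamma> y) (sharp (\<gamma> y) m) w) x = dird e (\<lambda>y. bf (\<gamma> y) (?s m) w) x
        + bf (\<gamma> x) (dird e (\<lambda>y. sharp (\<gamma> y) m) x) w + bf (\<gamma> x) (?s m) (dird e (\<lambda>y. w) x)"
      by (rule dird_bilinear_family[where B = "\<lambda>y. bf (\<gamma> y)", OF bilinear_bf diff_g[OF x] ds c])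
    moreover have "dird e (\<lambda>y. bf (\<gamma> y) (sharp (\<gamma> y) m) w) x = dird e (\<lambda>y. w $ m) x"
      by (rule dird_cong_open[OF open_dom x]) (rule bf_sharp(2)[OF sym nondeg])
    ultimately show ?thesis
      unfolding d_def compat[OF x] by (simp add: bf_simps bf_sharp(2)[OF M])
  qed
  have "(\<Sum>m\<in>UNIV. bf (r x) (?e m) (d m)) = - (\<Sum>l\<in>UNIV. bf (r x) (Gam \<gamma> x e (?e l)) (?s l))"
  proof -
    have "bf (r x) (?e m) (d m) = - (\<Sum>l\<in>UNIV. Gam \<gamma> x e (?e l) $ m * bf (r x) (?e m) (?s l))" for m
      by (rule trans[OF arg_cong[OF sharp_expand[OF M, of "d m"], of "bf (r x) (?e m)"]])
        (simp add: linear_sum[OF linear_bf(1)] bf_simps d sum_negf)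
    then have "(\<Sum>m\<in>UNIV. bf (r x) (?e m) (d m))
        = - (\<Sum>m\<in>UNIV. \<Sum>l\<in>UNIV. Gam \<gamma> x e (?e l) $ m * bf (r x) (?e m) (?s l))"
      by (simp add: sum_negf)
    also have "(\<Sum>m\<in>UNIV. \<Sum>l\<in>UNIV. Gam \<gamma> x e (?e l) $ m * bf (r x) (?e m) (?s l))
        = (\<Sum>l\<in>UNIV. \<Sum>m\<in>UNIV. Gam \<gamma> x e (?e l) $ m *\<^sub>R bf (r x) (?e m) (?s l))"
      by (subst sum.swap) simp
    also have "\<dots> = (\<Sum>l\<in>UNIV. bf (r x) (Gam \<gamma> x e (?e l)) (?s l))"
      by (simp only: linear_expand[OF linear_bf(2), symmetric])
    finally show ?thesis .
  qed
  moreover have "dird e (\<lambda>y. bf (r y) (?e m) (sharp (\<gamma> y) m)) x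
      = nabla \<gamma> (\<lambda>y. bf (r y)) x e (?e m) (?s m) + bf (r x) (Gam \<gamma> x e (?e m)) (?s m) + bf (r x) (?e m) (d m)" for m
  proof -
    have "dird e (\<lambda>y. bf (r y) (?e m) (sharp (\<gamma> y) m)) x = dird e (\<lambda>y. bf (r y) (?e m) (?s m)) x
        + bf (r x) (dird e (\<lambda>y. ?e m) x) (?s m) + bf (r x) (?e m) (dird e (\<lambda>y. sharp (\<gamma> y) m) x)"
      by (rule dird_bilinear_family[where B = "\<lambda>y. bf (r y)", OF bilinear_bf dr c ds])
    then show ?thesis unfolding nabla_def d_def by (simp add: bf_simps)
  qed
  moreover have "(\<lambda>y. bf (r y) (?e m) (sharp (\<gamma> y) m)) differentiable (at x)" for m
    by (intro differentiable smooth_on_bf r smooth_on_const smooth_sharp x)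
  ultimately show ?thesis by (simp add: dird_sum_UNIV sum.distrib)
qed

text \<open>For \<open>T = r - (tr r / 2) \<gamma>\<close>, the covariant divergence of
  \<open>T(X, _)\<close> is the divergence of \<open>T\<close> applied to \<open>X\<close>, plus the
  pairing of \<open>T\<close> with the covariant derivative of \<open>X\<close>. The former is 0 by
  \<open>bianchi\<close>; the latter pairs a symmetric tensor with a skew one.\<close>

lemma divergence_conserved_current:
  assumes pos: "\<And>y. y \<in> \<Omega> \<Longrightarrow> det (\<gamma> y) > 0"
    and r: "smooth_on \<Omega> r" "\<And>y. y \<in> \<Omega> \<Longrightarrow> transpose (r y) = r y"
    and bianchi: "\<And>y e. y \<in> \<Omega> \<Longrightarrow>
      (\<Sum>m\<in>UNIV. nabla \<gamma> (\<lambda>y. bf (r y)) y e (axis m 1) (sharp (\<gamma> y) m))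
        = 2 * (\<Sum>k\<in>UNIV. nabla \<gamma> (\<lambda>y. bf (r y)) y (axis k 1) (sharp (\<gamma> y) k) e)"
    and X: "smooth_on \<Omega> X"
    and killing: "\<And>y u v. y \<in> \<Omega> \<Longrightarrow>
      bf (dird (X y) \<gamma> y) u v + bf (\<gamma> y) (dird u X y) v + bf (\<gamma> y) u (dird v X y) = 0"
    and x: "x \<in> \<Omega>"
  shows "(\<Sum>k\<in>UNIV. dird (axis k 1) (conserved_current \<gamma> r X) x $ k) = 0"
proof -
  note M = sym[OF x] nondeg[OF x]
  let ?s = "sharp (\<gamma> x)" and ?e = "\<lambda>k. axis k (1::real)" and ?g = "bf (\<gamma> x)"
  define \<tau> where "\<tau> y = (\<Sum>m\<in>UNIV. bf (r y) (axis m 1) (sharp (\<gamma> y) m))" for y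
  define W where "W y = matrix_inv (\<gamma> y) *v (r y *v X y) - (\<tau> y / 2) *\<^sub>R X y" for y
  define N where "N = nabla \<gamma> (\<lambda>y. bf (r y)) x"
  \<comment> \<open>The covariant derivative of \<open>X\<close>; the Killing equation becomes its
    skewness for the metric (\<open>skewA\<close>).\<close>
  define A where "A e = dird e X x + Gam \<gamma> x e (X x)" for e
  have sm\<tau>: "smooth_on \<Omega> \<tau>" unfolding \<tau>_def by (intro smooth_intros smooth_sharp r)
  have smW: "smooth_on \<Omega> W" unfolding W_def by (intro smooth_intros smooth nondeg r X sm\<tau>) simp_all
  note dW = differentiable[OF smW x] and dX = differentiable[OF X x] and d\<tau> = differentiable[OF sm\<tau> x]
  have c: "(\<lambda>y. c) differentiable (at x)" for c :: "real^'n" by simp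
  have dr: "(\<lambda>y. bf (r y) u v) differentiable (at x)" for u v
    by (intro differentiable smooth_on_bf r smooth_on_const x)
  have W: "bf (\<gamma> y) (W y) v = bf (r y) v (X y) - \<tau> y / 2 * bf (\<gamma> y) (X y) v" if "y \<in> \<Omega>" for y v
  proof -
    have "bf (\<gamma> y) (matrix_inv (\<gamma> y) *v (r y *v X y)) v = bf (\<gamma> y) v (matrix_inv (\<gamma> y) *v (r y *v X y))"
      by (rule g_sym[OF that])
    also have "\<dots> = bf (r y) v (X y)"
      by (simp add: bf_def matrix_vector_mul_assoc matrix_mul_assoc matrix_inv_mult[OF nondeg[OF that]])
    finally show ?thesis unfolding W_def by (simp add: bf_simps)
  qed
  have nablaW: "?g (dird e W x + Gam \<gamma> x e (W x)) v
      = N e v (X x) + bf (r x) v (A e) - \<tau> x / 2 * ?g (A e) v - dird e \<tau> x / 2 * ?g (X x) v" for e v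
  proof -
    have 1: "dird e (\<lambda>y. bf (\<gamma> y) (W y) v) x
        = dird e (\<lambda>y. bf (\<gamma> y) (W x) v) x + ?g (dird e W x) v + ?g (W x) (dird e (\<lambda>y. v) x)"
      by (rule dird_bilinear_family[where B = "\<lambda>y. bf (\<gamma> y)", OF bilinear_bf diff_g[OF x] dW c])
    have 2: "dird e (\<lambda>y. bf (\<gamma> y) (X y) v) x
        = dird e (\<lambda>y. bf (\<gamma> y) (X x) v) x + ?g (dird e X x) v + ?g (X x) (dird e (\<lambda>y. v) x)"
      by (rule dird_bilinear_family[where B = "\<lambda>y. bf (\<gamma> y)", OF bilinear_bf diff_g[OF x] dX c])
    have 3: "dird e (\<lambda>y. bf (r y) v (X y)) x
        = dird e (\<lambda>y. bf (r y) v (X x)) x + bf (r x) (dird e (\<lambda>y. v) x) (X x) + bf (r x) v (dird e X x)"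
      by (rule dird_bilinear_family[where B = "\<lambda>y. bf (r y)", OF bilinear_bf dr c dX])
    have d1: "(\<lambda>y. bf (\<gamma> y) (X y) v) differentiable (at x)" "(\<lambda>y. bf (r y) v (X y)) differentiable (at x)"
      by (intro differentiable smooth_on_bf smooth r X smooth_on_const x)+
    have dh: "(\<lambda>y. \<tau> y / 2) differentiable (at x)" "dird e (\<lambda>y. \<tau> y / 2) x = dird e \<tau> x / 2"
      using dird_linear[OF bounded_linear_divide d\<tau>, of e 2]
        differentiableI[OF bounded_linear.has_derivative[OF bounded_linear_divide has_derivative_dird[OF d\<tau>]]] by auto
    have dp: "(\<lambda>y. \<tau> y / 2 * bf (\<gamma> y) (X y) v) differentiable (at x)"
      by (rule differentiableI[OF has_derivative_mult[OF has_derivative_dird[OF dh(1)] has_derivative_dird[OF d1(1)]]])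
    have "dird e (\<lambda>y. bf (\<gamma> y) (W y) v) x = dird e (\<lambda>y. bf (r y) v (X y) - \<tau> y / 2 * bf (\<gamma> y) (X y) v) x"
      by (rule dird_cong_open[OF open_dom x W])
    also have "\<dots> = dird e (\<lambda>y. bf (r y) v (X y)) x
        - (\<tau> x / 2 * dird e (\<lambda>y. bf (\<gamma> y) (X y) v) x + dird e \<tau> x / 2 * ?g (X x) v)"
      unfolding dird_diff[OF d1(2) dp] dird_mult[OF dh(1) d1(1)] dh(2) ..
    finally have "?g (Gam \<gamma> x e (W x)) v + ?g (W x) (Gam \<gamma> x e v) + ?g (dird e W x) v
        = dird e (\<lambda>y. bf (r y) v (X x)) x + bf (r x) v (dird e X x)
        - (\<tau> x / 2 * (?g (Gam \<gamma> x e (X x)) v + ?g (X x) (Gam \<gamma> x e v) + ?g (dird e X x) v)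
           + dird e \<tau> x / 2 * ?g (X x) v)"
      unfolding 1 2 3 compat[OF x] by (simp add: bf_simps)
    then show ?thesis
      unfolding W[OF x, of "Gam \<gamma> x e v"] N_def nabla_def A_def bf_simps by (simp add: algebra_simps)
  qed
  have linA: "linear A" unfolding A_def
    by (intro linear_compose_add linear_dird[OF dX] linear_Gam)
  have skewA: "?g (A u) v + ?g u (A v) = 0" for u v
    using killing[OF x, of u v] compat[OF x, of "X x" u v]
    unfolding A_def bf_simps dird_bf[OF diff_\<gamma>[OF x]] Gam_sym[OF x, of _ "X x"] by linarith
  have d\<tau>_eq: "dird e \<tau> x = (\<Sum>m\<in>UNIV. N e (?e m) (?s m))" for e
    unfolding \<tau>_def N_def by (rule dird_trace[OF r(1) x])
  have divW: "(\<Sum>k\<in>UNIV. (dird (?e k) W x + Gam \<gamma> x (?e k) (W x)) $ k) = 0"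
  proof -
    have "(\<Sum>k\<in>UNIV. (dird (?e k) W x + Gam \<gamma> x (?e k) (W x)) $ k)
        = (\<Sum>k\<in>UNIV. N (?e k) (?s k) (X x)) + (\<Sum>k\<in>UNIV. bf (r x) (?s k) (A (?e k)))
          - \<tau> x / 2 * (\<Sum>k\<in>UNIV. ?g (A (?e k)) (?s k)) - (\<Sum>k\<in>UNIV. X x $ k * dird (?e k) \<tau> x) / 2"
      unfolding bf_sharp(1)[OF M, symmetric] nablaW
      by (simp add: sum.distrib sum_subtractf sum_distrib_left sum_divide_distrib mult.commute)
    moreover have "(\<Sum>k\<in>UNIV. N (?e k) (?s k) (X x)) = (\<Sum>m\<in>UNIV. N (X x) (?e m) (?s m)) / 2"
      unfolding N_def bianchi[OF x] by simp
    moreover have "(\<Sum>k\<in>UNIV. bf (r x) (?s k) (A (?e k))) = 0"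
      by (rule contraction_skew[OF M linA skewA r(2)[OF x]])
    moreover have "(\<Sum>k\<in>UNIV. ?g (A (?e k)) (?s k)) = 0"
      using contraction_skew[OF M linA skewA M(1)] by (simp only: g_sym[OF x, of "?s _"])
    moreover have "(\<Sum>k\<in>UNIV. X x $ k * dird (?e k) \<tau> x) = dird (X x) \<tau> x"
      using linear_expand[OF linear_dird[OF d\<tau>], of "X x"] by simp
    ultimately show ?thesis unfolding d\<tau>_eq by simp
  qed
  have V: "conserved_current \<gamma> r X = (\<lambda>y. sqrt (det (\<gamma> y)) *\<^sub>R W y)"
    by (simp add: conserved_current_def W_def \<tau>_def fun_eq_iff)
  have dsd: "(\<lambda>y. sqrt (det (\<gamma> y))) differentiable (at x)"
    by (intro differentiable smooth_on_sqrt smooth_on_det smooth pos x)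
  \<comment> \<open>Differentiating the density supplies the contracted Christoffel term by which
    the covariant divergence of \<open>W\<close> differs from the coordinate one.\<close>
  have "dird (?e k) (conserved_current \<gamma> r X) x $ k
      = sqrt (det (\<gamma> x)) * dird (?e k) W x $ k + W x $ k * dird (?e k) (\<lambda>y. sqrt (det (\<gamma> y))) x" for k
    unfolding V dird_bilinear[OF bounded_bilinear_scaleR dsd dW] by (simp add: mult.commute)
  then have "(\<Sum>k\<in>UNIV. dird (?e k) (conserved_current \<gamma> r X) x $ k)
      = sqrt (det (\<gamma> x)) * (\<Sum>k\<in>UNIV. dird (?e k) W x $ k) + (\<Sum>k\<in>UNIV. W x $ k *\<^sub>R dird (?e k) (\<lambda>y. sqrt (det (\<gamma> y))) x)"
    by (simp add: sum.distrib sum_distrib_left)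
  also have "(\<Sum>k\<in>UNIV. W x $ k *\<^sub>R dird (?e k) (\<lambda>y. sqrt (det (\<gamma> y))) x)
      = sqrt (det (\<gamma> x)) * tr (Gam \<gamma> x (W x))"
    unfolding linear_expand[OF linear_dird[OF dsd], symmetric] by (rule dird_sqrt_det[OF x pos[OF x]])
  also have "tr (Gam \<gamma> x (W x)) = (\<Sum>k\<in>UNIV. Gam \<gamma> x (?e k) (W x) $ k)"
    unfolding tr_def by (simp only: Gam_sym[OF x, of "W x"])
  finally show ?thesis using divW by (simp add: sum.distrib distrib_left[symmetric])
qed

end

subsection \<open>The Ricci tensor as a function of the 2-jet of the metric\<close>

text \<open>The Ricci tensor at a point is a smooth function of the value and the first and second
  derivatives of the metric there. On this finite-dimensional space, variations of the metric become
  ordinary directional derivatives.\<close>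

type_synonym 'n jet2 = "(real^'n^'n) \<times> (real^'n^'n^'n) \<times> (real^'n^'n^'n^'n)"

definition jet :: "(real^'n::finite \<Rightarrow> real^'n^'n) \<Rightarrow> real^'n \<Rightarrow> 'n jet2" where
  "jet \<gamma> x = (\<gamma> x, \<chi> k. dird (axis k 1) \<gamma> x, \<chi> k l. dird (axis k 1) (dird (axis l 1) \<gamma>) x)"

definition jet_chr :: "'n::finite jet2 \<Rightarrow> 'n \<Rightarrow> 'n \<Rightarrow> 'n \<Rightarrow> real" where
  "jet_chr J k i j = (case J of (a, b, c) \<Rightarrow>
     (\<Sum>l\<in>UNIV. matrix_inv a $ k $ l * (b $ i $ j $ l + b $ j $ i $ l - b $ l $ i $ j)) / 2)"

text \<open>The derivative of the Christoffel symbol, with \<open>- a\<^sup>-\<^sup>1 b a\<^sup>-\<^sup>1\<close> as the derivative of the inverse metric.\<close>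

definition jet_dchr :: "'n::finite jet2 \<Rightarrow> 'n \<Rightarrow> 'n \<Rightarrow> 'n \<Rightarrow> 'n \<Rightarrow> real" where
  "jet_dchr J m k i j = (case J of (a, b, c) \<Rightarrow>
     (\<Sum>l\<in>UNIV. matrix_inv a $ k $ l * (c $ m $ i $ j $ l + c $ m $ j $ i $ l - c $ m $ l $ i $ j)
       + (- (matrix_inv a ** b $ m ** matrix_inv a)) $ k $ l * (b $ i $ j $ l + b $ j $ i $ l - b $ l $ i $ j)) / 2)"

definition jet_ricci :: "'n::finite jet2 \<Rightarrow> real^'n^'n" where
  "jet_ricci J = (\<chi> i j. (\<Sum>k\<in>UNIV. jet_dchr J k k i j - jet_dchr J j k i k)
     + (\<Sum>k\<in>UNIV. \<Sum>l\<in>UNIV. jet_chr J k k l * jet_chr J l i j - jet_chr J k j l * jet_chr J l i k))"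

lemma smooth_jet_chr: "smooth_on {J. det (fst J) \<noteq> 0} (\<lambda>J. jet_chr J k i j)"
  unfolding jet_chr_def case_prod_beta by (intro smooth_intros) simp_all

lemma smooth_jet_dchr: "smooth_on {J. det (fst J) \<noteq> 0} (\<lambda>J. jet_dchr J m k i j)"
  unfolding jet_dchr_def case_prod_beta by (intro smooth_intros) simp_all

lemma smooth_jet_ricci: "smooth_on {J. det (fst J) \<noteq> 0} jet_ricci"
proof -
  have "smooth_on {J. det (fst J) \<noteq> 0} (\<lambda>J. jet_ricci J)"
    unfolding jet_ricci_def by (intro smooth_intros smooth_jet_chr smooth_jet_dchr)
  then show ?thesis .
qed

lemma open_jet_domain: "open {J :: 'n::finite jet2. det (fst J) \<noteq> 0}"
proof -
  have "continuous_on UNIV (\<lambda>J :: 'n jet2. det (fst J))"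
    by (intro smooth_on_continuous_on smooth_intros)
  then have "open {J :: 'n jet2. det (fst J) \<in> - {0}}"
    using open_vimage[of "- {0}" "\<lambda>J :: 'n jet2. det (fst J)"] by (simp add: vimage_def open_Compl)
  then show ?thesis by simp
qed

lemma jet_cong:
  assumes S: "open S" and x: "x \<in> S" and eq: "\<And>y. y \<in> S \<Longrightarrow> f y = g y"
  shows "jet f x = jet g x"
proof -
  have d: "dird v f y = dird v g y" if "y \<in> S" for v y
    by (rule dird_cong_open[OF S that eq])
  have "dird w (dird v f) x = dird w (dird v g) x" for v w
    by (rule dird_cong_open[OF S x d])
  then have "(\<chi> k l. dird (axis k 1) (dird (axis l 1) f) x) = (\<chi> k l. dird (axis k 1) (dird (axis l 1) g) x)"
    by (intro arg_cong[where f = vec_lambda] ext)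
  moreover have "(\<chi> k. dird (axis k 1) f x) = (\<chi> k. dird (axis k 1) g x)"
    by (intro arg_cong[where f = vec_lambda] ext d x)
  ultimately show ?thesis unfolding jet_def using eq[OF x] by (intro arg_cong2[where f = Pair])
qed

lemma jet_add:
  assumes S: "open S" and x: "x \<in> S" and sm: "smooth_on S f" "smooth_on S g"
  shows "jet (\<lambda>y. f y + g y) x = jet f x + jet g x"
proof -
  note d = smooth_on_differentiable[OF S sm(1)] smooth_on_differentiable[OF S sm(2)]
  note d' = smooth_on_differentiable[OF S smooth_on_dird[OF S sm(1)]] smooth_on_differentiable[OF S smooth_on_dird[OF S sm(2)]]
  have "dird w (dird v (\<lambda>y. f y + g y)) x = dird w (\<lambda>y. dird v f y + dird v g y) x" for v w
    by (rule dird_cong_open[OF S x]) (rule dird_add[OF d])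
  then have "dird w (dird v (\<lambda>y. f y + g y)) x = dird w (dird v f) x + dird w (dird v g) x" for v w
    by (simp only: dird_add[OF d'[OF x]])
  then show ?thesis by (simp add: jet_def dird_add[OF d[OF x]] vec_eq_iff)
qed

lemma jet_scaleR:
  assumes S: "open S" and x: "x \<in> S" and sm: "smooth_on S f"
  shows "jet (\<lambda>y. s *\<^sub>R f y) x = s *\<^sub>R jet f x"
proof -
  note d = smooth_on_differentiable[OF S sm]
  note d' = smooth_on_differentiable[OF S smooth_on_dird[OF S sm]]
  have "dird w (dird v (\<lambda>y. s *\<^sub>R f y)) x = dird w (\<lambda>y. s *\<^sub>R dird v f y) x" for v w
    by (rule dird_cong_open[OF S x]) (rule dird_scaleR_right[OF d])
  then have "dird w (dird v (\<lambda>y. s *\<^sub>R f y)) x = s *\<^sub>R dird w (dird v f) x" for v w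
    by (simp only: dird_scaleR_right[OF d'[OF x]])
  then show ?thesis by (simp add: jet_def dird_scaleR_right[OF d[OF x]] vec_eq_iff)
qed

lemma jet_zero: "jet (\<lambda>y. 0) x = 0"
proof -
  have "dird v (\<lambda>y. 0 :: real^'a^'a) = (\<lambda>y. 0)" for v :: "real^'a" by (simp add: fun_eq_iff)
  then show ?thesis by (simp add: jet_def vec_eq_iff zero_prod_def)
qed

lemma smooth_on_jet:
  assumes "open S" "smooth_on S \<gamma>"
  shows "smooth_on S (\<lambda>x. jet \<gamma> x)"
  unfolding jet_def by (intro smooth_intros assms)

lemma bounded_bilinear_matrix_mult:
  "bounded_bilinear ((**) :: real^'n::finite^'n \<Rightarrow> real^'n^'n \<Rightarrow> real^'n^'n)"
proof -
  have "bilinear ((**) :: real^'n^'n \<Rightarrow> real^'n^'n \<Rightarrow> real^'n^'n)"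
    unfolding bilinear_def
    by (intro conjI allI linearI)
      (simp_all add: vec_eq_iff matrix_matrix_mult_def distrib_left distrib_right sum.distrib sum_distrib_left mult_ac)
  then show ?thesis using bilinear_conv_bounded_bilinear by blast
qed

text \<open>The product of the inverse with the matrix is constant; its derivative is multiplied by
  the inverse on the right.\<close>

lemma dird_matrix_inv:
  fixes \<gamma> :: "'a::real_normed_vector \<Rightarrow> real^'n::finite^'n"
  assumes S: "open S" "smooth_on S \<gamma>" and nz: "\<And>y. y \<in> S \<Longrightarrow> det (\<gamma> y) \<noteq> 0" and x: "x \<in> S"
  shows "dird w (\<lambda>y. matrix_inv (\<gamma> y)) x = - (matrix_inv (\<gamma> x) ** dird w \<gamma> x ** matrix_inv (\<gamma> x))"
proof -
  let ?U = "\<lambda>y. matrix_inv (\<gamma> y)"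
  have dU: "?U differentiable (at x)"
    by (intro smooth_on_differentiable[OF S(1) _ x] smooth_on_matrix_inv S nz)
  have "dird w (\<lambda>y. ?U y ** \<gamma> y) x = dird w (\<lambda>y. mat 1) x"
    by (rule dird_cong_open[OF S(1) x]) (rule matrix_inv_mult(2)[OF nz])
  then have "?U x ** dird w \<gamma> x + dird w ?U x ** \<gamma> x = 0"
    unfolding dird_bilinear[OF bounded_bilinear_matrix_mult dU smooth_on_differentiable[OF S x]] by simp
  then have "(?U x ** dird w \<gamma> x + dird w ?U x ** \<gamma> x) ** ?U x = 0 ** ?U x" by simp
  then have "?U x ** dird w \<gamma> x ** ?U x + dird w ?U x ** (\<gamma> x ** ?U x) = 0"
    by (simp add: bounded_bilinear.add_left[OF bounded_bilinear_matrix_mult]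
        bounded_bilinear.zero_left[OF bounded_bilinear_matrix_mult] matrix_mul_assoc)
  then show ?thesis
    unfolding matrix_inv_mult(1)[OF nz[OF x]] by (simp add: eq_neg_iff_add_eq_0 add.commute)
qed

lemma pderiv_at_matrix_nth:
  assumes "\<gamma> differentiable (at x)"
  shows "pderiv_at i (\<lambda>y. \<gamma> y $ j $ l) x = dird (axis i 1) \<gamma> x $ j $ l"
proof -
  have "(\<lambda>y. \<gamma> y $ j) differentiable (at x)"
    by (rule differentiableI[OF bounded_linear.has_derivative[OF bounded_linear_vec_nth has_derivative_dird[OF assms]]])
  then show ?thesis unfolding pderiv_at_eq_dird by (simp add: dird_nth assms)
qed

lemma coord_ricci_jet:
  assumes S: "open S" "smooth_on S \<gamma>" and nz: "\<And>y. y \<in> S \<Longrightarrow> det (\<gamma> y) \<noteq> 0" and x: "x \<in> S"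
  shows "coord_ricci \<gamma> x = jet_ricci (jet \<gamma> x)"
proof -
  have chr: "christoffel \<gamma> k i j y = jet_chr (jet \<gamma> y) k i j" if "y \<in> S" for k i j y
    unfolding christoffel_def jet_chr_def jet_def
    by (simp add: pderiv_at_matrix_nth[OF smooth_on_differentiable[OF S that]])
  have dchr: "pderiv_at m (christoffel \<gamma> k i j) x = jet_dchr (jet \<gamma> x) m k i j" for m k i j
  proof -
    let ?U = "\<lambda>y. matrix_inv (\<gamma> y)" and ?d = "\<lambda>i. dird (axis i 1) \<gamma>"
    let ?q = "\<lambda>l y. ?d i y $ j $ l + ?d j y $ i $ l - ?d l y $ i $ j"
    have smU: "smooth_on S ?U" by (intro smooth_on_matrix_inv S nz)
    have smd: "smooth_on S (\<lambda>y. ?d i y)" for i by (intro smooth_on_dird S)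
    note D = smooth_on_differentiable[OF S(1) _ x]
    have U: "?U differentiable (at x)" "(\<lambda>y. ?U y $ k) differentiable (at x)" "(\<lambda>y. ?U y $ k $ l) differentiable (at x)" for l
      by (intro D smooth_intros smU)+
    have d: "?d i differentiable (at x)" for i by (rule D[OF smd])
    have d2: "(\<lambda>y. ?d i y $ j) differentiable (at x)" "(\<lambda>y. ?d i y $ j $ l) differentiable (at x)" for i j l
      by (intro D smooth_on_nth smd)+
    have d3: "(\<lambda>y. ?d i y $ j $ l + ?d j y $ i $ l) differentiable (at x)" "?q l differentiable (at x)" for l
      by (intro D smooth_on_diff smooth_on_add smooth_on_nth smd)+
    have p: "(\<lambda>y. ?U y $ k $ l * ?q l y) differentiable (at x)" for l
      by (intro D smooth_on_mult smooth_on_diff smooth_on_add smooth_on_nth smd smU)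
    have s: "(\<lambda>y. \<Sum>l\<in>UNIV. ?U y $ k $ l * ?q l y) differentiable (at x)"
      by (intro D smooth_on_sum smooth_on_mult smooth_on_diff smooth_on_add smooth_on_nth smd smU)
    have q: "dird w (?q l) x = dird w (?d i) x $ j $ l + dird w (?d j) x $ i $ l - dird w (?d l) x $ i $ j" for w l
      unfolding dird_diff[OF d3(1) d2(2)] dird_add[OF d2(2) d2(2)] by (simp add: dird_nth d d2)
    have u: "dird w (\<lambda>y. ?U y $ k $ l) x = (- (?U x ** dird w \<gamma> x ** ?U x)) $ k $ l" for w l
      by (simp only: dird_nth[OF U(2)] dird_nth[OF U(1)] dird_matrix_inv[OF S nz x])
    have "pderiv_at m (christoffel \<gamma> k i j) x = dird (axis m 1) (\<lambda>y. (\<Sum>l\<in>UNIV. ?U y $ k $ l * ?q l y) / 2) x"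
      unfolding pderiv_at_eq_dird
      by (rule dird_cong_open[OF S(1) x])
        (simp add: christoffel_def pderiv_at_matrix_nth[OF smooth_on_differentiable[OF S]])
    also have "\<dots> = (\<Sum>l\<in>UNIV. dird (axis m 1) (\<lambda>y. ?U y $ k $ l * ?q l y) x) / 2"
      by (simp only: dird_linear[OF bounded_linear_divide s] dird_sum_UNIV[OF p])
    finally show ?thesis
      unfolding dird_mult[OF U(3) d3(2)] q u jet_dchr_def jet_def by simp
  qed
  show ?thesis
    unfolding coord_ricci_def jet_ricci_def by (simp only: chr[OF x] dchr)
qed

subsection \<open>The linearized Ricci tensor\<close>

text \<open>As a derivative on the space of jets, the linearization is plainly linear in
  \<open>l\<close> and determined by its germ at the point. By \<open>lin_ricci_eq_dird\<close> and
  \<open>joint_ricci_eq\<close> it is the derivative at \<open>s = 0\<close> of the Ricci tensor of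
  \<open>\<gamma> + s l\<close>.\<close>

definition lin_ricci ::
  "(real^'n::finite \<Rightarrow> real^'n^'n) \<Rightarrow> (real^'n \<Rightarrow> real^'n^'n) \<Rightarrow> real^'n \<Rightarrow> real^'n^'n" where
  "lin_ricci \<gamma> l x = dird (jet l x) jet_ricci (jet \<gamma> x)"

lemma jet_in_domain: "det (\<gamma> x) \<noteq> 0 \<Longrightarrow> jet \<gamma> x \<in> {J. det (fst J) \<noteq> 0}"
  by (simp add: jet_def)

lemma linear_dird_jet_ricci: "det (\<gamma> x) \<noteq> 0 \<Longrightarrow> linear (\<lambda>K. dird K jet_ricci (jet \<gamma> x))"
  by (rule linear_dird[OF smooth_on_differentiable[OF open_jet_domain smooth_jet_ricci jet_in_domain]])

lemma lin_ricci_cong: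
  assumes "open S" "x \<in> S" "\<And>y. y \<in> S \<Longrightarrow> l y = l' y"
  shows "lin_ricci \<gamma> l x = lin_ricci \<gamma> l' x"
  unfolding lin_ricci_def using jet_cong[OF assms] by simp

lemma lin_ricci_zero: "det (\<gamma> x) \<noteq> 0 \<Longrightarrow> lin_ricci \<gamma> (\<lambda>y. 0) x = 0"
  unfolding lin_ricci_def jet_zero by (rule linear_0[OF linear_dird_jet_ricci])

lemma jet_sum:
  assumes S: "open S" and x: "x \<in> S" and sm: "\<And>i. i \<in> I \<Longrightarrow> smooth_on S (f i)" and "finite I"
  shows "jet (\<lambda>y. \<Sum>i\<in>I. f i y) x = (\<Sum>i\<in>I. jet (f i) x)"
  using \<open>finite I\<close> sm
proof (induction I rule: finite_induct)
  case empty
  then show ?case by (simp add: jet_zero)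
next
  case (insert i I)
  have "jet (\<lambda>y. f i y + (\<Sum>i\<in>I. f i y)) x = jet (f i) x + jet (\<lambda>y. \<Sum>i\<in>I. f i y) x"
    by (intro jet_add[OF S x] smooth_on_sum insert.prems) simp_all
  then show ?case using insert by simp
qed

lemma lin_ricci_sum:
  assumes S: "open S" and x: "x \<in> S" and sm: "\<And>i. i \<in> I \<Longrightarrow> smooth_on S (l i)" and I: "finite I"
    and nz: "det (\<gamma> x) \<noteq> 0"
  shows "lin_ricci \<gamma> (\<lambda>y. \<Sum>i\<in>I. l i y) x = (\<Sum>i\<in>I. lin_ricci \<gamma> (l i) x)"
proof -
  have "jet (\<lambda>y. \<Sum>i\<in>I. l i y) x = (\<Sum>i\<in>I. jet (l i) x)" by (rule jet_sum[OF S x sm I])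
  then show ?thesis
    unfolding lin_ricci_def
    using linear_sum[OF linear_dird_jet_ricci[where \<gamma> = \<gamma> and x = x, OF nz], of "\<lambda>i. jet (l i) x" I] by simp
qed

locale metric_variation = metric_chart +
  fixes l :: "real^'n \<Rightarrow> real^'n^'n"
  assumes smooth_l: "smooth_on \<Omega> l" and sym_l: "x \<in> \<Omega> \<Longrightarrow> transpose (l x) = l x"
begin

abbreviation \<gamma>s :: "real \<Rightarrow> real^'n \<Rightarrow> real^'n^'n" where "\<gamma>s s y \<equiv> \<gamma> y + s *\<^sub>R l y"

text \<open>The perturbed metrics may degenerate for larger \<open>s\<close>. On this open set,
  which contains all points with \<open>s = 0\<close>, the Ricci tensor is smooth in parameter and
  position jointly, so that derivatives in the two can be interchanged.\<close>

definition joint_domain :: "(real \<times> (real^'n)) set" where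
  "joint_domain = {z. snd z \<in> \<Omega> \<and> det (\<gamma>s (fst z) (snd z)) \<noteq> 0}"

lemma smooth_joint: "smooth_on (UNIV \<times> \<Omega>) (\<lambda>z. \<gamma>s (fst z) (snd z))"
proof -
  have *: "smooth_on (UNIV \<times> \<Omega>) (\<lambda>z :: real \<times> (real^'n). f (snd z))" if "smooth_on \<Omega> f" for f :: "real^'n \<Rightarrow> real^'n^'n"
    by (rule smooth_on_compose[OF smooth_on_snd[OF smooth_on_ident] that]) auto
  show ?thesis by (intro smooth_intros *[OF smooth] *[OF smooth_l])
qed

lemma open_joint_domain: "open joint_domain"
proof -
  have op: "open (UNIV \<times> \<Omega>)" by (intro open_Times open_UNIV open_dom)
  have "continuous_on (UNIV \<times> \<Omega>) (\<lambda>z. det (\<gamma>s (fst z) (snd z)))"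
    by (rule smooth_on_continuous_on) (intro smooth_on_det smooth_joint)
  then have "open ((\<lambda>z. det (\<gamma>s (fst z) (snd z))) -` (- {0}) \<inter> (UNIV \<times> \<Omega>))"
    using continuous_on_open_vimage[OF op, THEN iffD1, rule_format, OF _ open_Compl[OF closed_singleton]] by blast
  moreover have "(\<lambda>z. det (\<gamma>s (fst z) (snd z))) -` (- {0}) \<inter> (UNIV \<times> \<Omega>) = joint_domain"
    by (auto simp: joint_domain_def)
  ultimately show ?thesis by simp
qed

lemma zero_in_joint_domain: "x \<in> \<Omega> \<Longrightarrow> (0, x) \<in> joint_domain"
  by (simp add: joint_domain_def nondeg)

text \<open>A product neighbourhood inside \<open>joint_domain\<close> gives one bound on
  \<open>s\<close> for a whole neighbourhood of \<open>x\<close>. Identities for metrics can then be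
  applied for all small \<open>s\<close> before differentiating at 0.\<close>

lemma variation_chart:
  assumes x: "x \<in> \<Omega>"
  obtains \<epsilon> N where "\<epsilon> > 0" "open N" "x \<in> N" "N \<subseteq> \<Omega>"
    "\<And>s. s \<in> {-\<epsilon><..<\<epsilon>} \<Longrightarrow> metric_chart N (\<gamma>s s)"
    "\<And>s y. s \<in> {-\<epsilon><..<\<epsilon>} \<Longrightarrow> y \<in> N \<Longrightarrow> (s, y) \<in> joint_domain"
proof -
  obtain A N where AN: "open A" "open N" "(0, x) \<in> A \<times> N" "A \<times> N \<subseteq> joint_domain"
    using open_prod_elim[OF open_joint_domain zero_in_joint_domain[OF x]] by blast
  then obtain \<epsilon> where e: "\<epsilon> > 0" "ball 0 \<epsilon> \<subseteq> A" using open_contains_ball by (metis mem_Sigma_iff)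
  have sA: "s \<in> A" if "s \<in> {-\<epsilon><..<\<epsilon>}" for s
    using e(2) that by (auto simp: dist_norm subset_iff)
  have N: "N \<subseteq> \<Omega>" using AN(3,4) by (auto simp: joint_domain_def)
  show thesis
  proof (rule that[OF e(1) AN(2) _ N])
    show "x \<in> N" using AN(3) by simp
    show jd: "(s, y) \<in> joint_domain" if "s \<in> {-\<epsilon><..<\<epsilon>}" "y \<in> N" for s y
      using sA[OF that(1)] that(2) AN(4) by blast
    show "metric_chart N (\<gamma>s s)" if s: "s \<in> {-\<epsilon><..<\<epsilon>}" for s
    proof
      show "open N" by (rule AN(2))
      show "smooth_on N (\<gamma>s s)"
        by (rule smooth_on_subset[OF _ N]) (intro smooth_intros smooth smooth_l)
      show "det (\<gamma>s s y) \<noteq> 0" if "y \<in> N" for y using jd[OF s that] by (simp add: joint_domain_def)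
      show "transpose (\<gamma>s s y) = \<gamma>s s y" if "y \<in> N" for y
        using sym sym_l that N by (auto simp: transpose_def vec_eq_iff subset_iff)
    qed
  qed
qed

lemma jet_\<gamma>s: "x \<in> \<Omega> \<Longrightarrow> jet (\<gamma>s s) x = jet \<gamma> x + s *\<^sub>R jet l x"
  using jet_add[OF open_dom _ smooth, of x "\<lambda>y. s *\<^sub>R l y"] jet_scaleR[OF open_dom _ smooth_l, of x s]
    smooth_on_scaleR[OF smooth_on_const smooth_l, of s] by simp

definition joint_ricci :: "real \<times> (real^'n) \<Rightarrow> real^'n^'n" where
  "joint_ricci z = jet_ricci (jet \<gamma> (snd z) + fst z *\<^sub>R jet l (snd z))"

lemma joint_jet_in_domain: "z \<in> joint_domain \<Longrightarrow> jet \<gamma> (snd z) + fst z *\<^sub>R jet l (snd z) \<in> {J. det (fst J) \<noteq> 0}"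
  by (simp add: joint_domain_def jet_def)

lemma smooth_joint_jet: "smooth_on (UNIV \<times> \<Omega>) (\<lambda>z. jet \<gamma> (snd z) + fst z *\<^sub>R jet l (snd z))"
proof -
  have *: "smooth_on (UNIV \<times> \<Omega>) (\<lambda>z :: real \<times> (real^'n). jet f (snd z))" if "smooth_on \<Omega> f" for f
    by (rule smooth_on_compose[OF smooth_on_snd[OF smooth_on_ident] smooth_on_jet[OF open_dom that]]) auto
  show ?thesis by (intro smooth_intros *[OF smooth] *[OF smooth_l])
qed

lemma smooth_joint_ricci: "smooth_on joint_domain joint_ricci"
proof -
  have "smooth_on joint_domain (\<lambda>z. jet_ricci (jet \<gamma> (snd z) + fst z *\<^sub>R jet l (snd z)))"
  proof (rule smooth_on_compose[OF smooth_on_subset[OF smooth_joint_jet] smooth_jet_ricci])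
    show "joint_domain \<subseteq> UNIV \<times> \<Omega>" by (auto simp: joint_domain_def)
    show "(\<lambda>z. jet \<gamma> (snd z) + fst z *\<^sub>R jet l (snd z)) ` joint_domain \<subseteq> {J. det (fst J) \<noteq> 0}"
      using joint_jet_in_domain by (rule image_subsetI)
  qed
  then show ?thesis by (simp add: joint_ricci_def[abs_def])
qed

lemma joint_ricci_eq:
  assumes "(s, x) \<in> joint_domain"
  shows "coord_ricci (\<gamma>s s) x = joint_ricci (s, x)"
proof -
  have x: "x \<in> \<Omega>" using assms by (simp add: joint_domain_def)
  have c: "continuous_on \<Omega> (\<lambda>y. det (\<gamma>s s y))"
    by (rule smooth_on_continuous_on) (intro smooth_intros smooth smooth_l)
  let ?N = "(\<lambda>y. det (\<gamma>s s y)) -` (- {0}) \<inter> \<Omega>"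
  have "coord_ricci (\<gamma>s s) x = jet_ricci (jet (\<gamma>s s) x)"
  proof (rule coord_ricci_jet)
    show "open ?N" using continuous_on_open_vimage[OF open_dom, THEN iffD1, rule_format, OF c open_Compl[OF closed_singleton]] .
    show "smooth_on ?N (\<gamma>s s)"
      by (rule smooth_on_subset[of \<Omega>]) (intro smooth_intros smooth smooth_l, simp)
    show "x \<in> ?N" using assms by (simp add: joint_domain_def)
    show "det (\<gamma>s s y) \<noteq> 0" if "y \<in> ?N" for y using that by simp
  qed
  then show ?thesis unfolding jet_\<gamma>s[OF x] joint_ricci_def by simp
qed

lemma dird_joint_ricci:
  assumes x: "x \<in> \<Omega>"
  shows "dird (1, 0) joint_ricci (0, x) = lin_ricci \<gamma> l x"
proof -
  let ?j = "\<lambda>z. jet \<gamma> (snd z) + fst z *\<^sub>R jet l (snd z)"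
  let ?c = "\<lambda>s::real. (s, x)"
  have dj: "?j differentiable (at (0, x))"
    by (rule smooth_on_differentiable[OF open_Times[OF open_UNIV open_dom] smooth_joint_jet]) (simp add: x)
  have dR: "jet_ricci differentiable (at (?j (0, x)))"
    by (rule smooth_on_differentiable[OF open_jet_domain smooth_jet_ricci joint_jet_in_domain[OF zero_in_joint_domain[OF x]]])
  have c: "(?c has_derivative (\<lambda>r. (r, 0))) (at 0)"
    by (rule has_derivative_Pair[OF has_derivative_ident has_derivative_const])
  have "dird (dird 1 ?c 0) ?j (?c 0) = dird 1 (\<lambda>s. ?j (?c s)) 0"
    by (rule dird_compose[symmetric, OF differentiableI[OF c]]) (rule dj)
  also have "\<dots> = jet l x"
    by (rule dird_eqI[where f' = "\<lambda>r. r *\<^sub>R jet l x" and v = 1, simplified])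
      (auto intro!: derivative_eq_intros)
  finally have "dird (1, 0) ?j (0, x) = jet l x" unfolding dird_eqI[OF c] by simp
  then show ?thesis
    unfolding joint_ricci_def[abs_def] dird_compose[OF dj dR] lin_ricci_def by simp
qed

lemma smooth_lin_ricci: "smooth_on \<Omega> (lin_ricci \<gamma> l)"
proof -
  have "smooth_on \<Omega> (\<lambda>x. dird (1, 0) joint_ricci (0, x))"
    by (rule smooth_on_compose[OF _ smooth_on_dird[OF open_joint_domain smooth_joint_ricci]])
      (intro smooth_intros, use zero_in_joint_domain in blast)
  then show ?thesis by (rule smooth_on_cong[rotated]) (rule dird_joint_ricci)
qed

lemma lin_ricci_eq_dird:
  assumes x: "x \<in> \<Omega>"
  shows "bf (lin_ricci \<gamma> l x) u v = dird 1 (\<lambda>s. bf (joint_ricci (s, x)) u v) 0"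
    and "(\<lambda>s. joint_ricci (s, x)) differentiable (at 0)"
    and "dird 1 (\<lambda>s. joint_ricci (s, x)) 0 = lin_ricci \<gamma> l x"
proof -
  have c: "((\<lambda>s::real. (s, x)) has_derivative (\<lambda>r. (r, 0))) (at 0)"
    by (rule has_derivative_Pair[OF has_derivative_ident has_derivative_const])
  have d: "joint_ricci differentiable (at (0, x))"
    by (rule smooth_on_differentiable[OF open_joint_domain smooth_joint_ricci zero_in_joint_domain[OF x]])
  show dd: "(\<lambda>s. joint_ricci (s, x)) differentiable (at 0)"
    by (rule differentiableI[OF has_derivative_compose[OF c has_derivative_dird[OF d]]])
  show e: "dird 1 (\<lambda>s. joint_ricci (s, x)) 0 = lin_ricci \<gamma> l x"
    unfolding dird_compose[OF differentiableI[OF c] d] dird_eqI[OF c] by (rule dird_joint_ricci[OF x])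
  show "bf (lin_ricci \<gamma> l x) u v = dird 1 (\<lambda>s. bf (joint_ricci (s, x)) u v) 0"
    unfolding dird_bf[OF dd] e ..
qed

text \<open>Inherited from \<open>Ric_sym\<close> for the perturbed metrics by differentiating at
  \<open>s = 0\<close>.\<close>

lemma lin_ricci_sym:
  assumes x: "x \<in> \<Omega>"
  shows "transpose (lin_ricci \<gamma> l x) = lin_ricci \<gamma> l x"
proof -
  obtain \<epsilon> N where N: "\<epsilon> > 0" "open N" "x \<in> N" "N \<subseteq> \<Omega>"
    "\<And>s. s \<in> {-\<epsilon><..<\<epsilon>} \<Longrightarrow> metric_chart N (\<gamma>s s)"
    "\<And>s y. s \<in> {-\<epsilon><..<\<epsilon>} \<Longrightarrow> y \<in> N \<Longrightarrow> (s, y) \<in> joint_domain"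
    by (rule variation_chart[OF x]) (rule that)
  have "bf (joint_ricci (s, x)) u v = bf (joint_ricci (s, x)) v u" if s: "s \<in> {-\<epsilon><..<\<epsilon>}" for s u v
  proof -
    interpret v: metric_chart N "\<gamma>s s" by (rule N(5)[OF s])
    show ?thesis unfolding joint_ricci_eq[OF N(6)[OF s N(3)], symmetric] v.bf_coord_ricci[OF N(3)]
      by (rule v.Ric_sym[OF N(3)])
  qed
  note sym_joint = this
  have "bf (lin_ricci \<gamma> l x) u v = bf (lin_ricci \<gamma> l x) v u" for u v
    unfolding lin_ricci_eq_dird(1)[OF x]
  proof (rule dird_cong_open)
    show "open {-\<epsilon><..<\<epsilon>}" by simp
    show "0 \<in> {-\<epsilon><..<\<epsilon>}" using N(1) by simp
  qed (rule sym_joint)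
  then have "lin_ricci \<gamma> l x $ j $ i = lin_ricci \<gamma> l x $ i $ j" for i j
    unfolding bf_axis[symmetric] .
  then show ?thesis by (simp add: vec_eq_iff transpose_def)
qed

end

lemma metric_chart_subset: "metric_chart \<Omega> \<gamma> \<Longrightarrow> open N \<Longrightarrow> N \<subseteq> \<Omega> \<Longrightarrow> metric_chart N \<gamma>"
  unfolding metric_chart_def by (blast intro: smooth_on_subset)

lemma bf_zero_matrix: "bf 0 u v = 0"
  by (simp add: bf_def matrix_vector_mult_def zero_vec_def[symmetric])

lemma christoffel_jet:
  assumes "\<gamma> differentiable (at x)"
  shows "christoffel \<gamma> k i j x = jet_chr (jet \<gamma> x) k i j"
  unfolding christoffel_def jet_chr_def jet_def by (simp add: pderiv_at_matrix_nth[OF assms])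

text \<open>For every small \<open>s\<close> the metric \<open>\<gamma>' + s l'\<close> is the
  pullback of \<open>\<gamma> + s l\<close>, so \<open>Ric_pullback\<close> applies. The
  differential of \<phi> does not depend on \<open>s\<close>, and differentiation at
  \<open>s = 0\<close> gives the claim.\<close>

lemma lin_ricci_pullback:
  fixes \<phi> :: "real^'n::finite \<Rightarrow> real^'n"
  assumes "metric_variation \<Omega>' \<gamma>' l'" "metric_variation \<Omega> \<gamma> l"
    and sm: "smooth_on \<Omega>' \<phi>" and rng: "\<And>y. y \<in> \<Omega>' \<Longrightarrow> \<phi> y \<in> \<Omega>"
    and pb: "\<And>y u v. y \<in> \<Omega>' \<Longrightarrow> bf (\<gamma>' y) u v = bf (\<gamma> (\<phi> y)) (dird u \<phi> y) (dird v \<phi> y)"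
    and pbl: "\<And>y u v. y \<in> \<Omega>' \<Longrightarrow> bf (l' y) u v = bf (l (\<phi> y)) (dird u \<phi> y) (dird v \<phi> y)"
    and y: "y \<in> \<Omega>'"
  shows "bf (lin_ricci \<gamma>' l' y) u v = bf (lin_ricci \<gamma> l (\<phi> y)) (dird u \<phi> y) (dird v \<phi> y)"
proof -
  interpret s: metric_variation \<Omega>' \<gamma>' l' by (rule assms(1))
  interpret t: metric_variation \<Omega> \<gamma> l by (rule assms(2))
  obtain \<epsilon>' N' where N': "\<epsilon>' > 0" "open N'" "y \<in> N'" "N' \<subseteq> \<Omega>'"
    "\<And>r. r \<in> {-\<epsilon>'<..<\<epsilon>'} \<Longrightarrow> metric_chart N' (s.\<gamma>s r)"
    "\<And>r z. r \<in> {-\<epsilon>'<..<\<epsilon>'} \<Longrightarrow> z \<in> N' \<Longrightarrow> (r, z) \<in> s.joint_domain"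
    by (rule s.variation_chart[OF y]) (rule that)
  obtain \<epsilon> N where N: "\<epsilon> > 0" "open N" "\<phi> y \<in> N" "N \<subseteq> \<Omega>"
    "\<And>r. r \<in> {-\<epsilon><..<\<epsilon>} \<Longrightarrow> metric_chart N (t.\<gamma>s r)"
    "\<And>r z. r \<in> {-\<epsilon><..<\<epsilon>} \<Longrightarrow> z \<in> N \<Longrightarrow> (r, z) \<in> t.joint_domain"
    by (rule t.variation_chart[OF rng[OF y]]) (rule that)
  \<comment> \<open>Shrunk so that \<phi> maps it into the neighbourhood \<open>N\<close> on which
    the perturbed target metrics are nondegenerate.\<close>
  define N'' where "N'' = \<phi> -` N \<inter> N'"
  have "continuous_on N' \<phi>"
    by (rule smooth_on_continuous_on[OF smooth_on_subset[OF sm N'(4)]])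
  then have op: "open N''" unfolding N''_def
    using continuous_on_open_vimage[OF N'(2), THEN iffD1, rule_format, OF _ N(2)] by blast
  have yN: "y \<in> N''" and sub: "N'' \<subseteq> N'" "N'' \<subseteq> \<Omega>'" using N(3) N'(3,4) by (auto simp: N''_def)
  define \<delta> where "\<delta> = min \<epsilon> \<epsilon>'"
  have eq: "bf (s.joint_ricci (r, y)) u v = bf (t.joint_ricci (r, \<phi> y)) (dird u \<phi> y) (dird v \<phi> y)"
    if "r \<in> {-\<delta><..<\<delta>}" for r
  proof -
    have r: "r \<in> {-\<epsilon><..<\<epsilon>}" "r \<in> {-\<epsilon>'<..<\<epsilon>'}" using that by (auto simp: \<delta>_def)
    interpret p: metric_pullback N'' "s.\<gamma>s r" N "t.\<gamma>s r" \<phi>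
    proof (rule metric_pullback.intro)
      show "metric_chart N'' (s.\<gamma>s r)" by (rule metric_chart_subset[OF N'(5)[OF r(2)] op sub(1)])
      show "metric_chart N (t.\<gamma>s r)" by (rule N(5)[OF r(1)])
      show "metric_pullback_axioms N'' (s.\<gamma>s r) N (t.\<gamma>s r) \<phi>"
      proof
        show "smooth_on N'' \<phi>" by (rule smooth_on_subset[OF sm sub(2)])
        show "\<phi> z \<in> N" if "z \<in> N''" for z using that by (simp add: N''_def)
        show "bf (s.\<gamma>s r z) u v = bf (t.\<gamma>s r (\<phi> z)) (dird u \<phi> z) (dird v \<phi> z)" if "z \<in> N''" for z u v
        proof -
          have z: "z \<in> \<Omega>'" using that sub(2) by blast
          show ?thesis unfolding bf_add_matrix bf_scaleR_matrix pb[OF z] pbl[OF z] ..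
        qed
      qed
    qed
    show ?thesis
      using p.Ric_pullback[OF yN, of u v]
      unfolding p.source.bf_coord_ricci[OF yN, symmetric] p.target.bf_coord_ricci[OF N(3), symmetric]
        s.joint_ricci_eq[OF N'(6)[OF r(2) N'(3)]] t.joint_ricci_eq[OF N(6)[OF r(1) N(3)]] .
  qed
  show ?thesis
    unfolding s.lin_ricci_eq_dird(1)[OF y] t.lin_ricci_eq_dird(1)[OF rng[OF y]]
  proof (rule dird_cong_open)
    show "open {-\<delta><..<\<delta>}" by simp
    show "0 \<in> {-\<delta><..<\<delta>}" using N(1) N'(1) by (simp add: \<delta>_def)
  qed (rule eq)
qed

context metric_variation
begin

text \<open>The derivative at \<open>s = 0\<close> of the contracted Bianchi identity of \<open>\<gamma> + s l\<close>; the variation of the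
  connection only enters through products with the Ricci tensor of \<open>\<gamma>\<close>, which vanishes.\<close>

lemma lin_ricci_bianchi:
  assumes flat: "\<And>y. y \<in> \<Omega> \<Longrightarrow> coord_ricci \<gamma> y = 0" and x: "x \<in> \<Omega>"
  shows "(\<Sum>m\<in>UNIV. nabla \<gamma> (\<lambda>y. bf (lin_ricci \<gamma> l y)) x e (axis m 1) (sharp (\<gamma> x) m))
    = 2 * (\<Sum>k\<in>UNIV. nabla \<gamma> (\<lambda>y. bf (lin_ricci \<gamma> l y)) x (axis k 1) (sharp (\<gamma> x) k) e)"
proof -
  obtain \<epsilon> N where N: "\<epsilon> > 0" "open N" "x \<in> N" "N \<subseteq> \<Omega>"
    "\<And>s. s \<in> {-\<epsilon><..<\<epsilon>} \<Longrightarrow> metric_chart N (\<gamma>s s)"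
    "\<And>s y. s \<in> {-\<epsilon><..<\<epsilon>} \<Longrightarrow> y \<in> N \<Longrightarrow> (s, y) \<in> joint_domain"
    by (rule variation_chart[OF x]) (rule that)
  let ?I = "{-\<epsilon><..<\<epsilon>}"
  have I: "open ?I" "0 \<in> ?I" using N(1) by simp_all
  have inI: "(s, x) \<in> joint_domain" if "s \<in> ?I" for s by (rule N(6)[OF that N(3)])
  have smI: "smooth_on ?I (\<lambda>s. f (s, x))" if "smooth_on joint_domain f" for f :: "real \<times> (real^'n) \<Rightarrow> real^'n^'n"
    by (rule smooth_on_compose[OF smooth_on_Pair[OF smooth_on_ident smooth_on_const] that]) (use inI in auto)
  \<comment> \<open>At the fixed point \<open>x\<close>, the space derivatives (\<open>A\<close>)
    and the value (\<open>B\<close>) of the Ricci tensor of \<open>\<gamma>s s\<close>, as functions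
    of the parameter alone.\<close>
  define A where "A a s = dird (0, a) joint_ricci (s, x)" for a s
  define B where "B s = joint_ricci (s, x)" for s
  have smA: "smooth_on ?I (A a)" for a
    unfolding A_def by (rule smI) (rule smooth_on_dird[OF open_joint_domain smooth_joint_ricci])
  have smB: "smooth_on ?I B" unfolding B_def by (rule smI[OF smooth_joint_ricci])
  have c1: "((\<lambda>s::real. (s, y)) has_derivative (\<lambda>r. (r, 0))) (at s)" for s and y :: "real^'n"
    by (rule has_derivative_Pair[OF has_derivative_ident has_derivative_const])
  have c2: "((\<lambda>y. (s::real, y)) has_derivative (\<lambda>w. (0, w))) (at y)" for s and y :: "real^'n"
    by (rule has_derivative_Pair[OF has_derivative_const has_derivative_ident])
  note jd = smooth_on_differentiable[OF open_joint_domain]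
  have slice: "dird a (\<lambda>y. f (s, y)) y = dird (0, a) f (s, y)"
    if "smooth_on joint_domain f" "(s, y) \<in> joint_domain"
    for f :: "real \<times> (real^'n) \<Rightarrow> real^'n^'n" and a s y
    using dird_compose[OF differentiableI[OF c2] jd[OF that], of a] unfolding dird_eqI[OF c2] .
  have flat_joint: "joint_ricci (0, y) = 0" if "y \<in> \<Omega>" for y
    using joint_ricci_eq[OF zero_in_joint_domain[OF that]] flat[OF that] by simp
  have B0: "B 0 = 0" unfolding B_def by (rule flat_joint[OF x])
  \<comment> \<open>Flatness holds on all of \<Omega>, so the space derivatives of the Ricci tensor
    vanish at \<open>s = 0\<close> as well.\<close>
  have A0: "A a 0 = 0" for a
  proof -
    have "A a 0 = dird a (\<lambda>y. joint_ricci (0, y)) x"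
      unfolding A_def by (rule slice[OF smooth_joint_ricci zero_in_joint_domain[OF x], symmetric])
    also have "\<dots> = dird a (\<lambda>y. 0) x" by (rule dird_cong_open[OF open_dom x flat_joint])
    finally show ?thesis by simp
  qed
  have dB: "dird 1 B 0 = lin_ricci \<gamma> l x" unfolding B_def by (rule lin_ricci_eq_dird(3)[OF x])
  have dA: "dird 1 (A a) 0 = dird a (lin_ricci \<gamma> l) x" for a
  proof -
    note sm2 = smooth_on_dird[OF open_joint_domain smooth_joint_ricci]
    have "dird 1 (A a) 0 = dird (1, 0) (dird (0, a) joint_ricci) (0, x)"
      using dird_compose[OF differentiableI[OF c1] jd[OF sm2 zero_in_joint_domain[OF x]], of 1]
      unfolding A_def[abs_def] dird_eqI[OF c1] .
    also have "\<dots> = dird (0, a) (dird (1, 0) joint_ricci) (0, x)"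
      by (rule dird_commute[OF open_joint_domain smooth_joint_ricci zero_in_joint_domain[OF x]])
    also have "\<dots> = dird a (\<lambda>y. dird (1, 0) joint_ricci (0, y)) x"
      by (rule slice[OF sm2 zero_in_joint_domain[OF x], symmetric])
    also have "\<dots> = dird a (lin_ricci \<gamma> l) x"
      by (rule dird_cong_open[OF open_dom x]) (rule dird_joint_ricci)
    finally show ?thesis .
  qed
  \<comment> \<open>The covariant derivative of the Ricci tensor of \<open>\<gamma>s s\<close> with
    respect to its own connection, see \<open>nablaP\<close>.\<close>
  define P where "P s a u v = bf (A a s) u v - bf (B s) (Gam (\<gamma>s s) x a u) v - bf (B s) u (Gam (\<gamma>s s) x a v)" for s a u v
  have nablaP: "nabla (\<gamma>s s) (Ric (\<gamma>s s)) x a u v = P s a u v" if s: "s \<in> ?I" for s a u v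
  proof -
    interpret v: metric_chart N "\<gamma>s s" by (rule N(5)[OF s])
    have R: "Ric (\<gamma>s s) y u v = bf (joint_ricci (s, y)) u v" if "y \<in> N" for y u v
      unfolding v.bf_coord_ricci[OF that, symmetric] joint_ricci_eq[OF N(6)[OF s that]] ..
    have d: "(\<lambda>y. joint_ricci (s, y)) differentiable (at x)"
      by (rule differentiableI[OF has_derivative_compose[OF c2 has_derivative_dird[OF jd[OF smooth_joint_ricci inI[OF s]]]]])
    have "dird a (\<lambda>y. Ric (\<gamma>s s) y u v) x = dird a (\<lambda>y. bf (joint_ricci (s, y)) u v) x"
      by (rule dird_cong_open[OF N(2,3) R])
    also have "\<dots> = bf (A a s) u v"
      unfolding dird_bf[OF d] A_def slice[OF smooth_joint_ricci inI[OF s]] ..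
    finally show ?thesis unfolding nabla_def P_def B_def R[OF N(3)] by simp
  qed
  have smchr: "smooth_on ?I (\<lambda>s. christoffel (\<gamma>s s) k i j x)" for k i j
  proof -
    have "smooth_on ?I (\<lambda>s. jet_chr (jet \<gamma> x + s *\<^sub>R jet l x) k i j)"
      by (rule smooth_on_compose[OF _ smooth_jet_chr])
        (intro smooth_intros, use joint_jet_in_domain[OF inI] in auto)
    moreover have "jet_chr (jet \<gamma> x + s *\<^sub>R jet l x) k i j = christoffel (\<gamma>s s) k i j x" for s
    proof -
      have "(\<gamma>s s) differentiable (at x)"
        by (intro differentiable smooth_intros smooth smooth_l x)
      from christoffel_jet[OF this] show ?thesis unfolding jet_\<gamma>s[OF x] by simp
    qed
    ultimately show ?thesis by simp
  qed
  have smGam: "smooth_on ?I (\<lambda>s. Gam (\<gamma>s s) x (u s) (v s))" if "smooth_on ?I u" "smooth_on ?I v" for u v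
    unfolding Gam_def by (intro smooth_intros smchr that)
  note dI = smooth_on_differentiable[OF I(1) _ I(2)]
  \<comment> \<open>If the form vanishes at \<open>s = 0\<close>, only its own derivative survives
    in the product rule. This removes the variations of the connection and of the raised
    vectors.\<close>
  have fam: "dird 1 (\<lambda>s. bf (M s) (u s) (v s)) 0 = bf (dird 1 M 0) (u 0) (v 0)"
    if "M 0 = 0" "smooth_on ?I M" "smooth_on ?I u" "smooth_on ?I v" for M u v
  proof -
    have "dird 1 (\<lambda>s. bf (M s) (u s) (v s)) 0
        = dird 1 (\<lambda>s. bf (M s) (u 0) (v 0)) 0 + bf (M 0) (dird 1 u 0) (v 0) + bf (M 0) (u 0) (dird 1 v 0)"
      by (rule dird_bilinear_family[where B = "\<lambda>s. bf (M s)"])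
        (intro bilinear_bf dI smooth_intros that)+
    then show ?thesis unfolding dird_bf[OF dI[OF that(2)]] that(1) bf_zero_matrix by simp
  qed
  have smP: "smooth_on ?I (\<lambda>s. P s a (u s) (v s))" if "smooth_on ?I u" "smooth_on ?I v" for a u v
    unfolding P_def by (intro smooth_intros smA smB smGam that)
  have dP: "dird 1 (\<lambda>s. P s a (u s) (v s)) 0 = nabla \<gamma> (\<lambda>y. bf (lin_ricci \<gamma> l y)) x a (u 0) (v 0)"
    if uv: "smooth_on ?I u" "smooth_on ?I v" for a u v
  proof -
    note G = smGam[OF smooth_on_const uv(1), of a] smGam[OF smooth_on_const uv(2), of a]
    have d: "(\<lambda>s. bf (A a s) (u s) (v s)) differentiable (at 0)"
      "(\<lambda>s. bf (B s) (Gam (\<gamma>s s) x a (u s)) (v s)) differentiable (at 0)"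
      "(\<lambda>s. bf (B s) (u s) (Gam (\<gamma>s s) x a (v s))) differentiable (at 0)"
      "(\<lambda>s. bf (A a s) (u s) (v s) - bf (B s) (Gam (\<gamma>s s) x a (u s)) (v s)) differentiable (at 0)"
      by (intro dI smooth_intros smA smB G uv)+
    have dl: "dird a (\<lambda>y. bf (lin_ricci \<gamma> l y) (u 0) (v 0)) x = bf (dird a (lin_ricci \<gamma> l) x) (u 0) (v 0)"
      by (rule dird_bf) (rule differentiable[OF smooth_lin_ricci x])
    show ?thesis
      unfolding P_def dird_diff[OF d(4,3)] dird_diff[OF d(1,2)] fam[OF A0 smA uv] fam[OF B0 smB G(1) uv(2)]
        fam[OF B0 smB uv(1) G(2)] dA dB nabla_def dl by simp
  qed
  have sms: "smooth_on ?I (\<lambda>s. sharp (\<gamma>s s x) m)" for m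
    unfolding sharp_def
    by (intro smooth_intros) (use inI in \<open>simp add: joint_domain_def\<close>)
  have "dird 1 (\<lambda>s. \<Sum>m\<in>UNIV. P s e (axis m 1) (sharp (\<gamma>s s x) m)) 0
      = dird 1 (\<lambda>s. 2 *\<^sub>R (\<Sum>k\<in>UNIV. P s (axis k 1) (sharp (\<gamma>s s x) k) e)) 0"
  proof (rule dird_cong_open[OF I])
    fix s assume s: "s \<in> ?I"
    interpret v: metric_chart N "\<gamma>s s" by (rule N(5)[OF s])
    show "(\<Sum>m\<in>UNIV. P s e (axis m 1) (sharp (\<gamma>s s x) m)) = 2 *\<^sub>R (\<Sum>k\<in>UNIV. P s (axis k 1) (sharp (\<gamma>s s x) k) e)"
      using v.contracted_bianchi[OF N(3), of e] unfolding nablaP[OF s] by simp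
  qed
  moreover have "dird 1 (\<lambda>s. \<Sum>m\<in>UNIV. P s e (axis m 1) (sharp (\<gamma>s s x) m)) 0
      = (\<Sum>m\<in>UNIV. nabla \<gamma> (\<lambda>y. bf (lin_ricci \<gamma> l y)) x e (axis m 1) (sharp (\<gamma>s 0 x) m))"
    unfolding dird_sum_UNIV[OF dI[OF smP[OF smooth_on_const sms]]] dP[OF smooth_on_const sms] ..
  moreover have "dird 1 (\<lambda>s. 2 *\<^sub>R (\<Sum>k\<in>UNIV. P s (axis k 1) (sharp (\<gamma>s s x) k) e)) 0
      = 2 *\<^sub>R (\<Sum>k\<in>UNIV. nabla \<gamma> (\<lambda>y. bf (lin_ricci \<gamma> l y)) x (axis k 1) (sharp (\<gamma>s 0 x) k) e)"
  proof -
    have "(\<lambda>s. \<Sum>k\<in>UNIV. P s (axis k 1) (sharp (\<gamma>s s x) k) e) differentiable (at 0)"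
      by (intro dI smooth_on_sum smP sms smooth_on_const)
    then show ?thesis
      unfolding dird_scaleR_right[OF \<open>(\<lambda>s. \<Sum>k\<in>UNIV. P s (axis k 1) (sharp (\<gamma>s s x) k) e) differentiable (at 0)\<close>]
        dird_sum_UNIV[OF dI[OF smP[OF sms smooth_on_const]]] dP[OF sms smooth_on_const] by simp
  qed
  moreover have "\<gamma>s 0 x = \<gamma> x" by simp
  ultimately show ?thesis by (simp only: real_scaleR_def)
qed

end

subsection \<open>The second-order expansion along a curve of Einstein metrics\<close>

lemma has_vector_derivative_dird:
  assumes "f differentiable (at t)"
  shows "(f has_vector_derivative dird 1 f t) (at t)"
proof -
  have "dird r f t = r *\<^sub>R dird 1 f t" for r
    using linear_cmul[OF linear_dird[OF assms], of r 1] by (simp only: real_scaleR_def mult_1_right)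
  then show ?thesis
    unfolding has_vector_derivative_def by (rule has_derivative_eq_rhs[OF has_derivative_dird[OF assms] ext])
qed

text \<open>The Einstein equation is available only for \<open>t \<ge> 0\<close>; a derivative that
  exists in the two-sided sense is already determined by its one-sided difference quotients.\<close>

lemma one_sided_derivative_zero:
  fixes f :: "real \<Rightarrow> real"
  assumes I: "open I" "t \<in> I" and z: "\<And>s. s \<in> I \<Longrightarrow> s \<ge> t \<Longrightarrow> f s = 0"
    and d: "f differentiable (at t)"
  shows "dird 1 f t = 0"
proof -
  note D = has_vector_derivative_dird[OF d]
  obtain e where e: "e > 0" "ball t e \<subseteq> I" using I open_contains_ball by blast
  have "f s = 0" if "s \<in> {t..}" "dist s t < e" for s
  proof (rule z)
    show "s \<in> I" using e(2) that(2) by (metis dist_commute mem_ball subsetD)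
    show "s \<ge> t" using that(1) by simp
  qed
  then have "((\<lambda>s. 0) has_vector_derivative dird 1 f t) (at t within {t..})"
    by (intro has_vector_derivative_transform_within[OF has_vector_derivative_at_within[OF D] e(1)]) simp_all
  moreover have "((\<lambda>s. 0) has_vector_derivative 0) (at t within {t..})" by simp
  moreover have "at t within {t..} \<noteq> bot"
    unfolding at_within_Ici_at_right by (rule trivial_limit_at_right_real)
  ultimately show ?thesis by (metis vector_derivative_unique_within)
qed

text \<open>Differentiating \<open>\<Phi> (j t) = 0\<close> twice gives a Hessian term in the
  velocity of \<open>j\<close> and a gradient term in its acceleration. The Hessian term is the
  second derivative of \<Phi> along the straight line with the same velocity, which is the left
  side.\<close>

lemma second_order_expansion:
  fixes j :: "real \<Rightarrow> 'e::euclidean_space" and \<Phi> :: "'e \<Rightarrow> real"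
  assumes D: "open D" "smooth_on D \<Phi>" and I: "open I" "0 \<in> I" and j: "smooth_on I j" "\<And>t. t \<in> I \<Longrightarrow> j t \<in> D"
    and z: "\<And>t. t \<in> I \<Longrightarrow> t \<ge> 0 \<Longrightarrow> \<Phi> (j t) = 0"
  shows "(deriv ^^ 2) (\<lambda>s. \<Phi> (j 0 + s *\<^sub>R dird 1 j 0)) 0 = - dird (dird 1 (dird 1 j) 0) \<Phi> (j 0)"
proof -
  let ?v = "dird 1 j 0"
  note dI = smooth_on_differentiable[OF I(1)]
  have sm: "smooth_on I (\<lambda>t. \<Phi> (j t))"
    by (rule smooth_on_compose[OF j(1) D(2)]) (rule image_subsetI, rule j(2))
  have smj: "smooth_on I (dird 1 j)" by (rule smooth_on_dird[OF I(1) j(1)])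
  have first: "dird 1 (\<lambda>t. \<Phi> (j t)) t = dird (dird 1 j t) \<Phi> (j t)" if "t \<in> I" for t
    by (rule dird_compose[OF dI[OF j(1) that] smooth_on_differentiable[OF D j(2)[OF that]]])
  have z': "dird 1 (\<lambda>t. \<Phi> (j t)) t = 0" if "t \<in> I" "t \<ge> 0" for t
    by (rule one_sided_derivative_zero[OF I(1) that(1)]) (use z that dI[OF sm that(1)] in auto)
  have "dird 1 (dird 1 (\<lambda>t. \<Phi> (j t))) 0 = 0"
    by (rule one_sided_derivative_zero[OF I]) (use z' dI[OF smooth_on_dird[OF I(1) sm] I(2)] in auto)
  moreover have "dird 1 (dird 1 (\<lambda>t. \<Phi> (j t))) 0 = dird 1 (\<lambda>t. dird (dird 1 j t) \<Phi> (j t)) 0"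
    by (rule dird_cong_open[OF I first])
  moreover have "\<dots> = dird ?v (dird ?v \<Phi>) (j 0) + dird (dird 1 (dird 1 j) 0) \<Phi> (j 0)"
    by (rule dird_dird_family[OF D I j(2) dI[OF j(1) I(2)] dI[OF smj I(2)]])
  ultimately have sum0: "dird ?v (dird ?v \<Phi>) (j 0) + dird (dird 1 (dird 1 j) 0) \<Phi> (j 0) = 0" by simp
  \<comment> \<open>The parameters for which the straight line stays in the domain of
    \<Phi>.\<close>
  define L where "L = {s. j 0 + s *\<^sub>R ?v \<in> D}"
  have "continuous_on UNIV (\<lambda>s::real. j 0 + s *\<^sub>R ?v)" by (intro continuous_intros)
  then have L: "open L" "0 \<in> L"
    using open_vimage[OF D(1)] j(2)[OF I(2)] by (auto simp: L_def vimage_def)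
  have line: "((\<lambda>s. f (j 0 + s *\<^sub>R ?v)) has_real_derivative dird ?v f (j 0 + s *\<^sub>R ?v)) (at s)"
    if "smooth_on D f" "s \<in> L" for f s
    by (rule dird_line) (rule smooth_on_differentiable[OF D(1) that(1)], use that(2) in \<open>simp add: L_def\<close>)
  have "(deriv ^^ 2) (\<lambda>s. \<Phi> (j 0 + s *\<^sub>R ?v)) 0 = deriv (deriv (\<lambda>s. \<Phi> (j 0 + s *\<^sub>R ?v))) 0"
    by (simp add: numeral_2_eq_2)
  also have "\<dots> = deriv (\<lambda>s. dird ?v \<Phi> (j 0 + s *\<^sub>R ?v)) 0"
  proof (rule deriv_cong_ev[OF _ refl])
    show "\<forall>\<^sub>F s in nhds 0. deriv (\<lambda>s. \<Phi> (j 0 + s *\<^sub>R ?v)) s = dird ?v \<Phi> (j 0 + s *\<^sub>R ?v)"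
      using eventually_nhds_in_open[OF L] by (rule eventually_mono) (rule DERIV_imp_deriv[OF line[OF D(2)]])
  qed
  also have "\<dots> = dird ?v (dird ?v \<Phi>) (j 0)"
    using DERIV_imp_deriv[OF line[OF smooth_on_dird[OF D] L(2)]] by simp
  finally show ?thesis using sum0 by linarith
qed

section \<open>The traceless Ricci tensor on jets\<close>

definition jet_traceless :: "'n::finite jet2 \<Rightarrow> real^'n^'n" where
  "jet_traceless J = jet_ricci J
     - ((\<Sum>i\<in>UNIV. \<Sum>j\<in>UNIV. matrix_inv (fst J) $ i $ j * jet_ricci J $ i $ j) / real CARD('n)) *\<^sub>R fst J"

lemma smooth_jet_scalar:
  "smooth_on {J. det (fst J) \<noteq> 0}
    (\<lambda>J :: 'n::finite jet2. (\<Sum>i\<in>UNIV. \<Sum>j\<in>UNIV. matrix_inv (fst J) $ i $ j * jet_ricci J $ i $ j) / real CARD('n))"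
  by (intro smooth_intros smooth_jet_ricci) simp_all

lemma smooth_jet_traceless: "smooth_on {J :: 'n::finite jet2. det (fst J) \<noteq> 0} jet_traceless"
proof -
  have "smooth_on {J :: 'n jet2. det (fst J) \<noteq> 0} (\<lambda>J. jet_traceless J)"
    unfolding jet_traceless_def by (intro smooth_on_diff smooth_on_scaleR smooth_jet_scalar smooth_jet_ricci smooth_intros)
  then show ?thesis .
qed

text \<open>At a jet with vanishing Ricci tensor the scalar curvature is 0, so the derivative of
  scalar curvature times metric is just a multiple of the metric.\<close>

lemma dird_jet_traceless_flat:
  fixes J :: "'n::finite jet2"
  assumes nz: "det (fst J) \<noteq> 0" and flat: "jet_ricci J = 0"
  shows "\<exists>c. dird K jet_traceless J = dird K jet_ricci J - c *\<^sub>R fst J"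
proof -
  let ?s = "\<lambda>J :: 'n jet2. (\<Sum>i\<in>UNIV. \<Sum>j\<in>UNIV. matrix_inv (fst J) $ i $ j * jet_ricci J $ i $ j) / real CARD('n)"
  have JD: "J \<in> {J. det (fst J) \<noteq> 0}" using nz by simp
  note d = smooth_on_differentiable[OF open_jet_domain _ JD]
  have sf: "smooth_on {J :: 'n jet2. det (fst J) \<noteq> 0} fst"
    using smooth_on_fst[OF smooth_on_ident] .
  have ds: "?s differentiable (at J)" by (rule d[OF smooth_jet_scalar])
  have df: "fst differentiable (at J)" by (rule d[OF sf])
  have dp: "(\<lambda>J. ?s J *\<^sub>R fst J) differentiable (at J)"
    by (rule differentiableI[OF has_derivative_scaleR[OF has_derivative_dird[OF ds] has_derivative_dird[OF df]]])
  have "dird K jet_traceless J = dird K jet_ricci J - dird K (\<lambda>J. ?s J *\<^sub>R fst J) J"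
    unfolding jet_traceless_def[abs_def] by (rule dird_diff[OF d[OF smooth_jet_ricci] dp])
  also have "dird K (\<lambda>J. ?s J *\<^sub>R fst J) J = ?s J *\<^sub>R dird K fst J + dird K ?s J *\<^sub>R fst J"
    by (rule dird_bilinear[OF bounded_bilinear_scaleR ds df])
  also have "?s J = 0" by (simp add: flat)
  finally show ?thesis by auto
qed

text \<open>The jet in the space variables as a function of time and position together, so that it
  can be differentiated in time; \<open>jet_slice\<close> identifies it with the jet of a time
  slice.\<close>

definition space_jet ::
    "(real \<times> (real^'n) \<Rightarrow> real^'n::finite^'n) \<Rightarrow> real \<times> (real^'n) \<Rightarrow> 'n jet2" where
  "space_jet F z = (F z, \<chi> k. dird (0, axis k 1) F z, \<chi> k l. dird (0, axis k 1) (dird (0, axis l 1) F) z)"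

lemma jet_slice:
  assumes T: "open T" "smooth_on T F" and z: "(t, x) \<in> T"
  shows "jet (\<lambda>y. F (t, y)) x = space_jet F (t, x)"
proof -
  have c: "((\<lambda>y. (t, y)) has_derivative (\<lambda>w. (0, w))) (at y)" for y :: "real^'a"
    by (rule has_derivative_Pair[OF has_derivative_const has_derivative_ident])
  have slice: "dird a (\<lambda>y. f (t, y)) y = dird (0, a) f (t, y)"
    if "smooth_on T f" "(t, y) \<in> T" for f :: "real \<times> (real^'a) \<Rightarrow> real^'a^'a" and a y
    using dird_compose[OF differentiableI[OF c] smooth_on_differentiable[OF T(1) that], of a] unfolding dird_eqI[OF c] .
  let ?T = "(\<lambda>y. (t, y)) -` T"
  have op: "open ?T" by (rule open_vimage[OF T(1)]) (intro continuous_intros)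
  have xT: "x \<in> ?T" using z by simp
  have "dird a (dird b (\<lambda>y. F (t, y))) x = dird (0, a) (dird (0, b) F) (t, x)" for a b
  proof -
    have "dird a (dird b (\<lambda>y. F (t, y))) x = dird a (\<lambda>y. dird (0, b) F (t, y)) x"
      by (rule dird_cong_open[OF op xT]) (rule slice[OF T(2)], simp)
    also have "\<dots> = dird (0, a) (dird (0, b) F) (t, x)"
      by (rule slice[OF smooth_on_dird[OF T] z])
    finally show ?thesis .
  qed
  then show ?thesis unfolding jet_def space_jet_def by (simp add: slice[OF T(2) z])
qed

lemma smooth_space_jet: "open T \<Longrightarrow> smooth_on T F \<Longrightarrow> smooth_on T (space_jet F)"
  unfolding space_jet_def[abs_def] by (intro smooth_intros)

lemma dird_Pair:
  assumes "f differentiable (at x)" "g differentiable (at x)"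
  shows "dird v (\<lambda>y. (f y, g y)) x = (dird v f x, dird v g x)"
  by (rule dird_eqI[OF has_derivative_Pair[OF has_derivative_dird[OF assms(1)] has_derivative_dird[OF assms(2)]]])

lemma dird_vec_lambda:
  fixes f :: "'i::finite \<Rightarrow> 'a::real_normed_vector \<Rightarrow> 'b::euclidean_space"
  assumes S: "open S" "\<And>i. smooth_on S (f i)" and x: "x \<in> S"
  shows "dird v (\<lambda>y. \<chi> i. f i y) x = (\<chi> i. dird v (f i) x)"
proof -
  have d: "(\<lambda>y. \<chi> i. f i y) differentiable (at x)"
    by (rule smooth_on_differentiable[OF S(1) smooth_on_vec_lambda[OF S(2)] x])
  have "dird v (\<lambda>y. \<chi> i. f i y) x $ k = dird v (f k) x" for k
    using dird_nth[OF d, of v k] by simp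
  then show ?thesis by (simp add: vec_eq_iff)
qed

lemma dird_space_jet:
  assumes T: "open T" "smooth_on T F" and z: "z \<in> T"
  shows "dird w (space_jet F) z = space_jet (dird w F) z"
proof -
  note sd = smooth_on_dird[OF T(1)]
  note d = smooth_on_differentiable[OF T(1) _ z]
  have comm: "dird w (dird a f) y = dird a (dird w f) y" if "smooth_on T f" "y \<in> T"
    for f :: "real \<times> (real^'a) \<Rightarrow> real^'a^'a" and a y
    by (rule dird_commute[OF T(1) that])
  have "dird w (dird a (dird b F)) z = dird a (dird b (dird w F)) z" for a b
  proof -
    have "dird w (dird a (dird b F)) z = dird a (dird w (dird b F)) z"
      by (rule comm[OF sd[OF T(2)] z])
    also have "\<dots> = dird a (dird b (dird w F)) z"
      by (rule dird_cong_open[OF T(1) z]) (rule comm[OF T(2)])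
    finally show ?thesis .
  qed
  moreover have "dird w (\<lambda>z. \<chi> k. dird (0, axis k 1) F z) z = (\<chi> k. dird w (dird (0, axis k 1) F) z)"
    by (rule dird_vec_lambda[OF T(1) sd[OF T(2)] z])
  moreover have "dird w (\<lambda>z. \<chi> k l. dird (0, axis k 1) (dird (0, axis l 1) F) z) z
      = (\<chi> k l. dird w (dird (0, axis k 1) (dird (0, axis l 1) F)) z)"
    by (subst dird_vec_lambda[OF T(1) smooth_on_vec_lambda[OF sd[OF sd[OF T(2)]]] z],
        subst dird_vec_lambda[OF T(1) sd[OF sd[OF T(2)]] z]) (rule refl)
  moreover have "(\<lambda>z. \<chi> k. dird (0, axis k 1) F z) differentiable (at z)"
    "(\<lambda>z. \<chi> k l. dird (0, axis k 1) (dird (0, axis l 1) F) z) differentiable (at z)"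
    "(\<lambda>z. (\<chi> k. dird (0, axis k 1) F z, \<chi> k l. dird (0, axis k 1) (dird (0, axis l 1) F) z)) differentiable (at z)"
    by (intro d smooth_intros T)+
  ultimately show ?thesis
    unfolding space_jet_def[abs_def] by (simp add: dird_Pair d[OF T(2)] comm[OF T(2) z])
qed

text \<open>The curve of jets \<open>j t\<close> stays in the zero set of the traceless Ricci tensor \<open>E\<close>, so differentiating
  \<open>E (j t) = 0\<close> twice gives \<open>D\<^sup>2E (j', j') = - DE (j'')\<close> at \<open>t = 0\<close>.\<close>

lemma traceless_expansion:
  fixes F :: "real \<times> (real^'n::finite) \<Rightarrow> real^'n^'n"
  assumes T: "open T" "smooth_on T F" and z: "(0, x) \<in> T" and nz: "det (F (0, x)) \<noteq> 0"
    and zero: "\<And>t. t \<ge> 0 \<Longrightarrow> (t, x) \<in> T \<Longrightarrow> jet_traceless (jet (\<lambda>y. F (t, y)) x) = 0"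
  shows "(deriv ^^ 2) (\<lambda>s. jet_traceless (jet (\<lambda>y. F (0, y)) x + s *\<^sub>R jet (\<lambda>y. dird (1, 0) F (0, y)) x) $ a $ b) 0
    = - (dird (jet (\<lambda>y. dird (1, 0) (dird (1, 0) F) (0, y)) x) jet_traceless (jet (\<lambda>y. F (0, y)) x) $ a $ b)"
proof -
  let ?D = "{J :: 'n jet2. det (fst J) \<noteq> 0}"
  let ?F1 = "dird (1, 0) F" let ?F2 = "dird (1, 0) ?F1"
  have sF: "smooth_on T ?F1" "smooth_on T ?F2" by (intro smooth_on_dird T)+
  \<comment> \<open>The times at which the curve of jets lies in the open set on which
    \<open>jet_traceless\<close> is smooth.\<close>
  define I where "I = {t. (t, x) \<in> T \<and> det (F (t, x)) \<noteq> 0}"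
  have c: "((\<lambda>s::real. (s, x)) has_derivative (\<lambda>r. (r, 0))) (at s)" for s
    by (rule has_derivative_Pair[OF has_derivative_ident has_derivative_const])
  have I: "open I" "0 \<in> I"
  proof -
    have "continuous_on T (\<lambda>z. det (F z))"
      by (rule smooth_on_continuous_on) (intro smooth_intros T)
    then have "open ((\<lambda>z. det (F z)) -` (- {0}) \<inter> T)"
      using continuous_on_open_vimage[OF T(1), THEN iffD1, rule_format, OF _ open_Compl[OF closed_singleton]] by blast
    then have "open ((\<lambda>t. (t, x)) -` ((\<lambda>z. det (F z)) -` (- {0}) \<inter> T))"
      by (rule open_vimage) (intro continuous_intros)
    moreover have "(\<lambda>t. (t, x)) -` ((\<lambda>z. det (F z)) -` (- {0}) \<inter> T) = I" by (auto simp: I_def)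
    ultimately show "open I" by simp
    show "0 \<in> I" using z nz by (simp add: I_def)
  qed
  define j where "j t = space_jet F (t, x)" for t
  have dj: "dird 1 (\<lambda>t. space_jet G (t, x)) t = space_jet (dird (1, 0) G) (t, x)"
    if "t \<in> I" "smooth_on T G" for t G
  proof -
    have tx: "(t, x) \<in> T" using that(1) by (simp add: I_def)
    show ?thesis
      using dird_compose[OF differentiableI[OF c] smooth_on_differentiable[OF T(1) smooth_space_jet[OF T(1) that(2)] tx], of 1]
      unfolding dird_eqI[OF c] dird_space_jet[OF T(1) that(2) tx] .
  qed
  have j1: "dird 1 j t = space_jet ?F1 (t, x)" if "t \<in> I" for t
    unfolding j_def[abs_def] by (rule dj[OF that T(2)])
  have j2: "dird 1 (dird 1 j) 0 = space_jet ?F2 (0, x)"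
  proof -
    have "dird 1 (dird 1 j) 0 = dird 1 (\<lambda>t. space_jet ?F1 (t, x)) 0"
      by (rule dird_cong_open[OF I j1])
    then show ?thesis unfolding dj[OF I(2) sF(1)] .
  qed
  have smj: "smooth_on I j"
    unfolding j_def[abs_def]
    by (rule smooth_on_compose[OF smooth_on_Pair[OF smooth_on_ident smooth_on_const] smooth_space_jet[OF T]])
      (auto simp: I_def)
  have \<Phi>: "smooth_on ?D (\<lambda>J. jet_traceless J $ a $ b)"
    by (intro smooth_on_nth smooth_jet_traceless)
  have jt: "jet (\<lambda>y. F (t, y)) x = j t" if "t \<in> I" for t
    unfolding j_def by (rule jet_slice[OF T]) (use that in \<open>simp add: I_def\<close>)
  have jD: "j t \<in> ?D" if "t \<in> I" for t
    using that by (simp add: j_def space_jet_def I_def)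
  have "(deriv ^^ 2) (\<lambda>s. jet_traceless (j 0 + s *\<^sub>R dird 1 j 0) $ a $ b) 0
      = - dird (dird 1 (dird 1 j) 0) (\<lambda>J. jet_traceless J $ a $ b) (j 0)"
  proof (rule second_order_expansion[OF open_jet_domain \<Phi> I smj jD])
    fix t assume t: "t \<in> I" "t \<ge> 0"
    then have "(t, x) \<in> T" by (simp add: I_def)
    then show "jet_traceless (j t) $ a $ b = 0" using zero[OF t(2)] jt[OF t(1)] by simp
  qed
  moreover have "dird K (\<lambda>J. jet_traceless J $ a $ b) (j 0) = dird K jet_traceless (j 0) $ a $ b" for K
  proof -
    have d: "jet_traceless differentiable (at (j 0))" "(\<lambda>J. jet_traceless J $ a) differentiable (at (j 0))"
      by (intro smooth_on_differentiable[OF open_jet_domain _ jD[OF I(2)]] smooth_on_nth smooth_jet_traceless)+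
    show ?thesis by (simp add: dird_nth[OF d(2)] dird_nth[OF d(1)])
  qed
  ultimately show ?thesis
    unfolding jt[OF I(2)] jet_slice[OF T(1) sF(1) z] jet_slice[OF T(1) sF(2) z] j1[OF I(2)] j2 by simp
qed

subsection \<open>Integration over coordinate hyperplanes\<close>

lemma Basis_vec_eq: "(Basis :: (real^'n::finite) set) = (\<lambda>i. axis i 1) ` UNIV"
  by (auto simp: Basis_vec_def)

lemma prod_Basis_vec: "(\<Prod>b\<in>(Basis :: (real^'n::finite) set). f b) = (\<Prod>i\<in>UNIV. f (axis i 1))"
  unfolding Basis_vec_eq by (rule prod.reindex_cong[of "\<lambda>i. axis i 1"]) (auto simp: inj_on_def axis_eq_axis)

lemma measurable_vec_lambda_PiM: "(\<lambda>f. \<chi> i. f i) \<in> Pi\<^sub>M UNIV (\<lambda>_::'n::finite. lborel :: real measure) \<rightarrow>\<^sub>M borel"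
  by (subst borel_measurable_euclidean_space) (auto simp: Basis_vec_eq inner_axis)

text \<open>Slice integrals are taken over a product measure on functions of the index, so Lebesgue
  measure on vectors is presented as the image of such a measure; the two agree on boxes.\<close>

lemma lborel_vec:
  "(lborel :: (real^'n::finite) measure) = distr (Pi\<^sub>M UNIV (\<lambda>_. lborel)) borel (\<lambda>f. \<chi> i. f i)"
proof (rule lborel_eqI)
  interpret product_sigma_finite "\<lambda>_::'n. lborel :: real measure" ..
  fix l u :: "real^'n" assume le: "\<And>b. b \<in> Basis \<Longrightarrow> l \<bullet> b \<le> u \<bullet> b"
  have le': "l $ i \<le> u $ i" for i
    using le[of "axis i 1"] by (simp add: Basis_vec_eq inner_axis)
  have "(\<lambda>f. \<chi> i. f i) -` box l u \<inter> space (Pi\<^sub>M UNIV (\<lambda>_::'n. lborel :: real measure))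
      = Pi\<^sub>E UNIV (\<lambda>i. {l $ i <..< u $ i})"
    by (auto simp: space_PiM PiE_def Pi_def mem_box_cart)
  then have "emeasure (distr (Pi\<^sub>M UNIV (\<lambda>_. lborel)) borel (\<lambda>f. \<chi> i. f i)) (box l u)
      = emeasure (Pi\<^sub>M UNIV (\<lambda>_::'n. lborel :: real measure)) (Pi\<^sub>E UNIV (\<lambda>i. {l $ i <..< u $ i}))"
    using emeasure_distr[OF measurable_vec_lambda_PiM, of "box l u"] by simp
  also have "\<dots> = (\<Prod>i\<in>UNIV. emeasure lborel {l $ i <..< u $ i})"
    by (rule emeasure_PiM) simp_all
  also have "\<dots> = (\<Prod>i\<in>UNIV. ennreal (u $ i - l $ i))"
    using le' by simp
  also have "\<dots> = ennreal (\<Prod>i\<in>UNIV. u $ i - l $ i)"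
    using le' by (intro prod_ennreal) simp
  also have "(\<Prod>i\<in>UNIV. u $ i - l $ i) = (\<Prod>b\<in>Basis. (u - l) \<bullet> b)"
    unfolding prod_Basis_vec by (simp add: inner_axis)
  finally show "emeasure (distr (Pi\<^sub>M UNIV (\<lambda>_. lborel)) borel (\<lambda>f. \<chi> i. f i)) (box l u) = (\<Prod>b\<in>Basis. (u - l) \<bullet> b)" .
qed simp

definition slice_point :: "'n \<Rightarrow> real \<Rightarrow> ('n \<Rightarrow> real) \<Rightarrow> real^'n::finite" where
  "slice_point i t y = (\<chi> j. if j = i then t else y j)"

abbreviation slice_measure :: "'n::finite \<Rightarrow> ('n \<Rightarrow> real) measure" where
  "slice_measure i \<equiv> Pi\<^sub>M (UNIV - {i}) (\<lambda>_. lborel)"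

lemma integral_slices:
  fixes F :: "real^'n::finite \<Rightarrow> real"
  assumes F: "integrable lborel F"
  shows "(\<integral>x. F x \<partial>lborel) = (\<integral>y. (\<integral>t. F (slice_point i t y) \<partial>lborel) \<partial>slice_measure i)"
proof -
  interpret product_sigma_finite "\<lambda>_::'n. lborel :: real measure" ..
  have U: "(UNIV :: 'n set) = insert i (UNIV - {i})" by auto
  have mF: "F \<in> borel_measurable borel" using F by auto
  have "(\<integral>x. F x \<partial>lborel) = (\<integral>f. F (\<chi> i. f i) \<partial>Pi\<^sub>M UNIV (\<lambda>_. lborel))"
    by (subst lborel_vec) (rule integral_distr[OF measurable_vec_lambda_PiM mF])
  also have "\<dots> = (\<integral>f. F (\<chi> i. f i) \<partial>Pi\<^sub>M (insert i (UNIV - {i})) (\<lambda>_. lborel))"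
    using U by simp
  also have "\<dots> = (\<integral>y. (\<integral>t. F (\<chi> j. (y(i := t)) j) \<partial>lborel) \<partial>slice_measure i)"
  proof (rule product_integral_insert)
    have "integrable (Pi\<^sub>M UNIV (\<lambda>_. lborel)) (\<lambda>f. F (\<chi> i. f i))"
      using F integrable_distr_eq[OF measurable_vec_lambda_PiM mF] lborel_vec[where 'n = 'n] by simp
    then show "integrable (Pi\<^sub>M (insert i (UNIV - {i})) (\<lambda>_. lborel)) (\<lambda>f. F (\<chi> i. f i))"
      using U by simp
  qed simp_all
  finally show ?thesis by (simp add: slice_point_def)
qed

lemma integrable_continuous_bounded_support:
  fixes f :: "'a::euclidean_space \<Rightarrow> real"
  assumes "continuous_on UNIV f" and "\<And>x. R < norm x \<Longrightarrow> f x = 0"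
  shows "integrable lborel f"
proof -
  have "integrable lborel (\<lambda>x. indicator (cball 0 R) x *\<^sub>R f x)"
    by (rule borel_integrable_compact[OF compact_cball continuous_on_subset[OF assms(1) subset_UNIV]])
  moreover have "(\<lambda>x. indicator (cball 0 R) x *\<^sub>R f x) = f"
    using assms(2) by (auto simp: indicator_def fun_eq_iff not_le)
  ultimately show ?thesis by simp
qed

lemma slice_point_line: "slice_point i t y = slice_point i 0 y + t *\<^sub>R axis i 1"
  by (simp add: slice_point_def vec_eq_iff axis_def)

lemma norm_slice_point: "\<bar>t\<bar> \<le> norm (slice_point i t y)"
  using component_le_norm_cart[of "slice_point i t y" i] by (simp add: slice_point_def)

text \<open>The vanishing divergence is integrated over the half-space \<open>x $ i \<le> 0\<close>.
  On lines in a direction \<open>k \<noteq> i\<close> the indicator is constant, and bounded support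
  makes the integral 0; on lines in direction \<open>i\<close> the integral is the value on the
  hyperplane.\<close>

lemma divergence_slice:
  fixes V :: "real^'n::finite \<Rightarrow> real^'n"
  assumes sm: "smooth_on UNIV V" and supp: "\<And>x. R < norm x \<Longrightarrow> V x = 0"
    and div: "\<And>x. (\<Sum>k\<in>UNIV. dird (axis k 1) V x $ k) = 0"
  shows "(\<integral>y. V (slice_point i 0 y) $ i \<partial>slice_measure i) = 0"
proof -
  define D where "D k x = dird (axis k 1) V x $ k" for k x
  define F where "F k x = indicator {x. x $ i \<le> 0} x * D k x" for k and x :: "real^'n"
  have contD: "continuous_on UNIV (D k)" for k
    unfolding D_def by (intro smooth_on_continuous_on open_UNIV smooth_intros sm)
  have suppD: "D k x = 0" if "R < norm x" for k x
  proof -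
    have "dird (axis k 1) V x = dird (axis k 1) (\<lambda>x. 0) x"
      by (rule dird_cong_open[of "{x. R < norm x}"]) (use that supp in \<open>auto intro: open_Collect_less continuous_intros\<close>)
    then show ?thesis by (simp add: D_def)
  qed
  have "closed {x::real^'n. x $ i \<le> 0}"
    by (intro closed_Collect_le continuous_intros)
  then have intF: "integrable lborel (F k)" for k
    using integrable_mult_indicator[of "{x. x $ i \<le> 0}" lborel "D k"]
      integrable_continuous_bounded_support[OF contD suppD, of R] by (simp add: F_def[abs_def])
  \<comment> \<open>Positive and beyond the support: on every coordinate line the field and its
    derivatives vanish once the parameter has absolute value at least \<open>S\<close>.\<close>
  define S where "S = max R 0 + 1"
  have S: "S > 0" "S > R" by (auto simp: S_def)
  have line: "((\<lambda>t. V (slice_point k t y) $ k) has_real_derivative D k (slice_point k t y)) (at t)" for k y t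
  proof -
    have d: "V differentiable (at x)" "(\<lambda>x. V x $ k) differentiable (at x)" for x
      by (intro smooth_on_differentiable[OF open_UNIV _ UNIV_I] smooth_intros sm)+
    have "((\<lambda>t. V (slice_point k 0 y + t *\<^sub>R axis k 1) $ k) has_real_derivative
        dird (axis k 1) (\<lambda>x. V x $ k) (slice_point k 0 y + t *\<^sub>R axis k 1)) (at t)"
      by (rule dird_line[OF d(2)])
    then show ?thesis
      unfolding slice_point_line[symmetric] dird_nth[OF d(1)] D_def .
  qed
  have contl: "isCont (\<lambda>t. D k (slice_point k t y)) t" for k y t
  proof -
    have "continuous_on UNIV (\<lambda>t. D k (slice_point k 0 y + t *\<^sub>R axis k 1))"
      by (rule continuous_on_compose2[OF contD]) (auto intro!: continuous_intros)
    then show ?thesis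
      unfolding slice_point_line[symmetric] by (simp add: continuous_on_eq_continuous_at)
  qed
  have far: "V (slice_point k t y) = 0" "D k (slice_point k t y) = 0" if "S \<le> \<bar>t\<bar>" for k t y
    using supp suppD norm_slice_point[of t k y] that S(2) by (simp_all add: order.strict_trans2)
  have FTC: "(\<integral>t. D k (slice_point k t y) * indicator {a..b} t \<partial>lborel)
      = V (slice_point k b y) $ k - V (slice_point k a y) $ k" if "a \<le> b" for a b k y
    by (rule integral_FTC_Icc_real[OF that]) (auto intro: line contl)
  have other: "(\<integral>x. F k x \<partial>lborel) = 0" if k: "k \<noteq> i" for k
  proof -
    have "(\<integral>t. F k (slice_point k t y) \<partial>lborel) = 0" for y
    proof -
      have "F k (slice_point k t y) = (if y i \<le> 0 then 1 else 0) * (D k (slice_point k t y) * indicator {-S..S} t)" for t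
      proof -
        have "D k (slice_point k t y) = 0 \<or> t \<in> {-S..S}"
          using far(2)[of t k y] by (cases "S \<le> \<bar>t\<bar>") auto
        then show ?thesis using k by (auto simp: F_def slice_point_def indicator_def)
      qed
      then have "(\<integral>t. F k (slice_point k t y) \<partial>lborel)
          = (if y i \<le> 0 then 1 else 0) * (\<integral>t. D k (slice_point k t y) * indicator {-S..S} t \<partial>lborel)"
        by simp
      also have "(\<integral>t. D k (slice_point k t y) * indicator {-S..S} t \<partial>lborel) = 0"
        using S far(1)[of S k y] far(1)[of "-S" k y] by (subst FTC) auto
      finally show ?thesis by simp
    qed
    then show ?thesis using integral_slices[OF intF[of k], of k] by simp
  qed
  have same: "(\<integral>x. F i x \<partial>lborel) = (\<integral>y. V (slice_point i 0 y) $ i \<partial>slice_measure i)"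
  proof -
    have "(\<integral>t. F i (slice_point i t y) \<partial>lborel) = V (slice_point i 0 y) $ i" for y
    proof -
      have "F i (slice_point i t y) = D i (slice_point i t y) * indicator {-S..0} t" for t
      proof -
        have "D i (slice_point i t y) = 0 \<or> t \<ge> -S"
          using far(2)[of t i y] by (cases "S \<le> \<bar>t\<bar>") auto
        then show ?thesis by (auto simp: F_def slice_point_def indicator_def)
      qed
      then have "(\<integral>t. F i (slice_point i t y) \<partial>lborel) = (\<integral>t. D i (slice_point i t y) * indicator {-S..0} t \<partial>lborel)"
        by simp
      also have "\<dots> = V (slice_point i 0 y) $ i"
        using S far(1)[of "-S" i y] by (subst FTC) auto
      finally show ?thesis .
    qed
    then show ?thesis using integral_slices[OF intF[of i], of i] by simp
  qed
  have "(\<Sum>k\<in>UNIV. F k x) = 0" for x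
    using div[of x] by (simp add: F_def D_def sum_distrib_left[symmetric])
  then have "(\<Sum>k\<in>UNIV. \<integral>x. F k x \<partial>lborel) = 0"
    using Bochner_Integration.integral_sum[of UNIV lborel F] intF by simp
  then have "(\<integral>x. F i x \<partial>lborel) + (\<Sum>k\<in>UNIV - {i}. \<integral>x. F k x \<partial>lborel) = 0"
    by (simp add: sum.remove[of UNIV i])
  then show ?thesis using other same by simp
qed

subsection \<open>Change of variables over an arbitrary finite index type\<close>

text \<open>The change of variables theorem of the library needs a well-ordered index type; every finite
  type has a well-ordered copy.\<close>

typedef 'a wo = "UNIV :: 'a set" by simp

lemma bij_Rep_wo: "bij Rep_wo"
  by (rule bijI', rule Rep_wo_inject, rule exI, rule Abs_wo_inverse[OF UNIV_I, symmetric])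

instance wo :: (finite) finite
proof
  show "finite (UNIV :: 'a wo set)"
    by (rule finite_imageD[OF finite bij_is_inj[OF bij_Rep_wo]])
qed

definition wo_index :: "'a::finite wo \<Rightarrow> nat" where
  "wo_index = (SOME f. inj f)"

lemma inj_wo_index: "inj (wo_index :: 'a::finite wo \<Rightarrow> nat)"
proof -
  have "\<exists>f :: 'a wo \<Rightarrow> nat. inj f"
    using finite_imp_inj_to_nat_seg[OF finite[of "UNIV :: 'a wo set"]] by (elim exE conjE) (rule exI)
  then show ?thesis unfolding wo_index_def by (rule someI_ex)
qed

instantiation wo :: (finite) wellorder
begin

definition less_eq_wo :: "'a wo \<Rightarrow> 'a wo \<Rightarrow> bool" where
  "less_eq_wo x y \<longleftrightarrow> wo_index x \<le> wo_index y"

definition less_wo :: "'a wo \<Rightarrow> 'a wo \<Rightarrow> bool" where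
  "less_wo x y \<longleftrightarrow> wo_index x < wo_index y"

instance
proof
  fix P :: "'a wo \<Rightarrow> bool" and a
  assume step: "\<And>x. (\<And>y. y < x \<Longrightarrow> P y) \<Longrightarrow> P x"
  show "P a"
  proof (induction a rule: measure_induct_rule[where f = wo_index])
    case (less x)
    show ?case by (rule step) (use less in \<open>simp add: less_wo_def\<close>)
  qed
qed (auto simp: less_eq_wo_def less_wo_def inj_eq[OF inj_wo_index])

end

definition to_wo :: "real^'n::finite \<Rightarrow> real^'n wo" where
  "to_wo x = (\<chi> a. x $ Rep_wo a)"

definition of_wo :: "real^'n::finite wo \<Rightarrow> real^'n" where
  "of_wo x = (\<chi> i. x $ Abs_wo i)"

lemma of_to_wo [simp]: "of_wo (to_wo x) = x" and to_of_wo [simp]: "to_wo (of_wo z) = z"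
  by (simp_all add: of_wo_def to_wo_def vec_eq_iff Abs_wo_inverse Rep_wo_inverse)

lemma bounded_linear_wo: "bounded_linear to_wo" "bounded_linear of_wo"
  by (auto intro!: linear_conv_bounded_linear[THEN iffD1] linearI simp: to_wo_def of_wo_def vec_eq_iff)

lemma borel_measurable_wo: "to_wo \<in> borel \<rightarrow>\<^sub>M borel" "of_wo \<in> borel \<rightarrow>\<^sub>M borel"
  by (intro borel_measurable_continuous_onI bounded_linear.continuous_on[OF bounded_linear_wo(1)]
      bounded_linear.continuous_on[OF bounded_linear_wo(2)] continuous_on_id)+

lemma lborel_wo: "(lborel :: (real^'n::finite wo) measure) = distr lborel borel to_wo"
proof (rule lborel_eqI)
  fix l u :: "real^'n wo" assume le: "\<And>b. b \<in> Basis \<Longrightarrow> l \<bullet> b \<le> u \<bullet> b"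
  have le': "l $ a \<le> u $ a" for a
    using le[of "axis a 1"] by (simp add: Basis_vec_eq inner_axis)
  have "to_wo -` box l u = box (of_wo l) (of_wo u)"
  proof -
    have "(\<forall>a. l $ a < x $ Rep_wo a \<and> x $ Rep_wo a < u $ a) \<longleftrightarrow> (\<forall>i. l $ Abs_wo i < x $ i \<and> x $ i < u $ Abs_wo i)" for x :: "real^'n"
      by (metis Abs_wo_inverse Rep_wo_inverse UNIV_I)
    then show ?thesis by (auto simp: mem_box_cart to_wo_def of_wo_def)
  qed
  then have "emeasure (distr lborel borel to_wo) (box l u) = emeasure lborel (box (of_wo l) (of_wo u))"
    using emeasure_distr[of to_wo lborel borel "box l u"] borel_measurable_wo(1) by simp
  also have "\<dots> = (\<Prod>b\<in>Basis. (of_wo u - of_wo l) \<bullet> b)"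
    by (rule emeasure_lborel_box) (auto simp: Basis_vec_eq inner_axis of_wo_def le')
  also have "(\<Prod>b\<in>Basis. (of_wo u - of_wo l) \<bullet> b) = (\<Prod>b\<in>Basis. (u - l) \<bullet> b)"
    unfolding prod_Basis_vec
    by (rule prod.reindex_bij_witness[of _ Rep_wo Abs_wo]) (simp_all add: Rep_wo_inverse Abs_wo_inverse inner_axis of_wo_def)
  finally show "emeasure (distr lborel borel to_wo) (box l u) = (\<Prod>b\<in>Basis. (u - l) \<bullet> b)" .
qed simp

lemma integral_wo:
  fixes F :: "real^'n::finite wo \<Rightarrow> real"
  assumes F: "F \<in> borel_measurable borel"
  shows "(\<integral>z. F z \<partial>lborel) = (\<integral>x. F (to_wo x) \<partial>lborel)"
    and "integrable lborel F \<longleftrightarrow> integrable lborel (\<lambda>x. F (to_wo x))"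
  by (subst lborel_wo, rule integral_distr[OF _ F], use borel_measurable_wo in simp)
    (subst lborel_wo, rule integrable_distr_eq[OF _ F], use borel_measurable_wo in simp)

text \<open>Relabelling the indices conjugates the permutations in the Leibniz formula and preserves
  their signs.\<close>

lemma det_wo:
  fixes M :: "real^'n::finite^'n"
  shows "det (\<chi> a b. M $ Rep_wo a $ Rep_wo b) = det M"
proof -
  have AR: "Abs_wo (Rep_wo a) = a" "Rep_wo (Abs_wo i) = i" for a :: "'n wo" and i :: 'n
    by (simp_all add: Rep_wo_inverse Abs_wo_inverse)
  have bijs: "bij (Abs_wo :: 'n \<Rightarrow> 'n wo)" "bij (Rep_wo :: 'n wo \<Rightarrow> 'n)"
    by (rule bij_betw_byWitness[of _ Rep_wo]; simp add: AR) (rule bij_Rep_wo)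
  have sgn: "sign (Abs_wo \<circ> p \<circ> Rep_wo :: 'n wo \<Rightarrow> 'n wo) = sign p" if p: "p permutes UNIV" for p
  proof -
    have "inv_into UNIV (Abs_wo :: 'n \<Rightarrow> 'n wo) = Rep_wo"
      by (rule inv_equality) (simp_all add: AR)
    then have "map_permutation UNIV Abs_wo p = (Abs_wo \<circ> p \<circ> Rep_wo :: 'n wo \<Rightarrow> 'n wo)"
      using bij_is_surj[OF bijs(1)] by (simp add: map_permutation_def restrict_id_def fun_eq_iff)
    then show ?thesis
      using sign_map_permutation[OF bij_is_inj[OF bijs(1)] p finite] by simp
  qed
  have perm: "f permutes UNIV \<longleftrightarrow> bij f" for f :: "'b \<Rightarrow> 'b"
    by (rule iffI, rule permutes_bij, assumption, rule bij_imp_permutes) simp_all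
  show ?thesis
    unfolding det_def
  proof (rule sum.reindex_bij_witness[of _ "\<lambda>p. Abs_wo \<circ> p \<circ> Rep_wo" "\<lambda>q. Rep_wo \<circ> q \<circ> Abs_wo"])
    fix q :: "'n wo \<Rightarrow> 'n wo" assume q: "q \<in> {p. p permutes UNIV}"
    show "Abs_wo \<circ> (Rep_wo \<circ> q \<circ> Abs_wo) \<circ> Rep_wo = q" by (simp add: fun_eq_iff AR)
    then have s: "sign q = sign (Rep_wo \<circ> q \<circ> Abs_wo)"
      using sgn[of "Rep_wo \<circ> q \<circ> Abs_wo"] q bijs by (simp add: perm bij_comp)
    show "Rep_wo \<circ> q \<circ> Abs_wo \<in> {p. p permutes UNIV}" using q bijs by (simp add: perm bij_comp)
    have "(\<Prod>i\<in>UNIV. M $ i $ (Rep_wo \<circ> q \<circ> Abs_wo) i) = (\<Prod>a\<in>UNIV. (\<chi> a b. M $ Rep_wo a $ Rep_wo b) $ a $ q a)"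
      by (rule prod.reindex_bij_witness[of _ Rep_wo Abs_wo]) (simp_all add: AR)
    then show "of_int (sign (Rep_wo \<circ> q \<circ> Abs_wo)) * (\<Prod>i\<in>UNIV. M $ i $ (Rep_wo \<circ> q \<circ> Abs_wo) i)
        = of_int (sign q) * (\<Prod>a\<in>UNIV. (\<chi> a b. M $ Rep_wo a $ Rep_wo b) $ a $ q a)"
      by (simp add: s)
  next
    fix p :: "'n \<Rightarrow> 'n" assume p: "p \<in> {p. p permutes UNIV}"
    show "Rep_wo \<circ> (Abs_wo \<circ> p \<circ> Rep_wo) \<circ> Abs_wo = p" by (simp add: fun_eq_iff AR)
    show "Abs_wo \<circ> p \<circ> Rep_wo \<in> {p. p permutes UNIV}" using p bijs by (simp add: perm bij_comp)
  qed
qed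

lemma bounded_linear_vec_1: "bounded_linear (vec :: real \<Rightarrow> real^1)"
  by (auto intro!: linear_conv_bounded_linear[THEN iffD1] linearI simp: vec_eq_iff)

text \<open>All data are transported by \<open>to_wo\<close>. The hypothesis \<open>meas\<close>
  serves to bring integrability of the transformed integrand, first obtained for Lebesgue measure,
  back to \<open>lborel\<close>.\<close>

lemma change_of_variables:
  fixes g :: "real^'n::finite \<Rightarrow> real^'n" and f :: "real^'n \<Rightarrow> real"
  assumes S: "S \<in> sets borel" and der: "\<And>x. x \<in> S \<Longrightarrow> (g has_derivative g' x) (at x within S)"
    and inj: "inj_on g S"
    and f: "integrable lborel (\<lambda>z. indicator (g ` S) z * f z)"
    and meas: "(\<lambda>x. indicator S x * (\<bar>det (matrix (g' x))\<bar> * f (g x))) \<in> borel_measurable borel"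
  shows "(\<integral>x. indicator S x * (\<bar>det (matrix (g' x))\<bar> * f (g x)) \<partial>lborel) = (\<integral>z. indicator (g ` S) z * f z \<partial>lborel)"
proof -
  define T where "T = to_wo ` S"
  define G where "G z = to_wo (g (of_wo z))" for z
  define G' where "G' z v = to_wo (g' (of_wo z) (of_wo v))" for z v
  \<comment> \<open>Values in \<open>real^1\<close> match the vector-valued form of the change of
    variables theorem applied below.\<close>
  define f1 where "f1 z = (vec (f (of_wo z)) :: real^1)" for z
  have inT: "z \<in> T \<longleftrightarrow> of_wo z \<in> S" for z unfolding T_def by (metis image_iff of_to_wo to_of_wo)
  have T: "T \<in> sets borel"
  proof -
    have "T = of_wo -` S \<inter> space borel" using inT by auto
    then show ?thesis using measurable_sets[OF borel_measurable_wo(2) S] by simp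
  qed
  have GT: "z \<in> G ` T \<longleftrightarrow> of_wo z \<in> g ` S" for z
    unfolding G_def T_def by (auto simp: image_iff) (metis to_of_wo)+
  have derG: "(G has_derivative G' z) (at z within T)" if "z \<in> T" for z
  proof -
    have 1: "(of_wo has_derivative of_wo) (at z within T)"
      by (rule bounded_linear.has_derivative[OF bounded_linear_wo(2) has_derivative_ident])
    have im: "of_wo ` T = S" using inT by (auto simp: image_iff) (metis of_to_wo)
    have "(g has_derivative g' (of_wo z)) (at (of_wo z) within of_wo ` T)"
      unfolding im by (rule der) (use that inT in simp)
    from has_derivative_in_compose[OF 1 this]
    have "((\<lambda>z. g (of_wo z)) has_derivative (\<lambda>v. g' (of_wo z) (of_wo v))) (at z within T)" .
    from bounded_linear.has_derivative[OF bounded_linear_wo(1) this]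
    show ?thesis unfolding G_def[abs_def] G'_def[abs_def] .
  qed
  have injG: "inj_on G T"
    using inj inT unfolding G_def inj_on_def by (metis of_to_wo to_of_wo)
  have detG: "det (matrix (G' z)) = det (matrix (g' (of_wo z)))" for z
  proof -
    have ax: "of_wo (axis b 1) = axis (Rep_wo b) 1" for b :: "'n wo"
      by (simp add: of_wo_def vec_eq_iff axis_def) (metis Abs_wo_inverse Rep_wo_inverse UNIV_I)
    have "matrix (G' z) = (\<chi> a b. matrix (g' (of_wo z)) $ Rep_wo a $ Rep_wo b)"
      by (simp add: matrix_def G'_def to_wo_def ax vec_eq_iff)
    then show ?thesis by (simp add: det_wo)
  qed
  \<comment> \<open>Passage from \<open>lborel\<close> to its completion, which changes neither
    integrability nor integrals of Borel functions.\<close>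
  have conv: "set_integrable lebesgue A h" "(LINT x:A|lebesgue. h x) = (\<integral>x. F x \<partial>lborel)"
    if "integrable lborel F" "\<And>x. F x = indicator A x * h x" for A and h F :: "real^'n wo \<Rightarrow> real"
  proof -
    have "F = (\<lambda>x. indicator A x * h x)" using that(2) by auto
    then show "set_integrable lebesgue A h" "(LINT x:A|lebesgue. h x) = (\<integral>x. F x \<partial>lborel)"
      using that(1) unfolding set_integrable_def set_lebesgue_integral_def
      by (simp_all add: integrable_completion[of _ lborel] integral_completion borel_measurable_integrable)
  qed
  let ?F = "\<lambda>z. indicator (G ` T) z * f (of_wo z)"
  have Fto: "?F (to_wo x) = indicator (g ` S) x * f x" for x
    by (simp add: indicator_def GT)
  have mF: "?F \<in> borel_measurable borel"
  proof -
    have "(\<lambda>z. indicator (g ` S) (of_wo z) * f (of_wo z)) \<in> borel_measurable borel"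
      using measurable_compose[OF borel_measurable_wo(2), of "\<lambda>z. indicator (g ` S) z * f z" borel] f by auto
    then show ?thesis by (simp add: indicator_def GT)
  qed
  have iF: "integrable lborel ?F"
    unfolding integral_wo(2)[OF mF] Fto by (rule f)
  note F = conv[OF iF refl]
  have vec_f: "f1 absolutely_integrable_on (G ` T)"
    using absolutely_integrable_linear[OF F(1) bounded_linear_vec_1] by (simp add: f1_def[abs_def] o_def)
  have TL: "T \<in> sets lebesgue" using T by (simp add: sets_completionI_sets)
  have cov: "(\<lambda>x. \<bar>det (matrix (G' x))\<bar> *\<^sub>R f1 (G x)) absolutely_integrable_on T"
    "integral T (\<lambda>x. \<bar>det (matrix (G' x))\<bar> *\<^sub>R f1 (G x)) = integral (G ` T) f1"
    using has_absolute_integral_change_of_variables[OF TL derG injG, of f1 "integral (G ` T) f1"] vec_f by auto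
  have comp: "(\<lambda>x. \<bar>det (matrix (G' x))\<bar> *\<^sub>R f1 (G x)) = vec \<circ> (\<lambda>x. \<bar>det (matrix (G' x))\<bar> * f (of_wo (G x)))"
    by (simp add: f1_def vec_eq_iff fun_eq_iff)
  let ?h = "\<lambda>x. \<bar>det (matrix (G' x))\<bar> * f (of_wo (G x))"
  have h: "?h absolutely_integrable_on T"
    using absolutely_integrable_linear[OF cov(1) bounded_linear_vec_nth[of 1]]
    by (simp add: comp o_def f1_def)
  have vecI: "integral A (vec \<circ> k) = (vec (integral A k) :: real^1)" if "k integrable_on A"
    for A and k :: "real^'n wo \<Rightarrow> real"
    by (rule integral_linear[OF that bounded_linear_vec_1])
  have "(vec (integral T ?h) :: real^1) = vec (integral (G ` T) (\<lambda>z. f (of_wo z)))"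
    using cov(2) vecI[OF set_lebesgue_integral_eq_integral(1)[OF h]] vecI[OF set_lebesgue_integral_eq_integral(1)[OF F(1)]]
    unfolding comp by (simp add: f1_def[abs_def] o_def)
  then have eq: "integral T ?h = integral (G ` T) (\<lambda>z. f (of_wo z))" by (simp add: vec_eq_iff)
  let ?H = "\<lambda>z. indicator T z * ?h z"
  have Hto: "?H (to_wo x) = indicator S x * (\<bar>det (matrix (g' x))\<bar> * f (g x))" for x
    by (simp add: indicator_def inT detG G_def)
  have mH: "?H \<in> borel_measurable borel"
  proof -
    have "(\<lambda>z. indicator S (of_wo z) * (\<bar>det (matrix (g' (of_wo z)))\<bar> * f (g (of_wo z)))) \<in> borel_measurable borel"
      using measurable_compose[OF borel_measurable_wo(2) meas] .
    then show ?thesis by (simp add: indicator_def inT detG G_def)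
  qed
  have "integrable lborel ?H"
    using h mH unfolding set_integrable_def by (simp add: integrable_completion)
  note H = conv[OF this refl]
  have "(\<integral>x. indicator S x * (\<bar>det (matrix (g' x))\<bar> * f (g x)) \<partial>lborel) = (\<integral>z. ?H z \<partial>lborel)"
    unfolding integral_wo(1)[OF mH] Hto ..
  also have "\<dots> = integral T ?h"
    using H(2) set_lebesgue_integral_eq_integral(2)[OF h] by simp
  also have "\<dots> = (\<integral>z. ?F z \<partial>lborel)"
    using eq F(2) set_lebesgue_integral_eq_integral(2)[OF F(1)] by simp
  also have "\<dots> = (\<integral>z. indicator (g ` S) z * f z \<partial>lborel)"
    unfolding integral_wo(1)[OF mF] Fto ..
  finally show ?thesis .
qed

subsection \<open>Charts\<close>

lemma is_chart_facts:
  assumes c: "is_chart c"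
  shows "open (chart_dom c)" "open (chart_img c)"
    and "p \<in> chart_dom c \<Longrightarrow> chart_inv c (chart_map c p) = p"
    and "p \<in> chart_dom c \<Longrightarrow> chart_map c p \<in> chart_img c"
    and "x \<in> chart_img c \<Longrightarrow> chart_map c (chart_inv c x) = x"
    and "x \<in> chart_img c \<Longrightarrow> chart_inv c x \<in> chart_dom c"
    and "continuous_on (chart_dom c) (chart_map c)" "continuous_on (chart_img c) (chart_inv c)"
proof -
  have h: "homeomorphism (chart_dom c) (chart_img c) (chart_map c) (chart_inv c)"
    using c by (simp add: is_chart_def)
  show "open (chart_dom c)" "open (chart_img c)" using c by (simp_all add: is_chart_def)
  show "p \<in> chart_dom c \<Longrightarrow> chart_inv c (chart_map c p) = p" by (rule homeomorphism_apply1[OF h])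
  show "x \<in> chart_img c \<Longrightarrow> chart_map c (chart_inv c x) = x" by (rule homeomorphism_apply2[OF h])
  show "p \<in> chart_dom c \<Longrightarrow> chart_map c p \<in> chart_img c" by (simp add: chart_img_def)
  show "x \<in> chart_img c \<Longrightarrow> chart_inv c x \<in> chart_dom c" using homeomorphism_image2[OF h] by blast
  show "continuous_on (chart_dom c) (chart_map c)" "continuous_on (chart_img c) (chart_inv c)"
    using h by (simp_all add: homeomorphism_def)
qed

lemma chart_image_eq:
  assumes c: "is_chart c"
  shows "chart_map c ` (chart_dom c \<inter> A) = chart_inv c -` A \<inter> chart_img c"
proof (rule set_eqI, rule iffI)
  fix x assume "x \<in> chart_map c ` (chart_dom c \<inter> A)"
  then obtain p where "p \<in> chart_dom c" "p \<in> A" "x = chart_map c p" by blast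
  then show "x \<in> chart_inv c -` A \<inter> chart_img c" using is_chart_facts(3,4)[OF c] by simp
next
  fix x assume x: "x \<in> chart_inv c -` A \<inter> chart_img c"
  then have "x = chart_map c (chart_inv c x)" "chart_inv c x \<in> chart_dom c \<inter> A"
    using is_chart_facts(5,6)[OF c] by simp_all
  then show "x \<in> chart_map c ` (chart_dom c \<inter> A)" by (rule image_eqI)
qed

lemma open_chart_image:
  assumes c: "is_chart c" and A: "open A"
  shows "open (chart_map c ` (chart_dom c \<inter> A))"
  unfolding chart_image_eq[OF c]
  using continuous_on_open_vimage[OF is_chart_facts(2)[OF c], THEN iffD1, rule_format, OF is_chart_facts(8)[OF c] A] .

lemma open_chart_preimage:
  assumes c: "is_chart c" and A: "open A"
  shows "open {p \<in> chart_dom c. chart_map c p \<in> A}"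
proof -
  have "open (chart_map c -` A \<inter> chart_dom c)"
    using continuous_on_open_vimage[OF is_chart_facts(1)[OF c], THEN iffD1, rule_format, OF is_chart_facts(7)[OF c] A] .
  moreover have "chart_map c -` A \<inter> chart_dom c = {p \<in> chart_dom c. chart_map c p \<in> A}" by blast
  ultimately show ?thesis by simp
qed

text \<open>The curve of metrics lives on a smaller set \<open>W\<close>, while the charts in the
  statement belong to \<open>U\<close>. Restriction to \<open>W\<close> produces members of
  \<open>charts A W\<close>; the transition is the identity, so components do not change.\<close>

definition restrict_chart :: "('m, 'n::finite) chart \<Rightarrow> 'm set \<Rightarrow> ('m, 'n) chart" where
  "restrict_chart c W = Chart (chart_dom c \<inter> W) (chart_map c)"

lemma restrict_chart_simps [simp]:
  "chart_dom (restrict_chart c W) = chart_dom c \<inter> W" "chart_map (restrict_chart c W) = chart_map c"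
  by (simp_all add: restrict_chart_def)

lemma chart_img_restrict: "chart_img (restrict_chart c W) = chart_map c ` (chart_dom c \<inter> W)"
  by (simp add: chart_img_def)

lemma chart_inv_restrict:
  assumes c: "is_chart c" and x: "x \<in> chart_img (restrict_chart c W)"
  shows "chart_inv (restrict_chart c W) x = chart_inv c x"
proof -
  obtain p where p: "p \<in> chart_dom c \<inter> W" "x = chart_map c p"
    using x unfolding chart_img_restrict by blast
  have "inj_on (chart_map c) (chart_dom c \<inter> W)"
    by (rule inj_on_inverseI[of _ "chart_inv c"]) (use is_chart_facts(3)[OF c] in simp)
  then have "chart_inv (restrict_chart c W) x = p"
    unfolding chart_inv_def using p by simp
  then show ?thesis using p is_chart_facts(3)[OF c] by simp
qed

lemma is_chart_restrict:
  assumes c: "is_chart c" and W: "open W"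
  shows "is_chart (restrict_chart c W)"
proof -
  let ?r = "restrict_chart c W"
  have sub: "chart_img ?r \<subseteq> chart_img c" unfolding chart_img_restrict
    unfolding chart_img_def by (rule image_mono) simp
  have inv: "chart_inv ?r x \<in> chart_dom ?r \<and> chart_map c (chart_inv ?r x) = x" if x: "x \<in> chart_img ?r" for x
  proof -
    obtain p where p: "p \<in> chart_dom c \<inter> W" "x = chart_map c p"
      using x unfolding chart_img_restrict by blast
    then show ?thesis unfolding chart_inv_restrict[OF c x] using is_chart_facts(3)[OF c] by simp
  qed
  have "homeomorphism (chart_dom ?r) (chart_img ?r) (chart_map ?r) (chart_inv ?r)"
  proof (rule homeomorphismI)
    show "continuous_on (chart_dom ?r) (chart_map ?r)"
      using continuous_on_subset[OF is_chart_facts(7)[OF c]] by simp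
    have "continuous_on (chart_img ?r) (chart_inv c)"
      by (rule continuous_on_subset[OF is_chart_facts(8)[OF c] sub])
    then show "continuous_on (chart_img ?r) (chart_inv ?r)"
      using chart_inv_restrict[OF c] by (simp cong: continuous_on_cong)
    show "chart_map ?r ` chart_dom ?r \<subseteq> chart_img ?r" by (simp add: chart_img_def)
    show "chart_inv ?r ` chart_img ?r \<subseteq> chart_dom ?r" using inv by blast
    show "chart_inv ?r (chart_map ?r p) = p" if "p \<in> chart_dom ?r" for p
    proof -
      have "chart_map c p \<in> chart_img ?r" using that by (simp add: chart_img_restrict)
      from chart_inv_restrict[OF c this] show ?thesis using that is_chart_facts(3)[OF c] by simp
    qed
    show "chart_map ?r (chart_inv ?r x) = x" if "x \<in> chart_img ?r" for x using inv[OF that] by simp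
  qed
  moreover have "open (chart_img ?r)" unfolding chart_img_restrict by (rule open_chart_image[OF c W])
  ultimately show ?thesis using is_chart_facts(1)[OF c] W by (simp add: is_chart_def open_Int)
qed

lemma charts_is_chart: "c \<in> charts A U \<Longrightarrow> is_chart c"
  by (simp add: charts_def)

lemma charts_mono: "W \<subseteq> U \<Longrightarrow> charts A W \<subseteq> charts A U"
  unfolding charts_def by blast

lemma restrict_chart_in_charts:
  assumes c: "c \<in> charts A U" and W: "open W"
  shows "restrict_chart c W \<in> charts A W" "restrict_chart c W \<in> charts A U"
proof -
  let ?r = "restrict_chart c W"
  note ic = charts_is_chart[OF c]
  have "compatible ?r d" if d: "d \<in> A" for d
  proof -
    have cd: "smooth_on (chart_map c ` (chart_dom c \<inter> chart_dom d)) (chart_map d \<circ> chart_inv c)"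
      "smooth_on (chart_map d ` (chart_dom c \<inter> chart_dom d)) (chart_map c \<circ> chart_inv d)"
      using c d by (simp_all add: charts_def compatible_def)
    have sub: "chart_map c ` (chart_dom c \<inter> W \<inter> chart_dom d) \<subseteq> chart_map c ` (chart_dom c \<inter> chart_dom d)"
      "chart_map d ` (chart_dom c \<inter> W \<inter> chart_dom d) \<subseteq> chart_map d ` (chart_dom c \<inter> chart_dom d)"
      by blast+
    have "smooth_on (chart_map c ` (chart_dom c \<inter> W \<inter> chart_dom d)) (chart_map d \<circ> chart_inv ?r)"
    proof (rule smooth_on_cong)
      show "smooth_on (chart_map c ` (chart_dom c \<inter> W \<inter> chart_dom d)) (chart_map d \<circ> chart_inv c)"
        by (rule smooth_on_subset[OF cd(1) sub(1)])
      fix x assume "x \<in> chart_map c ` (chart_dom c \<inter> W \<inter> chart_dom d)"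
      then have "x \<in> chart_img ?r" unfolding chart_img_restrict by blast
      then show "(chart_map d \<circ> chart_inv c) x = (chart_map d \<circ> chart_inv ?r) x"
        by (simp add: chart_inv_restrict[OF ic])
    qed
    moreover have "smooth_on (chart_map d ` (chart_dom c \<inter> W \<inter> chart_dom d)) (chart_map c \<circ> chart_inv d)"
      by (rule smooth_on_subset[OF cd(2) sub(2)])
    ultimately show ?thesis by (simp add: compatible_def)
  qed
  then show "?r \<in> charts A W" "?r \<in> charts A U"
    using is_chart_restrict[OF ic W] c by (auto simp: charts_def)
qed

text \<open>Charts of the maximal atlas are by definition compatible only with those of
  \<open>A\<close>. Near each point the transition is therefore factored through a chart of
  \<open>A\<close>.\<close>

lemma smooth_transition:
  assumes c: "c \<in> charts A U" and d: "d \<in> charts A U" and A: "smooth_atlas A"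
  shows "smooth_on (chart_map c ` (chart_dom c \<inter> chart_dom d)) (\<lambda>x. chart_map d (chart_inv c x))"
proof (rule smooth_on_local)
  note ic = charts_is_chart[OF c] and id = charts_is_chart[OF d]
  fix x assume "x \<in> chart_map c ` (chart_dom c \<inter> chart_dom d)"
  then obtain p where p: "p \<in> chart_dom c" "p \<in> chart_dom d" "x = chart_map c p" by blast
  have "p \<in> manifold_space A" using c p(1) by (auto simp: charts_def)
  then obtain e where e: "e \<in> A" "p \<in> chart_dom e" by (auto simp: manifold_space_def)
  have ie: "is_chart e" using A e(1) by (simp add: smooth_atlas_def)
  let ?T = "chart_map c ` (chart_dom c \<inter> (chart_dom d \<inter> chart_dom e))"
  have "open ?T" by (rule open_chart_image[OF ic open_Int[OF is_chart_facts(1)[OF id] is_chart_facts(1)[OF ie]]])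
  moreover have "x \<in> ?T" using p e by blast
  moreover have "smooth_on ?T (\<lambda>x. chart_map d (chart_inv c x))"
  proof (rule smooth_on_cong)
    have "smooth_on (chart_map c ` (chart_dom c \<inter> chart_dom e)) (chart_map e \<circ> chart_inv c)"
      "smooth_on (chart_map e ` (chart_dom d \<inter> chart_dom e)) (chart_map d \<circ> chart_inv e)"
      using c d e(1) by (auto simp: charts_def compatible_def)
    moreover have "?T \<subseteq> chart_map c ` (chart_dom c \<inter> chart_dom e)" by blast
    ultimately have sm: "smooth_on ?T (chart_map e \<circ> chart_inv c)"
      "smooth_on (chart_map e ` (chart_dom d \<inter> chart_dom e)) (chart_map d \<circ> chart_inv e)"
      using smooth_on_subset by blast+
    have im: "(chart_map e \<circ> chart_inv c) ` ?T \<subseteq> chart_map e ` (chart_dom d \<inter> chart_dom e)"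
    proof (rule image_subsetI)
      fix y assume "y \<in> ?T"
      then obtain q where q: "q \<in> chart_dom c" "q \<in> chart_dom d" "q \<in> chart_dom e" "y = chart_map c q" by blast
      then have "(chart_map e \<circ> chart_inv c) y = chart_map e q" using is_chart_facts(3)[OF ic] by simp
      then show "(chart_map e \<circ> chart_inv c) y \<in> chart_map e ` (chart_dom d \<inter> chart_dom e)" using q by simp
    qed
    show "smooth_on ?T (\<lambda>x. (chart_map d \<circ> chart_inv e) ((chart_map e \<circ> chart_inv c) x))"
      by (rule smooth_on_compose[OF sm im])
    fix y assume "y \<in> ?T"
    then obtain q where q: "q \<in> chart_dom c" "q \<in> chart_dom d" "q \<in> chart_dom e" "y = chart_map c q" by blast
    then show "(chart_map d \<circ> chart_inv e) ((chart_map e \<circ> chart_inv c) y) = chart_map d (chart_inv c y)"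
      using is_chart_facts(3)[OF ic] is_chart_facts(3)[OF ie] by simp
  qed
  ultimately show "\<exists>T. open T \<and> x \<in> T \<and> smooth_on (chart_map c ` (chart_dom c \<inter> chart_dom d) \<inter> T) (\<lambda>x. chart_map d (chart_inv c x))"
    by (meson smooth_on_subset inf_le2)
qed

lemma transition_jacobian_mult:
  assumes c: "c \<in> charts A U" and d: "d \<in> charts A U" and A: "smooth_atlas A"
    and p: "p \<in> chart_dom c" "p \<in> chart_dom d"
  shows "transition_jacobian c d p *v u = dird u (\<lambda>x. chart_map d (chart_inv c x)) (chart_map c p)"
proof -
  let ?f = "\<lambda>x. chart_map d (chart_inv c x)"
  have "?f differentiable (at (chart_map c p))"
    by (rule smooth_on_differentiable[OF open_chart_image[OF charts_is_chart[OF c] is_chart_facts(1)[OF charts_is_chart[OF d]]]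
          smooth_transition[OF c d A]]) (use p in blast)
  from linear_dird[OF this] show ?thesis
    unfolding transition_jacobian_def jacobian_def o_def dird_def by (simp add: matrix_works linear_def)
qed

lemma transition_jacobian_restrict:
  assumes c: "c \<in> charts A U" and W: "open W" and p: "p \<in> chart_dom c \<inter> W"
  shows "transition_jacobian c (restrict_chart c W) p = mat 1"
proof -
  note ic = charts_is_chart[OF c]
  have "frechet_derivative (chart_map c \<circ> chart_inv c) (at (chart_map c p)) = frechet_derivative (\<lambda>x. x) (at (chart_map c p))"
    by (rule frechet_derivative_cong_open[OF is_chart_facts(2)[OF ic]])
      (use p is_chart_facts(4,5)[OF ic] in simp_all)
  also have "\<dots> = (\<lambda>v. v)" by (rule frechet_derivative_ident)
  finally show ?thesis
    unfolding transition_jacobian_def jacobian_def restrict_chart_simps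
    by (simp only:) (auto simp: matrix_def mat_def axis_def vec_eq_iff)
qed

section \<open>Components of tensors and vector fields in different charts\<close>

lemma tensor_transform:
  assumes T: "tensor_field A U T" and c: "c \<in> charts A U" and d: "d \<in> charts A U"
    and p: "p \<in> chart_dom c" "p \<in> chart_dom d"
  shows "bf (T c p) u v = bf (T d p) (transition_jacobian c d p *v u) (transition_jacobian c d p *v v)"
proof -
  have "T c p = transpose (transition_jacobian c d p) ** T d p ** transition_jacobian c d p"
    by (rule conjunct1[OF T[unfolded tensor_field_def], rule_format, OF c d IntI[OF p]])
  moreover have "u \<bullet> (transpose J *v z) = (J *v u) \<bullet> z" for J :: "real^'b^'b" and z
    by (metis dot_lmul_matrix transpose_transpose transpose_matrix_vector)
  ultimately show ?thesis
    unfolding bf_def by (simp only: matrix_vector_mul_assoc[symmetric])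
qed

lemma tensor_restrict:
  assumes T: "tensor_field A U T" and c: "c \<in> charts A U" and W: "open W" and p: "p \<in> chart_dom c \<inter> W"
  shows "T (restrict_chart c W) p = T c p"
proof -
  have "T c p = transpose (transition_jacobian c (restrict_chart c W) p) ** T (restrict_chart c W) p
      ** transition_jacobian c (restrict_chart c W) p"
    using p by (intro conjunct1[OF T[unfolded tensor_field_def], rule_format, OF c restrict_chart_in_charts(2)[OF c W]]) simp
  then show ?thesis unfolding transition_jacobian_restrict[OF c W p] by simp
qed

lemma vector_transform:
  "vector_field_along A U S X \<Longrightarrow> c \<in> charts A U \<Longrightarrow> d \<in> charts A U \<Longrightarrow> p \<in> chart_dom c \<Longrightarrow>
    p \<in> chart_dom d \<Longrightarrow> p \<in> S \<Longrightarrow> X d p = transition_jacobian c d p *v X c p"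
  unfolding vector_field_along_def by (elim conjE) (drule bspec, assumption, drule bspec, assumption, drule bspec, simp_all)

lemma vector_restrict:
  assumes X: "vector_field_along A U S X" and c: "c \<in> charts A U" and W: "open W" and p: "p \<in> chart_dom c \<inter> W" "p \<in> S"
  shows "X (restrict_chart c W) p = X c p"
  using vector_transform[OF X c restrict_chart_in_charts(2)[OF c W], of p] p
  unfolding transition_jacobian_restrict[OF c W p(1)] by simp

text \<open>All matrices on the segment from the identity to \<open>M\<close> are nonsingular, since
  their quadratic forms are positive; the determinant starts at 1 and cannot change sign.\<close>

lemma posdef_det_pos:
  fixes M :: "real^'n::finite^'n"
  assumes pos: "\<And>v. v \<noteq> 0 \<Longrightarrow> v \<bullet> (M *v v) > 0"
  shows "det M > 0"
proof -
  let ?N = "\<lambda>t::real. (1 - t) *\<^sub>R mat 1 + t *\<^sub>R M"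
  have nz: "det (?N t) \<noteq> 0" if t: "0 \<le> t" "t \<le> 1" for t
  proof
    assume "det (?N t) = 0"
    then have "\<not> invertible (?N t)" using invertible_det_nz by blast
    then obtain v where v: "v \<noteq> 0" "?N t *v v = 0"
      using invertible_left_inverse matrix_left_invertible_ker by blast
    have "v \<bullet> (?N t *v v) = (1 - t) * (v \<bullet> v) + t * (v \<bullet> (M *v v))"
      by (simp add: matrix_vector_mult_add_rdistrib scaleR_matrix_vector_assoc[symmetric] inner_add_right)
    moreover have "v \<bullet> v > 0" using v(1) by simp
    ultimately show False
      using v t pos[OF v(1)] by (smt (verit) inner_zero_right mult_nonneg_nonneg mult_pos_pos)
  qed
  have "continuous_on {0..1} (\<lambda>t. det (?N t))"
    by (rule smooth_on_continuous_on) (intro smooth_intros)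
  show ?thesis
  proof (rule ccontr)
    assume "\<not> det M > 0"
    then have "det (?N 1) \<le> 0" "0 \<le> det (?N 0)" by simp_all
    from IVT2'[OF this _ \<open>continuous_on {0..1} (\<lambda>t. det (?N t))\<close>] nz show False by force
  qed
qed

lemma riemannian_metric_chart:
  assumes g: "riemannian_metric A U g" and c: "c \<in> charts A U"
  shows "metric_chart (chart_img c) (\<lambda>x. g c (chart_inv c x))"
    and "x \<in> chart_img c \<Longrightarrow> det (g c (chart_inv c x)) > 0"
proof -
  note ic = charts_is_chart[OF c]
  have pos: "det (g c p) > 0" "transpose (g c p) = g c p" if "p \<in> chart_dom c" for p
    using g c that posdef_det_pos[of "g c p"] by (simp_all add: riemannian_metric_def)
  show "det (g c (chart_inv c x)) > 0" if "x \<in> chart_img c"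
    by (rule pos(1)[OF is_chart_facts(6)[OF ic that]])
  show "metric_chart (chart_img c) (\<lambda>x. g c (chart_inv c x))"
  proof
    show "open (chart_img c)" by (rule is_chart_facts(2)[OF ic])
    show "smooth_on (chart_img c) (\<lambda>x. g c (chart_inv c x))"
      using g c by (simp add: riemannian_metric_def tensor_field_def)
    fix x assume "x \<in> chart_img c"
    then have "chart_inv c x \<in> chart_dom c" by (rule is_chart_facts(6)[OF ic])
    from pos[OF this] show "transpose (g c (chart_inv c x)) = g c (chart_inv c x)" "det (g c (chart_inv c x)) \<noteq> 0"
      by simp_all
  qed
qed

subsection \<open>Bump functions\<close>

text \<open>The powers of \<open>inverse t\<close> make the family closed under differentiation up
  to linear combinations. Smoothness of the standard flat function, the case \<open>m = 0\<close>,
  then follows by an induction on the order for all \<open>m\<close> at once.\<close>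

definition flat_exp :: "nat \<Rightarrow> real \<Rightarrow> real" where
  "flat_exp m t = (if t > 0 then exp (- inverse t) * inverse t ^ m else 0)"

lemma flat_exp_tendsto: "(flat_exp m \<longlongrightarrow> 0) (at 0)"
proof -
  have "((\<lambda>x. x ^ m / exp x) \<longlongrightarrow> 0) (at_top :: real filter)" by (rule tendsto_power_div_exp_0)
  then have "((\<lambda>t. inverse t ^ m / exp (inverse t)) \<longlongrightarrow> 0) (at_right (0::real))"
    by (rule filterlim_compose[OF _ filterlim_inverse_at_top_right])
  moreover have "\<forall>\<^sub>F t in at_right (0::real). inverse t ^ m / exp (inverse t) = flat_exp m t"
    unfolding eventually_at_right_field
    by (rule exI[of _ 1]) (simp add: flat_exp_def exp_minus divide_inverse mult.commute)
  ultimately have "(flat_exp m \<longlongrightarrow> 0) (at_right 0)" by (rule Lim_transform_eventually)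
  moreover have "(flat_exp m \<longlongrightarrow> 0) (at_left 0)"
  proof (rule Lim_transform_eventually[OF tendsto_const])
    show "\<forall>\<^sub>F t in at_left (0::real). 0 = flat_exp m t"
      unfolding eventually_at_left_field by (rule exI[of _ "-1"]) (simp add: flat_exp_def)
  qed
  ultimately show ?thesis by (simp add: filterlim_split_at_real)
qed

lemma flat_exp_derivative:
  "(flat_exp m has_real_derivative flat_exp (m + 2) t - real m * flat_exp (m + 1) t) (at t)"
proof -
  consider "t > 0" | "t < 0" | "t = 0" by linarith
  then show ?thesis
  proof cases
    case 1
    have inv: "(inverse has_real_derivative - (inverse t ^ 2)) (at t)"
      using DERIV_inverse[of t UNIV] 1 by (simp add: numeral_2_eq_2)
    have pw: "((\<lambda>t. inverse t ^ m) has_real_derivative - real m * inverse t ^ (m + 1)) (at t)" for m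
    proof (induction m)
      case (Suc m)
      have "((\<lambda>t. inverse t * inverse t ^ m) has_real_derivative
          - (inverse t ^ 2) * inverse t ^ m + (- real m * inverse t ^ (m + 1)) * inverse t) (at t)"
        by (rule DERIV_mult[OF inv Suc.IH])
      also have "- (inverse t ^ 2) * inverse t ^ m + (- real m * inverse t ^ (m + 1)) * inverse t
          = - real (Suc m) * inverse t ^ (Suc m + 1)"
        by (simp add: power2_eq_square algebra_simps)
      finally show ?case by simp
    qed simp
    have "((\<lambda>t. exp (- inverse t)) has_real_derivative exp (- inverse t) * (inverse t ^ 2)) (at t)"
      using DERIV_fun_exp[OF DERIV_minus[OF inv]] by simp
    from DERIV_mult[OF this pw[of m]]
    have "((\<lambda>t. exp (- inverse t) * inverse t ^ m) has_real_derivative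
        exp (- inverse t) * inverse t ^ (m + 2) - real m * (exp (- inverse t) * inverse t ^ (m + 1))) (at t)"
      by (simp add: power2_eq_square mult_ac)
    then have "((\<lambda>t. exp (- inverse t) * inverse t ^ m) has_real_derivative
        flat_exp (m + 2) t - real m * flat_exp (m + 1) t) (at t)"
      using 1 by (simp add: flat_exp_def)
    then show ?thesis
      by (rule has_field_derivative_transform_within_open[of _ _ _ "{0<..}"]) (use 1 in \<open>simp_all add: flat_exp_def\<close>)
  next
    case 2
    have "((\<lambda>t. 0) has_real_derivative flat_exp (m + 2) t - real m * flat_exp (m + 1) t) (at t)"
      using 2 by (simp add: flat_exp_def)
    then show ?thesis
      by (rule has_field_derivative_transform_within_open[of _ _ _ "{..<0}"]) (use 2 in \<open>simp_all add: flat_exp_def\<close>)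
  next
    case 3
    \<comment> \<open>At 0 the difference quotient of \<open>flat_exp m\<close> is
      \<open>flat_exp (m + 1)\<close>, which tends to 0.\<close>
    have "((\<lambda>h. (flat_exp m (0 + h) - flat_exp m 0) / h) \<longlongrightarrow> 0) (at 0)"
    proof (rule Lim_transform_eventually[OF flat_exp_tendsto[of "m + 1"]])
      show "\<forall>\<^sub>F h in at 0. flat_exp (m + 1) h = (flat_exp m (0 + h) - flat_exp m 0) / h"
        by (rule always_eventually) (simp add: flat_exp_def divide_inverse)
    qed
    then show ?thesis unfolding 3 DERIV_def by (simp add: flat_exp_def)
  qed
qed

lemma smooth_flat_exp: "smooth_on UNIV (flat_exp m)"
proof -
  have "Ck_on k UNIV (flat_exp m)" for k
  proof (induction k arbitrary: m)
    case 0
    show ?case unfolding Ck_on.simps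
      by (intro continuous_at_imp_continuous_on ballI DERIV_isCont[OF flat_exp_derivative])
  next
    case (Suc k)
    have "Ck_on k UNIV (\<lambda>t. v * (flat_exp (m + 2) t + (- real m) * flat_exp (m + 1) t))" for v
      by (intro Ck_on_bilinear[OF bounded_bilinear_mult open_UNIV] Ck_on_add[OF open_UNIV] Ck_on_const Suc.IH)
    moreover have "(flat_exp m has_derivative (\<lambda>v. v * (flat_exp (m + 2) t + (- real m) * flat_exp (m + 1) t))) (at t)" for t
      by (rule has_derivative_eq_rhs[OF flat_exp_derivative[unfolded has_field_derivative_def] ext])
        (simp add: algebra_simps)
    ultimately show ?case by (intro Ck_on_SucI[OF open_UNIV])
  qed
  then show ?thesis by (simp add: smooth_on_open_iff)
qed

definition smooth_step :: "real \<Rightarrow> real" where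
  "smooth_step t = flat_exp 0 t / (flat_exp 0 t + flat_exp 0 (1 - t))"

lemma flat_exp_0: "flat_exp 0 t \<ge> 0" "t > 0 \<Longrightarrow> flat_exp 0 t > 0" "t \<le> 0 \<Longrightarrow> flat_exp 0 t = 0"
  by (simp_all add: flat_exp_def)

lemma smooth_step_denominator: "flat_exp 0 t + flat_exp 0 (1 - t) > 0"
  using flat_exp_0[of t] flat_exp_0[of "1 - t"] by (cases "t > 0") (simp_all add: add_pos_nonneg add_nonneg_pos)

lemma smooth_smooth_step: "smooth_on UNIV smooth_step"
proof -
  have "smooth_on UNIV (\<lambda>t. flat_exp 0 (1 - t))"
    by (rule smooth_on_compose[OF _ smooth_flat_exp]) (intro smooth_intros, simp)
  then have "smooth_on UNIV (\<lambda>t. flat_exp 0 t / (flat_exp 0 t + flat_exp 0 (1 - t)))"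
    by (intro smooth_on_divide smooth_on_add smooth_flat_exp) (assumption, rule less_imp_neq[OF smooth_step_denominator, symmetric])
  then show ?thesis by (simp add: smooth_step_def[abs_def])
qed

lemma smooth_step_values:
  "0 \<le> smooth_step t" "smooth_step t \<le> 1" "t \<le> 0 \<Longrightarrow> smooth_step t = 0" "t \<ge> 1 \<Longrightarrow> smooth_step t = 1"
  using flat_exp_0(1)[of t] flat_exp_0(1)[of "1 - t"] smooth_step_denominator[of t]
    flat_exp_0(3)[of t] flat_exp_0(3)[of "1 - t"]
  by (auto simp: smooth_step_def)

text \<open>The argument of \<open>smooth_step\<close> is 1 at distance \<open>r / 2\<close> from
  \<open>a\<close> and 0 at distance \<open>r / sqrt 2\<close>, which is less than
  \<open>3 / 4 * r\<close>. The squared distance keeps the function smooth at the centre.\<close>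

definition bump :: "'a::real_inner \<Rightarrow> real \<Rightarrow> 'a \<Rightarrow> real" where
  "bump a r x = smooth_step (2 - 4 * ((x - a) \<bullet> (x - a)) / r\<^sup>2)"

lemma smooth_bump: "r > 0 \<Longrightarrow> smooth_on UNIV (bump a r)"
  unfolding bump_def[abs_def]
  by (rule smooth_on_compose[OF _ smooth_smooth_step]) (intro smooth_intros, simp_all)

lemma bump_values:
  assumes r: "r > 0"
  shows "0 \<le> bump a r x" "bump a r x \<le> 1" "dist a x < r / 2 \<Longrightarrow> bump a r x = 1"
    "3 / 4 * r < dist a x \<Longrightarrow> bump a r x = 0"
proof -
  have d: "(x - a) \<bullet> (x - a) = (dist a x)\<^sup>2"
    by (simp add: dist_norm norm_minus_commute power2_norm_eq_inner[symmetric])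
  show "0 \<le> bump a r x" "bump a r x \<le> 1" by (simp_all add: bump_def smooth_step_values)
  show "bump a r x = 1" if "dist a x < r / 2"
  proof -
    have "(dist a x)\<^sup>2 \<le> (r / 2)\<^sup>2" using that r by (intro power_mono) auto
    then show ?thesis unfolding bump_def d using r
      by (intro smooth_step_values(4)) (simp add: field_simps power2_eq_square)
  qed
  show "bump a r x = 0" if "3 / 4 * r < dist a x"
  proof -
    have "(3 / 4 * r)\<^sup>2 \<le> (dist a x)\<^sup>2" using that r by (intro power_mono) auto
    moreover have "r\<^sup>2 / 2 \<le> (3 / 4 * r)\<^sup>2" by (simp add: power2_eq_square)
    ultimately have "r\<^sup>2 / 2 \<le> (dist a x)\<^sup>2" by linarith
    then show ?thesis unfolding bump_def d using r
      by (intro smooth_step_values(3)) (simp add: field_simps)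
  qed
qed

subsection \<open>Partitions of unity near a hypersurface\<close>

definition smooth_function ::
    "('m::topological_space, 'n::finite) chart set \<Rightarrow> 'm set \<Rightarrow> ('m \<Rightarrow> real) \<Rightarrow> bool" where
  "smooth_function A U f \<longleftrightarrow> (\<forall>d\<in>charts A U. smooth_on (chart_img d) (\<lambda>x. f (chart_inv d x)))"

definition chart_bump :: "('m, 'n::finite) chart \<Rightarrow> real^'n \<Rightarrow> real \<Rightarrow> 'm \<Rightarrow> real" where
  "chart_bump c a r p = (if p \<in> chart_dom c then bump a r (chart_map c p) else 0)"

text \<open>The factor is that of \<open>bump_values\<close>: it gives a closed ball strictly inside
  that of radius \<open>r\<close> which still contains the support of the bump function.\<close>

definition chart_cball :: "('m, 'n::finite) chart \<Rightarrow> real^'n \<Rightarrow> real \<Rightarrow> 'm set" where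
  "chart_cball c a r = chart_inv c ` cball a (3 / 4 * r)"

lemma chart_cball:
  fixes c :: "('m::t2_space, 'n::finite) chart"
  assumes c: "is_chart c" and r: "r > 0" and sub: "cball a (3 / 4 * r) \<subseteq> chart_img c"
  shows "compact (chart_cball c a r)" "chart_cball c a r \<subseteq> chart_dom c"
    and "p \<notin> chart_cball c a r \<Longrightarrow> chart_bump c a r p = 0"
proof -
  show "compact (chart_cball c a r)" unfolding chart_cball_def
    by (rule compact_continuous_image[OF continuous_on_subset[OF is_chart_facts(8)[OF c] sub] compact_cball])
  show "chart_cball c a r \<subseteq> chart_dom c"
    unfolding chart_cball_def using is_chart_facts(6)[OF c] sub by blast
  assume p: "p \<notin> chart_cball c a r"
  show "chart_bump c a r p = 0"
  proof (cases "p \<in> chart_dom c")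
    case True
    have "chart_map c p \<notin> cball a (3 / 4 * r)"
    proof
      assume "chart_map c p \<in> cball a (3 / 4 * r)"
      then have "chart_inv c (chart_map c p) \<in> chart_cball c a r" unfolding chart_cball_def by (rule imageI)
      then show False using p is_chart_facts(3)[OF c True] by simp
    qed
    then have "3 / 4 * r < dist a (chart_map c p)" unfolding mem_cball not_le .
    from bump_values(4)[OF r this] show ?thesis by (simp add: chart_bump_def)
  qed (simp add: chart_bump_def)
qed

lemma chart_bump_bounds: "r > 0 \<Longrightarrow> 0 \<le> chart_bump c a r p" "r > 0 \<Longrightarrow> chart_bump c a r p \<le> 1"
  using bump_values(1,2)[of r a] by (simp_all add: chart_bump_def)

text \<open>The set \<open>chart_cball c a r\<close> is compact, hence closed in a Hausdorff space.
  A point outside the chart therefore has a neighbourhood on which the bump function vanishes, so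
  continuation by 0 is smooth.\<close>

lemma smooth_chart_bump:
  fixes c :: "('m::{t2_space, second_countable_topology}, 'n::finite) chart"
  assumes A: "smooth_atlas A" and c: "c \<in> charts A U" and r: "r > 0" and sub: "cball a (3 / 4 * r) \<subseteq> chart_img c"
  shows "smooth_function A U (chart_bump c a r)"
  unfolding smooth_function_def
proof (intro ballI smooth_on_local)
  fix d x assume d: "d \<in> charts A U" and x: "x \<in> chart_img d"
  note ic = charts_is_chart[OF c] and id = charts_is_chart[OF d]
  let ?p = "chart_inv d x"
  have p: "?p \<in> chart_dom d" "chart_map d ?p = x" using is_chart_facts(5,6)[OF id x] by simp_all
  let ?P = "\<lambda>T. open T \<and> x \<in> T \<and> smooth_on (chart_img d \<inter> T) (\<lambda>x. chart_bump c a r (chart_inv d x))"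
  show "\<exists>T. ?P T"
  proof (cases "?p \<in> chart_dom c")
    case True
    let ?T = "chart_map d ` (chart_dom d \<inter> chart_dom c)"
    have xT: "x \<in> ?T" by (rule image_eqI[of _ _ ?p]) (use p True in simp_all)
    have sm: "smooth_on ?T (\<lambda>x. bump a r (chart_map c (chart_inv d x)))"
      by (rule smooth_on_compose[OF smooth_transition[OF d c A] smooth_bump[OF r] subset_UNIV])
    have eq: "bump a r (chart_map c (chart_inv d y)) = chart_bump c a r (chart_inv d y)" if y: "y \<in> ?T" for y
    proof -
      obtain q where "q \<in> chart_dom d" "q \<in> chart_dom c" "y = chart_map d q" using y by blast
      then show ?thesis using is_chart_facts(3)[OF id] by (simp add: chart_bump_def)
    qed
    have "smooth_on ?T (\<lambda>x. chart_bump c a r (chart_inv d x))"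
      by (rule smooth_on_cong[OF eq sm])
    then have "smooth_on (chart_img d \<inter> ?T) (\<lambda>x. chart_bump c a r (chart_inv d x))"
      by (rule smooth_on_subset) simp
    then show ?thesis
      by (intro exI[of _ ?T] conjI open_chart_image[OF id is_chart_facts(1)[OF ic]] xT)
  next
    case False
    note K = chart_cball[OF ic r sub]
    let ?T = "chart_map d ` (chart_dom d \<inter> - chart_cball c a r)"
    have xT: "x \<in> ?T" by (rule image_eqI[of _ _ ?p]) (use p False K(2) in auto)
    have eq: "0 = chart_bump c a r (chart_inv d y)" if y: "y \<in> ?T" for y
    proof -
      obtain q where "q \<in> chart_dom d" "q \<notin> chart_cball c a r" "y = chart_map d q" using y by blast
      then show ?thesis using is_chart_facts(3)[OF id] K(3) by simp
    qed
    have "smooth_on ?T (\<lambda>x. chart_bump c a r (chart_inv d x))"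
      by (rule smooth_on_cong[OF eq smooth_on_const])
    then have "smooth_on (chart_img d \<inter> ?T) (\<lambda>x. chart_bump c a r (chart_inv d x))"
      by (rule smooth_on_subset) simp
    then show ?thesis
      by (intro exI[of _ ?T] conjI open_chart_image[OF id open_Compl[OF compact_imp_closed[OF K(1)]]] xT)
  qed
qed

text \<open>A construction without a normalizing division: the partial sums telescope to 1 minus a
  product, and this product vanishes wherever one of its functions \<open>\<beta> b\<close> equals
  1.\<close>

definition partition_function :: "(nat \<Rightarrow> 'm \<Rightarrow> real) \<Rightarrow> nat \<Rightarrow> 'm \<Rightarrow> real" where
  "partition_function \<beta> a p = \<beta> a p * (\<Prod>b<a. 1 - \<beta> b p)"

lemma sum_partition_function: "(\<Sum>a<m. partition_function \<beta> a p) = 1 - (\<Prod>b<m. 1 - \<beta> b p)"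
  by (induction m) (simp_all add: partition_function_def algebra_simps)

lemma smooth_partition_function:
  "(\<And>b. b \<le> a \<Longrightarrow> smooth_function A U (\<beta> b)) \<Longrightarrow> smooth_function A U (partition_function \<beta> a)"
  unfolding smooth_function_def partition_function_def
  by (intro ballI smooth_on_mult smooth_on_prod smooth_on_diff smooth_on_const) simp_all

text \<open>Restriction to a coordinate ball centred at a point of the hypersurface. The slice is
  then a disc, hence connected, and smaller concentric closed balls can carry supports.\<close>

lemma slice_ball_chart:
  fixes A :: "('m::{t2_space, second_countable_topology}, 'n::finite) chart set"
  assumes S: "slice_chart A U S c i" and p: "p \<in> chart_dom c" "p \<in> S" and W: "open W" "S \<subseteq> W"
  shows "\<exists>e r. r > 0 \<and> e \<in> charts A W \<and> slice_chart A U S e i \<and> p \<in> chart_dom e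
    \<and> chart_img e = ball (chart_map e p) r \<and> chart_map e p $ i = 0"
proof -
  have c: "c \<in> charts A U" and sl: "chart_map c ` (chart_dom c \<inter> S) = {x \<in> chart_img c. x $ i = 0}"
    using S by (simp_all add: slice_chart_def)
  note ic = charts_is_chart[OF c]
  let ?x = "chart_map c p"
  have "open (chart_map c ` (chart_dom c \<inter> W))" by (rule open_chart_image[OF ic W(1)])
  moreover have "?x \<in> chart_map c ` (chart_dom c \<inter> W)" using p W(2) by blast
  ultimately obtain r where r: "r > 0" "ball ?x r \<subseteq> chart_map c ` (chart_dom c \<inter> W)"
    using open_contains_ball by blast
  define N where "N = {q \<in> chart_dom c. chart_map c q \<in> ball ?x r}"
  have N: "open N" unfolding N_def by (rule open_chart_preimage[OF ic open_ball])
  let ?e = "restrict_chart c N"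
  have img: "chart_map c ` (chart_dom c \<inter> N) = ball ?x r"
  proof
    show "chart_map c ` (chart_dom c \<inter> N) \<subseteq> ball ?x r" by (auto simp: N_def)
    show "ball ?x r \<subseteq> chart_map c ` (chart_dom c \<inter> N)"
    proof
      fix y assume y: "y \<in> ball ?x r"
      then obtain q where "q \<in> chart_dom c" "y = chart_map c q" using r(2) by blast
      then show "y \<in> chart_map c ` (chart_dom c \<inter> N)" using y by (auto simp: N_def)
    qed
  qed
  have NW: "chart_dom c \<inter> N \<subseteq> W"
  proof
    fix q assume q: "q \<in> chart_dom c \<inter> N"
    then have "chart_map c q \<in> chart_map c ` (chart_dom c \<inter> W)" using r(2) by (auto simp: N_def)
    then obtain q' where "q' \<in> chart_dom c" "q' \<in> W" "chart_map c q = chart_map c q'" by blast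
    then show "q \<in> W" using is_chart_facts(3)[OF ic] q by (metis IntD1)
  qed
  have e: "?e \<in> charts A U" by (rule restrict_chart_in_charts(2)[OF c N])
  then have "?e \<in> charts A W" using NW by (auto simp: charts_def)
  moreover have "slice_chart A U S ?e i"
  proof -
    have "chart_map c ` (chart_dom c \<inter> N \<inter> S) = {x \<in> chart_map c ` (chart_dom c \<inter> N). x $ i = 0}"
    proof (rule set_eqI, rule iffI)
      fix y assume "y \<in> chart_map c ` (chart_dom c \<inter> N \<inter> S)"
      then obtain q where q: "q \<in> chart_dom c" "q \<in> N" "q \<in> S" "y = chart_map c q" by blast
      then have "y \<in> chart_map c ` (chart_dom c \<inter> S)" by blast
      then have "y $ i = 0" unfolding sl by simp
      then show "y \<in> {x \<in> chart_map c ` (chart_dom c \<inter> N). x $ i = 0}" using q by blast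
    next
      fix y assume "y \<in> {x \<in> chart_map c ` (chart_dom c \<inter> N). x $ i = 0}"
      then obtain q where q: "q \<in> chart_dom c" "q \<in> N" "y = chart_map c q" "y $ i = 0" by blast
      then have "y \<in> {x \<in> chart_img c. x $ i = 0}" by (simp add: chart_img_def)
      then obtain q' where q': "q' \<in> chart_dom c" "q' \<in> S" "y = chart_map c q'" unfolding sl[symmetric] by blast
      have "q = q'" using is_chart_facts(3)[OF ic q(1)] is_chart_facts(3)[OF ic q'(1)] q(3) q'(3) by simp
      then show "y \<in> chart_map c ` (chart_dom c \<inter> N \<inter> S)" using q q' by blast
    qed
    then show ?thesis using e by (simp add: slice_chart_def chart_img_restrict)
  qed
  moreover have "p \<in> chart_dom ?e" using p(1) r(1) by (simp add: N_def)
  moreover have "chart_img ?e = ball (chart_map ?e p) r" by (simp add: chart_img_restrict img)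
  moreover have "chart_map ?e p $ i = 0"
  proof -
    have "?x \<in> chart_map c ` (chart_dom c \<inter> S)" using p by blast
    then show ?thesis unfolding sl by simp
  qed
  ultimately show ?thesis using r(1) by blast
qed

text \<open>The functions add up to 1 on an open neighbourhood \<open>N\<close> of \<open>S\<close>,
  not just on \<open>S\<close>: the linearized Ricci tensor differentiates the cut-off tensors
  twice, also transversally to \<open>S\<close>.\<close>

definition slice_cover ::
    "('m::topological_space, 'n::finite) chart set \<Rightarrow> 'm set \<Rightarrow> 'm set \<Rightarrow> 'm set \<Rightarrow> nat \<Rightarrow>
     (nat \<Rightarrow> ('m, 'n) chart) \<Rightarrow> (nat \<Rightarrow> 'n) \<Rightarrow> (nat \<Rightarrow> real^'n) \<Rightarrow> (nat \<Rightarrow> real) \<Rightarrow>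
     (nat \<Rightarrow> 'm \<Rightarrow> real) \<Rightarrow> 'm set \<Rightarrow> bool" where
  "slice_cover A U S W m e i x r \<phi> N \<longleftrightarrow>
     (\<forall>a<m. r a > 0 \<and> e a \<in> charts A W \<and> slice_chart A U S (e a) (i a) \<and>
        chart_img (e a) = ball (x a) (r a) \<and> x a $ i a = 0 \<and>
        smooth_function A U (\<phi> a) \<and> (\<forall>p. 0 \<le> \<phi> a p) \<and>
        (\<forall>p. p \<notin> chart_cball (e a) (x a) (r a) \<longrightarrow> \<phi> a p = 0)) \<and>
     open N \<and> S \<subseteq> N \<and> (\<forall>p\<in>N. (\<Sum>a<m. \<phi> a p) = 1)"

lemma slice_cover_exists:
  fixes A :: "('m::{t2_space, second_countable_topology}, 'n::finite) chart set"
  assumes A: "smooth_atlas A" and S: "compact_hypersurface A U S" and W: "open W" "S \<subseteq> W"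
  shows "\<exists>m e i x r \<phi> N. slice_cover A U S W m e i x r \<phi> N"
proof -
  have "\<exists>e i r. r > 0 \<and> e \<in> charts A W \<and> slice_chart A U S e i \<and> p \<in> chart_dom e
      \<and> chart_img e = ball (chart_map e p) r \<and> chart_map e p $ i = 0" if p: "p \<in> S" for p
  proof -
    obtain c i where "slice_chart A U S c i" "p \<in> chart_dom c"
      using S p by (auto simp: compact_hypersurface_def)
    from slice_ball_chart[OF this p W] show ?thesis by blast
  qed
  then obtain E I R where E: "\<And>p. p \<in> S \<Longrightarrow> R p > 0 \<and> E p \<in> charts A W \<and> slice_chart A U S (E p) (I p) \<and> p \<in> chart_dom (E p)
      \<and> chart_img (E p) = ball (chart_map (E p) p) (R p) \<and> chart_map (E p) p $ I p = 0"
    by metis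
  \<comment> \<open>Half the radius, because the bump function of radius \<open>R p\<close> equals 1
    there.\<close>
  define Q where "Q p = {q \<in> chart_dom (E p). chart_map (E p) q \<in> ball (chart_map (E p) p) (R p / 2)}" for p
  have Q: "open (Q p)" "p \<in> Q p" if "p \<in> S" for p
  proof -
    have "is_chart (E p)" using E[OF that] charts_is_chart by blast
    then show "open (Q p)" unfolding Q_def by (rule open_chart_preimage[OF _ open_ball])
    show "p \<in> Q p" using E[OF that] by (simp add: Q_def)
  qed
  have comp: "compact S" using S by (simp add: compact_hypersurface_def)
  have "S \<subseteq> (\<Union>p\<in>S. Q p)" using Q(2) by blast
  from compactE_image[OF comp Q(1) this]
  obtain F where F: "F \<subseteq> S" "finite F" "S \<subseteq> (\<Union>p\<in>F. Q p)" by metis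
  obtain h where h: "bij_betw h {0..<card F} F" using ex_bij_betw_nat_finite[OF F(2)] by blast
  have hF: "h a \<in> F" if "a < card F" for a using bij_betwE[OF h] that by simp
  then have hS: "h a \<in> S" if "a < card F" for a using F(1) that by blast
  define e where "e a = E (h a)" for a
  define i where "i a = I (h a)" for a
  define r where "r a = R (h a)" for a
  define x where "x a = chart_map (e a) (h a)" for a
  define \<beta> where "\<beta> a = chart_bump (e a) (x a) (r a)" for a
  define \<phi> where "\<phi> = partition_function \<beta>"
  define N where "N = (\<Union>p\<in>F. Q p)"
  have ea: "r a > 0" "e a \<in> charts A W" "slice_chart A U S (e a) (i a)" "chart_img (e a) = ball (x a) (r a)" "x a $ i a = 0"
    if "a < card F" for a
    using E[OF hS[OF that]] by (simp_all add: e_def i_def r_def x_def)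
  have eU: "e a \<in> charts A U" if "a < card F" for a using ea(3)[OF that] by (simp add: slice_chart_def)
  have sub: "cball (x a) (3 / 4 * r a) \<subseteq> chart_img (e a)" if "a < card F" for a
    unfolding ea(4)[OF that] using ea(1)[OF that] by (simp add: cball_subset_ball_iff)
  have \<beta>: "0 \<le> \<beta> a p" "\<beta> a p \<le> 1" "smooth_function A U (\<beta> a)" "p \<notin> chart_cball (e a) (x a) (r a) \<Longrightarrow> \<beta> a p = 0"
    if "a < card F" for a p
  proof -
    show "0 \<le> \<beta> a p" "\<beta> a p \<le> 1"
      unfolding \<beta>_def by (rule chart_bump_bounds[OF ea(1)[OF that]])+
    show "smooth_function A U (\<beta> a)"
      unfolding \<beta>_def by (rule smooth_chart_bump[OF A eU[OF that] ea(1)[OF that] sub[OF that]])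
    show "p \<notin> chart_cball (e a) (x a) (r a) \<Longrightarrow> \<beta> a p = 0"
      unfolding \<beta>_def by (rule chart_cball(3)[OF charts_is_chart[OF eU[OF that]] ea(1)[OF that] sub[OF that]])
  qed
  have one: "(\<Sum>a<card F. \<phi> a p) = 1" if p: "p \<in> N" for p
  proof -
    obtain q where q: "q \<in> F" "p \<in> Q q" using p by (auto simp: N_def)
    then have "q \<in> h ` {0..<card F}" using bij_betw_imp_surj_on[OF h] by simp
    then obtain a where a: "a < card F" "q = h a" by auto
    have "\<beta> a p = 1"
      using q(2) bump_values(3)[OF ea(1)[OF a(1)], of "x a" "chart_map (e a) p"]
      by (simp add: \<beta>_def chart_bump_def Q_def a(2) e_def x_def r_def)
    then have "(\<Prod>b<card F. 1 - \<beta> b p) = 0" using a(1) by (intro prod_zero bexI[of _ a]) simp_all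
    then show ?thesis unfolding \<phi>_def sum_partition_function by simp
  qed
  have "open N" unfolding N_def using Q(1) F(1) by (intro open_UN ballI) blast
  moreover have "smooth_function A U (\<phi> a)" if "a < card F" for a
    unfolding \<phi>_def using that \<beta>(3) by (intro smooth_partition_function) simp
  moreover have "0 \<le> \<phi> a p" if "a < card F" for a p
    unfolding \<phi>_def partition_function_def using that \<beta>(1,2) by (intro mult_nonneg_nonneg prod_nonneg ballI) simp_all
  moreover have "\<phi> a p = 0" if "a < card F" "p \<notin> chart_cball (e a) (x a) (r a)" for a p
    unfolding \<phi>_def partition_function_def using \<beta>(4)[OF that] by simp
  ultimately have "slice_cover A U S W (card F) e i x r \<phi> N"
    unfolding slice_cover_def using ea one F(3) by (simp add: N_def)
  then show ?thesis by blast
qed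

text \<open>Ensures that the list selected in \<open>hypersurface_integral\<close> really is a
  partition of unity.\<close>

lemma slice_partition_exists:
  fixes A :: "('m::{t2_space, second_countable_topology}, 'n::finite) chart set"
  assumes A: "smooth_atlas A" and U: "open U" and S: "compact_hypersurface A U S"
  shows "\<exists>P. slice_partition A U S P"
proof -
  have SU: "S \<subseteq> U" using S by (simp add: compact_hypersurface_def)
  obtain m e i x r \<phi> N where C: "slice_cover A U S U m e i x r \<phi> N"
    using slice_cover_exists[OF A S U SU] by blast
  let ?P = "map (\<lambda>a. (e a, i a, \<phi> a)) [0..<m]"
  have one: "(\<Sum>(c, i, \<rho>)\<leftarrow>?P. \<rho> p) = 1" if p: "p \<in> S" for p
  proof -
    have "(\<Sum>(c, i, \<rho>)\<leftarrow>?P. \<rho> p) = (\<Sum>a\<leftarrow>[0..<m]. \<phi> a p)" by (simp add: o_def)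
    also have "\<dots> = (\<Sum>a<m. \<phi> a p)" by (simp add: interv_sum_list_conv_sum_set_nat lessThan_atLeast0)
    finally show ?thesis using C p unfolding slice_cover_def by (metis subsetD)
  qed
  have part: "slice_chart A U S (e a) (i a) \<and> (\<forall>p\<in>S. \<phi> a p \<ge> 0) \<and>
        S \<inter> closure {p \<in> S. \<phi> a p \<noteq> 0} \<subseteq> chart_dom (e a) \<and>
        (\<forall>d\<in>charts A U. smooth_on (chart_map d ` (chart_dom d \<inter> S)) (\<lambda>x. \<phi> a (chart_inv d x)))"
    if a: "a < m" for a
  proof -
    have Ca: "r a > 0" "e a \<in> charts A U" "slice_chart A U S (e a) (i a)" "chart_img (e a) = ball (x a) (r a)"
      "smooth_function A U (\<phi> a)" "\<And>p. 0 \<le> \<phi> a p" "\<And>p. p \<notin> chart_cball (e a) (x a) (r a) \<Longrightarrow> \<phi> a p = 0"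
      using C a by (simp_all add: slice_cover_def)
    have "cball (x a) (3 / 4 * r a) \<subseteq> chart_img (e a)"
      unfolding Ca(4) using Ca(1) by (simp add: cball_subset_ball_iff)
    note K = chart_cball[OF charts_is_chart[OF Ca(2)] Ca(1) this]
    have "{p \<in> S. \<phi> a p \<noteq> 0} \<subseteq> chart_cball (e a) (x a) (r a)" using Ca(7) by blast
    then have "closure {p \<in> S. \<phi> a p \<noteq> 0} \<subseteq> chart_cball (e a) (x a) (r a)"
      by (rule closure_minimal[OF _ compact_imp_closed[OF K(1)]])
    then have "S \<inter> closure {p \<in> S. \<phi> a p \<noteq> 0} \<subseteq> chart_dom (e a)" using K(2) by blast
    moreover have "smooth_on (chart_map d ` (chart_dom d \<inter> S)) (\<lambda>x. \<phi> a (chart_inv d x))" if "d \<in> charts A U" for d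
      by (rule smooth_on_subset[of "chart_img d"]) (use Ca(5) that in \<open>auto simp: smooth_function_def chart_img_def\<close>)
    ultimately show ?thesis using Ca(3,6) by blast
  qed
  have "slice_partition A U S ?P"
    unfolding slice_partition_def using one part by simp
  then show ?thesis by blast
qed

subsection \<open>Integrals over slices\<close>

definition flat :: "'n \<Rightarrow> real^'n::finite \<Rightarrow> real^'n" where
  "flat i x = (\<chi> j. if j = i then 0 else x $ j)"

definition slice_density ::
    "('m, 'n::finite) tfield \<Rightarrow> ('m, 'n) chart \<Rightarrow> 'n \<Rightarrow> ('m \<Rightarrow> real) \<Rightarrow> real^'n \<Rightarrow> real" where
  "slice_density g c i w x = (if x \<in> chart_img c
     then w (chart_inv c x) * sqrt (det (drop_index i (g c (chart_inv c x)))) else 0)"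

text \<open>The slice is thickened by a unit interval, which turns slice integrals into integrals over
  the whole coordinate space.\<close>

definition thick_density ::
    "('m, 'n::finite) tfield \<Rightarrow> ('m, 'n) chart \<Rightarrow> 'n \<Rightarrow> ('m \<Rightarrow> real) \<Rightarrow> real^'n \<Rightarrow> real" where
  "thick_density g c i w x = indicator {0..1} (x $ i) * slice_density g c i w (flat i x)"

lemma slice_integral_density: "slice_integral g c i w = (\<integral>y. slice_density g c i w (slice_point i 0 y) \<partial>slice_measure i)"
  unfolding slice_integral_def slice_density_def slice_point_def Let_def ..

lemma flat_slice_point: "flat i (slice_point i t y) = slice_point i 0 y"
  by (simp add: flat_def slice_point_def vec_eq_iff)

lemma slice_integral_thick:
  assumes "integrable lborel (thick_density g c i w)"
  shows "slice_integral g c i w = (\<integral>x. thick_density g c i w x \<partial>lborel)"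
proof -
  have "(\<integral>t. thick_density g c i w (slice_point i t y) \<partial>lborel) = slice_density g c i w (slice_point i 0 y)" for y
  proof -
    have "thick_density g c i w (slice_point i t y) = slice_density g c i w (slice_point i 0 y) * indicator {0..1} t" for t
      unfolding thick_density_def flat_slice_point by (simp add: slice_point_def mult.commute)
    then show ?thesis by simp
  qed
  then show ?thesis unfolding slice_integral_density using integral_slices[OF assms, of i] by simp
qed

lemma flat_simps [simp]: "flat i x $ i = 0" "flat i (flat i x) = flat i x"
  by (simp_all add: flat_def vec_eq_iff)

lemma flat_diff: "flat i x = x - x $ i *\<^sub>R axis i 1"
  by (simp add: flat_def vec_eq_iff axis_def)

lemma linear_flat: "linear (flat i)"
  by (rule linearI) (simp_all add: flat_def vec_eq_iff)

lemma smooth_flat: "smooth_on S (flat i)"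
  unfolding flat_diff[abs_def] by (intro smooth_intros)

lemma continuous_flat: "continuous_on S (flat i)"
  by (rule smooth_on_continuous_on[OF smooth_flat])

text \<open>The compact set \<open>L\<close> keeps the support away from the boundary of a chart
  domain, so that the density in coordinates can be continued continuously by 0.\<close>

definition supported_on :: "'m::topological_space set \<Rightarrow> 'm set \<Rightarrow> ('m \<Rightarrow> real) \<Rightarrow> bool" where
  "supported_on S D w \<longleftrightarrow> continuous_on S w \<and> (\<exists>L. compact L \<and> L \<subseteq> S \<inter> D \<and> (\<forall>p\<in>S - L. w p = 0))"

lemma slice_chart_facts:
  assumes "slice_chart A U S c i"
  shows "c \<in> charts A U" "is_chart c" "p \<in> chart_dom c \<Longrightarrow> p \<in> S \<Longrightarrow> chart_map c p $ i = 0"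
    and "x \<in> chart_img c \<Longrightarrow> x $ i = 0 \<Longrightarrow> chart_inv c x \<in> S"
proof -
  show c: "c \<in> charts A U" using assms by (simp add: slice_chart_def)
  then show ic: "is_chart c" by (rule charts_is_chart)
  have sl: "chart_map c ` (chart_dom c \<inter> S) = {x \<in> chart_img c. x $ i = 0}"
    using assms by (simp add: slice_chart_def)
  show "chart_map c p $ i = 0" if "p \<in> chart_dom c" "p \<in> S"
    using sl that by blast
  show "chart_inv c x \<in> S" if "x \<in> chart_img c" "x $ i = 0"
  proof -
    have "x \<in> chart_map c ` (chart_dom c \<inter> S)" unfolding sl using that by simp
    then obtain p where "p \<in> chart_dom c" "p \<in> S" "x = chart_map c p" by blast
    then show ?thesis using is_chart_facts(3)[OF ic] by simp
  qed
qed

lemma smooth_drop_index [smooth_intros]: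
  assumes "smooth_on S M"
  shows "smooth_on S (\<lambda>x. drop_index i (M x))"
proof -
  have "smooth_on S (\<lambda>x. \<chi> j k. if j = i \<or> k = i then (if j = k then 1 else 0) else M x $ j $ k)"
  proof (intro smooth_on_vec_lambda)
    fix j k
    show "smooth_on S (\<lambda>x. if j = i \<or> k = i then (if j = k then 1 else 0) else M x $ j $ k)"
      by (cases "j = i \<or> k = i") (simp_all add: smooth_on_const smooth_on_nth assms)
  qed
  then show ?thesis unfolding drop_index_def .
qed

text \<open>The coordinate density is continuous on the whole hyperplane, being 0 there off the
  compact image \<open>K\<close> of \<open>L\<close>; thickening by a unit interval leaves it
  supported in a compact set of the full space.\<close>

lemma thick_density_integrable:
  fixes A :: "('m::{t2_space, second_countable_topology}, 'n::finite) chart set"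
  assumes c: "slice_chart A U S c i" and g: "riemannian_metric A U g" and w: "supported_on S (chart_dom c) w"
  shows "integrable lborel (thick_density g c i w)"
proof -
  note sc = slice_chart_facts[OF c]
  interpret mc: metric_chart "chart_img c" "\<lambda>x. g c (chart_inv c x)"
    by (rule riemannian_metric_chart(1)[OF g sc(1)])
  obtain L where L: "compact L" "L \<subseteq> S \<inter> chart_dom c" "\<And>p. p \<in> S - L \<Longrightarrow> w p = 0" and cw: "continuous_on S w"
    using w by (auto simp: supported_on_def)
  let ?P = "{x :: real^'n. x $ i = 0}" and ?q = "slice_density g c i w"
  define K where "K = chart_map c ` L"
  have K: "compact K" unfolding K_def
    by (rule compact_continuous_image[OF continuous_on_subset[OF is_chart_facts(7)[OF sc(2)]] L(1)]) (use L(2) in blast)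
  have zero: "?q x = 0" if "x \<in> ?P" "x \<notin> K" for x
  proof (cases "x \<in> chart_img c")
    case True
    have "chart_inv c x \<in> S" using sc(4)[OF True] that(1) by simp
    moreover have "chart_inv c x \<notin> L"
      using that(2) is_chart_facts(5)[OF sc(2) True] unfolding K_def by (metis imageI)
    ultimately show ?thesis using L(3) by (simp add: slice_density_def)
  qed (simp add: slice_density_def)
  have "continuous_on ?P ?q"
  proof -
    have 1: "continuous_on (?P \<inter> chart_img c) ?q"
    proof -
      have "continuous_on (?P \<inter> chart_img c) (\<lambda>x. w (chart_inv c x))"
        by (rule continuous_on_compose2[OF cw continuous_on_subset[OF is_chart_facts(8)[OF sc(2)]]])
          (use sc(4) in auto)
      moreover have "continuous_on (?P \<inter> chart_img c) (\<lambda>x. sqrt (det (drop_index i (g c (chart_inv c x)))))"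
        by (intro continuous_on_real_sqrt continuous_on_subset[OF smooth_on_continuous_on[OF smooth_on_det[OF smooth_drop_index[OF mc.smooth]]]]) blast
      ultimately have "continuous_on (?P \<inter> chart_img c) (\<lambda>x. w (chart_inv c x) * sqrt (det (drop_index i (g c (chart_inv c x)))))"
        by (rule continuous_on_mult)
      then show ?thesis by (rule continuous_on_eq) (simp add: slice_density_def)
    qed
    have 2: "continuous_on (?P \<inter> - K) ?q"
      by (rule continuous_on_eq[OF continuous_on_const[of _ 0]]) (use zero in simp)
    have KI: "K \<subseteq> chart_img c" unfolding K_def chart_img_def using L(2) by blast
    have un: "?P \<inter> chart_img c \<union> ?P \<inter> - K = ?P" using KI by blast
    have "continuous_on (?P \<inter> chart_img c \<union> ?P \<inter> - K) ?q"
    proof (rule continuous_on_Un_local_open[OF _ _ 1 2])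
      show "openin (top_of_set (?P \<inter> chart_img c \<union> ?P \<inter> - K)) (?P \<inter> chart_img c)"
        unfolding un by (rule openin_open_Int[OF mc.open_dom])
      show "openin (top_of_set (?P \<inter> chart_img c \<union> ?P \<inter> - K)) (?P \<inter> - K)"
        unfolding un by (rule openin_open_Int[OF open_Compl[OF compact_imp_closed[OF K]]])
    qed
    then show ?thesis unfolding un .
  qed
  then have cf: "continuous_on UNIV (\<lambda>x. ?q (flat i x))"
    by (rule continuous_on_compose2[OF _ continuous_flat]) auto
  obtain R where R: "\<And>x. x \<in> K \<Longrightarrow> norm x \<le> R" using compact_imp_bounded[OF K] bounded_iff by blast
  \<comment> \<open>The cylinder of unit height over a ball of the hyperplane that captures the
    support.\<close>
  define C where "C = {x :: real^'n. norm (flat i x) \<le> R} \<inter> {x. x $ i \<in> {0..1}}"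
  have "closed C" unfolding C_def
    by (intro closed_Int closed_Collect_le continuous_on_norm continuous_flat continuous_on_const)
      (auto intro!: closed_Collect_conj closed_Collect_le continuous_intros)
  moreover have "bounded C"
    unfolding bounded_iff
  proof (intro exI ballI)
    fix x assume x: "x \<in> C"
    have "x = flat i x + x $ i *\<^sub>R axis i 1" by (simp add: flat_diff)
    then have "norm x \<le> norm (flat i x) + norm (x $ i *\<^sub>R axis i (1::real))" by (metis norm_triangle_ineq)
    then show "norm x \<le> R + 1" using x by (simp add: C_def)
  qed
  ultimately have "compact C" by (simp add: compact_eq_bounded_closed)
  from borel_integrable_compact[OF this continuous_on_subset[OF cf subset_UNIV]]
  have "integrable lborel (\<lambda>x. indicator C x *\<^sub>R ?q (flat i x))" .
  moreover have "indicator C x *\<^sub>R ?q (flat i x) = thick_density g c i w x" for x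
  proof (cases "flat i x \<in> K")
    case True
    then show ?thesis using R[OF True] by (simp add: thick_density_def C_def indicator_def)
  next
    case False
    then have "?q (flat i x) = 0" using zero by simp
    then show ?thesis by (simp add: thick_density_def)
  qed
  ultimately show ?thesis by simp
qed

lemma inner_transpose: "u \<bullet> (transpose J *v z) = (J *v u) \<bullet> (z :: real^'n::finite)"
  by (metis dot_lmul_matrix transpose_transpose transpose_matrix_vector)

lemma bf_congruence: "bf (transpose J ** M ** J) u v = bf M (J *v u) (J *v v)"
  unfolding bf_def by (simp only: matrix_vector_mul_assoc[symmetric] inner_transpose)

text \<open>The matrix \<open>drop_index i M\<close> represents the form on the hyperplane, extended
  by an orthogonal unit vector in direction \<open>i\<close>. Gram determinants of slices thus
  become determinants of full matrices, to which congruence applies.\<close>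

lemma bf_drop_index: "bf (drop_index i M) u v = bf M (flat i u) (flat i v) + u $ i * v $ i"
proof -
  have lin: "linear (\<lambda>u. bf M (flat i u) (flat i v) + u $ i * v $ i)"
    "linear (\<lambda>v. bf M (flat i u) (flat i v) + u $ i * v $ i)" for u v
    by (rule linearI; simp add: linear_add[OF linear_flat] linear_cmul[OF linear_flat] bf_simps algebra_simps)+
  have fl: "flat i (axis a 1) = (if a = i then 0 else axis a 1)" for a
    by (auto simp: flat_def axis_def vec_eq_iff)
  have ax: "axis a (1::real) $ i = (if a = i then 1 else 0)" for a
    by (simp add: axis_def)
  show ?thesis
  proof (rule linear_eq_axis[OF linear_bf(2) lin(1)], rule linear_eq_axis[OF linear_bf(1) lin(2)])
    fix a b
    show "bf (drop_index i M) (axis a 1) (axis b 1)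
        = bf M (flat i (axis a 1)) (flat i (axis b 1)) + axis a 1 $ i * axis b 1 $ i"
      unfolding bf_axis fl by (simp add: drop_index_def bf_axis bf_simps ax)
  qed
qed

lemma supported_on_mono: "supported_on S D w \<Longrightarrow> D \<subseteq> D' \<Longrightarrow> supported_on S D' w"
  unfolding supported_on_def by (meson Int_mono dual_order.refl order_trans)

text \<open>Both hyperplanes are the coordinate images of the same set \<open>S\<close>, so the
  transition maps one into the other; the second part differentiates this along a line in the
  hyperplane.\<close>

lemma slice_transition:
  assumes A: "smooth_atlas A" and c: "slice_chart A U S c i" and d: "slice_chart A U S d j"
    and x: "x \<in> chart_map c ` (chart_dom c \<inter> chart_dom d)" "x $ i = 0"
  shows "chart_map d (chart_inv c x) $ j = 0"
    and "w $ i = 0 \<Longrightarrow> dird w (\<lambda>x. chart_map d (chart_inv c x)) x $ j = 0"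
proof -
  note sc = slice_chart_facts[OF c] and sd = slice_chart_facts[OF d]
  let ?O = "chart_map c ` (chart_dom c \<inter> chart_dom d)" and ?\<tau> = "\<lambda>x. chart_map d (chart_inv c x)"
  have \<tau>0: "?\<tau> y $ j = 0" if y: "y \<in> ?O" "y $ i = 0" for y
  proof -
    obtain p where p: "p \<in> chart_dom c" "p \<in> chart_dom d" "y = chart_map c p" using y(1) by blast
    have "y \<in> chart_img c" using p by (simp add: chart_img_def)
    then have "chart_inv c y \<in> S" using sc(4) y(2) by blast
    moreover have "chart_inv c y = p" using p is_chart_facts(3)[OF sc(2)] by simp
    ultimately show ?thesis using sd(3) p(2) by simp
  qed
  show "?\<tau> x $ j = 0" by (rule \<tau>0[OF x])
  assume w: "w $ i = 0"
  have op: "open ?O" by (rule open_chart_image[OF sc(2) is_chart_facts(1)[OF sd(2)]])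
  have sm: "smooth_on ?O ?\<tau>" by (rule smooth_transition[OF sc(1) sd(1) A])
  have d: "?\<tau> differentiable (at x)" "(\<lambda>x. ?\<tau> x $ j) differentiable (at x)"
    by (intro smooth_on_differentiable[OF op _ x(1)] smooth_on_nth sm)+
  have line: "((\<lambda>s. ?\<tau> (x + s *\<^sub>R w) $ j) has_real_derivative dird w (\<lambda>x. ?\<tau> x $ j) (x + 0 *\<^sub>R w)) (at 0)"
    by (rule dird_line) (use d(2) in simp)
  have opL: "open ((\<lambda>s::real. x + s *\<^sub>R w) -` ?O)"
    by (rule open_vimage[OF op]) (intro continuous_intros)
  have "((\<lambda>s. 0) has_real_derivative dird w (\<lambda>x. ?\<tau> x $ j) (x + 0 *\<^sub>R w)) (at 0)"
  proof (rule has_field_derivative_transform_within_open[OF line opL])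
    show "0 \<in> (\<lambda>s::real. x + s *\<^sub>R w) -` ?O" using x(1) by simp
    show "?\<tau> (x + s *\<^sub>R w) $ j = 0" if s: "s \<in> (\<lambda>s. x + s *\<^sub>R w) -` ?O" for s
    proof (rule \<tau>0)
      show "x + s *\<^sub>R w \<in> ?O" using s by (rule vimageD)
      show "(x + s *\<^sub>R w) $ i = 0" using x(2) w by simp
    qed
  qed
  from DERIV_unique[OF this DERIV_const] have "dird w (\<lambda>x. ?\<tau> x $ j) x = 0" by simp
  then show "dird w ?\<tau> x $ j = 0" unfolding dird_nth[OF d(1)] .
qed

text \<open>The transition between the slices is thickened to a map \<Phi> that keeps the transverse
  coordinate. The square of its Jacobian determinant is the factor between the Gram determinants, so
  the change of variables formula matches the two thickened densities.\<close>

lemma slice_integral_invariant: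
  fixes A :: "('m::{t2_space, second_countable_topology}, 'n::finite) chart set"
  assumes A: "smooth_atlas A" and g: "riemannian_metric A U g"
    and c: "slice_chart A U S c i" and d: "slice_chart A U S d j"
    and w: "supported_on S (chart_dom c \<inter> chart_dom d) w"
  shows "slice_integral g c i w = slice_integral g d j w"
proof -
  note sc = slice_chart_facts[OF c] and sd = slice_chart_facts[OF d]
  note fc = is_chart_facts[OF sc(2)] and fd = is_chart_facts[OF sd(2)]
  obtain L where "L \<subseteq> S \<inter> (chart_dom c \<inter> chart_dom d) \<and> (\<forall>p\<in>S - L. w p = 0)"
    using w unfolding supported_on_def by (elim conjE exE) (rule that, rule conjI)
  then have L: "L \<subseteq> S \<inter> (chart_dom c \<inter> chart_dom d)" "\<And>p. p \<in> S - L \<Longrightarrow> w p = 0"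
    by simp_all
  let ?O = "chart_map c ` (chart_dom c \<inter> chart_dom d)" and ?O' = "chart_map d ` (chart_dom d \<inter> chart_dom c)"
  let ?\<tau> = "\<lambda>x. chart_map d (chart_inv c x)" and ?\<sigma> = "\<lambda>x. chart_map c (chart_inv d x)"
  have op: "open ?O" by (rule open_chart_image[OF sc(2) fd(1)])
  have op': "open ?O'" by (rule open_chart_image[OF sd(2) fc(1)])
  have sm: "smooth_on ?O ?\<tau>" by (rule smooth_transition[OF sc(1) sd(1) A])
  have inv: "?\<tau> x \<in> ?O' \<and> ?\<sigma> (?\<tau> x) = x" if x: "x \<in> ?O" for x
  proof -
    obtain p where p: "p \<in> chart_dom c" "p \<in> chart_dom d" "x = chart_map c p" using x by blast
    then show ?thesis using fc(3) fd(3) by simp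
  qed
  have inv': "?\<sigma> x \<in> ?O \<and> ?\<tau> (?\<sigma> x) = x" if x: "x \<in> ?O'" for x
  proof -
    obtain p where p: "p \<in> chart_dom c" "p \<in> chart_dom d" "x = chart_map d p" using x by blast
    then show ?thesis using fc(3) fd(3) by simp
  qed
  have \<tau>0: "?\<tau> x $ j = 0" if "x \<in> ?O" "x $ i = 0" for x by (rule slice_transition(1)[OF A c d that])
  have \<sigma>0: "?\<sigma> x $ i = 0" if "x \<in> ?O'" "x $ j = 0" for x by (rule slice_transition(1)[OF A d c that])
  define S0 where "S0 = {x. x $ i \<in> {0..1} \<and> flat i x \<in> ?O}"
  define S1 where "S1 = {x. x $ j \<in> {0..1} \<and> flat j x \<in> ?O'}"
  define \<Phi> where "\<Phi> x = ?\<tau> (flat i x) + x $ i *\<^sub>R axis j 1" for x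
  define \<Psi> where "\<Psi> x = ?\<sigma> (flat j x) + x $ j *\<^sub>R axis i 1" for x
  have flat_add: "flat k (a + t *\<^sub>R axis k 1) = a" "(a + t *\<^sub>R axis k 1) $ k = t" if "a $ k = 0" for a :: "real^'n" and k t
    using that by (auto simp: flat_def axis_def vec_eq_iff)
  have \<Phi>: "flat j (\<Phi> x) = ?\<tau> (flat i x)" "\<Phi> x $ j = x $ i" if "flat i x \<in> ?O" for x
    unfolding \<Phi>_def by (rule flat_add[OF \<tau>0[OF that]], simp)+
  have \<Psi>: "flat i (\<Psi> x) = ?\<sigma> (flat j x)" "\<Psi> x $ i = x $ j" if "flat j x \<in> ?O'" for x
    unfolding \<Psi>_def by (rule flat_add[OF \<sigma>0[OF that]], simp)+
  have flat_rep: "flat k x + x $ k *\<^sub>R axis k 1 = x" for k and x :: "real^'n" by (simp add: flat_diff)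
  have \<Psi>\<Phi>: "\<Psi> (\<Phi> x) = x" if "flat i x \<in> ?O" for x
    unfolding \<Psi>_def \<Phi>[OF that] using inv[OF that] flat_rep by simp
  have \<Phi>\<Psi>: "\<Phi> (\<Psi> x) = x" if "flat j x \<in> ?O'" for x
    unfolding \<Phi>_def \<Psi>[OF that] using inv'[OF that] flat_rep by simp
  have img: "\<Phi> ` S0 = S1"
  proof (rule set_eqI, rule iffI)
    fix z assume "z \<in> \<Phi> ` S0"
    then obtain x where x: "x \<in> S0" "z = \<Phi> x" by blast
    then show "z \<in> S1" using \<Phi>[of x] inv[of "flat i x"] by (simp add: S0_def S1_def)
  next
    fix z assume z: "z \<in> S1"
    then have fz: "flat j z \<in> ?O'" by (simp add: S1_def)
    have "\<Psi> z \<in> S0" using \<Psi>[OF fz] inv'[OF fz] z by (simp add: S0_def S1_def)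
    then show "z \<in> \<Phi> ` S0" using \<Phi>\<Psi>[OF fz] by (metis imageI)
  qed
  define \<Phi>' where "\<Phi>' x v = dird (flat i v) ?\<tau> (flat i x) + v $ i *\<^sub>R axis j 1" for x v :: "real^'n"
  have der: "(\<Phi> has_derivative \<Phi>' x) (at x within S0)" if x: "x \<in> S0" for x
  proof -
    have fx: "flat i x \<in> ?O" using x by (simp add: S0_def)
    have "(flat i has_derivative flat i) (at x within S0)"
      by (rule bounded_linear.has_derivative[OF linear_conv_bounded_linear[THEN iffD1, OF linear_flat] has_derivative_ident])
    from has_derivative_compose[OF this smooth_on_has_derivative[OF op sm fx]]
    have "((\<lambda>x. ?\<tau> (flat i x)) has_derivative (\<lambda>v. dird (flat i v) ?\<tau> (flat i x))) (at x within S0)" .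
    moreover have "((\<lambda>x. x $ i *\<^sub>R axis j 1) has_derivative (\<lambda>v. v $ i *\<^sub>R (axis j 1 :: real^'n))) (at x within S0)"
      by (rule has_derivative_scaleR_left[OF bounded_linear.has_derivative[OF bounded_linear_vec_nth has_derivative_ident]])
    ultimately show ?thesis unfolding \<Phi>_def[abs_def] \<Phi>'_def[abs_def] by (rule has_derivative_add)
  qed
  have dets: "\<bar>det (matrix (\<Phi>' x))\<bar> * slice_density g d j w (flat j (\<Phi> x)) = slice_density g c i w (flat i x)"
    if x: "x \<in> S0" for x
  proof -
    have fx: "flat i x \<in> ?O" using x by (simp add: S0_def)
    then obtain p where p: "p \<in> chart_dom c" "p \<in> chart_dom d" "flat i x = chart_map c p" by blast
    have ip: "chart_inv c (flat i x) = p" "chart_inv d (?\<tau> (flat i x)) = p" using p fc(3) fd(3) by simp_all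
    have im: "flat i x \<in> chart_img c" "?\<tau> (flat i x) \<in> chart_img d"
      using p fc(4) fd(4) ip by simp_all
    let ?M = "matrix (\<Phi>' x)"
    have M: "?M *v v = \<Phi>' x v" for v
      by (rule fun_cong[OF matrix_vector_mul(2)[OF has_derivative_linear[OF der[OF x]]]])
    \<comment> \<open>The derivative of \<Phi> respects the splitting into hyperplane and transverse
      direction; by \<open>bf_drop_index\<close> it pulls the extended form of \<open>d\<close> back
      to that of \<open>c\<close>.\<close>
    have fM: "flat j (?M *v v) = transition_jacobian c d p *v flat i v" "(?M *v v) $ j = v $ i" for v
    proof -
      have "dird (flat i v) ?\<tau> (flat i x) $ j = 0"
        by (rule slice_transition(2)[OF A c d fx]) simp_all
      from flat_add[OF this]
      show "flat j (?M *v v) = transition_jacobian c d p *v flat i v" "(?M *v v) $ j = v $ i"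
        unfolding M \<Phi>'_def transition_jacobian_mult[OF sc(1) sd(1) A p(1,2)] p(3) by blast+
    qed
    have gt: "tensor_field A U g" using g by (simp add: riemannian_metric_def)
    have "bf (drop_index i (g c p)) u v = bf (transpose ?M ** drop_index j (g d p) ** ?M) u v" for u v
      unfolding bf_congruence bf_drop_index fM tensor_transform[OF gt sc(1) sd(1) p(1,2)] ..
    then have "drop_index i (g c p) = transpose ?M ** drop_index j (g d p) ** ?M"
      by (simp add: vec_eq_iff flip: bf_axis)
    then have "det (drop_index i (g c p)) = (det ?M)\<^sup>2 * det (drop_index j (g d p))"
      by (simp add: det_mul det_transpose power2_eq_square)
    then have "sqrt (det (drop_index i (g c p))) = \<bar>det ?M\<bar> * sqrt (det (drop_index j (g d p)))"
      by (simp add: real_sqrt_mult)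
    then show ?thesis
      unfolding \<Phi>(1)[OF fx] slice_density_def ip(1) using im(1) fd(3,4)[OF p(2)] by simp
  qed
  \<comment> \<open>Off the overlap of the charts the density vanishes, because the support lies in
    \<open>L\<close>; so the integrals over \<open>S0\<close> and \<open>S1\<close> are integrals
    over the whole space.\<close>
  have out: "slice_density g c i w (flat i x) = 0" if "flat i x \<notin> ?O" for x
  proof (cases "flat i x \<in> chart_img c")
    case True
    have "chart_inv c (flat i x) \<in> S" by (rule sc(4)[OF True]) simp
    moreover have "chart_inv c (flat i x) \<notin> L"
    proof
      assume "chart_inv c (flat i x) \<in> L"
      then have "chart_map c (chart_inv c (flat i x)) \<in> ?O" using L(1) by blast
      then show False using that fc(5)[OF True] by simp
    qed
    ultimately show ?thesis using L(2) by (simp add: slice_density_def)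
  qed (simp add: slice_density_def)
  have out': "slice_density g d j w (flat j x) = 0" if "flat j x \<notin> ?O'" for x
  proof (cases "flat j x \<in> chart_img d")
    case True
    have "chart_inv d (flat j x) \<in> S" by (rule sd(4)[OF True]) simp
    moreover have "chart_inv d (flat j x) \<notin> L"
    proof
      assume "chart_inv d (flat j x) \<in> L"
      then have "chart_map d (chart_inv d (flat j x)) \<in> ?O'" using L(1) by blast
      then show False using that fd(5)[OF True] by simp
    qed
    ultimately show ?thesis using L(2) by (simp add: slice_density_def)
  qed (simp add: slice_density_def)
  have ti: "integrable lborel (thick_density g c i w)" "integrable lborel (thick_density g d j w)"
    by (rule thick_density_integrable[OF c g supported_on_mono[OF w]], simp)
      (rule thick_density_integrable[OF d g supported_on_mono[OF w]], simp)
  have e0: "indicator S0 x * (\<bar>det (matrix (\<Phi>' x))\<bar> * slice_density g d j w (flat j (\<Phi> x))) = thick_density g c i w x" for x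
  proof (cases "x \<in> S0")
    case True
    then show ?thesis using dets[OF True] by (simp add: thick_density_def S0_def)
  next
    case False
    then show ?thesis using out[of x] by (auto simp: thick_density_def S0_def indicator_def)
  qed
  have e1: "indicator (\<Phi> ` S0) z * slice_density g d j w (flat j z) = thick_density g d j w z" for z
    unfolding img using out'[of z] by (auto simp: thick_density_def S1_def indicator_def)
  have S0: "S0 \<in> sets borel"
  proof -
    have 1: "open (flat i -` ?O)" by (rule open_vimage[OF op continuous_flat])
    have 2: "closed {x :: real^'n. x $ i \<in> {0..1}}"
      by (auto intro!: closed_Collect_conj closed_Collect_le continuous_intros)
    have "{x :: real^'n. x $ i \<in> {0..1}} \<inter> flat i -` ?O \<in> sets borel"
      by (rule sets.Int[OF borel_closed[OF 2] borel_open[OF 1]])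
    moreover have "S0 = {x. x $ i \<in> {0..1}} \<inter> flat i -` ?O" by (auto simp: S0_def)
    ultimately show ?thesis by simp
  qed
  have inj: "inj_on \<Phi> S0"
    by (rule inj_on_inverseI[of _ \<Psi>]) (rule \<Psi>\<Phi>, simp add: S0_def)
  have "slice_integral g c i w = (\<integral>x. thick_density g c i w x \<partial>lborel)"
    by (rule slice_integral_thick[OF ti(1)])
  also have "\<dots> = (\<integral>z. thick_density g d j w z \<partial>lborel)"
    using change_of_variables[OF S0 der inj, of "\<lambda>z. slice_density g d j w (flat j z)"] ti
    unfolding e0 e1 by (simp add: borel_measurable_integrable)
  also have "\<dots> = slice_integral g d j w"
    by (rule slice_integral_thick[OF ti(2), symmetric])
  finally show ?thesis .
qed

subsection \<open>The flux of the conserved current through a slice\<close>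

text \<open>The minor is a cofactor, given by Cramer's rule. In the Leibniz formula the permutations
  that move \<open>i\<close> contribute 0 to both determinants, and for the others the products
  agree.\<close>

lemma det_drop_index:
  fixes M :: "real^'n::finite^'n"
  assumes nz: "det M \<noteq> 0"
  shows "det (drop_index i M) = matrix_inv M $ i $ i * det M"
proof -
  let ?C = "(\<chi> a b. if b = i then axis i 1 $ a else M $ a $ b) :: real^'n^'n"
  have "(\<Prod>a\<in>UNIV. drop_index i M $ a $ p a) = (\<Prod>a\<in>UNIV. ?C $ a $ p a)" if p: "p permutes UNIV" for p
  proof (cases "p i = i")
    case True
    have "p a \<noteq> i" if "a \<noteq> i" for a using permutes_inj[OF p] True that by (metis injD)
    then show ?thesis by (intro prod.cong refl) (auto simp: drop_index_def axis_def True)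
  next
    case False
    obtain a where a: "p a = i" using permutes_surj[OF p] by (metis surjD)
    have "(\<Prod>a\<in>UNIV. drop_index i M $ a $ p a) = 0"
      by (rule prod_zero) (use False in \<open>auto intro!: bexI[of _ i] simp: drop_index_def\<close>)
    moreover have "(\<Prod>a\<in>UNIV. ?C $ a $ p a) = 0"
    proof (rule prod_zero)
      show "\<exists>a\<in>UNIV. ?C $ a $ p a = 0"
        by (rule bexI[of _ a]) (use a False in \<open>auto simp: axis_def\<close>)
    qed simp
    ultimately show ?thesis by (simp only:)
  qed
  then have "det (drop_index i M) = det ?C"
    unfolding det_def by (intro sum.cong refl) simp
  then show ?thesis using matrix_inv_nth_cramer[OF nz, of i i] nz by simp
qed

text \<open>The normal is a multiple of the gradient \<open>sharp M i\<close> of the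
  \<open>i\<close>-th coordinate, scaled to unit length, and \<open>det_drop_index\<close> gives the
  area density. Area density times unit normal is thus, up to sign, volume density times gradient:
  the form in which a flux occurs in the divergence theorem.\<close>

lemma unit_normal_sharp:
  fixes M :: "real^'n::finite^'n"
  assumes M: "transpose M = M" "\<And>v. v \<noteq> 0 \<Longrightarrow> bf M v v > 0"
    and n: "bf M n n = 1" "\<And>v. v $ i = 0 \<Longrightarrow> bf M v n = 0"
  shows "sqrt (det (drop_index i M)) *\<^sub>R n = (sgn (n $ i) * sqrt (det M)) *\<^sub>R sharp M i" and "n $ i \<noteq> 0"
proof -
  have pos: "det M > 0" by (rule posdef_det_pos) (use M(2) in \<open>simp add: bf_def\<close>)
  then have nz: "det M \<noteq> 0" by simp
  define \<mu> where "\<mu> = bf M (axis i 1) n"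
  have "n = \<mu> *\<^sub>R sharp M i"
  proof (rule bf_nondeg[OF M(1) nz])
    fix v
    have "v = flat i v + v $ i *\<^sub>R axis i 1" by (simp add: flat_diff)
    then have "bf M v n = bf M (flat i v) n + v $ i * \<mu>"
      unfolding \<mu>_def using bf_simps(1)[of M "flat i v" "v $ i *\<^sub>R axis i 1" n] bf_simps(7)[of M "v $ i" "axis i 1" n]
      by (simp only: real_scaleR_def)
    then have "bf M v n = v $ i * \<mu>" using n(2)[of "flat i v"] by simp
    then show "bf M n v = bf M (\<mu> *\<^sub>R sharp M i) v"
      unfolding bf_sym[OF M(1), of n v] bf_simps bf_sharp(2)[OF M(1) nz] by simp
  qed
  then have n_eq: "n = \<mu> *\<^sub>R sharp M i" .
  let ?q = "sharp M i $ i"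
  have q: "?q > 0"
  proof -
    have "sharp M i \<noteq> 0" using n(1) n_eq by (auto simp: bf_simps)
    from M(2)[OF this] show ?thesis unfolding bf_sharp(1)[OF M(1) nz] .
  qed
  have "bf M n n = \<mu> * n $ i"
    by (subst n_eq) (simp only: bf_simps bf_sharp(2)[OF M(1) nz] real_scaleR_def)
  then have \<mu>1: "\<mu> * n $ i = 1" using n(1) by simp
  then show "n $ i \<noteq> 0" by auto
  have ni: "n $ i = \<mu> * ?q" by (subst n_eq) simp
  have "(sqrt ?q * \<mu>)\<^sup>2 = 1"
    using \<mu>1 q unfolding ni by (simp add: power_mult_distrib power2_eq_square mult_ac)
  then have "sqrt ?q * \<mu> = 1 \<or> sqrt ?q * \<mu> = -1" by (simp add: power2_eq_1_iff)
  moreover have "sgn (sqrt ?q * \<mu>) = sgn (n $ i)" using q unfolding ni by (simp add: sgn_mult)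
  ultimately have s: "sqrt ?q * \<mu> = sgn (n $ i)" by (metis sgn_1 sgn_minus)
  have "matrix_inv M $ i $ i = ?q"
    by (simp add: sharp_def matrix_vector_mul_component inner_axis)
  then have "sqrt (det (drop_index i M)) = sqrt ?q * sqrt (det M)"
    unfolding det_drop_index[OF nz] by (simp add: real_sqrt_mult)
  then have "sqrt (det (drop_index i M)) *\<^sub>R n = (sqrt ?q * \<mu> * sqrt (det M)) *\<^sub>R sharp M i"
    by (subst n_eq) (simp add: mult_ac)
  then show "sqrt (det (drop_index i M)) *\<^sub>R n = (sgn (n $ i) * sqrt (det M)) *\<^sub>R sharp M i"
    unfolding s .
qed

lemma (in metric_chart) conserved_current_nth:
  assumes x: "x \<in> \<Omega>" and X: "X x $ i = 0"
  shows "conserved_current \<gamma> r X x $ i = sqrt (det (\<gamma> x)) * bf (r x) (sharp (\<gamma> x) i) (X x)"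
proof -
  note M = sym[OF x] nondeg[OF x]
  have "(matrix_inv (\<gamma> x) *v (r x *v X x)) $ i
      = bf (\<gamma> x) (sharp (\<gamma> x) i) (matrix_inv (\<gamma> x) *v (r x *v X x))"
    by (rule bf_sharp(2)[OF M, symmetric])
  also have "\<dots> = bf (r x) (sharp (\<gamma> x) i) (X x)"
    by (simp add: bf_def matrix_vector_mul_assoc matrix_mul_assoc matrix_inv_mult[OF M(2)])
  finally show ?thesis by (simp add: conserved_current_def X)
qed

text \<open>The variation \<open>l\<close> vanishes near the boundary of the ball, hence so does its
  linearized Ricci tensor. The current therefore extends by 0 to a smooth divergence-free field on
  the whole space.\<close>

lemma slice_flux_zero:
  fixes \<gamma> l :: "real^'n::finite \<Rightarrow> real^'n^'n"
  assumes "metric_variation (ball a \<rho>) \<gamma> l" and \<rho>: "\<rho> > 0"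
    and supp: "\<And>x. x \<in> ball a \<rho> \<Longrightarrow> x \<notin> cball a (3 / 4 * \<rho>) \<Longrightarrow> l x = 0"
    and flat: "\<And>x. x \<in> ball a \<rho> \<Longrightarrow> coord_ricci \<gamma> x = 0"
    and pos: "\<And>x. x \<in> ball a \<rho> \<Longrightarrow> det (\<gamma> x) > 0"
    and X: "smooth_on (ball a \<rho>) X"
    and killing: "\<And>y u v. y \<in> ball a \<rho> \<Longrightarrow>
      bf (dird (X y) \<gamma> y) u v + bf (\<gamma> y) (dird u X y) v + bf (\<gamma> y) u (dird v X y) = 0"
  shows "(\<integral>y. (if slice_point i 0 y \<in> ball a \<rho>
      then conserved_current \<gamma> (lin_ricci \<gamma> l) X (slice_point i 0 y) $ i else 0) \<partial>slice_measure i) = 0"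
proof -
  interpret metric_variation "ball a \<rho>" \<gamma> l by (rule assms(1))
  let ?B = "ball a \<rho>" and ?N = "- cball a (3 / 4 * \<rho>)"
  let ?c = "conserved_current \<gamma> (lin_ricci \<gamma> l) X"
  define V where "V x = (if x \<in> ?B then ?c x else 0)" for x
  have BN: "x \<in> ?N" if "x \<notin> ?B" for x using that \<rho> by simp
  have V0: "V x = 0" if x: "x \<in> ?N" for x
  proof (cases "x \<in> ?B")
    case True
    have "lin_ricci \<gamma> l x = lin_ricci \<gamma> (\<lambda>y. 0) x"
      by (rule lin_ricci_cong[of "?B \<inter> ?N"]) (use True x supp in \<open>auto simp: open_Int open_Compl\<close>)
    then have "lin_ricci \<gamma> l x = 0" using lin_ricci_zero[of \<gamma> x, OF nondeg[OF True]] by simp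
    then show ?thesis by (simp add: V_def conserved_current_def bf_zero_matrix)
  qed (simp add: V_def)
  have smc: "smooth_on ?B ?c"
    unfolding conserved_current_def[abs_def]
    by (intro smooth_on_scaleR smooth_on_diff smooth_on_sqrt smooth_on_det smooth_on_matrix_vector smooth_on_matrix_inv
        smooth_on_divide smooth_on_sum smooth_on_bf smooth_on_const smooth_sharp smooth smooth_lin_ricci X pos nondeg) simp_all
  have "smooth_on UNIV V"
  proof (rule smooth_on_local)
    fix x
    show "\<exists>T. open T \<and> x \<in> T \<and> smooth_on (UNIV \<inter> T) V"
    proof (cases "x \<in> ?B")
      case True
      have "smooth_on ?B V" by (rule smooth_on_cong[OF _ smc]) (simp add: V_def)
      then show ?thesis using True by (intro exI[of _ ?B]) simp
    next
      case False
      have "smooth_on ?N V" by (rule smooth_on_cong[OF _ smooth_on_const[of _ 0]]) (simp add: V0)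
      then show ?thesis using BN[OF False] by (intro exI[of _ ?N]) (simp add: open_Compl)
    qed
  qed
  moreover have "V x = 0" if "norm a + \<rho> < norm x" for x
  proof (rule V0, rule BN, rule notI)
    assume "x \<in> ?B"
    then have "dist a x < \<rho>" by simp
    moreover have "norm x \<le> norm a + dist a x" by (metis dist_norm norm_minus_commute norm_triangle_sub)
    ultimately show False using that by linarith
  qed
  moreover have "(\<Sum>k\<in>UNIV. dird (axis k 1) V x $ k) = 0" for x
  proof (cases "x \<in> ?B")
    case True
    have "dird w V x = dird w ?c x" for w
      by (rule dird_cong_open[OF open_ball True]) (simp add: V_def)
    moreover have "(\<Sum>k\<in>UNIV. dird (axis k 1) ?c x $ k) = 0"
      by (rule divergence_conserved_current[OF pos smooth_lin_ricci lin_ricci_sym lin_ricci_bianchi[OF flat] X killing True])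
    ultimately show ?thesis by simp
  next
    case False
    have "dird w V x = dird w (\<lambda>x. 0) x" for w
      by (rule dird_cong_open[of ?N]) (use BN[OF False] V0 in \<open>simp_all add: open_Compl\<close>)
    then show ?thesis by simp
  qed
  ultimately have "(\<integral>y. V (slice_point i 0 y) $ i \<partial>slice_measure i) = 0"
    by (rule divergence_slice)
  moreover have "V (slice_point i 0 y) $ i = (if slice_point i 0 y \<in> ?B then ?c (slice_point i 0 y) $ i else 0)" for y
    by (simp add: V_def)
  ultimately show ?thesis by simp
qed

subsection \<open>The second jet of a curve of Einstein metrics\<close>

text \<open>Derivatives are one-sided at 0 and the first one is demanded only for small parameters,
  which is what the local extension of a curve on \<open>{0..1}\<close> provides.\<close>

definition has_second_derivative :: "(real \<Rightarrow> 'e::real_normed_vector) \<Rightarrow> 'e \<Rightarrow> bool" where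
  "has_second_derivative f D \<longleftrightarrow> (\<exists>\<delta> f'. \<delta> > 0 \<and> \<delta> \<le> 1 \<and>
     (\<forall>t\<in>{0..<\<delta>}. (f has_vector_derivative f' t) (at t within {0..1})) \<and>
     (f' has_vector_derivative D) (at 0 within {0..1}))"

definition second_derivative :: "(real \<Rightarrow> 'e::real_normed_vector) \<Rightarrow> 'e" where
  "second_derivative f = vector_derivative (\<lambda>t. vector_derivative f (at t within {0..1})) (at 0 within {0..1})"

lemma vector_derivative_unit_interval:
  assumes "t \<in> {0..1}" "(f has_vector_derivative D) (at t within {0..1})"
  shows "vector_derivative f (at t within {0..1}) = D"
  using vector_derivative_within_cbox[of 0 1 t f D] assms by simp

lemma second_derivative_eqI:
  assumes "has_second_derivative f D"
  shows "second_derivative f = D"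
proof -
  obtain \<delta> f' where \<delta>: "\<delta> > 0" "\<delta> \<le> 1" and d: "\<And>t. t \<in> {0..<\<delta>} \<Longrightarrow> (f has_vector_derivative f' t) (at t within {0..1})"
    and D: "(f' has_vector_derivative D) (at 0 within {0..1})"
    using assms unfolding has_second_derivative_def by metis
  have eq: "f' t = vector_derivative f (at t within {0..1})" if "t \<in> {0..1}" "dist t 0 < \<delta>" for t
    by (rule vector_derivative_unit_interval[OF that(1) d, symmetric]) (use that in auto)
  have "((\<lambda>t. vector_derivative f (at t within {0..1})) has_vector_derivative D) (at 0 within {0..1})"
    by (rule has_vector_derivative_transform_within[OF D \<delta>(1) _ eq]) simp_all
  then show ?thesis
    unfolding second_derivative_def by (intro vector_derivative_unit_interval) simp_all
qed

text \<open>Linear relations that hold for each metric of the curve pass to the second derivative.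
  This yields the symmetry and the transformation law of \<open>k\<close>.\<close>

lemma has_second_derivative_linear:
  assumes f: "has_second_derivative f D" and L: "bounded_linear L"
    and eq: "\<And>t. t \<in> {0..1} \<Longrightarrow> h t = L (f t)"
  shows "has_second_derivative h (L D)"
proof -
  obtain \<delta> f' where \<delta>: "\<delta> > 0" "\<delta> \<le> 1" and d: "\<And>t. t \<in> {0..<\<delta>} \<Longrightarrow> (f has_vector_derivative f' t) (at t within {0..1})"
    and D: "(f' has_vector_derivative D) (at 0 within {0..1})"
    using f unfolding has_second_derivative_def by metis
  have "(h has_vector_derivative L (f' t)) (at t within {0..1})" if t: "t \<in> {0..<\<delta>}" for t
  proof (rule has_vector_derivative_transform[OF _ eq])
    show "t \<in> {0..1}" using t \<delta>(2) by simp
    show "((\<lambda>t. L (f t)) has_vector_derivative L (f' t)) (at t within {0..1})"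
      by (rule bounded_linear.has_vector_derivative[OF L d[OF t]])
  qed
  moreover have "((\<lambda>t. L (f' t)) has_vector_derivative L D) (at 0 within {0..1})"
    by (rule bounded_linear.has_vector_derivative[OF L D])
  ultimately show ?thesis
    unfolding has_second_derivative_def by (intro exI[of _ \<delta>] exI[of _ "\<lambda>t. L (f' t)"]) (use \<delta> in blast)
qed

text \<open>Smoothness up to \<open>t = 0\<close> means that near each point a smooth extension
  \<open>F\<close> to negative times exists. Its first and second time derivatives at 0 are the
  one-sided ones of the curve and so do not depend on the extension.\<close>

lemma curve_extension:
  fixes \<Gamma> :: "real \<Rightarrow> real^'n::finite \<Rightarrow> real^'n^'n"
  assumes sm: "smooth_on ({0..1} \<times> \<Omega>) (\<lambda>(t, x). \<Gamma> t x)" and \<Omega>: "open \<Omega>" "x \<in> \<Omega>"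
  shows "\<exists>\<delta> N F. 0 < \<delta> \<and> \<delta> \<le> 1 \<and> open N \<and> x \<in> N \<and> N \<subseteq> \<Omega> \<and> smooth_on ({-\<delta><..<\<delta>} \<times> N) F \<and>
    (\<forall>t y. t \<in> {0..<\<delta>} \<longrightarrow> y \<in> N \<longrightarrow> F (t, y) = \<Gamma> t y) \<and>
    (\<forall>y\<in>N. ((\<lambda>t. \<Gamma> t y) has_vector_derivative dird (1, 0) F (0, y)) (at 0 within {0..1}) \<and>
       has_second_derivative (\<lambda>t. \<Gamma> t y) (dird (1, 0) (dird (1, 0) F) (0, y)))"
proof -
  have "(0::real, x) \<in> {0..1} \<times> \<Omega>" using \<Omega> by simp
  then obtain T F where T: "open T" "(0::real, x) \<in> T" "\<forall>k. Ck_on k T F"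
    "\<forall>z\<in>({0..1} \<times> \<Omega>) \<inter> T. F z = (case z of (t, x) \<Rightarrow> \<Gamma> t x)"
    using sm unfolding smooth_on_def by blast
  obtain P N0 where P: "open P" "open N0" "(0, x) \<in> P \<times> N0" "P \<times> N0 \<subseteq> T"
    using open_prod_elim[OF T(1,2)] by blast
  obtain \<epsilon> where \<epsilon>: "\<epsilon> > 0" "ball 0 \<epsilon> \<subseteq> P" using P(1,3) open_contains_ball by (metis mem_Sigma_iff)
  define \<delta> where "\<delta> = min \<epsilon> 1"
  define N where "N = N0 \<inter> \<Omega>"
  have \<delta>: "0 < \<delta>" "\<delta> \<le> 1" using \<epsilon>(1) by (simp_all add: \<delta>_def)
  have N: "open N" "x \<in> N" "N \<subseteq> \<Omega>" using P(2,3) \<Omega> by (auto simp: N_def)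
  let ?D = "{-\<delta><..<\<delta>} \<times> N"
  have "{-\<delta><..<\<delta>} \<subseteq> P" using \<epsilon>(2) by (auto simp: \<delta>_def dist_norm subset_iff)
  then have DT: "?D \<subseteq> T" using P(4) by (auto simp: N_def)
  have opD: "open ?D" using N(1) by (intro open_Times) simp_all
  have smF: "smooth_on ?D F"
    unfolding smooth_on_open_iff[OF opD] by (intro allI Ck_on_subset[OF T(3)[rule_format] DT])
  have F: "F (t, y) = \<Gamma> t y" if "t \<in> {0..<\<delta>}" "y \<in> N" for t y
  proof -
    have "(t, y) \<in> ({0..1} \<times> \<Omega>) \<inter> T" using that \<delta> N(3) DT by auto
    from T(4)[rule_format, OF this] show ?thesis by simp
  qed
  have c: "((\<lambda>s::real. (s, y)) has_derivative (\<lambda>r. (r, 0))) (at s)" for s and y :: "real^'n"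
    by (rule has_derivative_Pair[OF has_derivative_ident has_derivative_const])
  have hvd: "((\<lambda>t. f (t, y)) has_vector_derivative dird (1, 0) f (t, y)) (at t)"
    if "smooth_on ?D f" "(t, y) \<in> ?D" for f :: "real \<times> (real^'n) \<Rightarrow> real^'n^'n" and t y
  proof -
    note df = smooth_on_differentiable[OF opD that]
    have "(\<lambda>t. f (t, y)) differentiable (at t)"
      by (rule differentiableI[OF has_derivative_compose[OF c has_derivative_dird[OF df]]])
    from has_vector_derivative_dird[OF this]
    show ?thesis unfolding dird_compose[OF differentiableI[OF c] df] dird_eqI[OF c] .
  qed
  have first: "((\<lambda>t. \<Gamma> t y) has_vector_derivative dird (1, 0) F (t, y)) (at t within {0..1})"
    if t: "t \<in> {0..<\<delta>}" and y: "y \<in> N" for t y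
  proof -
    have "(t, y) \<in> ?D" using t y \<delta> by simp
    from has_vector_derivative_at_within[OF hvd[OF smF this]]
    have D: "((\<lambda>t. F (t, y)) has_vector_derivative dird (1, 0) F (t, y)) (at t within {0..1})" .
    show ?thesis
    proof (rule has_vector_derivative_transform_within[OF D])
      show "0 < \<delta> - t" "t \<in> {0..1}" using t \<delta> by simp_all
      show "F (s, y) = \<Gamma> s y" if "s \<in> {0..1}" "dist s t < \<delta> - t" for s
        by (rule F[OF _ y]) (use that in \<open>auto simp: dist_real_def\<close>)
    qed
  qed
  have second: "has_second_derivative (\<lambda>t. \<Gamma> t y) (dird (1, 0) (dird (1, 0) F) (0, y))" if y: "y \<in> N" for y
    unfolding has_second_derivative_def
  proof (intro exI[of _ \<delta>] exI[of _ "\<lambda>t. dird (1, 0) F (t, y)"] conjI ballI \<delta>)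
    show "((\<lambda>t. \<Gamma> t y) has_vector_derivative dird (1, 0) F (t, y)) (at t within {0..1})" if "t \<in> {0..<\<delta>}" for t
      by (rule first[OF that y])
    show "((\<lambda>t. dird (1, 0) F (t, y)) has_vector_derivative dird (1, 0) (dird (1, 0) F) (0, y)) (at 0 within {0..1})"
      by (rule has_vector_derivative_at_within[OF hvd[OF smooth_on_dird[OF opD smF]]]) (use y \<delta> in simp)
  qed
  show ?thesis
    by (intro exI[of _ \<delta>] exI[of _ N] exI[of _ F] conjI \<delta> N smF allI impI ballI F first second) (use \<delta> in simp_all)
qed

section \<open>The quadratic term in terms of jets\<close>

lemma deriv2_cong_ev:
  fixes f g :: "real \<Rightarrow> real"
  assumes "\<forall>\<^sub>F s in nhds x. f s = g s"
  shows "(deriv ^^ 2) f x = (deriv ^^ 2) g x"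
proof -
  have "\<forall>\<^sub>F y in nhds x. \<forall>\<^sub>F s in nhds y. f s = g s" using assms by (simp add: eventually_eventually)
  then have "\<forall>\<^sub>F y in nhds x. deriv f y = deriv g y"
    by (rule eventually_mono) (rule deriv_cong_ev, simp_all)
  then show ?thesis by (simp add: numeral_2_eq_2 deriv_cong_ev)
qed

lemma trace_inverse_self:
  fixes M :: "real^'n::finite^'n"
  assumes "transpose M = M" "det M \<noteq> 0"
  shows "(\<Sum>i\<in>UNIV. \<Sum>j\<in>UNIV. matrix_inv M $ i $ j * M $ i $ j) = real CARD('n)"
proof -
  have "M $ i $ j = M $ j $ i" for i j using assms(1) by (metis transpose_def vec_lambda_beta)
  then have "(\<Sum>j\<in>UNIV. matrix_inv M $ i $ j * M $ i $ j) = (matrix_inv M ** M) $ i $ i" for i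
    by (simp add: matrix_matrix_mult_def)
  then show ?thesis unfolding matrix_inv_mult(2)[OF assms(2)] by (simp add: mat_def)
qed

text \<open>The trace of the metric with respect to itself is the dimension, so removing the trace
  part of \<Lambda> times the metric removes all of it.\<close>

lemma jet_traceless_einstein:
  fixes \<gamma> :: "real^'n::finite \<Rightarrow> real^'n^'n"
  assumes "metric_chart \<Omega> \<gamma>" and x: "x \<in> \<Omega>" and ein: "coord_ricci \<gamma> x = \<Lambda> *\<^sub>R \<gamma> x"
  shows "jet_traceless (jet \<gamma> x) = 0"
proof -
  interpret metric_chart \<Omega> \<gamma> by (rule assms(1))
  have R: "jet_ricci (jet \<gamma> x) = \<Lambda> *\<^sub>R \<gamma> x"
    using coord_ricci_jet[OF open_dom smooth nondeg x] ein by simp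
  have "fst (jet \<gamma> x) = \<gamma> x" by (simp add: jet_def)
  moreover have "(\<Sum>i\<in>UNIV. \<Sum>j\<in>UNIV. matrix_inv (\<gamma> x) $ i $ j * (\<Lambda> *\<^sub>R \<gamma> x) $ i $ j)
      = \<Lambda> * (\<Sum>i\<in>UNIV. \<Sum>j\<in>UNIV. matrix_inv (\<gamma> x) $ i $ j * \<gamma> x $ i $ j)"
    by (simp add: sum_distrib_left mult.left_commute)
  ultimately show ?thesis
    unfolding jet_traceless_def R by (simp add: trace_inverse_self[OF sym[OF x] nondeg[OF x]])
qed

text \<open>The definition perturbs the whole tensor field. For small \<open>s\<close> the perturbed
  matrix at \<open>p\<close> is nonsingular, and there the traceless Ricci tensor is
  \<open>jet_traceless\<close> along an affine path of jets; functions that agree near 0 have equal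
  second derivatives at 0.\<close>

lemma traceless_ricci2_jet:
  fixes g h :: "('m::topological_space, 'n::finite) tfield"
  assumes c: "is_chart c" and p: "p \<in> chart_dom c" "chart_map c p = x"
    and g: "metric_chart (chart_img c) (\<lambda>y. g c (chart_inv c y))"
    and h: "smooth_on (chart_img c) (\<lambda>y. h c (chart_inv c y))"
  shows "traceless_ricci2 g h c p $ a $ b =
    (deriv ^^ 2) (\<lambda>s. jet_traceless (jet (\<lambda>y. g c (chart_inv c y)) x + s *\<^sub>R jet (\<lambda>y. h c (chart_inv c y)) x) $ a $ b) 0 / 2"
proof -
  interpret metric_chart "chart_img c" "\<lambda>y. g c (chart_inv c y)" by (rule g)
  let ?\<gamma> = "\<lambda>y. g c (chart_inv c y)" and ?\<eta> = "\<lambda>y. h c (chart_inv c y)"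
  let ?\<gamma>s = "\<lambda>s y. ?\<gamma> y + s *\<^sub>R ?\<eta> y"
  have x: "x \<in> chart_img c" and ix: "chart_inv c x = p" using p is_chart_facts(3,4)[OF c] by auto
  define I where "I = (\<lambda>s::real. det (?\<gamma>s s x)) -` (- {0})"
  have "continuous_on UNIV (\<lambda>s::real. det (?\<gamma>s s x))"
    by (rule smooth_on_continuous_on) (intro smooth_intros)
  then have I: "open I" "0 \<in> I"
    using open_vimage[OF open_Compl[OF closed_singleton]] nondeg[OF x] by (auto simp: I_def)
  have "traceless_ricci (\<lambda>d q. g d q + s *\<^sub>R h d q) c p = jet_traceless (jet ?\<gamma> x + s *\<^sub>R jet ?\<eta> x)"
    if s: "s \<in> I" for s
  proof -
    have sm: "smooth_on (chart_img c) (?\<gamma>s s)" by (intro smooth_intros smooth h)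
    let ?N = "(\<lambda>y. det (?\<gamma>s s y)) -` (- {0}) \<inter> chart_img c"
    have "open ?N"
      using continuous_on_open_vimage[OF open_dom, THEN iffD1, rule_format,
          OF smooth_on_continuous_on[OF smooth_on_det[OF sm]] open_Compl[OF closed_singleton]] .
    then have "coord_ricci (?\<gamma>s s) x = jet_ricci (jet (?\<gamma>s s) x)"
      by (rule coord_ricci_jet[OF _ smooth_on_subset[OF sm]]) (use s x in \<open>auto simp: I_def\<close>)
    moreover have j: "jet (?\<gamma>s s) x = jet ?\<gamma> x + s *\<^sub>R jet ?\<eta> x"
      unfolding jet_scaleR[OF open_dom x h, symmetric]
      by (rule jet_add[OF open_dom x smooth]) (intro smooth_intros h)
    moreover have "fst (jet (?\<gamma>s s) x) = g c p + s *\<^sub>R h c p" by (simp add: jet_def ix)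
    ultimately show ?thesis
      unfolding traceless_ricci_def scalar_curvature_def ricci_def jet_traceless_def p(2)
      by simp
  qed
  then have "\<forall>\<^sub>F s in nhds 0. traceless_ricci (\<lambda>d q. g d q + s *\<^sub>R h d q) c p $ a $ b
      = jet_traceless (jet ?\<gamma> x + s *\<^sub>R jet ?\<eta> x) $ a $ b"
    using eventually_nhds_in_open[OF I] by (auto elim: eventually_mono)
  from deriv2_cong_ev[OF this] show ?thesis by (simp add: traceless_ricci2_def)
qed

subsection \<open>Fluxes of the linearized Ricci tensor\<close>

lemma continuous_on_local:
  fixes f :: "'a::t2_space \<Rightarrow> 'b::topological_space"
  assumes "\<And>x. x \<in> S \<Longrightarrow> \<exists>T. open T \<and> x \<in> T \<and> continuous_on (S \<inter> T) f"
  shows "continuous_on S f"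
  unfolding continuous_on_eq_continuous_within
proof
  fix x assume x: "x \<in> S"
  obtain T where T: "open T" "x \<in> T" "continuous_on (S \<inter> T) f" using assms[OF x] by blast
  have "continuous (at x within S \<inter> T) f"
    using T x by (simp add: continuous_on_eq_continuous_within)
  moreover have "at x within S \<inter> T = at x within S"
    by (rule at_within_nhd[OF T(2,1)]) blast
  ultimately show "continuous (at x within S) f" by (simp only:)
qed

lemma slice_integral_cong:
  assumes c: "slice_chart A U S c i" and eq: "\<And>p. p \<in> S \<Longrightarrow> w p = w' p"
  shows "slice_integral g c i w = slice_integral g c i w'"
proof -
  have "slice_density g c i w (slice_point i 0 y) = slice_density g c i w' (slice_point i 0 y)" for y
  proof (cases "slice_point i 0 y \<in> chart_img c")
    case True
    have "chart_inv c (slice_point i 0 y) \<in> S"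
      by (rule slice_chart_facts(4)[OF c True]) (simp add: slice_point_def)
    then show ?thesis unfolding slice_density_def by (simp only: eq)
  qed (simp add: slice_density_def)
  then show ?thesis unfolding slice_integral_density by (simp only:)
qed

lemma slice_integral_sum:
  fixes A :: "('m::{t2_space, second_countable_topology}, 'n::finite) chart set"
  assumes c: "slice_chart A U S c i" and g: "riemannian_metric A U g"
    and w: "\<And>a. a \<in> I \<Longrightarrow> supported_on S (chart_dom c) (w a)"
  shows "slice_integral g c i (\<lambda>p. \<Sum>a\<in>I. w a p) = (\<Sum>a\<in>I. slice_integral g c i (w a))"
proof -
  note int = thick_density_integrable[OF c g w]
  have thick: "thick_density g c i (\<lambda>p. \<Sum>a\<in>I. w a p) x = (\<Sum>a\<in>I. thick_density g c i (w a) x)" for x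
    by (simp add: thick_density_def slice_density_def sum_distrib_left sum_distrib_right)
  have "integrable lborel (\<lambda>x. \<Sum>a\<in>I. thick_density g c i (w a) x)"
    by (rule Bochner_Integration.integrable_sum[OF int])
  then have "slice_integral g c i (\<lambda>p. \<Sum>a\<in>I. w a p) = (\<integral>x. (\<Sum>a\<in>I. thick_density g c i (w a) x) \<partial>lborel)"
    using slice_integral_thick[of g c i "\<lambda>p. \<Sum>a\<in>I. w a p"] unfolding thick by simp
  also have "\<dots> = (\<Sum>a\<in>I. \<integral>x. thick_density g c i (w a) x \<partial>lborel)"
    by (rule Bochner_Integration.integral_sum[OF int])
  also have "\<dots> = (\<Sum>a\<in>I. slice_integral g c i (w a))"
    by (rule sum.cong[OF refl slice_integral_thick[OF int, symmetric]])
  finally show ?thesis .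
qed

lemma metric_variation_subset:
  assumes "metric_variation \<Omega> \<gamma> l" "open N" "N \<subseteq> \<Omega>"
  shows "metric_variation N \<gamma> l"
proof -
  interpret metric_variation \<Omega> \<gamma> l by (rule assms(1))
  show ?thesis
  proof (rule metric_variation.intro)
    show "metric_chart N \<gamma>" by (rule metric_chart_subset[OF _ assms(2,3)]) unfold_locales
    show "metric_variation_axioms N l"
    proof
      show "smooth_on N l" by (rule smooth_on_subset[OF smooth_l assms(3)])
      show "transpose (l x) = l x" if "x \<in> N" for x using sym_l assms(3) that by blast
    qed
  qed
qed

lemma bounded_linear_transpose: "bounded_linear (transpose :: real^'n::finite^'n \<Rightarrow> real^'n^'n)"
  by (intro linear_conv_bounded_linear[THEN iffD1] linearI) (simp_all add: transpose_def vec_eq_iff)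

lemma bounded_linear_congruence: "bounded_linear (\<lambda>M. transpose J ** M ** (J :: real^'n::finite^'n))"
  by (intro linear_conv_bounded_linear[THEN iffD1] linearI)
    (simp_all only: bounded_bilinear.add_left[OF bounded_bilinear_matrix_mult]
      bounded_bilinear.add_right[OF bounded_bilinear_matrix_mult]
      bounded_bilinear.scaleR_left[OF bounded_bilinear_matrix_mult]
      bounded_bilinear.scaleR_right[OF bounded_bilinear_matrix_mult])

lemma killing_bf:
  assumes kf: "killing_field A U g X" and g: "riemannian_metric A U g" and c: "c \<in> charts A U" and y: "y \<in> chart_img c"
  defines "\<gamma> \<equiv> \<lambda>y. g c (chart_inv c y)" and "\<xi> \<equiv> \<lambda>y. X c (chart_inv c y)"
  shows "bf (dird (\<xi> y) \<gamma> y) u v + bf (\<gamma> y) (dird u \<xi> y) v + bf (\<gamma> y) u (dird v \<xi> y) = 0"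
proof -
  interpret metric_chart "chart_img c" \<gamma> unfolding \<gamma>_def by (rule riemannian_metric_chart(1)[OF g c])
  have "chart_dom c \<subseteq> U" using c by (simp add: charts_def)
  then have im: "chart_map c ` (chart_dom c \<inter> U) = chart_img c" by (simp add: chart_img_def Int_absorb2)
  have "vector_field A U X" using kf by (simp add: killing_field_def)
  then have sm\<xi>: "smooth_on (chart_img c) \<xi>"
    using c unfolding vector_field_along_def \<xi>_def im[symmetric] by blast
  note d\<xi> = differentiable[OF sm\<xi> y] and d\<gamma> = diff_\<gamma>[OF y]
  have K: "(\<Sum>k\<in>UNIV. \<xi> y $ k * pderiv_at k (\<lambda>y. \<gamma> y $ i $ j) y
      + \<gamma> y $ k $ j * pderiv_at i (\<lambda>y. \<xi> y $ k) y + \<gamma> y $ i $ k * pderiv_at j (\<lambda>y. \<xi> y $ k) y) = 0" for i j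
    using kf c y unfolding killing_field_def Let_def \<gamma>_def \<xi>_def by blast
  let ?B = "\<lambda>u v. bf (dird (\<xi> y) \<gamma> y) u v + bf (\<gamma> y) (dird u \<xi> y) v + bf (\<gamma> y) u (dird v \<xi> y)"
  have lin: "linear (\<lambda>u. ?B u v)" "linear (\<lambda>v. ?B u v)" for u v
    by (intro linear_compose_add linear_bf linear_chain[OF linear_dird[OF d\<xi>] linear_bf(2)]
        linear_chain[OF linear_dird[OF d\<xi>] linear_bf(1)])+
  have ax: "?B (axis i 1) (axis j 1) = 0" for i j
  proof -
    have 1: "bf (dird (\<xi> y) \<gamma> y) (axis i 1) (axis j 1) = (\<Sum>k\<in>UNIV. \<xi> y $ k * pderiv_at k (\<lambda>y. \<gamma> y $ i $ j) y)"
    proof -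
      have "bf (dird (\<xi> y) \<gamma> y) (axis i 1) (axis j 1)
          = (\<Sum>k\<in>UNIV. \<xi> y $ k *\<^sub>R bf (dird (axis k 1) \<gamma> y) (axis i 1) (axis j 1))"
        by (rule linear_expand[OF linear_chain[OF linear_dird[OF d\<gamma>] bounded_linear.linear[OF bounded_linear_bf]]])
      then show ?thesis by (simp add: bf_axis pderiv_at_matrix_nth[OF d\<gamma>])
    qed
    have 2: "bf (\<gamma> y) w (axis j 1) = (\<Sum>k\<in>UNIV. \<gamma> y $ k $ j * w $ k)" for w j
      using linear_expand[OF linear_bf(2)[of "\<gamma> y" "axis j 1"], of w] by (simp add: bf_axis mult.commute)
    have 3: "bf (\<gamma> y) (axis i 1) w = (\<Sum>k\<in>UNIV. \<gamma> y $ i $ k * w $ k)" for w i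
      using linear_expand[OF linear_bf(1)[of "\<gamma> y" "axis i 1"], of w] by (simp add: bf_axis mult.commute)
    have 4: "dird (axis i 1) \<xi> y $ k = pderiv_at i (\<lambda>y. \<xi> y $ k) y" for i k
      unfolding pderiv_at_eq_dird by (rule dird_nth[OF d\<xi>, symmetric])
    show ?thesis unfolding 1 2 3 4 sum.distrib[symmetric] by (rule K)
  qed
  show ?thesis
    by (rule linear_eq_axis[OF lin(1) linear_zero], rule linear_eq_axis[OF lin(2) linear_zero], rule ax)
qed

section \<open>Curves of Einstein metrics near the hypersurface\<close>

locale einstein_curve =
  fixes A :: "('m::{t2_space, second_countable_topology}, 'n::finite) chart set"
    and U S W :: "'m set" and g h :: "('m, 'n) tfield" and X \<nu> :: "('m, 'n) vfield"
    and G :: "real \<Rightarrow> ('m, 'n) tfield"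
  assumes atlas: "smooth_atlas A" and U: "open U" "U \<subseteq> manifold_space A"
    and flat: "ricci_flat_metric A U g" and h: "tensor_field A U h"
    and killing: "killing_field A U g X" and hyper: "compact_hypersurface A U S"
    and tangent: "tangent_along A U S X" and normal: "unit_normal_field A U g S \<nu>"
    and W: "open W" "S \<subseteq> W" "W \<subseteq> U"
    and einstein: "t \<in> {0..1} \<Longrightarrow> einstein_metric A W (G t)"
    and smooth_G: "c \<in> charts A W \<Longrightarrow> smooth_on ({0..1} \<times> chart_img c) (\<lambda>(t, x). G t c (chart_inv c x))"
    and G_0: "c \<in> charts A W \<Longrightarrow> p \<in> chart_dom c \<Longrightarrow> G 0 c p = g c p"
    and G_1: "c \<in> charts A W \<Longrightarrow> p \<in> chart_dom c \<Longrightarrow>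
      ((\<lambda>t. G t c p) has_vector_derivative h c p) (at 0 within {0..1})"
begin

lemma riem: "riemannian_metric A U g"
  using flat by (simp add: ricci_flat_metric_def)

lemma tensor_g: "tensor_field A U g"
  using riem by (simp add: riemannian_metric_def)

lemma WU: "c \<in> charts A W \<Longrightarrow> c \<in> charts A U"
  using charts_mono[OF W(3)] by blast

lemma SU: "S \<subseteq> U"
  using W by blast

lemma X_field: "vector_field A U X"
  using killing by (simp add: killing_field_def)

lemma \<nu>_field: "vector_field_along A U S \<nu>"
  using normal by (simp add: unit_normal_field_def)

abbreviation coord :: "('m, 'n) tfield \<Rightarrow> ('m, 'n) chart \<Rightarrow> real^'n \<Rightarrow> real^'n^'n" where
  "coord T c y \<equiv> T c (chart_inv c y)"

text \<open>The second derivative of the curve at \<open>t = 0\<close>.\<close>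

definition k :: "('m, 'n) tfield" where
  "k c p = second_derivative (\<lambda>t. G t c p)"

lemma extension:
  assumes c: "c \<in> charts A W" and x: "x \<in> chart_img c"
  obtains \<delta> N F where "0 < \<delta>" "\<delta> \<le> 1" "open N" "x \<in> N" "N \<subseteq> chart_img c" "smooth_on ({-\<delta><..<\<delta>} \<times> N) F"
    "\<And>t y. t \<in> {0..<\<delta>} \<Longrightarrow> y \<in> N \<Longrightarrow> F (t, y) = coord (G t) c y"
    "\<And>y. y \<in> N \<Longrightarrow> dird (1, 0) F (0, y) = coord h c y"
    "\<And>y. y \<in> N \<Longrightarrow> has_second_derivative (\<lambda>t. G t c (chart_inv c y)) (dird (1, 0) (dird (1, 0) F) (0, y))"
    "\<And>y. y \<in> N \<Longrightarrow> dird (1, 0) (dird (1, 0) F) (0, y) = coord k c y"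
proof -
  note ic = charts_is_chart[OF c]
  have "\<exists>\<delta> N F. 0 < \<delta> \<and> \<delta> \<le> 1 \<and> open N \<and> x \<in> N \<and> N \<subseteq> chart_img c \<and> smooth_on ({-\<delta><..<\<delta>} \<times> N) F \<and>
    (\<forall>t y. t \<in> {0..<\<delta>} \<longrightarrow> y \<in> N \<longrightarrow> F (t, y) = coord (G t) c y) \<and>
    (\<forall>y\<in>N. ((\<lambda>t. coord (G t) c y) has_vector_derivative dird (1, 0) F (0, y)) (at 0 within {0..1}) \<and>
       has_second_derivative (\<lambda>t. coord (G t) c y) (dird (1, 0) (dird (1, 0) F) (0, y)))"
    by (rule curve_extension[OF smooth_G[OF c] is_chart_facts(2)[OF ic] x])
  then obtain \<delta> N F where E: "0 < \<delta>" "\<delta> \<le> 1" "open N" "x \<in> N" "N \<subseteq> chart_img c" "smooth_on ({-\<delta><..<\<delta>} \<times> N) F"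
    "\<forall>t y. t \<in> {0..<\<delta>} \<longrightarrow> y \<in> N \<longrightarrow> F (t, y) = coord (G t) c y"
    "\<forall>y\<in>N. ((\<lambda>t. coord (G t) c y) has_vector_derivative dird (1, 0) F (0, y)) (at 0 within {0..1}) \<and>
       has_second_derivative (\<lambda>t. coord (G t) c y) (dird (1, 0) (dird (1, 0) F) (0, y))"
    by (elim exE conjE)
  have inv: "chart_inv c y \<in> chart_dom c" if "y \<in> N" for y
    using is_chart_facts(6)[OF ic] E(5) that by blast
  show thesis
  proof (rule that[OF E(1-6)])
    show "F (t, y) = coord (G t) c y" if "t \<in> {0..<\<delta>}" "y \<in> N" for t y
      by (rule E(7)[rule_format, OF that])
    show "dird (1, 0) F (0, y) = coord h c y" if y: "y \<in> N" for y
      using vector_derivative_unit_interval[OF _ conjunct1[OF E(8)[rule_format, OF y]]]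
        vector_derivative_unit_interval[OF _ G_1[OF c inv[OF y]]] by simp
    show D: "has_second_derivative (\<lambda>t. coord (G t) c y) (dird (1, 0) (dird (1, 0) F) (0, y))" if y: "y \<in> N" for y
      by (rule conjunct2[OF E(8)[rule_format, OF y]])
    show "dird (1, 0) (dird (1, 0) F) (0, y) = coord k c y" if y: "y \<in> N" for y
      unfolding k_def by (rule second_derivative_eqI[OF D[OF y], symmetric])
  qed
qed

lemma k_second_derivative:
  assumes c: "c \<in> charts A W" and p: "p \<in> chart_dom c"
  shows "has_second_derivative (\<lambda>t. G t c p) (k c p)"
proof -
  note ic = charts_is_chart[OF c]
  obtain N and F :: "real \<times> (real^'n) \<Rightarrow> real^'n^'n" where N: "chart_map c p \<in> N"
    "\<And>y. y \<in> N \<Longrightarrow> has_second_derivative (\<lambda>t. G t c (chart_inv c y)) (dird (1, 0) (dird (1, 0) F) (0, y))"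
    "\<And>y. y \<in> N \<Longrightarrow> dird (1, 0) (dird (1, 0) F) (0, y) = coord k c y"
    by (rule extension[OF c is_chart_facts(4)[OF ic p]]) (rule that)
  show ?thesis using N(2)[OF N(1)] unfolding N(3)[OF N(1)] is_chart_facts(3)[OF ic p] .
qed

lemma smooth_k:
  assumes c: "c \<in> charts A W"
  shows "smooth_on (chart_img c) (coord k c)"
proof (rule smooth_on_local)
  fix x assume x: "x \<in> chart_img c"
  obtain \<delta> N F where N: "0 < \<delta>" "\<delta> \<le> 1" "open N" "x \<in> N" "N \<subseteq> chart_img c" "smooth_on ({-\<delta><..<\<delta>} \<times> N) F"
    "\<And>t y. t \<in> {0..<\<delta>} \<Longrightarrow> y \<in> N \<Longrightarrow> F (t, y) = coord (G t) c y"
    "\<And>y. y \<in> N \<Longrightarrow> dird (1, 0) F (0, y) = coord h c y"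
    "\<And>y. y \<in> N \<Longrightarrow> dird (1, 0) (dird (1, 0) F) (0, y) = coord k c y"
    by (rule extension[OF c x]) (rule that)
  have op: "open ({-\<delta><..<\<delta>} \<times> N)" by (rule open_Times[OF open_greaterThanLessThan N(3)])
  have "smooth_on N (\<lambda>y. dird (1, 0) (dird (1, 0) F) (0, y))"
    by (rule smooth_on_compose[OF smooth_on_Pair[OF smooth_on_const smooth_on_ident]
          smooth_on_dird[OF op smooth_on_dird[OF op N(6)]]]) (use N(1) in auto)
  then have "smooth_on N (coord k c)" by (rule smooth_on_cong[rotated]) (rule N(9))
  then have "smooth_on (chart_img c \<inter> N) (coord k c)" by (rule smooth_on_subset) simp
  then show "\<exists>T. open T \<and> x \<in> T \<and> smooth_on (chart_img c \<inter> T) (coord k c)"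
    by (intro exI[of _ N] conjI N(3,4))
qed

lemma k_sym:
  assumes c: "c \<in> charts A W" and p: "p \<in> chart_dom c"
  shows "transpose (k c p) = k c p"
proof -
  have "has_second_derivative (\<lambda>t. G t c p) (transpose (k c p))"
  proof (rule has_second_derivative_linear[OF k_second_derivative[OF c p] bounded_linear_transpose])
    fix t :: real assume "t \<in> {0..1}"
    from einstein[OF this] show "G t c p = transpose (G t c p)"
      using c p by (simp add: einstein_metric_def riemannian_metric_def)
  qed
  then show ?thesis using second_derivative_eqI k_def by metis
qed

lemma k_transform:
  assumes c: "c \<in> charts A W" and d: "d \<in> charts A W" and p: "p \<in> chart_dom c" "p \<in> chart_dom d"
  shows "bf (k c p) u v = bf (k d p) (transition_jacobian c d p *v u) (transition_jacobian c d p *v v)"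
proof -
  let ?J = "transition_jacobian c d p"
  have "has_second_derivative (\<lambda>t. G t c p) (transpose ?J ** k d p ** ?J)"
  proof (rule has_second_derivative_linear[OF k_second_derivative[OF d p(2)] bounded_linear_congruence])
    fix t :: real assume "t \<in> {0..1}"
    then have T: "tensor_field A W (G t)"
      using einstein by (simp add: einstein_metric_def riemannian_metric_def)
    show "G t c p = transpose ?J ** G t d p ** ?J"
      by (rule conjunct1[OF T[unfolded tensor_field_def], rule_format, OF c d IntI[OF p]])
  qed
  then have "k c p = transpose ?J ** k d p ** ?J" using second_derivative_eqI k_def by metis
  then show ?thesis by (simp only: bf_congruence)
qed

lemma coord_flat:
  assumes c: "c \<in> charts A U" and y: "y \<in> chart_img c"
  shows "coord_ricci (coord g c) y = 0"
proof -
  note ic = charts_is_chart[OF c]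
  have "ricci g c (chart_inv c y) = 0"
    using flat c is_chart_facts(6)[OF ic y] by (simp add: ricci_flat_metric_def)
  then show ?thesis by (simp add: ricci_def is_chart_facts(5)[OF ic y])
qed

text \<open>\<open>traceless_expansion\<close> is applied to the local extension \<open>F\<close> of
  the curve. The factor 1/2 is the Taylor factor in \<open>traceless_ricci2\<close>; the multiple of
  the metric from \<open>dird_jet_traceless_flat\<close> is removed by \<open>orth\<close>.\<close>

lemma traceless_eq:
  assumes c: "c \<in> charts A W" and p: "p \<in> chart_dom c" and orth: "bf (g c p) u v = 0"
  shows "bf (traceless_ricci2 g h c p) u v = - bf (lin_ricci (coord g c) (coord k c) (chart_map c p)) u v / 2"
proof -
  note ic = charts_is_chart[OF c]
  let ?x = "chart_map c p" and ?\<gamma> = "coord g c"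
  have x: "?x \<in> chart_img c" by (rule is_chart_facts(4)[OF ic p])
  have gx: "?\<gamma> ?x = g c p" by (simp add: is_chart_facts(3)[OF ic p])
  interpret mc: metric_chart "chart_img c" ?\<gamma> by (rule riemannian_metric_chart(1)[OF riem WU[OF c]])
  obtain \<delta> N F where E: "0 < \<delta>" "\<delta> \<le> 1" "open N" "?x \<in> N" "N \<subseteq> chart_img c" "smooth_on ({-\<delta><..<\<delta>} \<times> N) F"
    "\<And>t y. t \<in> {0..<\<delta>} \<Longrightarrow> y \<in> N \<Longrightarrow> F (t, y) = coord (G t) c y"
    "\<And>y. y \<in> N \<Longrightarrow> dird (1, 0) F (0, y) = coord h c y"
    "\<And>y. y \<in> N \<Longrightarrow> dird (1, 0) (dird (1, 0) F) (0, y) = coord k c y"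
    by (rule extension[OF c x]) (rule that)
  have op: "open ({-\<delta><..<\<delta>} \<times> N)" by (rule open_Times[OF open_greaterThanLessThan E(3)])
  have F0: "F (0, y) = ?\<gamma> y" if y: "y \<in> N" for y
    using E(7)[OF _ y, of 0] E(1) G_0[OF c is_chart_facts(6)[OF ic]] E(5) y by auto
  have j0: "jet (\<lambda>y. F (0, y)) ?x = jet ?\<gamma> ?x" by (rule jet_cong[OF E(3,4) F0])
  have j1: "jet (\<lambda>y. dird (1, 0) F (0, y)) ?x = jet (coord h c) ?x" by (rule jet_cong[OF E(3,4) E(8)])
  have j2: "jet (\<lambda>y. dird (1, 0) (dird (1, 0) F) (0, y)) ?x = jet (coord k c) ?x" by (rule jet_cong[OF E(3,4) E(9)])
  have zero: "jet_traceless (jet (\<lambda>y. F (t, y)) ?x) = 0" if t: "t \<ge> 0" "(t, ?x) \<in> {-\<delta><..<\<delta>} \<times> N" for t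
  proof -
    have t': "t \<in> {0..<\<delta>}" "t \<in> {0..1}" using t E(2) by simp_all
    obtain \<Lambda> where \<Lambda>: "ricci (G t) c p = \<Lambda> *\<^sub>R G t c p" and rm: "riemannian_metric A W (G t)"
      using einstein[OF t'(2)] c p by (auto simp: einstein_metric_def)
    have "jet (\<lambda>y. F (t, y)) ?x = jet (coord (G t) c) ?x" by (rule jet_cong[OF E(3,4) E(7)[OF t'(1)]])
    moreover have "jet_traceless (jet (coord (G t) c) ?x) = 0"
      by (rule jet_traceless_einstein[where \<Lambda> = \<Lambda>, OF riemannian_metric_chart(1)[OF rm c] x])
        (use \<Lambda> in \<open>simp add: ricci_def is_chart_facts(3)[OF ic p]\<close>)
    ultimately show ?thesis by simp
  qed
  have smh: "smooth_on (chart_img c) (coord h c)"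
    using h WU[OF c] by (simp add: tensor_field_def)
  let ?D = "dird (jet (coord k c) ?x) jet_traceless (jet ?\<gamma> ?x)"
  have nz: "det (F (0, ?x)) \<noteq> 0" unfolding F0[OF E(4)] by (rule mc.nondeg[OF x])
  have z: "(0, ?x) \<in> {-\<delta><..<\<delta>} \<times> N" using E(1,4) by simp
  have "traceless_ricci2 g h c p $ a $ b = - (?D $ a $ b) / 2" for a b
    unfolding traceless_ricci2_jet[where g = g and h = h, OF ic p refl mc.metric_chart_axioms smh]
    using traceless_expansion[OF op E(6) z nz zero] unfolding j0 j1 j2 by simp
  then have T: "traceless_ricci2 g h c p = (- 1 / 2) *\<^sub>R ?D" by (simp add: vec_eq_iff)
  have fj: "fst (jet ?\<gamma> ?x) = g c p" unfolding jet_def gx by simp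
  have "jet_ricci (jet ?\<gamma> ?x) = 0"
    using coord_ricci_jet[OF mc.open_dom mc.smooth mc.nondeg x] coord_flat[OF WU[OF c] x] by simp
  moreover have "det (fst (jet ?\<gamma> ?x)) \<noteq> 0" unfolding fj gx[symmetric] by (rule mc.nondeg[OF x])
  ultimately obtain C where "?D = lin_ricci ?\<gamma> (coord k c) ?x - C *\<^sub>R g c p"
    using dird_jet_traceless_flat[of "jet ?\<gamma> ?x" "jet (coord k c) ?x"] unfolding lin_ricci_def fj by blast
  then have "?D = lin_ricci ?\<gamma> (coord k c) ?x + (- C) *\<^sub>R g c p" by simp
  then have "bf ?D u v = bf (lin_ricci ?\<gamma> (coord k c) ?x) u v"
    by (simp only: bf_add_matrix bf_scaleR_matrix orth mult_zero_right add_0_right)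
  then show ?thesis unfolding T bf_scaleR_matrix by (simp only: mult_minus_left mult_1_left times_divide_eq_left divide_minus_left)
qed

text \<open>The chart chosen in \<open>eval_tensor\<close> may leave \<open>W\<close>, where no
  curve is given. The quadratic term depends only on 2-jets at the point, so the chart can be
  restricted.\<close>

lemma traceless_restrict:
  assumes c: "c \<in> charts A U" and p: "p \<in> chart_dom c" "p \<in> W"
  shows "traceless_ricci2 g h (restrict_chart c W) p = traceless_ricci2 g h c p"
proof -
  let ?r = "restrict_chart c W" and ?x = "chart_map c p"
  note ic = charts_is_chart[OF c] and r = restrict_chart_in_charts(2)[OF c W(1)]
  note ir = charts_is_chart[OF r]
  have pr: "p \<in> chart_dom ?r" "chart_map ?r p = ?x" using p by simp_all
  have x: "?x \<in> chart_img ?r" using is_chart_facts(4)[OF ir pr(1)] by simp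
  have eq: "coord T ?r y = coord T c y" if T: "tensor_field A U T" and y: "y \<in> chart_img ?r" for T y
  proof -
    have "chart_inv c y \<in> chart_dom c \<inter> W"
      using is_chart_facts(6)[OF ir y] unfolding chart_inv_restrict[OF ic y] by simp
    from tensor_restrict[OF T c W(1) this] show ?thesis unfolding chart_inv_restrict[OF ic y] .
  qed
  have jets: "jet (coord T ?r) ?x = jet (coord T c) ?x" if "tensor_field A U T" for T
    by (rule jet_cong[OF is_chart_facts(2)[OF ir] x eq[OF that]])
  have smh: "smooth_on (chart_img d) (coord h d)" if "d \<in> charts A U" for d
    using h that by (simp add: tensor_field_def)
  show ?thesis
    unfolding vec_eq_iff traceless_ricci2_jet[where g = g and h = h, OF ir pr riemannian_metric_chart(1)[OF riem r] smh[OF r]]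
      traceless_ricci2_jet[where g = g and h = h, OF ic p(1) refl riemannian_metric_chart(1)[OF riem c] smh[OF c]]
      jets[OF tensor_g] jets[OF h] by simp
qed

text \<open>Tangency and normality are stated in slice charts only; the transformation laws carry
  their consequence to an arbitrary chart.\<close>

lemma orthogonal:
  assumes c: "c \<in> charts A U" and p: "p \<in> chart_dom c" "p \<in> S"
  shows "bf (g c p) (X c p) (\<nu> c p) = 0"
proof -
  have pU: "p \<in> U" using p(2) SU by blast
  obtain d i where d: "slice_chart A U S d i" "p \<in> chart_dom d"
    using hyper p(2) by (auto simp: compact_hypersurface_def)
  note sd = slice_chart_facts[OF d(1)]
  have "X d p $ i = 0" using tangent d p(2) by (simp add: tangent_along_def)
  then have "bf (g d p) (X d p) (\<nu> d p) = 0"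
    using normal d p(2) by (simp add: unit_normal_field_def bf_def)
  then show ?thesis
    unfolding vector_transform[OF X_field c sd(1) p(1) d(2) pU] vector_transform[OF \<nu>_field c sd(1) p(1) d(2) p(2)]
      tensor_transform[OF tensor_g c sd(1) p(1) d(2)] .
qed

lemma metric_variation_k:
  assumes \<phi>: "smooth_function A U \<phi>" and c: "c \<in> charts A W"
  shows "metric_variation (chart_img c) (coord g c) (coord (\<lambda>c p. \<phi> p *\<^sub>R k c p) c)"
proof (rule metric_variation.intro)
  show "metric_chart (chart_img c) (coord g c)" by (rule riemannian_metric_chart(1)[OF riem WU[OF c]])
  show "metric_variation_axioms (chart_img c) (coord (\<lambda>c p. \<phi> p *\<^sub>R k c p) c)"
  proof
    show "smooth_on (chart_img c) (coord (\<lambda>c p. \<phi> p *\<^sub>R k c p) c)"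
      using \<phi> WU[OF c] by (intro smooth_on_scaleR smooth_k c) (simp add: smooth_function_def)
    show "transpose (\<phi> (chart_inv c y) *\<^sub>R coord k c y) = \<phi> (chart_inv c y) *\<^sub>R coord k c y" if "y \<in> chart_img c" for y
      using linear_cmul[OF bounded_linear.linear[OF bounded_linear_transpose], of "\<phi> (chart_inv c y)" "coord k c y"]
        k_sym[OF c is_chart_facts(6)[OF charts_is_chart[OF c] that]] by simp
  qed
qed

text \<open>The contribution of the cut-off tensor, \<phi> times \<open>k\<close>, to the integrand;
  sign and factor are those of \<open>traceless_eq\<close>.\<close>

definition flux :: "('m \<Rightarrow> real) \<Rightarrow> ('m, 'n) chart \<Rightarrow> 'm \<Rightarrow> real" where
  "flux \<phi> c p = - bf (lin_ricci (coord g c) (coord (\<lambda>c p. \<phi> p *\<^sub>R k c p) c) (chart_map c p)) (X c p) (\<nu> c p) / 2"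

text \<open>The tensor \<open>k\<close> transforms as every metric of the curve does, and \<phi> is
  a function; so \<open>lin_ricci_pullback\<close> applies on the overlap of the charts.\<close>

lemma flux_transform:
  assumes \<phi>: "smooth_function A U \<phi>" and c: "c \<in> charts A W" and d: "d \<in> charts A W"
    and p: "p \<in> chart_dom c" "p \<in> chart_dom d" "p \<in> S"
  shows "flux \<phi> c p = flux \<phi> d p"
proof -
  note ic = charts_is_chart[OF c] and id = charts_is_chart[OF d]
  let ?O = "chart_map c ` (chart_dom c \<inter> chart_dom d)" and ?\<tau> = "\<lambda>x. chart_map d (chart_inv c x)"
  have op: "open ?O" by (rule open_chart_image[OF ic is_chart_facts(1)[OF id]])
  have sub: "?O \<subseteq> chart_img c" unfolding chart_img_def by blast
  have mv: "metric_variation ?O (coord g c) (coord (\<lambda>c p. \<phi> p *\<^sub>R k c p) c)"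
    by (rule metric_variation_subset[OF metric_variation_k[OF \<phi> c] op sub])
  have pt: "\<exists>q. q \<in> chart_dom c \<and> q \<in> chart_dom d \<and> y = chart_map c q \<and> chart_inv c y = q
      \<and> ?\<tau> y \<in> chart_img d \<and> chart_inv d (?\<tau> y) = q" if y: "y \<in> ?O" for y
  proof -
    obtain q where "q \<in> chart_dom c" "q \<in> chart_dom d" "y = chart_map c q" using y by blast
    then show ?thesis using is_chart_facts(3,4)[OF ic] is_chart_facts(3,4)[OF id] by (intro exI[of _ q]) simp
  qed
  have J: "transition_jacobian c d q *v u = dird u ?\<tau> (chart_map c q)" if "q \<in> chart_dom c" "q \<in> chart_dom d" for q u
    by (rule transition_jacobian_mult[OF c d atlas that])
  have xO: "chart_map c p \<in> ?O" using p by blast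
  have dp: "?\<tau> (chart_map c p) = chart_map d p" by (simp add: is_chart_facts(3)[OF ic p(1)])
  have pU: "p \<in> U" using p(3) SU by blast
  have "bf (lin_ricci (coord g c) (coord (\<lambda>c p. \<phi> p *\<^sub>R k c p) c) (chart_map c p)) u v
      = bf (lin_ricci (coord g d) (coord (\<lambda>c p. \<phi> p *\<^sub>R k c p) d) (?\<tau> (chart_map c p)))
          (dird u ?\<tau> (chart_map c p)) (dird v ?\<tau> (chart_map c p))" for u v
  proof (rule lin_ricci_pullback[OF mv metric_variation_k[OF \<phi> d] smooth_transition[OF c d atlas] _ _ _ xO])
    fix y assume y: "y \<in> ?O"
    obtain q where q: "q \<in> chart_dom c" "q \<in> chart_dom d" "y = chart_map c q" "chart_inv c y = q"
      "?\<tau> y \<in> chart_img d" "chart_inv d (?\<tau> y) = q" using pt[OF y] by blast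
    show "?\<tau> y \<in> chart_img d" by (rule q(5))
    show "bf (coord g c y) u v = bf (coord g d (?\<tau> y)) (dird u ?\<tau> y) (dird v ?\<tau> y)" for u v
    proof -
      have "bf (g c q) u v = bf (g d q) (dird u ?\<tau> (chart_map c q)) (dird v ?\<tau> (chart_map c q))"
        unfolding J[OF q(1,2), symmetric] by (rule tensor_transform[OF tensor_g WU[OF c] WU[OF d] q(1,2)])
      then show ?thesis unfolding q(6) unfolding q(4) unfolding q(3) .
    qed
    show "bf (\<phi> (chart_inv c y) *\<^sub>R coord k c y) u v
        = bf (\<phi> (chart_inv d (?\<tau> y)) *\<^sub>R coord k d (?\<tau> y)) (dird u ?\<tau> y) (dird v ?\<tau> y)" for u v
    proof -
      have "bf (k c q) u v = bf (k d q) (dird u ?\<tau> (chart_map c q)) (dird v ?\<tau> (chart_map c q))"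
        unfolding J[OF q(1,2), symmetric] by (rule k_transform[OF c d q(1,2)])
      then show ?thesis unfolding q(6) unfolding q(4) bf_scaleR_matrix unfolding q(3) by (rule arg_cong)
    qed
  qed
  then show ?thesis
    unfolding flux_def vector_transform[OF X_field WU[OF c] WU[OF d] p(1,2) pU]
      vector_transform[OF \<nu>_field WU[OF c] WU[OF d] p] J[OF p(1,2)] dp by simp
qed

lemma flux_zero:
  assumes c: "c \<in> charts A W" and p: "p \<in> chart_dom c" and K: "open K" "p \<in> K" "\<And>q. q \<in> K \<Longrightarrow> \<phi> q = 0"
  shows "flux \<phi> c p = 0"
proof -
  note ic = charts_is_chart[OF c]
  interpret mc: metric_chart "chart_img c" "coord g c" by (rule riemannian_metric_chart(1)[OF riem WU[OF c]])
  have x: "chart_map c p \<in> chart_map c ` (chart_dom c \<inter> K)" using p K(2) by blast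
  have "lin_ricci (coord g c) (coord (\<lambda>c p. \<phi> p *\<^sub>R k c p) c) (chart_map c p)
      = lin_ricci (coord g c) (\<lambda>y. 0) (chart_map c p)"
  proof (rule lin_ricci_cong[OF open_chart_image[OF ic K(1)] x])
    fix y assume "y \<in> chart_map c ` (chart_dom c \<inter> K)"
    then have "chart_inv c y \<in> K" unfolding chart_image_eq[OF ic] by blast
    then show "\<phi> (chart_inv c y) *\<^sub>R coord k c y = 0" using K(3) by simp
  qed
  also have "\<dots> = 0"
    by (rule lin_ricci_zero[of "coord g c", OF mc.nondeg[OF is_chart_facts(4)[OF ic p]]])
  finally show ?thesis by (simp add: flux_def bf_zero_matrix)
qed

lemma flux_continuous:
  assumes \<phi>: "smooth_function A U \<phi>" and c: "c \<in> charts A W"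
  shows "continuous_on (S \<inter> chart_dom c) (flux \<phi> c)"
proof -
  note ic = charts_is_chart[OF c]
  interpret mv: metric_variation "chart_img c" "coord g c" "coord (\<lambda>c p. \<phi> p *\<^sub>R k c p) c"
    by (rule metric_variation_k[OF \<phi> c])
  have cm: "continuous_on (S \<inter> chart_dom c) (chart_map c)"
    by (rule continuous_on_subset[OF is_chart_facts(7)[OF ic]]) simp
  have lr: "continuous_on (S \<inter> chart_dom c) (\<lambda>p. lin_ricci (coord g c) (coord (\<lambda>c p. \<phi> p *\<^sub>R k c p) c) (chart_map c p))"
    by (rule continuous_on_compose2[OF smooth_on_continuous_on[OF mv.smooth_lin_ricci] cm])
      (auto simp: chart_img_def)
  have vec: "continuous_on (S \<inter> chart_dom c) (Y c)" if Y: "vector_field_along A U T Y" "S \<subseteq> T" for Y T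
  proof -
    have "smooth_on (chart_map c ` (chart_dom c \<inter> T)) (\<lambda>x. Y c (chart_inv c x))"
      using Y(1) WU[OF c] by (simp add: vector_field_along_def)
    from continuous_on_compose2[OF smooth_on_continuous_on[OF this] cm]
    have "continuous_on (S \<inter> chart_dom c) (\<lambda>p. Y c (chart_inv c (chart_map c p)))"
      using Y(2) by blast
    then show ?thesis by (rule continuous_on_eq) (simp add: is_chart_facts(3)[OF ic])
  qed
  have mvm: "continuous_on T (\<lambda>p. M p *v v p)" if "continuous_on T M" "continuous_on T v"
    for T :: "'m set" and M :: "'m \<Rightarrow> real^'n^'n" and v :: "'m \<Rightarrow> real^'n"
    unfolding matrix_vector_mult_def using that by (intro continuous_intros) 
  show ?thesis
    unfolding flux_def bf_def
    by (intro continuous_on_divide continuous_on_minus continuous_on_inner mvm lr vec[OF X_field SU]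
        vec[OF \<nu>_field subset_refl] continuous_on_const) simp
qed

end

subsection \<open>Localization to slice charts\<close>

lemma connected_sgn_constant:
  fixes f :: "'a::topological_space \<Rightarrow> real"
  assumes Z: "connected Z" and f: "continuous_on Z f" and nz: "\<And>y. y \<in> Z \<Longrightarrow> f y \<noteq> 0"
  shows "\<exists>\<sigma>. \<forall>y\<in>Z. sgn (f y) = \<sigma>"
proof -
  have no: "\<not> (f y < 0 \<and> f z > 0)" if "y \<in> Z" "z \<in> Z" for y z
  proof
    assume "f y < 0 \<and> f z > 0"
    then have "0 \<in> f ` Z"
      using connectedD_interval[OF connected_continuous_image[OF f Z], of "f y" "f z" 0] that by simp
    then show False using nz by fastforce
  qed
  have "sgn (f y) = sgn (f z)" if "y \<in> Z" "z \<in> Z" for y z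
    using no[OF that] no[OF that(2,1)] nz[OF that(1)] nz[OF that(2)] by (auto simp: sgn_if)
  then show ?thesis by blast
qed

locale localised_einstein_curve = einstein_curve A U S W g h X \<nu> G
  for A :: "('m::{t2_space, second_countable_topology}, 'n::finite) chart set"
    and U S W g h X \<nu> G +
  fixes m :: nat and e :: "nat \<Rightarrow> ('m, 'n) chart" and i :: "nat \<Rightarrow> 'n"
    and x :: "nat \<Rightarrow> real^'n" and r :: "nat \<Rightarrow> real" and \<phi> :: "nat \<Rightarrow> 'm \<Rightarrow> real" and N :: "'m set"
  assumes cover: "slice_cover A U S W m e i x r \<phi> N"
begin

abbreviation core :: "nat \<Rightarrow> 'm set" where
  "core a \<equiv> chart_cball (e a) (x a) (r a)"

lemma cover_facts:
  assumes "a < m"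
  shows "r a > 0" "e a \<in> charts A W" "slice_chart A U S (e a) (i a)" "chart_img (e a) = ball (x a) (r a)"
    "x a $ i a = 0" "smooth_function A U (\<phi> a)" "p \<notin> core a \<Longrightarrow> \<phi> a p = 0"
  using cover assms unfolding slice_cover_def by blast+

lemma core:
  assumes a: "a < m"
  shows "compact (core a)" "core a \<subseteq> chart_dom (e a)"
proof -
  have sub: "cball (x a) (3 / 4 * r a) \<subseteq> chart_img (e a)"
    unfolding cover_facts(4)[OF a] using cover_facts(1)[OF a] by (intro cball_subset_ball_iff[THEN iffD2]) simp
  note cc = chart_cball[OF charts_is_chart[OF cover_facts(2)[OF a]] cover_facts(1)[OF a] sub]
  show "compact (core a)" by (rule cc(1))
  show "core a \<subseteq> chart_dom (e a)" by (rule cc(2))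
qed

lemma open_core: "a < m \<Longrightarrow> open (- core a)"
  by (rule open_Compl[OF compact_imp_closed[OF core(1)]])

text \<open>The flux in its own chart, continued by 0. By \<open>flux_eq_part\<close> every chart in
  \<open>charts A W\<close> gives the same values on the hypersurface.\<close>

definition part :: "nat \<Rightarrow> 'm \<Rightarrow> real" where
  "part a p = (if p \<in> chart_dom (e a) then flux (\<phi> a) (e a) p else 0)"

lemma flux_outside:
  assumes a: "a < m" and c: "c \<in> charts A W" and p: "p \<in> chart_dom c" "p \<notin> core a"
  shows "flux (\<phi> a) c p = 0"
proof (rule flux_zero[OF c p(1) open_core[OF a]])
  show "p \<in> - core a" using p(2) by simp
  show "\<phi> a q = 0" if "q \<in> - core a" for q using cover_facts(7)[OF a] that by simp
qed

lemma part_zero: "a < m \<Longrightarrow> p \<notin> core a \<Longrightarrow> part a p = 0"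
  unfolding part_def using flux_outside[OF _ cover_facts(2)] by simp

lemma flux_eq_part:
  assumes a: "a < m" and c: "c \<in> charts A W" and p: "p \<in> chart_dom c" "p \<in> S"
  shows "flux (\<phi> a) c p = part a p"
proof (cases "p \<in> chart_dom (e a)")
  case True
  then show ?thesis
    using flux_transform[OF cover_facts(6)[OF a] c cover_facts(2)[OF a] p(1) True p(2)] by (simp add: part_def)
next
  case False
  then have "p \<notin> core a" using core(2)[OF a] by blast
  from flux_outside[OF a c p(1) this] False show ?thesis by (simp add: part_def)
qed

text \<open>The cut-off functions add up to 1 on a neighbourhood of \<open>p\<close>, so
  \<open>k\<close> and the sum of its pieces have the same jet at \<open>p\<close>, and the
  linearized Ricci tensor is additive.\<close>

lemma eval_traceless_ricci2:
  assumes p: "p \<in> S"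
  shows "eval_tensor A U (traceless_ricci2 g h) X \<nu> p = (\<Sum>a<m. part a p)"
proof -
  \<comment> \<open>The chart selected by \<open>eval_tensor\<close>; below it is restricted to
    \<open>W\<close>.\<close>
  define c0 where "c0 = (SOME c. c \<in> charts A U \<and> p \<in> chart_dom c)"
  obtain d j where d: "slice_chart A U S d j" "p \<in> chart_dom d"
    using hyper p by (auto simp: compact_hypersurface_def)
  have "\<exists>c. c \<in> charts A U \<and> p \<in> chart_dom c" using slice_chart_facts(1)[OF d(1)] d(2) by blast
  from someI_ex[OF this] have c0: "c0 \<in> charts A U" "p \<in> chart_dom c0" by (simp_all add: c0_def)
  let ?c = "restrict_chart c0 W"
  have pW: "p \<in> W" and pU: "p \<in> U" using p W by blast+
  have pI: "p \<in> chart_dom c0 \<inter> W" using c0(2) pW by blast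
  have c: "?c \<in> charts A W" by (rule restrict_chart_in_charts(1)[OF c0(1) W(1)])
  note ic = charts_is_chart[OF c]
  have pc: "p \<in> chart_dom ?c" using pI by simp
  interpret mc: metric_chart "chart_img ?c" "coord g ?c" by (rule riemannian_metric_chart(1)[OF riem WU[OF c]])
  let ?l = "\<lambda>a. coord (\<lambda>c p. \<phi> a p *\<^sub>R k c p) ?c" and ?y = "chart_map ?c p"
  let ?O = "chart_map ?c ` (chart_dom ?c \<inter> N)"
  have N: "open N" "S \<subseteq> N" "\<And>q. q \<in> N \<Longrightarrow> (\<Sum>a<m. \<phi> a q) = 1" using cover by (simp_all add: slice_cover_def)
  have O: "open ?O" by (rule open_chart_image[OF ic N(1)])
  have yO: "?y \<in> ?O" by (rule imageI) (use pc p N(2) in blast)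
  have "eval_tensor A U (traceless_ricci2 g h) X \<nu> p = bf (traceless_ricci2 g h c0 p) (X c0 p) (\<nu> c0 p)"
    unfolding eval_tensor_def Let_def c0_def[symmetric] bf_def ..
  also have "\<dots> = bf (traceless_ricci2 g h ?c p) (X ?c p) (\<nu> ?c p)"
    unfolding traceless_restrict[OF c0 pW] vector_restrict[OF X_field c0(1) W(1) pI pU]
      vector_restrict[OF \<nu>_field c0(1) W(1) pI p] ..
  also have "\<dots> = - bf (lin_ricci (coord g ?c) (coord k ?c) ?y) (X ?c p) (\<nu> ?c p) / 2"
    by (rule traceless_eq[OF c pc orthogonal[OF WU[OF c] pc p]])
  also have "lin_ricci (coord g ?c) (coord k ?c) ?y = lin_ricci (coord g ?c) (\<lambda>y. \<Sum>a<m. ?l a y) ?y"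
  proof (rule lin_ricci_cong[OF O yO])
    fix y assume "y \<in> ?O"
    then have "chart_inv ?c y \<in> N" unfolding chart_image_eq[OF ic] by blast
    then show "coord k ?c y = (\<Sum>a<m. ?l a y)" unfolding scaleR_left.sum[symmetric] by (simp add: N(3))
  qed
  also have "\<dots> = (\<Sum>a<m. lin_ricci (coord g ?c) (?l a) ?y)"
  proof (rule lin_ricci_sum[where \<gamma> = "coord g ?c", OF mc.open_dom is_chart_facts(4)[OF ic pc] _ finite_lessThan mc.nondeg[OF is_chart_facts(4)[OF ic pc]]])
    show "smooth_on (chart_img ?c) (?l a)" if "a \<in> {..<m}" for a
      by (rule metric_variation.smooth_l[OF metric_variation_k[OF cover_facts(6) c]]) (use that in simp)
  qed
  also have "bf \<dots> (X ?c p) (\<nu> ?c p) = (\<Sum>a<m. bf (lin_ricci (coord g ?c) (?l a) ?y) (X ?c p) (\<nu> ?c p))"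
    by (rule linear_sum[OF bounded_linear.linear[OF bounded_linear_bf]])
  also have "- \<dots> / 2 = (\<Sum>a<m. flux (\<phi> a) ?c p)"
    unfolding flux_def sum_negf[symmetric] sum_divide_distrib ..
  also have "\<dots> = (\<Sum>a<m. part a p)"
    by (rule sum.cong[OF refl flux_eq_part[OF _ c pc p]]) simp
  finally show ?thesis .
qed

lemma part_continuous:
  assumes a: "a < m"
  shows "continuous_on S (part a)"
proof (rule continuous_on_local)
  fix p assume "p \<in> S"
  show "\<exists>T. open T \<and> p \<in> T \<and> continuous_on (S \<inter> T) (part a)"
  proof (cases "p \<in> chart_dom (e a)")
    case True
    have "continuous_on (S \<inter> chart_dom (e a)) (part a)"
      by (rule continuous_on_eq[OF flux_continuous[OF cover_facts(6)[OF a] cover_facts(2)[OF a]]]) (simp add: part_def)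
    then show ?thesis
      using True is_chart_facts(1)[OF charts_is_chart[OF cover_facts(2)[OF a]]] by blast
  next
    case False
    have "continuous_on (S \<inter> - core a) (part a)"
      by (rule continuous_on_eq[OF continuous_on_const[of _ 0]]) (simp add: part_zero[OF a])
    moreover have "p \<in> - core a" using False core(2)[OF a] by blast
    ultimately show ?thesis using open_core[OF a] by blast
  qed
qed

text \<open>The closed support of \<rho> within \<open>S\<close> lies in \<open>D\<close>, and the
  piece vanishes off \<open>core a\<close>. The product thus has compact support in both sets, as
  \<open>slice_integral_invariant\<close> requires.\<close>

lemma part_supported:
  assumes a: "a < m" and \<rho>: "continuous_on S \<rho>"
    and sub: "S \<inter> closure {p \<in> S. \<rho> p \<noteq> 0} \<subseteq> D"
  shows "supported_on S (D \<inter> chart_dom (e a)) (\<lambda>p. \<rho> p * part a p)"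
  unfolding supported_on_def
proof (intro conjI exI)
  let ?C = "closure {p \<in> S. \<rho> p \<noteq> 0}"
  let ?L = "S \<inter> (?C \<inter> core a)"
  have S: "compact S" using hyper by (simp add: compact_hypersurface_def)
  show "continuous_on S (\<lambda>p. \<rho> p * part a p)" by (intro continuous_on_mult \<rho> part_continuous[OF a])
  show "compact ?L"
    by (rule compact_Int_closed[OF S closed_Int[OF closed_closure compact_imp_closed[OF core(1)[OF a]]]])
  show "?L \<subseteq> S \<inter> (D \<inter> chart_dom (e a))" using sub core(2)[OF a] by blast
  show "\<forall>p\<in>S - ?L. \<rho> p * part a p = 0"
  proof
    fix p assume p: "p \<in> S - ?L"
    show "\<rho> p * part a p = 0"
    proof (cases "p \<in> core a")
      case True
      then have "p \<notin> ?C" using p by blast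
      then have "p \<notin> {p \<in> S. \<rho> p \<noteq> 0}" by (rule contra_subsetD[OF closure_subset])
      then show ?thesis using p by simp
    qed (simp add: part_zero[OF a])
  qed
qed

text \<open>By \<open>unit_normal_sharp\<close> the density of the piece is a component of the
  conserved current, times -1/2 and the sign of the normal against the coordinate direction. That
  sign is constant because the slice of a ball is connected, so the integral is a multiple of the
  one in \<open>slice_flux_zero\<close>.\<close>

lemma part_integral:
  assumes a: "a < m"
  shows "slice_integral g (e a) (i a) (part a) = 0"
proof -
  note c = cover_facts(2)[OF a] and sl = cover_facts(3)[OF a] and img = cover_facts(4)[OF a]
  note cU = WU[OF c] and ic = charts_is_chart[OF c]
  let ?c = "e a" and ?j = "i a"
  let ?\<gamma> = "coord g ?c" and ?l = "coord (\<lambda>c p. \<phi> a p *\<^sub>R k c p) ?c"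
  let ?\<xi> = "\<lambda>y. X ?c (chart_inv ?c y)" and ?n = "\<lambda>y. \<nu> ?c (chart_inv ?c y)"
  let ?R = "lin_ricci ?\<gamma> ?l"
  let ?J = "\<lambda>y. conserved_current ?\<gamma> ?R ?\<xi> y $ ?j"
  define Z where "Z = {y \<in> chart_img ?c. y $ ?j = 0}"
  have mvc: "metric_variation (chart_img ?c) ?\<gamma> ?l" by (rule metric_variation_k[OF cover_facts(6)[OF a] c])
  interpret mv: metric_variation "chart_img ?c" ?\<gamma> ?l by (rule mvc)
  have inS: "chart_inv ?c y \<in> chart_dom ?c \<inter> S" if "y \<in> Z" for y
    using that is_chart_facts(6)[OF ic] slice_chart_facts(4)[OF sl] by (simp add: Z_def)
  have us: "sqrt (det (drop_index ?j (?\<gamma> y))) *\<^sub>R ?n y = (sgn (?n y $ ?j) * sqrt (det (?\<gamma> y))) *\<^sub>R sharp (?\<gamma> y) ?j"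
    "?n y $ ?j \<noteq> 0" if y: "y \<in> Z" for y
  proof -
    note q = inS[OF y]
    have M: "transpose (?\<gamma> y) = ?\<gamma> y" "\<And>v. v \<noteq> 0 \<Longrightarrow> bf (?\<gamma> y) v v > 0"
      using riem cU q by (simp_all add: riemannian_metric_def bf_def)
    have n: "bf (?\<gamma> y) (?n y) (?n y) = 1" "\<And>v. v $ ?j = 0 \<Longrightarrow> bf (?\<gamma> y) v (?n y) = 0"
      using normal sl q by (simp_all add: unit_normal_field_def bf_def)
    show "sqrt (det (drop_index ?j (?\<gamma> y))) *\<^sub>R ?n y = (sgn (?n y $ ?j) * sqrt (det (?\<gamma> y))) *\<^sub>R sharp (?\<gamma> y) ?j"
      "?n y $ ?j \<noteq> 0"
      by (rule unit_normal_sharp(1)[OF M n], assumption, assumption, rule unit_normal_sharp(2)[OF M n], assumption, assumption)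
  qed
  have imZ: "chart_map ?c ` (chart_dom ?c \<inter> S) = Z" using sl by (simp add: slice_chart_def Z_def)
  have "smooth_on (chart_map ?c ` (chart_dom ?c \<inter> S)) ?n" using \<nu>_field cU by (simp add: vector_field_along_def)
  then have "smooth_on Z ?n" unfolding imZ .
  then have cn: "continuous_on Z (\<lambda>y. ?n y $ ?j)"
    by (intro continuous_on_component smooth_on_continuous_on)
  have "convex Z"
  proof -
    have "Z = ball (x a) (r a) \<inter> {y. axis ?j 1 \<bullet> y = 0}"
      unfolding Z_def img by (auto simp: inner_axis')
    then show ?thesis by (simp only: convex_Int convex_ball convex_hyperplane)
  qed
  then have "connected Z" by (rule convex_connected)
  then obtain \<sigma> where \<sigma>: "\<forall>y\<in>Z. sgn (?n y $ ?j) = \<sigma>"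
    using connected_sgn_constant[OF _ cn us(2)] by blast
  have dens: "slice_density g ?c ?j (part a) z = - \<sigma> / 2 * (if z \<in> ball (x a) (r a) then ?J z else 0)"
    if z: "z $ ?j = 0" for z
  proof (cases "z \<in> chart_img ?c")
    case True
    then have zZ: "z \<in> Z" using z by (simp add: Z_def)
    note q = inS[OF zZ]
    have X0: "?\<xi> z $ ?j = 0" using tangent sl q by (simp add: tangent_along_def)
    have "bf (?R z) (?\<xi> z) (?n z) * sqrt (det (drop_index ?j (?\<gamma> z)))
        = bf (?R z) (?\<xi> z) (sqrt (det (drop_index ?j (?\<gamma> z))) *\<^sub>R ?n z)"
      by (simp add: linear_cmul[OF linear_bf(1)])
    also have "\<dots> = \<sigma> * (sqrt (det (?\<gamma> z)) * bf (?R z) (?\<xi> z) (sharp (?\<gamma> z) ?j))"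
      unfolding us(1)[OF zZ] bspec[OF \<sigma> zZ] by (simp add: linear_cmul[OF linear_bf(1)])
    also have "bf (?R z) (?\<xi> z) (sharp (?\<gamma> z) ?j) = bf (?R z) (sharp (?\<gamma> z) ?j) (?\<xi> z)"
      by (rule bf_sym[OF mv.lin_ricci_sym[OF True]])
    also have "sqrt (det (?\<gamma> z)) * \<dots> = ?J z" by (rule mv.conserved_current_nth[where X = "?\<xi>", OF True X0, symmetric])
    finally have "bf (?R z) (?\<xi> z) (?n z) * sqrt (det (drop_index ?j (?\<gamma> z))) = \<sigma> * ?J z" .
    then show ?thesis
      using True q by (simp add: slice_density_def part_def flux_def is_chart_facts(5)[OF ic True] img)
  qed (simp add: slice_density_def img)
  have sX: "smooth_on (chart_img ?c) ?\<xi>"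
  proof -
    have "chart_dom ?c \<subseteq> U" using cU by (simp add: charts_def)
    then have im: "chart_map ?c ` (chart_dom ?c \<inter> U) = chart_img ?c" by (simp add: chart_img_def Int_absorb2)
    have "smooth_on (chart_map ?c ` (chart_dom ?c \<inter> U)) ?\<xi>" using X_field cU by (simp add: vector_field_along_def)
    then show ?thesis unfolding im .
  qed
  have sp: "slice_point ?j 0 y $ ?j = 0" for y by (simp add: slice_point_def)
  have "slice_integral g ?c ?j (part a) =
      (\<integral>y. - \<sigma> / 2 * (if slice_point ?j 0 y \<in> ball (x a) (r a) then ?J (slice_point ?j 0 y) else 0) \<partial>slice_measure ?j)"
    unfolding slice_integral_density dens[OF sp] ..
  also have "\<dots> = - \<sigma> / 2 * (\<integral>y. (if slice_point ?j 0 y \<in> ball (x a) (r a) then ?J (slice_point ?j 0 y) else 0) \<partial>slice_measure ?j)"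
    by (rule integral_mult_right_zero)
  also have "(\<integral>y. (if slice_point ?j 0 y \<in> ball (x a) (r a) then ?J (slice_point ?j 0 y) else 0) \<partial>slice_measure ?j) = 0"
  proof (rule slice_flux_zero[OF mvc[unfolded img] cover_facts(1)[OF a]])
    show "?l y = 0" if y: "y \<in> ball (x a) (r a)" "y \<notin> cball (x a) (3 / 4 * r a)" for y
    proof -
      have y': "y \<in> chart_img ?c" using y(1) img by simp
      have "chart_inv ?c y \<notin> core a"
      proof
        assume "chart_inv ?c y \<in> core a"
        then obtain z where z: "z \<in> cball (x a) (3 / 4 * r a)" "chart_inv ?c y = chart_inv ?c z"
          unfolding chart_cball_def by blast
        have "z \<in> chart_img ?c" unfolding img using z(1) cover_facts(1)[OF a] by simp
        then have "y = z" using z(2) is_chart_facts(5)[OF ic] y' by metis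
        then show False using z(1) y(2) by blast
      qed
      then show ?thesis using cover_facts(7)[OF a] by simp
    qed
    show "coord_ricci ?\<gamma> y = 0" if "y \<in> ball (x a) (r a)" for y
      by (rule coord_flat[OF cU]) (use that img in simp)
    show "det (?\<gamma> y) > 0" if "y \<in> ball (x a) (r a)" for y
      by (rule riemannian_metric_chart(2)[OF riem cU]) (use that img in simp)
    show "smooth_on (ball (x a) (r a)) ?\<xi>" using sX unfolding img .
    show "bf (dird (?\<xi> y) ?\<gamma> y) u v + bf (?\<gamma> y) (dird u ?\<xi> y) v + bf (?\<gamma> y) u (dird v ?\<xi> y) = 0"
      if "y \<in> ball (x a) (r a)" for y u v
      by (rule killing_bf[OF killing riem cU]) (use that img in simp)
  qed
  finally show ?thesis by simp
qed

lemma continuous_partition_function: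
  assumes \<rho>: "\<And>d. d \<in> charts A U \<Longrightarrow> smooth_on (chart_map d ` (chart_dom d \<inter> S)) (\<lambda>x. \<rho> (chart_inv d x))"
  shows "continuous_on S (\<rho> :: 'm \<Rightarrow> real)"
proof (rule continuous_on_local)
  fix p assume "p \<in> S"
  then obtain d j where d: "slice_chart A U S d j" "p \<in> chart_dom d"
    using hyper by (auto simp: compact_hypersurface_def)
  note id = slice_chart_facts(2)[OF d(1)]
  have cm: "continuous_on (S \<inter> chart_dom d) (chart_map d)"
    by (rule continuous_on_subset[OF is_chart_facts(7)[OF id]]) simp
  have "continuous_on (S \<inter> chart_dom d) (\<lambda>p. \<rho> (chart_inv d (chart_map d p)))"
    by (rule continuous_on_compose2[OF smooth_on_continuous_on[OF \<rho>[OF slice_chart_facts(1)[OF d(1)]]] cm]) blast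
  then have "continuous_on (S \<inter> chart_dom d) \<rho>"
    by (rule continuous_on_eq) (simp add: is_chart_facts(3)[OF id])
  then show "\<exists>T. open T \<and> p \<in> T \<and> continuous_on (S \<inter> T) \<rho>"
    using is_chart_facts(1)[OF id] d(2) by blast
qed

text \<open>Two decompositions meet: the partition functions \<rho> selected by the definition of
  the integral, and the pieces \<open>part a\<close>. Each product is integrated in the chart of its
  piece instead of that of its partition function; there the \<rho> add up to 1, and each piece
  integrates to 0.\<close>

theorem hypersurface_integral_zero:
  "hypersurface_integral A U g S (eval_tensor A U (traceless_ricci2 g h) X \<nu>) = 0"
proof -
  let ?f = "eval_tensor A U (traceless_ricci2 g h) X \<nu>"
  define P where "P = (SOME P. slice_partition A U S P)"
  have P: "slice_partition A U S P"
    unfolding P_def by (rule someI_ex[OF slice_partition_exists[OF atlas U(1) hyper]])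
  let ?n = "length P"
  let ?c = "\<lambda>n. fst (P ! n)" and ?j = "\<lambda>n. fst (snd (P ! n))" and ?\<rho> = "\<lambda>n. snd (snd (P ! n))"
  have P1: "slice_chart A U S (?c n) (?j n)" "S \<inter> closure {p \<in> S. ?\<rho> n p \<noteq> 0} \<subseteq> chart_dom (?c n)"
    "\<And>d. d \<in> charts A U \<Longrightarrow> smooth_on (chart_map d ` (chart_dom d \<inter> S)) (\<lambda>x. ?\<rho> n (chart_inv d x))"
    if n: "n < ?n" for n
  proof -
    have "case P ! n of (c, i, \<rho>) \<Rightarrow> slice_chart A U S c i \<and> (\<forall>p\<in>S. \<rho> p \<ge> 0) \<and>
        S \<inter> closure {p \<in> S. \<rho> p \<noteq> 0} \<subseteq> chart_dom c \<and>
        (\<forall>d\<in>charts A U. smooth_on (chart_map d ` (chart_dom d \<inter> S)) (\<lambda>x. \<rho> (chart_inv d x)))"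
      using P nth_mem[OF n] unfolding slice_partition_def by (elim conjE) (rule bspec)
    then have Q: "slice_chart A U S (?c n) (?j n) \<and> (\<forall>p\<in>S. ?\<rho> n p \<ge> 0) \<and>
        S \<inter> closure {p \<in> S. ?\<rho> n p \<noteq> 0} \<subseteq> chart_dom (?c n) \<and>
        (\<forall>d\<in>charts A U. smooth_on (chart_map d ` (chart_dom d \<inter> S)) (\<lambda>x. ?\<rho> n (chart_inv d x)))"
      unfolding case_prod_beta .
    show "slice_chart A U S (?c n) (?j n)" using Q by (rule conjunct1)
    show "S \<inter> closure {p \<in> S. ?\<rho> n p \<noteq> 0} \<subseteq> chart_dom (?c n)" using Q by (elim conjE)
    show "smooth_on (chart_map d ` (chart_dom d \<inter> S)) (\<lambda>x. ?\<rho> n (chart_inv d x))" if "d \<in> charts A U" for d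
      using Q that by (elim conjE) (rule bspec)
  qed
  have one: "(\<Sum>n<?n. ?\<rho> n p) = 1" if "p \<in> S" for p
    using P that by (simp add: slice_partition_def sum_list_sum_nth case_prod_beta atLeast0LessThan)
  have supp: "supported_on S (chart_dom (?c n) \<inter> chart_dom (e a)) (\<lambda>p. ?\<rho> n p * part a p)"
    if "n < ?n" "a < m" for n a
    by (rule part_supported[OF that(2) continuous_partition_function[OF P1(3)[OF that(1)]] P1(2)[OF that(1)]])
  have supp1: "supported_on S (chart_dom (?c n)) (\<lambda>p. ?\<rho> n p * part a p)" if "n < ?n" "a < m" for n a
    by (rule supported_on_mono[OF supp[OF that] Int_lower1])
  have supp2: "supported_on S (chart_dom (e a)) (\<lambda>p. ?\<rho> n p * part a p)" if "n < ?n" "a < m" for n a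
    by (rule supported_on_mono[OF supp[OF that] Int_lower2])
  have "hypersurface_integral A U g S ?f = (\<Sum>n<?n. slice_integral g (?c n) (?j n) (\<lambda>p. ?\<rho> n p * ?f p))"
    unfolding hypersurface_integral_def P_def[symmetric]
    by (simp add: sum_list_sum_nth case_prod_beta atLeast0LessThan)
  also have "\<dots> = (\<Sum>n<?n. \<Sum>a<m. slice_integral g (e a) (i a) (\<lambda>p. ?\<rho> n p * part a p))"
  proof (rule sum.cong[OF refl])
    fix n assume "n \<in> {..<?n}"
    then have n: "n < ?n" by simp
    have "slice_integral g (?c n) (?j n) (\<lambda>p. ?\<rho> n p * ?f p)
        = slice_integral g (?c n) (?j n) (\<lambda>p. \<Sum>a<m. ?\<rho> n p * part a p)"
      by (rule slice_integral_cong[OF P1(1)[OF n]]) (simp add: eval_traceless_ricci2 sum_distrib_left)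
    also have "\<dots> = (\<Sum>a<m. slice_integral g (?c n) (?j n) (\<lambda>p. ?\<rho> n p * part a p))"
      by (rule slice_integral_sum[OF P1(1)[OF n] riem supp1[OF n]]) simp
    also have "\<dots> = (\<Sum>a<m. slice_integral g (e a) (i a) (\<lambda>p. ?\<rho> n p * part a p))"
      by (rule sum.cong[OF refl], rule slice_integral_invariant[OF atlas riem P1(1)[OF n] cover_facts(3) supp[OF n]]) simp_all
    finally show "slice_integral g (?c n) (?j n) (\<lambda>p. ?\<rho> n p * ?f p)
        = (\<Sum>a<m. slice_integral g (e a) (i a) (\<lambda>p. ?\<rho> n p * part a p))" .
  qed
  also have "\<dots> = (\<Sum>a<m. \<Sum>n<?n. slice_integral g (e a) (i a) (\<lambda>p. ?\<rho> n p * part a p))"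
    by (rule sum.swap)
  also have "\<dots> = 0"
  proof (rule sum.neutral, rule ballI)
    fix a assume "a \<in> {..<m}"
    then have a: "a < m" by simp
    have "(\<Sum>n<?n. slice_integral g (e a) (i a) (\<lambda>p. ?\<rho> n p * part a p))
        = slice_integral g (e a) (i a) (\<lambda>p. \<Sum>n<?n. ?\<rho> n p * part a p)"
      by (rule slice_integral_sum[OF cover_facts(3)[OF a] riem supp2[OF _ a], symmetric]) simp
    also have "\<dots> = slice_integral g (e a) (i a) (part a)"
      by (rule slice_integral_cong[OF cover_facts(3)[OF a]]) (simp add: one sum_distrib_right[symmetric])
    also have "\<dots> = 0" by (rule part_integral[OF a])
    finally show "(\<Sum>n<?n. slice_integral g (e a) (i a) (\<lambda>p. ?\<rho> n p * part a p)) = 0" .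
  qed
  finally show ?thesis .
qed

end

theorem proposition1p9:
  fixes A :: "('m::{t2_space, second_countable_topology}, 'n::finite) chart set"
    and U S :: "'m set"
    and g h :: "('m, 'n) tfield"
    and X \<nu> :: "('m, 'n) vfield"
  assumes "smooth_atlas A" and "open U" and "U \<subseteq> manifold_space A"
    and "ricci_flat_metric A U g"
    and "tensor_field A U h" and "einstein_first_jet A U g h"
    and "killing_field A U g X"
    and "compact_hypersurface A U S" and "tangent_along A U S X"
    and "unit_normal_field A U g S \<nu>"
  shows "hypersurface_integral A U g S (eval_tensor A U (traceless_ricci2 g h) X \<nu>) = 0"
proof -
  \<comment> \<open>The jet condition is applied to the compact set \<open>S\<close> itself.\<close>
  have "compact S \<and> S \<subseteq> U" using assms(8) by (simp add: compact_hypersurface_def)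
  then have "\<exists>W G. open W \<and> S \<subseteq> W \<and> W \<subseteq> U \<and>
      (\<forall>t\<in>{0..1::real}. einstein_metric A W (G t)) \<and>
      (\<forall>c\<in>charts A W.
         smooth_on ({0..1} \<times> chart_img c) (\<lambda>(t, x). G t c (chart_inv c x)) \<and>
         (\<forall>p\<in>chart_dom c. G 0 c p = g c p \<and>
            ((\<lambda>t. G t c p) has_vector_derivative h c p) (at 0 within {0..1})))"
    by (rule assms(6)[unfolded einstein_first_jet_def, THEN spec, THEN mp])
  then obtain W G where W: "open W" "S \<subseteq> W" "W \<subseteq> U"
    and G: "\<forall>t\<in>{0..1::real}. einstein_metric A W (G t)"
    and G': "\<forall>c\<in>charts A W.
         smooth_on ({0..1} \<times> chart_img c) (\<lambda>(t, x). G t c (chart_inv c x)) \<and>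
         (\<forall>p\<in>chart_dom c. G 0 c p = g c p \<and>
            ((\<lambda>t. G t c p) has_vector_derivative h c p) (at 0 within {0..1}))"
    by (elim exE conjE)
  have "einstein_curve A U S W g h X \<nu> G"
  proof (rule einstein_curve.intro[OF assms(1-5,7-10) W])
    show "einstein_metric A W (G t)" if "t \<in> {0..1}" for t by (rule bspec[OF G that])
    fix c :: "('m, 'n) chart" assume "c \<in> charts A W"
    note c = bspec[OF G' this]
    show "smooth_on ({0..1} \<times> chart_img c) (\<lambda>(t, x). G t c (chart_inv c x))" by (rule conjunct1[OF c])
    show "G 0 c p = g c p" "((\<lambda>t. G t c p) has_vector_derivative h c p) (at 0 within {0..1})"
      if "p \<in> chart_dom c" for p
      using bspec[OF conjunct2[OF c] that] by (rule conjunct1, rule conjunct2)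
  qed
  moreover obtain m e i x r \<phi> N where "slice_cover A U S W m e i x r \<phi> N"
    using slice_cover_exists[OF assms(1,8) W(1,2)] by blast
  ultimately have "localised_einstein_curve A U S W g h X \<nu> G m e i x r \<phi> N"
    by (intro localised_einstein_curve.intro localised_einstein_curve_axioms.intro)
  then show ?thesis by (rule localised_einstein_curve.hypersurface_integral_zero)
qed

end
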